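(* Let $\epsilon>0$ be fixed (small), let $\sigma\geq\frac12+\epsilon$ be fixed and let $x>0$ be fixed. Let $\varphi_1$ be a Jacob's ladder and for sufficiently large $y$ write $[y]^1=\varphi_1^{-1}(y)$. Put $u=u(\tau)=\frac{2\pi^2}{\zeta^4(2\sigma)}x\tau$ and $v=v(\tau)=\frac{x}{1-c}\tau$, where $c$ is Euler's constant. Then, as $\tau\to\infty$, \[ \int_{v}^{[v]^1}\left|\zeta\left(\frac{1}{2}+it\right)\right|^2{\rm d}t\sim \frac{\left\{\int_{u}^{[u]^1}|\zeta(\sigma+it)|^2{\rm d}t\right\}^4\int_0^{u}\left|\zeta\left(\frac{1}{2}+it\right)\right|^4{\rm d}t}{\sum_{s=0}^4c_s\left\{\int_{u}^{[u]^1}\left|\zeta\left(\frac{1}{2}+it\right)\right|^2{\rm d}t\right\}^{4-s}\left\{\int_{u}^{[u]^1}|\zeta(\sigma+it)|^2{\rm d}t\right\}^s}, \] where $c_0=1$ and $c_s=2\pi^2\{\zeta(2\sigma)\}^{-s}a_s$, $s=1,2,3,4$.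
   Context: $\zeta$ is the Riemann zeta-function; $f\sim g$ means $f/g\to1$. The constants $a_0,\dots,a_4$ are those of the Ingham / Heath-Brown fourth moment formula: $\int_0^T|\zeta(\frac12+it)|^4{\rm d}t=T\sum_{s=0}^4a_s\ln^{4-s}T+\mathcal{O}(T^{7/8+\epsilon})$ as $T\to\infty$, with $a_0=\frac{1}{2\pi^2}$. A Jacob's ladder (in the sense of J. Moser) is a function $\varphi_1(T)=\frac12\varphi(T)$, where $\varphi(T)=x(T)$ is a solution of the nonlinear integral equation $\int_0^{\mu[x(T)]}Z^2(t)e^{-\frac{2}{x(T)}t}{\rm d}t=\int_0^T Z^2(t){\rm d}t$, with $Z(t)$ the Hardy function (so $Z^2(t)=|\zeta(\frac12+it)|^2$) and $\mu$ an increasing function with $\mu(y)\geq 7y\ln y$; it is known that $\varphi_1$ is increasing for sufficiently large arguments, so $\varphi_1^{-1}(y)$ is defined for sufficiently large $y$, and $\int_y^{[y]^1}|\zeta(\frac12+it)|^2{\rm d}t\sim(1-c)y$ as $y\to\infty$. *)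

theory Defs
  imports "HOL-Complex_Analysis.Complex_Analysis" "HOL-Library.Landau_Symbols"
begin

(* The Riemann zeta function, as the unique holomorphic continuation of the Dirichlet series to
   the plane without 1; the value 0 at the pole is a mere convention. *)
definition zeta :: "complex \<Rightarrow> complex" where
  "zeta = (THE f. f holomorphic_on - {1} \<and> f 1 = 0 \<and>
     (\<forall>s. Re s > 1 \<longrightarrow> (\<lambda>n. 1 / of_nat (Suc n) powr s) sums f s))"

definition theta_RS :: "real \<Rightarrow> real" where
  "theta_RS t = Im (ln_Gamma (Complex (1/4) (t/2))) - t/2 * ln pi"

(* Hardy's function, typed as a complex number. It is real-valued (by the functional equation of
   zeta), so its square is written below as the square of its modulus. *)
definition hardy_Z :: "real \<Rightarrow> complex" where
  "hardy_Z t = exp (\<i> * of_real (theta_RS t)) * zeta (Complex (1/2) t)"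

(* phi1 is a Jacob's ladder on the half-line from T0 on, i.e. half of a solution phi of the
   integral equation. The function mu is only required to be given on some half-line from
   y0 > 0 on, in which phi takes its values. *)
definition jacobs_ladder :: "real \<Rightarrow> (real \<Rightarrow> real) \<Rightarrow> bool" where
  "jacobs_ladder T0 \<phi>1 \<longleftrightarrow> 0 \<le> T0 \<and>
     (\<exists>\<mu> \<phi> y0. 0 < y0 \<and> mono_on {y0..} \<mu> \<and> (\<forall>y\<ge>y0. \<mu> y \<ge> 7 * y * ln y) \<and>
       (\<forall>T\<ge>T0. \<phi> T \<ge> y0 \<and> \<phi>1 T = \<phi> T / 2 \<and>
          integral {0..\<mu> (\<phi> T)} (\<lambda>t. (cmod (hardy_Z t))\<^sup>2 * exp (- (2 / \<phi> T) * t)) =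
          integral {0..T} (\<lambda>t. (cmod (hardy_Z t))\<^sup>2)))"

(* The coefficients of the Ingham / Heath-Brown formula; the asymptotic formula determines them
   uniquely. *)
definition fourth_moment_constants :: "(nat \<Rightarrow> real) \<Rightarrow> bool" where
  "fourth_moment_constants a \<longleftrightarrow> a 0 = 1 / (2 * pi\<^sup>2) \<and>
     (\<forall>\<delta>>0. (\<lambda>T. integral {0..T} (\<lambda>t. cmod (zeta (Complex (1/2) t)) ^ 4)
                  - T * (\<Sum>s=0..4. a s * ln T ^ (4 - s)))
              \<in> O[at_top](\<lambda>T. T powr (7/8 + \<delta>)))"

end

theory Submission
  imports Defs "HOL-Real_Asymp.Real_Asymp"
begin

text \<open>
  Write \<open>M(T)\<close> for the integral of \<open>|zeta(1/2 + it)|^2\<close> over \<open>[0, T]\<close>. A Jacob's ladder turns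
  \<open>y\<close> into the point \<open>T = [y]^1\<close> at which \<open>M(T)\<close> equals the Laplace transform of
  \<open>|zeta(1/2 + it)|^2\<close> with parameter \<open>1/y\<close>, up to a negligible tail. From
  \<open>M(T) = T ln T + A T + o(T)\<close> that transform is \<open>y ln y + (A + 1 - \<gamma>) y + o(y)\<close>, because
  the derivative of the Gamma function at 2 is \<open>1 - \<gamma>\<close>. Hence \<open>M(T) - M(y)\<close> is asymptotic to
  \<open>(1 - \<gamma>) y\<close> and \<open>T - y\<close> to \<open>(1 - \<gamma>) y / ln y\<close>. To the right of the critical line the mean
  square up to \<open>X\<close> is \<open>zeta(2\<sigma>) X\<close> with an error of \<open>o(X / ln X)\<close>, so its increment over
  \<open>[y, T]\<close> is asymptotic to \<open>zeta(2\<sigma>) (1 - \<gamma>) y / ln y\<close>. In the denominator of the theorem the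
  term with index 0 then dominates, and the fourth moment formula gives the claim.

  For \<open>1/2 \<le> \<sigma> < 1\<close> both mean square formulas come from one comparison. By the functional
  equation and Mellin inversion, the Laplace transform of \<open>|zeta(\<sigma> + it)|^2\<close> differs by a bounded
  amount from a sum over pairs of positive integers, even for complex parameters. Cauchy's
  estimates carry this over to the Taylor coefficients at a large real parameter; these are
  Poisson averages, which recover the cumulative mass with a power saving. The mass of the sum
  over pairs is an elementary divisor sum.
\<close>

section \<open>The Riemann zeta function\<close>

text \<open>The interval from y to its ladder image has length of order y / ln y, so a mean square
  formula right of the critical line helps only if its error is o(X / ln X), and on the critical
  line the linear term is needed besides X ln X. A Tauberian theorem for real Laplace parameters
  gives no such rate; hence the comparison in a complex region. It covers \<sigma> < 1, because a
  line of integration is moved to Re w = 1 - \<sigma>, where the functional equation produces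
  |zeta|^2. For \<sigma> \<ge> 1 a Dirichlet polynomial is integrated term by term instead. The
  inverse of the ladder is a choice of preimage, so every large y must be shown to have one: a
  truncated Laplace integral of |zeta|^2 determines its parameter, which forces phi T = 2 y. In the
  final quotient the integral on the line \<sigma> is smaller than the critical one by the factor ln
  y / zeta(2\<sigma>); its fourth power cancels the ln^4 of the fourth moment and leaves
  zeta(2\<sigma>)^4 u / (2 pi^2) = x \<tau>, which is also the size (1 - c) v of the left
  side.\<close>

lemma of_real_powr_diff_bound:
  fixes s :: complex and a b :: real
  assumes "0 < a" "a \<le> b" "Re s \<ge> -1"
  shows "norm (of_real b powr (-s) - of_real a powr (-s)) \<le> norm s * a powr (- Re s - 1) * (b - a)"
proof -
  let ?S = "closed_segment (of_real a :: complex) (of_real b)"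
  have S: "?S = of_real ` {a..b}"
    using assms by (simp add: closed_segment_of_real closed_segment_eq_real_ivl)
  have "norm ((of_real b :: complex) powr (-s) - of_real a powr (-s)) \<le>
          norm s * a powr (- Re s - 1) * norm (of_real b - (of_real a :: complex))"
  proof (rule field_differentiable_bound[where S = ?S and f' = "\<lambda>z. (-s) * z powr (-s - 1)"])
    fix z assume "z \<in> ?S"
    then obtain v where v: "z = of_real v" "a \<le> v" "v \<le> b" unfolding S by auto
    have "z \<notin> \<real>\<^sub>\<le>\<^sub>0" using v assms by auto
    then show "((\<lambda>z. z powr (-s)) has_field_derivative (-s) * z powr (-s - 1)) (at z within ?S)"
      by (rule has_field_derivative_at_within[OF has_field_derivative_powr])
    have "norm (z powr (-s - 1)) = v powr (- Re s - 1)"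
      using v assms by (subst norm_powr_real_powr) auto
    also have "\<dots> \<le> a powr (- Re s - 1)"
      using v assms by (intro powr_mono2') auto
    finally show "norm (-s * z powr (-s - 1)) \<le> norm s * a powr (- Re s - 1)"
      by (simp add: norm_mult mult_left_mono)
  qed auto
  then show ?thesis using assms by (simp flip: of_real_diff)
qed

definition zreg_term :: "nat \<Rightarrow> complex \<Rightarrow> complex" where
  "zreg_term n s = (s - 1) * of_nat (Suc n) powr (-s) +
     of_nat (Suc (Suc n)) powr (1 - s) - of_nat (Suc n) powr (1 - s)"

(* (s - 1) * zeta s on the right half plane, each term n powr (-s) compared with the integral of x powr (-s) over [n, n + 1] *)
definition zreg :: "complex \<Rightarrow> complex" where
  "zreg s = 1 + (\<Sum>n. zreg_term n s)"

text \<open>The term is the increment of \<open>?f\<close> between consecutive integers, and the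
  derivative of \<open>?f\<close> contains the difference of z powr (-s) and its value at the left
  end. By \<open>of_real_powr_diff_bound\<close> that difference is smaller by one power of n, which
  is what gives convergence for Re s > 0.\<close>

lemma norm_zreg_term_le:
  assumes "Re s > 0"
  shows "norm (zreg_term n s) \<le> norm (s - 1) * norm s * real (Suc n) powr (- Re s - 1)"
proof -
  define a b where "a = real (Suc n)" and "b = real (Suc (Suc n))"
  have ab: "a > 0" "b = a + 1" "of_nat (Suc n) = (of_real a :: complex)" "of_nat (Suc (Suc n)) = (of_real b :: complex)"
    by (auto simp: a_def b_def)
  let ?S = "closed_segment (of_real a :: complex) (of_real b)"
  let ?f = "\<lambda>z::complex. z powr (1 - s) + (s - 1) * of_real a powr (-s) * z"
  have S: "?S = of_real ` {a..b}"
  proof -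
    have "a \<le> b" using ab by simp
    then show ?thesis by (simp add: closed_segment_of_real closed_segment_eq_real_ivl)
  qed
  have "norm (?f (of_real b) - ?f (of_real a)) \<le>
          norm (s - 1) * norm s * a powr (- Re s - 1) * norm (of_real b - (of_real a :: complex))"
  proof (rule field_differentiable_bound[where S = ?S
        and f' = "\<lambda>z. (1 - s) * (z powr (-s) - of_real a powr (-s))"])
    fix z assume "z \<in> ?S"
    then obtain v where v: "z = of_real v" "a \<le> v" "v \<le> b" unfolding S by auto
    have "z \<notin> \<real>\<^sub>\<le>\<^sub>0" using v ab by auto
    then have "((\<lambda>z. z powr (1 - s)) has_field_derivative (1 - s) * z powr (1 - s - 1)) (at z within ?S)"
      by (rule has_field_derivative_at_within[OF has_field_derivative_powr])
    moreover have "((\<lambda>z. (s - 1) * of_real a powr (-s) * z) has_field_derivative (s - 1) * of_real a powr (-s)) (at z within ?S)"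
      by (auto intro!: derivative_eq_intros)
    ultimately have "(?f has_field_derivative (1 - s) * z powr (1 - s - 1) + (s - 1) * of_real a powr (-s)) (at z within ?S)"
      by (rule DERIV_add)
    then show "(?f has_field_derivative (1 - s) * (z powr (-s) - of_real a powr (-s))) (at z within ?S)"
      by (simp add: algebra_simps)
    have "norm (z powr (-s) - of_real a powr (-s)) \<le> norm s * a powr (- Re s - 1) * (v - a)"
      unfolding v(1) using v ab assms by (intro of_real_powr_diff_bound) auto
    also have "\<dots> \<le> norm s * a powr (- Re s - 1) * 1"
      using v ab by (intro mult_left_mono) auto
    finally show "norm ((1 - s) * (z powr (-s) - of_real a powr (-s))) \<le> norm (s - 1) * norm s * a powr (- Re s - 1)"
      by (simp add: norm_mult norm_minus_commute mult.assoc mult_left_mono)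
  qed auto
  moreover have "norm (of_real b - (of_real a :: complex)) = 1" using ab by simp
  moreover have "zreg_term n s = ?f (of_real b) - ?f (of_real a)"
    unfolding zreg_term_def ab(3,4) using ab(2) by (simp add: algebra_simps)
  ultimately show ?thesis by (simp add: a_def)
qed

lemma summable_zreg_bound: "(\<sigma>::real) > 0 \<Longrightarrow> summable (\<lambda>n. real (Suc n) powr (- \<sigma> - 1))"
  using summable_Suc_iff[of "\<lambda>n. real n powr (- \<sigma> - 1)"] summable_real_powr_iff by auto

lemma summable_zreg_term: "Re s > 0 \<Longrightarrow> summable (\<lambda>n. norm (zreg_term n s))"
  by (rule summable_comparison_test'[of "\<lambda>n. norm (s - 1) * norm s * real (Suc n) powr (- Re s - 1)" 0])
     (use norm_zreg_term_le summable_zreg_bound in \<open>auto intro!: summable_mult simp del: of_nat_Suc\<close>)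

lemma zreg_holomorphic: "zreg holomorphic_on {s. Re s > 0}"
proof (rule holomorphic_uniform_sequence)
  show "open {s. Re s > 0}" by (rule open_halfspace_Re_gt)
  show "(\<lambda>s. 1 + (\<Sum>k<n. zreg_term k s)) holomorphic_on {s. Re s > 0}" for n
    unfolding zreg_term_def by (auto intro!: holomorphic_intros simp del: of_nat_Suc)
  fix x :: complex assume x: "x \<in> {s. Re s > 0}"
  define d where "d = Re x / 2"
  have d: "d > 0" using x by (simp add: d_def)
  have sub: "Re s \<ge> d \<and> norm s \<le> norm x + d" if "s \<in> cball x d" for s
  proof -
    have "norm (x - s) \<le> d" using that by (simp add: dist_norm)
    moreover have "\<bar>Re (x - s)\<bar> \<le> norm (x - s)" by (rule abs_Re_le_cmod)
    moreover have "norm s \<le> norm x + norm (x - s)" by (metis norm_triangle_sub norm_minus_commute)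
    ultimately show ?thesis by (auto simp: d_def)
  qed
  define C where "C = (norm x + d + 1) * (norm x + d)"
  have "uniform_limit (cball x d) (\<lambda>n s. \<Sum>k<n. zreg_term k s) (\<lambda>s. \<Sum>k. zreg_term k s) sequentially"
  proof (rule Weierstrass_m_test)
    fix n s assume s: "s \<in> cball x d"
    have "norm (zreg_term n s) \<le> norm (s - 1) * norm s * real (Suc n) powr (- Re s - 1)"
      using sub[OF s] d by (intro norm_zreg_term_le) auto
    also have "\<dots> \<le> C * real (Suc n) powr (- d - 1)"
    proof (rule mult_mono)
      have "norm (s - 1) \<le> norm s + 1" using norm_triangle_ineq4[of s 1] by simp
      then show "norm (s - 1) * norm s \<le> C"
        unfolding C_def using sub[OF s] d by (intro mult_mono) auto
    qed (use sub[OF s] d in \<open>auto intro!: powr_mono simp: C_def\<close>)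
    finally show "norm (zreg_term n s) \<le> C * real (Suc n) powr (- d - 1)" .
  next
    show "summable (\<lambda>n. C * real (Suc n) powr (- d - 1))"
      using summable_zreg_bound[OF d] by (intro summable_mult)
  qed
  then have "uniform_limit (cball x d) (\<lambda>n s. 1 + (\<Sum>k<n. zreg_term k s)) zreg sequentially"
    unfolding zreg_def by (intro uniform_limit_intros)
  moreover have "cball x d \<subseteq> {s. Re s > 0}" using sub d by force
  ultimately show "\<exists>d>0. cball x d \<subseteq> {s. 0 < Re s} \<and>
         uniform_limit (cball x d) (\<lambda>n s. 1 + (\<Sum>k<n. zreg_term k s)) zreg sequentially"
    using d by blast
qed

lemma zreg_partial_sum:
  "1 + (\<Sum>k<N. zreg_term k s) = (s - 1) * (\<Sum>k<N. of_nat (Suc k) powr (-s)) + of_nat (Suc N) powr (1 - s)"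
  by (induction N) (auto simp: zreg_term_def algebra_simps)

text \<open>Comparison with the integral through the mean value theorem, which needs a positive left
  end. For N = 0 the first term has none, so it is split off; it accounts for the 1 in 1 +
  1/\<sigma>.\<close>

lemma powr_neg_tail_le:
  fixes \<sigma> :: real
  assumes "\<sigma> > 0" 
  shows "(\<Sum>n. real (Suc (n + N)) powr (- \<sigma> - 1)) \<le> (1 + 1 / \<sigma>) * real (Suc N) powr (- \<sigma>)"
proof (rule suminf_le_const)
  show "summable (\<lambda>n. real (Suc (n + N)) powr (- \<sigma> - 1))"
    using summable_ignore_initial_segment[OF summable_zreg_bound[OF assms], of N] by simp
  fix m
  have step: "real (Suc k) powr (- \<sigma> - 1) \<le> (real k powr (-\<sigma>) - real (Suc k) powr (-\<sigma>)) / \<sigma>" if "k > 0" for k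
  proof -
    have "\<exists>\<xi>. \<xi> > real k \<and> \<xi> < real (Suc k) \<and> real (Suc k) powr (-\<sigma>) - real k powr (-\<sigma>) = (real (Suc k) - real k) * (- \<sigma> * \<xi> powr (- \<sigma> - 1))"
      using that by (intro MVT2) (auto intro!: derivative_eq_intros)
    then obtain \<xi> where \<xi>: "\<xi> > real k" "\<xi> < real (Suc k)"
      "real (Suc k) powr (-\<sigma>) - real k powr (-\<sigma>) = - \<sigma> * \<xi> powr (- \<sigma> - 1)" by auto
    have "real (Suc k) powr (- \<sigma> - 1) \<le> \<xi> powr (- \<sigma> - 1)"
      using \<xi> that assms by (intro powr_mono2') auto
    also have "\<dots> = (real k powr (-\<sigma>) - real (Suc k) powr (-\<sigma>)) / \<sigma>"
      using \<xi>(3) assms by (simp add: field_simps)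
    finally show ?thesis .
  qed
  have part: "(\<Sum>n<Suc m. real (Suc (n + N)) powr (- \<sigma> - 1)) \<le> real (Suc N) powr (- \<sigma> - 1) + (real (Suc N) powr (-\<sigma>) - real (Suc (N + m)) powr (-\<sigma>)) / \<sigma>" for m
  proof (induction m)
    case (Suc m)
    have "(\<Sum>n<Suc (Suc m). real (Suc (n + N)) powr (- \<sigma> - 1)) =
      (\<Sum>n<Suc m. real (Suc (n + N)) powr (- \<sigma> - 1)) + real (Suc (Suc (m + N))) powr (- \<sigma> - 1)" by simp
    also have "\<dots> \<le> real (Suc N) powr (- \<sigma> - 1) + (real (Suc N) powr (-\<sigma>) - real (Suc (N + m)) powr (-\<sigma>)) / \<sigma>
        + (real (Suc (m + N)) powr (-\<sigma>) - real (Suc (Suc (m + N))) powr (-\<sigma>)) / \<sigma>"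
      by (intro add_mono Suc step) auto
    also have "\<dots> = real (Suc N) powr (- \<sigma> - 1) + (real (Suc N) powr (-\<sigma>) - real (Suc (N + Suc m)) powr (-\<sigma>)) / \<sigma>"
      by (simp add: diff_divide_distrib add_ac)
    finally show ?case .
  qed simp
  have "(\<Sum>n<m. real (Suc (n + N)) powr (- \<sigma> - 1)) \<le> (\<Sum>n<Suc m. real (Suc (n + N)) powr (- \<sigma> - 1))"
    by simp
  moreover have "real (Suc N) powr (- \<sigma> - 1) \<le> real (Suc N) powr (- \<sigma>)"
    by (intro powr_mono) auto
  moreover have "(real (Suc N) powr (-\<sigma>) - real (Suc (N + m)) powr (-\<sigma>)) / \<sigma> \<le> real (Suc N) powr (-\<sigma>) / \<sigma>"
    using assms by (intro divide_right_mono) auto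
  ultimately show "(\<Sum>n<m. real (Suc (n + N)) powr (- \<sigma> - 1)) \<le> (1 + 1 / \<sigma>) * real (Suc N) powr (- \<sigma>)"
    using part[of m] by (simp add: distrib_right del: of_nat_Suc sum.lessThan_Suc)
qed

text \<open>Remainder of the regularised series after N terms. With N = 0 it yields the growth of
  \<open>zeta\<close> in vertical strips, with N of order T^2 the approximation by Dirichlet
  polynomials.\<close>

lemma zreg_approx:
  assumes "Re s > 0"
  shows "norm (zreg s - ((s - 1) * (\<Sum>k<N. of_nat (Suc k) powr (-s)) + of_nat (Suc N) powr (1 - s))) \<le>
    norm (s - 1) * norm s * (1 + 1 / Re s) * real (Suc N) powr (- Re s)"
proof -
  have sm: "summable (\<lambda>n. zreg_term n s)" using summable_zreg_term[OF assms] by (rule summable_norm_cancel)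
  have sm1: "summable (\<lambda>n. norm (zreg_term (n + N) s))"
    by (rule summable_ignore_initial_segment[OF summable_zreg_term[OF assms]])
  have sm2: "summable (\<lambda>n. real (Suc (n + N)) powr (- Re s - 1))"
    by (rule summable_ignore_initial_segment[OF summable_zreg_bound[OF assms]])
  have "zreg s - ((s - 1) * (\<Sum>k<N. of_nat (Suc k) powr (-s)) + of_nat (Suc N) powr (1 - s)) = (\<Sum>n. zreg_term (n + N) s)"
    unfolding zreg_partial_sum[symmetric] zreg_def using suminf_split_initial_segment[OF sm, of N] by simp
  also have "norm \<dots> \<le> (\<Sum>n. norm (zreg_term (n + N) s))"
    using sm1 by (rule summable_norm)
  also have "\<dots> \<le> (\<Sum>n. norm (s - 1) * norm s * real (Suc (n + N)) powr (- Re s - 1))"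
    by (rule suminf_le[OF norm_zreg_term_le[OF assms] sm1 summable_mult[OF sm2]])
  also have "\<dots> = norm (s - 1) * norm s * (\<Sum>n. real (Suc (n + N)) powr (- Re s - 1))"
    by (rule suminf_mult[OF sm2])
  also have "\<dots> \<le> norm (s - 1) * norm s * ((1 + 1 / Re s) * real (Suc N) powr (- Re s))"
    by (intro mult_left_mono powr_neg_tail_le assms) auto
  finally show ?thesis by (simp only: mult.assoc)
qed

lemma tendsto_real_powr_neg: "(\<sigma>::real) > 0 \<Longrightarrow> (\<lambda>N. real (Suc N) powr (-\<sigma>)) \<longlonglongrightarrow> 0"
  by (rule LIMSEQ_Suc, rule tendsto_neg_powr) (auto simp: filterlim_real_sequentially)

lemma zreg_LIMSEQ:
  assumes "Re s > 0"
  shows "(\<lambda>N. (s - 1) * (\<Sum>k<N. of_nat (Suc k) powr (-s)) + of_nat (Suc N) powr (1 - s)) \<longlonglongrightarrow> zreg s"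
proof -
  have "summable (\<lambda>n. zreg_term n s)" using summable_zreg_term[OF assms] by (rule summable_norm_cancel)
  then have "(\<lambda>N. 1 + (\<Sum>k<N. zreg_term k s)) \<longlonglongrightarrow> zreg s"
    unfolding zreg_def by (intro tendsto_intros) (auto simp: summable_LIMSEQ)
  then show ?thesis by (simp only: zreg_partial_sum)
qed

lemma dirichlet_sums_zreg:
  assumes "Re s > 1"
  shows "(\<lambda>n. 1 / of_nat (Suc n) powr s) sums (zreg s / (s - 1))"
proof -
  have "(\<lambda>N. of_nat (Suc N) powr (1 - s)) \<longlonglongrightarrow> 0"
  proof (rule tendsto_norm_zero_cancel)
    have "norm (of_nat (Suc N) powr (1 - s)) = real (Suc N) powr (- (Re s - 1))" for N
      by (subst norm_powr_real_powr) (auto simp del: of_nat_Suc)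
    then show "(\<lambda>N. norm (of_nat (Suc N) powr (1 - s))) \<longlonglongrightarrow> 0"
      using tendsto_real_powr_neg[of "Re s - 1"] assms by simp
  qed
  with zreg_LIMSEQ[of s] have "(\<lambda>N. (s - 1) * (\<Sum>k<N. of_nat (Suc k) powr (-s)) + of_nat (Suc N) powr (1 - s)
      - of_nat (Suc N) powr (1 - s)) \<longlonglongrightarrow> zreg s - 0"
    using assms by (intro tendsto_diff) auto
  then have *: "(\<lambda>N. (s - 1) * (\<Sum>k<N. of_nat (Suc k) powr (-s)) / (s - 1)) \<longlonglongrightarrow> zreg s / (s - 1)"
    using assms by (intro tendsto_divide) auto
  have "s - 1 \<noteq> 0" using assms by auto
  with * show ?thesis by (simp add: sums_def powr_minus inverse_eq_divide del: of_nat_Suc)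
qed

section \<open>The functional equation\<close>

text \<open>Turns a regularised sum, the limit of integral minus sum, into one integral of a
  nonnegative function, so that Tonelli applies later. The antiderivative enters only through
  \<open>has_integral\<close>, which admits kernels such as \<open>v powr (-p)\<close> that are
  singular at 0.\<close>

lemma nn_integral_minus_ceiling:
  fixes k K :: "real \<Rightarrow> real"
  assumes [measurable]: "k \<in> borel_measurable borel"
    and dec: "\<And>u v. 0 < u \<Longrightarrow> u \<le> v \<Longrightarrow> k v \<le> k u"
    and int: "\<And>n::nat. (k has_integral (K (real (Suc n)) - K (real n))) {real n..real (Suc n)}"
    and lim: "(\<lambda>N. K (real N) - K 0 - (\<Sum>n<N. k (real (Suc n)))) \<longlonglongrightarrow> W"
  shows "(\<integral>\<^sup>+v\<in>{0<..}. ennreal (k v - k (of_int \<lceil>v\<rceil>)) \<partial>lborel) = ennreal W"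
proof -
  define f where "f n = (K (real (Suc n)) - K (real n)) - k (real (Suc n))" for n
  \<comment> \<open>Open on the left, so that the ceiling is constant on each piece and the pieces
    are disjoint.\<close>
  define I where "I n = {real n<..real (Suc n)}" for n
  have ceil: "of_int \<lceil>v\<rceil> = real (Suc n)" if "v \<in> I n" for v n
    using that by (simp add: I_def ceiling_unique[of "int (Suc n)"])
  have hi: "((\<lambda>v. k v - k (real (Suc n))) has_integral f n) (I n)" for n
  proof -
    have "((\<lambda>v. k v - k (real (Suc n))) has_integral f n) {real n..real (Suc n)}"
      unfolding f_def by (intro has_integral_diff int) (use has_integral_const_real[of "k (real (Suc n))" "real n" "real (Suc n)"] in auto)
    then have "((\<lambda>v. if v \<in> {real n..real (Suc n)} then k v - k (real (Suc n)) else 0) has_integral f n) UNIV"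
      by (simp only: has_integral_restrict_UNIV)
    then have "((\<lambda>v. if v \<in> I n then k v - k (real (Suc n)) else 0) has_integral f n) UNIV"
      by (rule has_integral_spike[of "{real n}", rotated 2]) (auto simp: I_def)
    then show ?thesis by (simp only: has_integral_restrict_UNIV)
  qed
  have nn: "k v - k (real (Suc n)) \<ge> 0" if "v \<in> I n" for v n
    using that dec[of v "real (Suc n)"] by (auto simp: I_def)
  have piece: "(\<integral>\<^sup>+v\<in>I n. ennreal (k v - k (of_int \<lceil>v\<rceil>)) \<partial>lborel) = ennreal (f n)" for n
  proof -
    have "(\<integral>\<^sup>+v\<in>I n. ennreal (k v - k (of_int \<lceil>v\<rceil>)) \<partial>lborel) = (\<integral>\<^sup>+v\<in>I n. ennreal (k v - k (real (Suc n))) \<partial>lborel)"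
      using ceil[of _ n] by (intro nn_integral_cong) (auto simp: indicator_def)
    also have "\<dots> = ennreal (f n)"
      by (rule nn_integral_has_integral_lebesgue'[OF nn hi])
    finally show ?thesis .
  qed
  have f0: "f n \<ge> 0" for n
    using has_integral_nonneg[OF hi nn] by auto
  have fs: "f sums W"
  proof -
    have "(\<Sum>n<N. f n) = K (real N) - K 0 - (\<Sum>n<N. k (real (Suc n)))" for N
      unfolding f_def by (subst sum_subtractf, subst sum_lessThan_telescope) simp
    then show ?thesis using lim by (simp add: sums_def)
  qed
  have ind: "ennreal (k v - k (of_int \<lceil>v\<rceil>)) * indicator {0<..} v = (\<Sum>n. ennreal (k v - k (of_int \<lceil>v\<rceil>)) * indicator (I n) v)" for v
  proof (cases "v > 0")
    case True
    define n where "n = nat \<lceil>v\<rceil> - 1"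
    have "\<lceil>v\<rceil> \<ge> 1" using True by simp
    then have n: "int n = \<lceil>v\<rceil> - 1" unfolding n_def by linarith
    have vn: "v \<in> I n" using True n by (auto simp: I_def) linarith+
    have "v \<notin> I m" if "m \<noteq> n" for m
      using ceil[of v m] ceil[of v n] vn that by auto
    then have "(\<Sum>m. ennreal (k v - k (of_int \<lceil>v\<rceil>)) * indicator (I m) v) = ennreal (k v - k (of_int \<lceil>v\<rceil>)) * indicator (I n) v"
      by (subst suminf_finite[of "{n}"]) (auto simp: indicator_def)
    then show ?thesis using True vn by simp
  next
    case False
    then have "v \<notin> I m" for m by (auto simp: I_def)
    then show ?thesis using False by simp
  qed
  have "(\<integral>\<^sup>+v\<in>{0<..}. ennreal (k v - k (of_int \<lceil>v\<rceil>)) \<partial>lborel) =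
      (\<integral>\<^sup>+v. (\<Sum>n. ennreal (k v - k (of_int \<lceil>v\<rceil>)) * indicator (I n) v) \<partial>lborel)"
    by (simp only: ind)
  also have "\<dots> = (\<Sum>n. \<integral>\<^sup>+v\<in>I n. ennreal (k v - k (of_int \<lceil>v\<rceil>)) \<partial>lborel)"
    by (rule nn_integral_suminf) (simp add: I_def)
  also have "\<dots> = (\<Sum>n. ennreal (f n))"
    by (simp only: piece)
  also have "\<dots> = ennreal W"
    using f0 fs by (rule suminf_ennreal_eq)
  finally show ?thesis .
qed

lemma nn_integral_on_has_integral:
  fixes f :: "real \<Rightarrow> real"
  assumes [measurable]: "f \<in> borel_measurable borel" "A \<in> sets borel"
    and "\<And>x. x \<in> A \<Longrightarrow> f x \<ge> 0" "(\<integral>\<^sup>+x\<in>A. ennreal (f x) \<partial>lborel) = ennreal b" "b \<ge> 0"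
  shows "(f has_integral b) A"
proof -
  have "((\<lambda>x. if x \<in> A then f x else 0) has_integral b) UNIV"
  proof (rule nn_integral_has_integral)
    have "(\<integral>\<^sup>+x. ennreal (if x \<in> A then f x else 0) \<partial>lborel) = (\<integral>\<^sup>+x\<in>A. ennreal (f x) \<partial>lborel)"
      by (intro nn_integral_cong) (auto simp: indicator_def)
    then show "(\<integral>\<^sup>+x. ennreal (if x \<in> A then f x else 0) \<partial>lborel) = ennreal b"
      using assms by simp
  qed (use assms in auto)
  then show ?thesis by (simp add: has_integral_restrict_UNIV)
qed

lemma nn_integral_Gamma_scaled:
  fixes s v :: real
  assumes "s > 0" "v > 0"
  shows "(\<integral>\<^sup>+x\<in>{0<..}. ennreal (x powr (s - 1) * exp (- v * x)) \<partial>lborel) = ennreal (Gamma s * v powr (-s))"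
proof -
  let ?f = "\<lambda>t::real. ennreal (indicat_real {0..} t * t powr (s - 1) / exp t)"
  have "ennreal (Gamma s) = (\<integral>\<^sup>+ t. ?f t \<partial>lborel)"
    using assms by (intro Gamma_conv_nn_integral_real)
  also have "\<dots> = ennreal \<bar>v\<bar> * (\<integral>\<^sup>+ x. ?f (0 + v * x) \<partial>lborel)"
    using assms by (intro nn_integral_real_affine) auto
  also have "(\<integral>\<^sup>+ x. ?f (0 + v * x) \<partial>lborel) =
     (\<integral>\<^sup>+ x. ennreal (v powr (s - 1)) * (ennreal (x powr (s - 1) * exp (- v * x)) * indicator {0<..} x) \<partial>lborel)"
  proof (intro nn_integral_cong)
    fix x :: real
    show "?f (0 + v * x) = ennreal (v powr (s - 1)) * (ennreal (x powr (s - 1) * exp (- v * x)) * indicator {0<..} x)"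
    proof (cases "x > 0")
      case True
      then show ?thesis using assms
        by (simp add: indicator_def powr_mult exp_minus field_simps flip: ennreal_mult)
    next
      case False
      then have "x = 0 \<or> v * x < 0" using assms by (auto simp: mult_less_0_iff not_less)
      then show ?thesis using False by (auto simp: indicator_def)
    qed
  qed
  also have "\<dots> = ennreal (v powr (s - 1)) * (\<integral>\<^sup>+x\<in>{0<..}. ennreal (x powr (s - 1) * exp (- v * x)) \<partial>lborel)"
    by (rule nn_integral_cmult) simp
  also have "ennreal \<bar>v\<bar> * (ennreal (v powr (s - 1)) * (\<integral>\<^sup>+x\<in>{0<..}. ennreal (x powr (s - 1) * exp (- v * x)) \<partial>lborel)) =
     ennreal (v powr s) * (\<integral>\<^sup>+x\<in>{0<..}. ennreal (x powr (s - 1) * exp (- v * x)) \<partial>lborel)"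
    using assms by (simp add: powr_diff mult.assoc[symmetric] flip: ennreal_mult)
  finally have "ennreal (v powr (-s)) * ennreal (Gamma s) =
      ennreal (v powr (-s)) * ennreal (v powr s) * (\<integral>\<^sup>+x\<in>{0<..}. ennreal (x powr (s - 1) * exp (- v * x)) \<partial>lborel)"
    by (simp add: mult.assoc)
  also have "ennreal (v powr (-s)) * ennreal (v powr s) = 1"
    using assms by (simp add: powr_add[symmetric] flip: ennreal_mult)
  finally show ?thesis
    using assms by (simp add: mult.commute Gamma_real_nonneg flip: ennreal_mult)
qed

text \<open>The substitution t = x^2 in the Gamma integral at (s + 1) / 2.\<close>

lemma nn_integral_Gamma_square:
  fixes s a :: real
  assumes "s > -1" "a > 0"
  shows "(\<integral>\<^sup>+x\<in>{0<..}. ennreal (2 * x powr s * exp (- a * x\<^sup>2)) \<partial>lborel) = ennreal (Gamma ((s + 1) / 2) * a powr (- (s + 1) / 2))"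
proof -
  define f where "f = (\<lambda>t::real. t powr ((s + 1) / 2 - 1) * exp (- a * t))"
  define b where "b = Gamma ((s + 1) / 2) * a powr (- ((s + 1) / 2))"
  have b0: "b \<ge> 0" using assms by (auto simp: b_def Gamma_real_nonneg)
  have nn: "(\<integral>\<^sup>+x\<in>{0<..}. ennreal (f x) \<partial>lborel) = ennreal b"
    unfolding f_def b_def using nn_integral_Gamma_scaled[of "(s + 1) / 2" a] assms by simp
  have "(f has_integral b) {0<..}"
    using b0 nn by (intro nn_integral_on_has_integral) (auto simp: f_def)
  moreover have img: "(\<lambda>x::real. x\<^sup>2) ` {0<..} = {0<..}"
    by (auto intro!: image_eqI[of _ _ "sqrt _"])
  ultimately have "f absolutely_integrable_on ((\<lambda>x. x\<^sup>2) ` {0<..}) \<and> integral ((\<lambda>x. x\<^sup>2) ` {0<..}) f = b"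
    by (auto intro!: nonnegative_absolutely_integrable_1 simp: has_integral_iff f_def)
  moreover have "inj_on (\<lambda>x::real. x\<^sup>2) {0<..}"
    by (auto simp: inj_on_def)
  ultimately have *: "(\<lambda>x. \<bar>2 * x\<bar> * f (x\<^sup>2)) absolutely_integrable_on {0<..} \<and> integral {0<..} (\<lambda>x. \<bar>2 * x\<bar> * f (x\<^sup>2)) = b"
    by (subst has_absolute_integral_change_of_variables_1')
       (auto intro!: derivative_eq_intros)
  have "((\<lambda>x. \<bar>2 * x\<bar> * f (x\<^sup>2)) has_integral b) {0<..}"
    using * by (auto simp: has_integral_iff set_lebesgue_integral_eq_integral)
  then have "(\<integral>\<^sup>+x\<in>{0<..}. ennreal (\<bar>2 * x\<bar> * f (x\<^sup>2)) \<partial>lborel) = ennreal b"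
    by (intro nn_integral_has_integral_lebesgue') (auto simp: f_def)
  also have "(\<integral>\<^sup>+x\<in>{0<..}. ennreal (\<bar>2 * x\<bar> * f (x\<^sup>2)) \<partial>lborel) = (\<integral>\<^sup>+x\<in>{0<..}. ennreal (2 * x powr s * exp (- a * x\<^sup>2)) \<partial>lborel)"
  proof (intro nn_integral_cong)
    fix x :: real
    show "ennreal (\<bar>2 * x\<bar> * f (x\<^sup>2)) * indicator {0<..} x = ennreal (2 * x powr s * exp (- a * x\<^sup>2)) * indicator {0<..} x"
    proof (cases "x > 0")
      case True
      have "(x\<^sup>2) powr ((s + 1) / 2 - 1) = x powr (s - 1)"
        using True powr_powr[of x 2 "(s + 1) / 2 - 1"] by (simp add: diff_divide_distrib add_divide_distrib algebra_simps)
      moreover have "x * x powr (s - 1) = x powr s"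
        using True by (simp add: powr_diff)
      ultimately show ?thesis using True by (simp add: f_def)
    qed simp
  qed
  finally show ?thesis by (simp only: b_def minus_divide_left)
qed

text \<open>The factor 1 / (x^2 + V^2) is the integral of exp (- (x^2 + V^2) a) over a > 0. Tonelli
  leaves a product of two Gamma integrals at (1 + s) / 2 and (1 - s) / 2, which the reflection
  formula turns into pi / cos.\<close>

lemma nn_integral_rational_kernel:
  fixes s V :: real
  assumes "0 < s" "s < 1" "V > 0"
  shows "(\<integral>\<^sup>+x\<in>{0<..}. ennreal (x powr (s - 1) * (2 * x / (x\<^sup>2 + V\<^sup>2))) \<partial>lborel) =
           ennreal (pi / cos (pi * s / 2) * V powr (s - 1))"
proof -
  have exp_int: "(\<integral>\<^sup>+a\<in>{0<..}. ennreal (exp (- c * a)) \<partial>lborel) = ennreal (1 / c)" if "c > 0" for c :: real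
  proof -
    have "(\<integral>\<^sup>+a\<in>{0<..}. ennreal (exp (- c * a)) \<partial>lborel) = (\<integral>\<^sup>+x\<in>{0<..}. ennreal (x powr (1 - 1) * exp (- c * x)) \<partial>lborel)"
      by (intro nn_integral_cong) (auto simp: indicator_def)
    also have "\<dots> = ennreal (1 / c)"
      using nn_integral_Gamma_scaled[of 1 c] that by (simp add: powr_minus inverse_eq_divide)
    finally show ?thesis .
  qed
  have "(\<integral>\<^sup>+x\<in>{0<..}. ennreal (x powr (s - 1) * (2 * x / (x\<^sup>2 + V\<^sup>2))) \<partial>lborel) =
    (\<integral>\<^sup>+x\<in>{0<..}. (\<integral>\<^sup>+a\<in>{0<..}. ennreal (2 * x powr s * exp (- (x\<^sup>2 + V\<^sup>2) * a)) \<partial>lborel) \<partial>lborel)"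
  proof (intro nn_integral_cong)
    fix x :: real
    show "ennreal (x powr (s - 1) * (2 * x / (x\<^sup>2 + V\<^sup>2))) * indicator {0<..} x =
      (\<integral>\<^sup>+a\<in>{0<..}. ennreal (2 * x powr s * exp (- (x\<^sup>2 + V\<^sup>2) * a)) \<partial>lborel) * indicator {0<..} x"
    proof (cases "x > 0")
      case True
      have pos: "x\<^sup>2 + V\<^sup>2 > 0" using True by (simp add: add_pos_nonneg)
      have "(\<integral>\<^sup>+a\<in>{0<..}. ennreal (2 * x powr s * exp (- (x\<^sup>2 + V\<^sup>2) * a)) \<partial>lborel) =
        (\<integral>\<^sup>+a. ennreal (2 * x powr s) * (ennreal (exp (- (x\<^sup>2 + V\<^sup>2) * a)) * indicator {0<..} a) \<partial>lborel)"
        by (intro nn_integral_cong) (simp add: ennreal_mult mult.assoc)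
      also have "\<dots> = ennreal (2 * x powr s) * ennreal (1 / (x\<^sup>2 + V\<^sup>2))"
        by (subst nn_integral_cmult) (simp_all only: exp_int[OF pos], measurable)
      also have "\<dots> = ennreal (x powr (s - 1) * (2 * x / (x\<^sup>2 + V\<^sup>2)))"
        using True pos by (simp add: powr_diff flip: ennreal_mult)
      finally show ?thesis by simp
    qed simp
  qed
  also have "\<dots> = (\<integral>\<^sup>+x. \<integral>\<^sup>+a. ennreal (2 * x powr s * exp (- (x\<^sup>2 + V\<^sup>2) * a)) * indicator {0<..} a * indicator {0<..} x \<partial>lborel \<partial>lborel)"
    by (subst nn_integral_multc[symmetric]) (auto simp: mult.assoc)
  also have "\<dots> = (\<integral>\<^sup>+a. \<integral>\<^sup>+x. ennreal (2 * x powr s * exp (- (x\<^sup>2 + V\<^sup>2) * a)) * indicator {0<..} a * indicator {0<..} x \<partial>lborel \<partial>lborel)"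
    by (rule lborel_pair.Fubini') measurable
  also have "\<dots> = (\<integral>\<^sup>+a\<in>{0<..}. ennreal (Gamma ((s + 1) / 2) * (a powr ((1 - s) / 2 - 1) * exp (- V\<^sup>2 * a))) \<partial>lborel)"
  proof (intro nn_integral_cong)
    fix a :: real
    show "(\<integral>\<^sup>+x. ennreal (2 * x powr s * exp (- (x\<^sup>2 + V\<^sup>2) * a)) * indicator {0<..} a * indicator {0<..} x \<partial>lborel) =
       ennreal (Gamma ((s + 1) / 2) * (a powr ((1 - s) / 2 - 1) * exp (- V\<^sup>2 * a))) * indicator {0<..} a"
    proof (cases "a > 0")
      case True
      have "(\<integral>\<^sup>+x. ennreal (2 * x powr s * exp (- (x\<^sup>2 + V\<^sup>2) * a)) * indicator {0<..} a * indicator {0<..} x \<partial>lborel) =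
        (\<integral>\<^sup>+x. ennreal (exp (- V\<^sup>2 * a)) * (ennreal (2 * x powr s * exp (- a * x\<^sup>2)) * indicator {0<..} x) \<partial>lborel)"
        using True by (intro nn_integral_cong)
          (auto simp: indicator_def algebra_simps exp_diff exp_minus field_simps simp flip: ennreal_mult exp_add)
      also have "\<dots> = ennreal (exp (- V\<^sup>2 * a)) * ennreal (Gamma ((s + 1) / 2) * a powr (- (s + 1) / 2))"
        using True assms by (subst nn_integral_cmult) (simp_all only: nn_integral_Gamma_square, measurable)
      also have "- (s + 1) / 2 = (1 - s) / 2 - 1" by (simp add: field_simps)
      finally show ?thesis using True assms by (simp add: mult_ac Gamma_real_nonneg flip: ennreal_mult)
    qed simp
  qed
  also have "\<dots> = (\<integral>\<^sup>+a. ennreal (Gamma ((s + 1) / 2)) * (ennreal (a powr ((1 - s) / 2 - 1) * exp (- V\<^sup>2 * a)) * indicator {0<..} a) \<partial>lborel)"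
    using assms by (intro nn_integral_cong) (simp add: ennreal_mult Gamma_real_nonneg mult.assoc)
  also have "\<dots> = ennreal (Gamma ((s + 1) / 2)) * ennreal (Gamma ((1 - s) / 2) * (V\<^sup>2) powr (- ((1 - s) / 2)))"
  proof (subst nn_integral_cmult)
    show "(\<lambda>a. ennreal (a powr ((1 - s) / 2 - 1) * exp (- V\<^sup>2 * a)) * indicator {0<..} a) \<in> borel_measurable lborel"
      by measurable
    have "(1 - s) / 2 > 0" "V\<^sup>2 > 0" using assms by auto
    from nn_integral_Gamma_scaled[OF this]
    show "ennreal (Gamma ((s + 1) / 2)) * (\<integral>\<^sup>+a\<in>{0<..}. ennreal (a powr ((1 - s) / 2 - 1) * exp (- V\<^sup>2 * a)) \<partial>lborel) =
      ennreal (Gamma ((s + 1) / 2)) * ennreal (Gamma ((1 - s) / 2) * (V\<^sup>2) powr (- ((1 - s) / 2)))" by simp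
  qed
  also have "(V\<^sup>2) powr (- ((1 - s) / 2)) = V powr (s - 1)"
    using assms powr_powr[of V 2 "- ((1 - s) / 2)"] by (simp add: diff_divide_distrib algebra_simps)
  also have "ennreal (Gamma ((s + 1) / 2)) * ennreal (Gamma ((1 - s) / 2) * V powr (s - 1)) = 
      ennreal (Gamma ((s + 1) / 2) * Gamma ((1 - s) / 2) * V powr (s - 1))"
    using assms by (simp add: Gamma_real_nonneg mult.assoc flip: ennreal_mult)
  also have "Gamma ((s + 1) / 2) * Gamma ((1 - s) / 2) = pi / cos (pi * s / 2)"
  proof -
    have eq: "(1 - s) / 2 = 1 - (s + 1) / 2" by (simp add: field_simps)
    have "complex_of_real (Gamma ((s + 1) / 2) * Gamma ((1 - s) / 2)) = Gamma (of_real ((s + 1) / 2)) * Gamma (1 - of_real ((s + 1) / 2))"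
      unfolding eq of_real_mult Gamma_complex_of_real[symmetric] of_real_diff of_real_1 ..
    also have "\<dots> = of_real pi / sin (of_real pi * of_real ((s + 1) / 2))"
      by (rule Gamma_reflection_complex)
    also have "\<dots> = of_real (pi / sin (pi * ((s + 1) / 2)))"
      by (simp only: sin_of_real of_real_mult[symmetric] of_real_divide[symmetric])
    also have "pi * ((s + 1) / 2) = pi / 2 + pi * s / 2" by (simp add: field_simps)
    also have "sin (pi / 2 + pi * s / 2) = cos (pi * s / 2)" by (simp add: sin_add)
    finally show ?thesis by (simp only: of_real_eq_iff)
  qed
  finally show ?thesis .
qed

section \<open>Partial fractions of the hyperbolic cotangent\<close>

lemma Digamma_reflection:
  fixes z :: complex
  assumes "z \<notin> \<int>"
  shows "Digamma z - Digamma (1 - z) = - of_real pi * cot (of_real pi * z)"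
proof -
  have z: "z \<notin> \<int>\<^sub>\<le>\<^sub>0" "1 - z \<notin> \<int>\<^sub>\<le>\<^sub>0"
    using assms by (auto elim!: nonpos_Ints_cases simp: algebra_simps) (metis Ints_1 Ints_diff Ints_of_int diff_diff_eq2 add_diff_cancel_left')+
  have sn: "sin (of_real pi * z) \<noteq> 0"
    using assms by (auto simp: sin_eq_0 Ints_def)
  have "((\<lambda>w. Gamma w * Gamma (1 - w)) has_field_derivative
      Gamma z * Digamma z * Gamma (1 - z) + Gamma z * (Gamma (1 - z) * Digamma (1 - z) * (-1))) (at z)"
    using z by (auto intro!: derivative_eq_intros simp: algebra_simps)
  moreover have "((\<lambda>w. Gamma w * Gamma (1 - w)) has_field_derivative
      - of_real pi * (cos (of_real pi * z) * of_real pi) / (sin (of_real pi * z))\<^sup>2) (at z)"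
    unfolding Gamma_reflection_complex using sn by (auto intro!: derivative_eq_intros simp: power2_eq_square field_simps)
  ultimately have "Gamma z * Digamma z * Gamma (1 - z) + Gamma z * (Gamma (1 - z) * Digamma (1 - z) * (-1)) =
     - of_real pi * (cos (of_real pi * z) * of_real pi) / (sin (of_real pi * z))\<^sup>2"
    by (rule DERIV_unique)
  also have "Gamma z * Digamma z * Gamma (1 - z) + Gamma z * (Gamma (1 - z) * Digamma (1 - z) * (-1)) = 
     (Gamma z * Gamma (1 - z)) * (Digamma z - Digamma (1 - z))" by (simp add: algebra_simps)
  also have "Gamma z * Gamma (1 - z) = of_real pi / sin (of_real pi * z)" by (rule Gamma_reflection_complex)
  finally have "of_real pi / sin (of_real pi * z) * (Digamma z - Digamma (1 - z)) =
      of_real pi / sin (of_real pi * z) * (- of_real pi * cot (of_real pi * z))"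
    by (simp add: cot_def power2_eq_square)
  moreover have "of_real pi / sin (of_real pi * z) \<noteq> 0" using sn by simp
  ultimately show ?thesis by (metis mult_left_cancel)
qed

text \<open>The value is coth (x/2) / 2 - 1/x. It is read off from the digamma series at 1 + z and 1
  - z with z = i x / (2 pi): their difference is a sum of 1 / (k - z) - 1 / (k + z), and the
  reflection formula evaluates it as a cotangent on the imaginary axis.\<close>

lemma coth_partial_fractions:
  fixes x :: real
  assumes "x > 0"
  shows "(\<lambda>n. 2 * x / (x\<^sup>2 + 4 * pi\<^sup>2 * (real (Suc n))\<^sup>2)) sums (1 / (exp x - 1) - 1 / x + 1 / 2)"
proof -
  define y where "y = x / (2 * pi)"
  have y: "y > 0" "x = 2 * pi * y" using assms by (auto simp: y_def)
  define z :: complex where "z = \<i> * of_real y"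
  have nz: "z \<notin> \<int>" using y by (auto simp: z_def complex_is_Int_iff)
  have z0: "z \<noteq> 0" "1 - z \<noteq> 0" "1 + z \<noteq> 0" using y by (auto simp: z_def complex_eq_iff)
  have nn: "1 - z + of_nat k \<noteq> 0" "1 + z + of_nat k \<noteq> 0" for k
    using y by (auto simp: z_def complex_eq_iff)
  have "(\<lambda>k. (inverse (of_nat (Suc k)) - inverse (1 + z + of_nat k)) - (inverse (of_nat (Suc k)) - inverse (1 - z + of_nat k)))
    sums ((\<Sum>k. inverse (of_nat (Suc k)) - inverse (1 + z + of_nat k)) - (\<Sum>k. inverse (of_nat (Suc k)) - inverse (1 - z + of_nat k)))"
    by (intro sums_diff summable_sums summable_Digamma z0)
  also have "(\<Sum>k. inverse (of_nat (Suc k)) - inverse (1 + z + of_nat k)) - (\<Sum>k. inverse (of_nat (Suc k)) - inverse (1 - z + of_nat k))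
      = Digamma (1 + z) - Digamma (1 - z)" by (simp add: Digamma_def)
  also have "\<dots> = - of_real pi * cot (of_real pi * z) + 1 / z"
    using Digamma_reflection[OF nz] Digamma_plus1[OF z0(1)] by (simp add: add.commute)
  also have "(\<lambda>k. (inverse (of_nat (Suc k)) - inverse (1 + z + of_nat k)) - (inverse (of_nat (Suc k)) - inverse (1 - z + of_nat k))) =
     (\<lambda>k. \<i> * of_real (2 * y / (y\<^sup>2 + (real (Suc k))\<^sup>2)))"
  proof
    fix k
    define w :: complex where "w = of_nat (Suc k)"
    have w: "w + z \<noteq> 0" "w - z \<noteq> 0" using nn[of k] by (auto simp: w_def algebra_simps)
    have "inverse (w - z) - inverse (w + z) = 2 * z / (w\<^sup>2 - z\<^sup>2)"
      using w by (simp add: field_simps power2_eq_square)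
    also have "w\<^sup>2 - z\<^sup>2 = of_real (y\<^sup>2 + (real (Suc k))\<^sup>2)"
      by (simp add: z_def w_def power_mult_distrib)
    finally show "(inverse (of_nat (Suc k)) - inverse (1 + z + of_nat k)) - (inverse (of_nat (Suc k)) - inverse (1 - z + of_nat k)) = 
       \<i> * of_real (2 * y / (y\<^sup>2 + (real (Suc k))\<^sup>2))"
      by (simp add: w_def z_def algebra_simps)
  qed
  also have "- of_real pi * cot (of_real pi * z) + 1 / z = \<i> * of_real (2 * pi * (1 / (exp x - 1) - 1 / x + 1 / 2))"
  proof -
    define E where "E = complex_of_real (exp (pi * y))"
    have E0: "E \<noteq> 0" by (simp add: E_def)
    have "exp (pi * y) > 1" using y by simp
    then have "exp (pi * y) ^ 2 > 1" by (intro one_less_power) auto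
    then have "complex_of_real (exp (pi * y) ^ 2) \<noteq> 1" by (metis of_real_eq_1_iff order_less_irrefl)
    then have E1: "E * E \<noteq> 1" by (simp add: E_def power2_eq_square)
    have iz: "\<i> * (of_real pi * z) = - of_real (pi * y)" by (simp add: z_def complex_eq_iff)
    have e1: "exp (\<i> * (of_real pi * z)) = inverse E"
      unfolding iz E_def by (simp only: exp_minus exp_of_real)
    have e2: "exp (- (\<i> * (of_real pi * z))) = E"
      unfolding iz E_def by (simp only: minus_minus exp_of_real)
    have "cot (of_real pi * z) = \<i> * (E * E + 1) / (1 - E * E)"
      unfolding cot_def cos_exp_eq sin_exp_eq e1 e2 using E0 E1 by (simp add: field_simps)
    also have "E * E = of_real (exp x)"
      by (simp add: E_def y flip: of_real_mult exp_add)
    also have "\<i> * (of_real (exp x) + 1) / (1 - of_real (exp x)) = \<i> * complex_of_real ((exp x + 1) / (1 - exp x))"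
      by simp
    finally have ct: "cot (of_real pi * z) = \<i> * of_real ((exp x + 1) / (1 - exp x))" .
    have zi: "1 / z = \<i> * of_real (- 1 / y)" using y by (simp add: z_def field_simps)
    have "exp x \<noteq> 1" using assms by simp
    then have "- pi * ((exp x + 1) / (1 - exp x)) - 1 / y = 2 * pi * (1 / (exp x - 1) - 1 / x + 1 / 2)"
      using y by (simp add: field_simps)
    moreover have "- of_real pi * (\<i> * of_real ((exp x + 1) / (1 - exp x))) + \<i> * of_real (- 1 / y) =
       \<i> * complex_of_real (- pi * ((exp x + 1) / (1 - exp x)) - 1 / y)"
      by (simp add: algebra_simps)
    ultimately show ?thesis unfolding ct zi by (simp only:)
  qed
  finally have "(\<lambda>k. of_real (2 * y / (y\<^sup>2 + (real (Suc k))\<^sup>2)) :: complex) sums of_real (2 * pi * (1 / (exp x - 1) - 1 / x + 1 / 2))"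
    by (subst (asm) sums_mult_iff) auto
  then have "(\<lambda>k. 2 * y / (y\<^sup>2 + (real (Suc k))\<^sup>2)) sums (2 * pi * (1 / (exp x - 1) - 1 / x + 1 / 2))"
    by (subst (asm) sums_of_real_iff)
  then have "(\<lambda>k. 2 * y / (y\<^sup>2 + (real (Suc k))\<^sup>2) / (2 * pi)) sums (2 * pi * (1 / (exp x - 1) - 1 / x + 1 / 2) / (2 * pi))"
    by (rule sums_divide)
  also have "(\<lambda>k. 2 * y / (y\<^sup>2 + (real (Suc k))\<^sup>2) / (2 * pi)) = (\<lambda>n. 2 * x / (x\<^sup>2 + 4 * pi\<^sup>2 * (real (Suc n))\<^sup>2))"
  proof
    fix k
    define A where "A = y\<^sup>2 + (real (Suc k))\<^sup>2"
    have "x\<^sup>2 + 4 * pi\<^sup>2 * (real (Suc k))\<^sup>2 = 4 * pi\<^sup>2 * A" 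
      by (simp add: A_def y power_mult_distrib algebra_simps del: of_nat_Suc)
    moreover have "A > 0" unfolding A_def by (intro add_pos_nonneg) (use y in auto)
    ultimately show "2 * y / (y\<^sup>2 + (real (Suc k))\<^sup>2) / (2 * pi) = 2 * x / (x\<^sup>2 + 4 * pi\<^sup>2 * (real (Suc k))\<^sup>2)"
      unfolding A_def[symmetric] by (simp add: y(2) field_simps power2_eq_square)
  qed
  finally show ?thesis by simp
qed

text \<open>The function 1/x - 1/(exp x - 1) is integral minus sum, over v, of a kernel k x v. If
  the Mellin transform of the kernel in x is C v powr (-p), exchanging the two integrals gives C
  times the regularised sum of v powr (-p), which is - zeta p. The kernel is left general because
  two different kernels will represent the same function, one with p = s and one with p = 1 -
  s.\<close>

lemma Gamma_zreg_transform:
  fixes k K :: "real \<Rightarrow> real \<Rightarrow> real" and s p C :: real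
  assumes [measurable]: "(\<lambda>(x, v). k x v) \<in> borel_measurable (borel \<Otimes>\<^sub>M borel)"
    and nonneg: "\<And>x v. 0 < x \<Longrightarrow> 0 < v \<Longrightarrow> 0 \<le> k x v"
    and dec: "\<And>x u v. 0 < x \<Longrightarrow> 0 < u \<Longrightarrow> u \<le> v \<Longrightarrow> k x v \<le> k x u"
    and deriv: "\<And>x v. 0 < x \<Longrightarrow> 0 \<le> v \<Longrightarrow> (K x has_real_derivative k x v) (at v)"
    and lim: "\<And>x. 0 < x \<Longrightarrow> (\<lambda>N. K x (real N) - K x 0 - (\<Sum>n<N. k x (real (Suc n)))) \<longlonglongrightarrow> 1 / x - 1 / (exp x - 1)"
    and mellin: "\<And>v. 0 < v \<Longrightarrow> (\<integral>\<^sup>+x\<in>{0<..}. ennreal (x powr (s - 1) * k x v) \<partial>lborel) = ennreal (C * v powr (-p))"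
    and p: "0 < p" "p < 1" and C: "C > 0"
  shows "\<exists>W\<ge>0. zreg (of_real p) = of_real ((1 - p) * W) \<and>
    (\<integral>\<^sup>+x\<in>{0<..}. ennreal (x powr (s - 1) * (1 / x - 1 / (exp x - 1))) \<partial>lborel) = ennreal (C * W)"
proof -
  let ?d = "\<lambda>x v. k x v - k x (of_int \<lceil>v\<rceil>)"
  have inner: "(\<integral>\<^sup>+v\<in>{0<..}. ennreal (?d x v) \<partial>lborel) = ennreal (1 / x - 1 / (exp x - 1))" if "x > 0" for x
  proof (rule nn_integral_minus_ceiling)
    show "k x \<in> borel_measurable borel" by measurable
    show "(k x has_integral (K x (real (Suc n)) - K x (real n))) {real n..real (Suc n)}" for n
    proof (rule fundamental_theorem_of_calculus)
      fix v assume "v \<in> {real n..real (Suc n)}"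
      then have "(K x has_real_derivative k x v) (at v)" by (intro deriv[OF that]) auto
      then show "(K x has_vector_derivative k x v) (at v within {real n..real (Suc n)})"
        by (rule has_vector_derivative_at_within[OF has_real_derivative_iff_has_vector_derivative[THEN iffD1]])
    qed simp
  qed (use that dec lim in auto)
  \<comment> \<open>This is - zeta p, which turns out to be nonnegative on the unit
    interval.\<close>
  define W where "W = Re (zreg (of_real p)) / (1 - p)"
  have powr_sum: "of_nat (Suc k) powr (- complex_of_real p) = of_real (real (Suc k) powr (-p))"
    "of_nat (Suc k) powr (1 - complex_of_real p) = of_real (real (Suc k) powr (1 - p))" for k
    using powr_of_real[of "real (Suc k)" "-p"] powr_of_real[of "real (Suc k)" "1 - p"] by (simp_all del: of_nat_Suc)
  have lim1: "(\<lambda>N. complex_of_real ((p - 1) * (\<Sum>k<N. real (Suc k) powr (-p)) + real (Suc N) powr (1 - p))) \<longlonglongrightarrow> zreg (of_real p)"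
    using zreg_LIMSEQ[of "of_real p"] p by (simp add: powr_sum del: of_nat_Suc)
  then have re: "zreg (of_real p) \<in> \<real>"
    by (rule closed_sequentially[OF closed_complex_Reals, rotated]) auto
  then have zW: "zreg (of_real p) = of_real ((1 - p) * W)"
    using p by (auto simp: W_def elim!: Reals_cases)
  have "(\<lambda>N. (p - 1) * (\<Sum>k<N. real (Suc k) powr (-p)) + real (Suc N) powr (1 - p)) \<longlonglongrightarrow> (1 - p) * W"
    using lim1 unfolding zW tendsto_of_real_iff .
  \<comment> \<open>In the approximants of \<open>zreg\<close> the power belongs to Suc N while the
    sum stops after N terms; subtracting the vanishing term \<open>real (Suc N) powr (-p)\<close>
    aligns the two.\<close>
  then have "(\<lambda>N. ((p - 1) * (\<Sum>k<N. real (Suc k) powr (-p)) + real (Suc N) powr (1 - p)) / (1 - p) - real (Suc N) powr (-p)) \<longlonglongrightarrow> (1 - p) * W / (1 - p) - 0"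
    using p by (intro tendsto_diff tendsto_divide tendsto_real_powr_neg) auto
  moreover have "((p - 1) * (\<Sum>k<N. real (Suc k) powr (-p)) + real (Suc N) powr (1 - p)) / (1 - p) - real (Suc N) powr (-p) =
     real (Suc N) powr (1 - p) / (1 - p) - (\<Sum>n<Suc N. real (Suc n) powr (-p))" for N
    using p by (simp add: field_simps del: of_nat_Suc)
  ultimately have "(\<lambda>N. real (Suc N) powr (1 - p) / (1 - p) - (\<Sum>n<Suc N. real (Suc n) powr (-p))) \<longlonglongrightarrow> W"
    using p by (simp del: of_nat_Suc sum.lessThan_Suc)
  then have lim2: "(\<lambda>N. real N powr (1 - p) / (1 - p) - (\<Sum>n<N. real (Suc n) powr (-p))) \<longlonglongrightarrow> W"
    by (rule LIMSEQ_imp_Suc)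
  have outer: "(\<integral>\<^sup>+v\<in>{0<..}. ennreal (v powr (-p) - of_int \<lceil>v\<rceil> powr (-p)) \<partial>lborel) = ennreal W"
  proof (rule nn_integral_minus_ceiling)
    show "((\<lambda>v. v powr (-p)) has_integral (real (Suc n) powr (1 - p) / (1 - p) - real n powr (1 - p) / (1 - p))) {real n..real (Suc n)}" for n
    proof -
      have A: "((\<lambda>v. v powr (-p)) has_integral (c powr (1 - p) / (1 - p))) {0..c}" if "c \<ge> 0" for c
        using has_integral_powr_from_0[of "-p" c] p that by (simp add: add.commute)
      have "(\<lambda>v. v powr (-p)) integrable_on {real n..real (Suc n)}"
        using integrable_on_subinterval[OF has_integral_integrable[OF A[of "real (Suc n)"]]] by auto
      moreover have "integral {0..real n} (\<lambda>v. v powr (-p)) + integral {real n..real (Suc n)} (\<lambda>v. v powr (-p)) = integral {0..real (Suc n)} (\<lambda>v. v powr (-p))"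
        using has_integral_integrable[OF A[of "real (Suc n)"]] by (intro Henstock_Kurzweil_Integration.integral_combine) auto
      ultimately show ?thesis
        using integral_unique[OF A[of "real (Suc n)"]] integral_unique[OF A[of "real n"]] by (simp add: has_integral_iff del: of_nat_Suc)
    qed
  qed (use p lim2 in \<open>auto intro!: powr_mono2'\<close>)
  have W0: "W \<ge> 0"
  proof (rule LIMSEQ_le_const[OF lim2], intro exI[of _ 0] allI impI)
    fix N :: nat
    have "(\<Sum>n<N. real (Suc n) powr (-p)) \<le> real N powr (1 - p) / (1 - p)"
    proof (induction N)
      case (Suc N)
      have "((\<lambda>v. v powr (1 - p) / (1 - p)) has_real_derivative v powr (-p)) (at v)" if "v > 0" for v
        using p that by (auto intro!: derivative_eq_intros)
      show ?case
      proof (cases "N = 0")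
        case True
        then show ?thesis using p by simp
      next
        case False
        have "\<exists>\<xi>. \<xi> > real N \<and> \<xi> < real (Suc N) \<and> real (Suc N) powr (1 - p) / (1 - p) - real N powr (1 - p) / (1 - p) = (real (Suc N) - real N) * \<xi> powr (-p)"
          using False p by (intro MVT2) (auto intro!: derivative_eq_intros)
        then obtain \<xi> where xi: "\<xi> > real N" "\<xi> < real (Suc N)"
          "real (Suc N) powr (1 - p) / (1 - p) - real N powr (1 - p) / (1 - p) = \<xi> powr (-p)" by auto
        have "real (Suc N) powr (-p) \<le> \<xi> powr (-p)"
          using xi p False by (intro powr_mono2') auto
        then show ?thesis using Suc xi(3) by (simp del: of_nat_Suc)
      qed
    qed simp
    then show "0 \<le> real N powr (1 - p) / (1 - p) - (\<Sum>n<N. real (Suc n) powr (-p))" by simp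
  qed
  have "(\<integral>\<^sup>+x\<in>{0<..}. ennreal (x powr (s - 1) * (1 / x - 1 / (exp x - 1))) \<partial>lborel) =
    (\<integral>\<^sup>+x. \<integral>\<^sup>+v. ennreal (x powr (s - 1)) * (ennreal (?d x v) * indicator {0<..} v) * indicator {0<..} x \<partial>lborel \<partial>lborel)"
  proof (intro nn_integral_cong)
    fix x :: real
    show "ennreal (x powr (s - 1) * (1 / x - 1 / (exp x - 1))) * indicator {0<..} x =
      (\<integral>\<^sup>+v. ennreal (x powr (s - 1)) * (ennreal (?d x v) * indicator {0<..} v) * indicator {0<..} x \<partial>lborel)"
    proof (cases "x > 0")
      case True
      have "(\<integral>\<^sup>+v. ennreal (x powr (s - 1)) * (ennreal (?d x v) * indicator {0<..} v) \<partial>lborel) = ennreal (x powr (s - 1)) * ennreal (1 / x - 1 / (exp x - 1))"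
        by (subst nn_integral_cmult) (simp_all only: inner[OF True], measurable)
      then show ?thesis using True by (simp add: ennreal_mult')
    qed simp
  qed
  also have "\<dots> = (\<integral>\<^sup>+v. \<integral>\<^sup>+x. ennreal (x powr (s - 1)) * (ennreal (?d x v) * indicator {0<..} v) * indicator {0<..} x \<partial>lborel \<partial>lborel)"
    by (rule lborel_pair.Fubini') measurable
  also have "\<dots> = (\<integral>\<^sup>+v\<in>{0<..}. ennreal (C * (v powr (-p) - of_int \<lceil>v\<rceil> powr (-p))) \<partial>lborel)"
  proof (intro nn_integral_cong)
    fix v :: real
    show "(\<integral>\<^sup>+x. ennreal (x powr (s - 1)) * (ennreal (?d x v) * indicator {0<..} v) * indicator {0<..} x \<partial>lborel) =
      ennreal (C * (v powr (-p) - of_int \<lceil>v\<rceil> powr (-p))) * indicator {0<..} v"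
    proof (cases "v > 0")
      case True
      define c where "c = real_of_int \<lceil>v\<rceil>"
      have c: "c \<ge> v" "c > 0" using True by (auto simp: c_def)
      have "(\<integral>\<^sup>+x. ennreal (x powr (s - 1)) * (ennreal (?d x v) * indicator {0<..} v) * indicator {0<..} x \<partial>lborel) =
        (\<integral>\<^sup>+x. ennreal (x powr (s - 1) * k x v) * indicator {0<..} x - ennreal (x powr (s - 1) * k x c) * indicator {0<..} x \<partial>lborel)"
        using True c by (intro nn_integral_cong)
          (auto simp: indicator_def right_diff_distrib c_def[symmetric] intro!: ennreal_minus[symmetric] mult_nonneg_nonneg nonneg simp flip: ennreal_mult')
      also have "\<dots> = ennreal (C * v powr (-p)) - ennreal (C * c powr (-p))"
      proof (subst nn_integral_diff)
        show "AE x in lborel. ennreal (x powr (s - 1) * k x c) * indicator {0<..} x \<le> ennreal (x powr (s - 1) * k x v) * indicator {0<..} x"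
          using True c by (auto intro!: AE_I2 ennreal_leI mult_left_mono dec simp: indicator_def)
      qed (use True c in \<open>auto simp: mellin\<close>)
      also have "\<dots> = ennreal (C * (v powr (-p) - c powr (-p)))"
        using C by (simp add: ennreal_minus right_diff_distrib)
      finally show ?thesis using True by (simp add: c_def)
    qed simp
  qed
  also have "\<dots> = (\<integral>\<^sup>+v. ennreal C * (ennreal (v powr (-p) - of_int \<lceil>v\<rceil> powr (-p)) * indicator {0<..} v) \<partial>lborel)"
    using C by (intro nn_integral_cong) (simp add: ennreal_mult' mult.assoc)
  also have "\<dots> = ennreal C * ennreal W"
    by (subst nn_integral_cmult) (simp_all only: outer, measurable)
  also have "\<dots> = ennreal (C * W)" using C by (simp add: ennreal_mult')
  finally show ?thesis using W0 zW by blast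
qed

text \<open>Two evaluations of the same Mellin integral \<open>J\<close>. The geometric series
  corresponds to the kernel exp (- v x), the partial fractions of coth to the kernel 2 x / (x^2 + 4
  pi^2 v^2). The antiderivative of the latter is an arctangent divided by pi; its limit 1/2 cancels
  the 1/2 in the partial fraction formula.\<close>

lemma zreg_functional_equation_real:
  fixes s :: real
  assumes s: "0 < s" "s < 1"
  shows "zreg (of_real (1 - s)) / of_real (- s) =
     2 * (2 * pi) powr (- s) * of_real (cos (pi * s / 2) * Gamma s) * (zreg (of_real s) / of_real (s - 1))"
proof -
  define J where "J = (\<integral>\<^sup>+x\<in>{0<..}. ennreal (x powr (s - 1) * (1 / x - 1 / (exp x - 1))) \<partial>lborel)"
  have exp_sum: "(\<lambda>n. exp (- real (Suc n) * x)) sums (1 / (exp x - 1))" if "x > 0" for x :: real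
  proof -
    have "(\<lambda>n. exp (-x) * exp (-x) ^ n) sums (exp (-x) * (1 / (1 - exp (-x))))"
      using that by (intro sums_mult geometric_sums) auto
    also have "exp (-x) * (1 / (1 - exp (-x))) = 1 / (exp x - 1)"
      using that by (simp add: exp_minus field_simps)
    also have "(\<lambda>n. exp (-x) * exp (-x) ^ n) = (\<lambda>n. exp (- real (Suc n) * x))"
      by (simp add: exp_of_nat_mult[symmetric] exp_add[symmetric] algebra_simps)
    finally show ?thesis .
  qed
  have "\<exists>W\<ge>0. zreg (of_real s) = of_real ((1 - s) * W) \<and> J = ennreal (Gamma s * W)"
    unfolding J_def
  proof (rule Gamma_zreg_transform[where k = "\<lambda>x v. exp (- v * x)" and K = "\<lambda>x v. - exp (- v * x) / x"])
    show "(\<lambda>N. - exp (- real N * x) / x - - exp (- 0 * x) / x - (\<Sum>n<N. exp (- real (Suc n) * x))) \<longlonglongrightarrow> 1 / x - 1 / (exp x - 1)"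
      if "x > 0" for x
    proof -
      have "(\<lambda>N. exp (-x) ^ N) \<longlonglongrightarrow> 0" using that by (intro LIMSEQ_realpow_zero) auto
      then have "(\<lambda>N. exp (- real N * x)) \<longlonglongrightarrow> 0"
        by (simp add: exp_of_nat_mult[symmetric])
      then have "(\<lambda>N. - exp (- real N * x) / x - - exp (- 0 * x) / x - (\<Sum>n<N. exp (- real (Suc n) * x))) \<longlonglongrightarrow> - 0 / x - - exp (- 0 * x) / x - 1 / (exp x - 1)"
        using exp_sum[OF that] that by (intro tendsto_intros) (auto simp: sums_def)
      then show ?thesis by simp
    qed
  qed (use s nn_integral_Gamma_scaled[OF s(1)] in \<open>auto intro!: derivative_eq_intros Gamma_real_pos mult_right_mono\<close>)
  then obtain W1 where W1: "W1 \<ge> 0" "zreg (of_real s) = of_real ((1 - s) * W1)" "J = ennreal (Gamma s * W1)" by blast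
  define C where "C = pi / cos (pi * s / 2) * (2 * pi) powr (s - 1)"
  have "0 < pi * s" "pi * s < pi * 1" using s by (intro mult_pos_pos mult_strict_left_mono; simp)+
  then have cs: "cos (pi * s / 2) > 0" by (intro cos_gt_zero_pi) (use pi_gt_zero in linarith)+
  have C: "C > 0" using cs by (simp add: C_def)
  have "\<exists>W\<ge>0. zreg (of_real (1 - s)) = of_real ((1 - (1 - s)) * W) \<and> J = ennreal (C * W)"
    unfolding J_def
  proof (rule Gamma_zreg_transform[where k = "\<lambda>x v. 2 * x / (x\<^sup>2 + 4 * pi\<^sup>2 * v\<^sup>2)" and K = "\<lambda>x v. arctan (2 * pi * v / x) / pi"])
    show "(\<integral>\<^sup>+x\<in>{0<..}. ennreal (x powr (s - 1) * (2 * x / (x\<^sup>2 + 4 * pi\<^sup>2 * v\<^sup>2))) \<partial>lborel) = ennreal (C * v powr (- (1 - s)))" if "v > 0" for v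
      using nn_integral_rational_kernel[of s "2 * pi * v"] s that by (simp add: C_def powr_mult power_mult_distrib mult_ac)
    show "((\<lambda>v. arctan (2 * pi * v / x) / pi) has_real_derivative 2 * x / (x\<^sup>2 + 4 * pi\<^sup>2 * v\<^sup>2)) (at v)" if "x > 0" "v \<ge> 0" for x v
    proof -
      define A where "A = x\<^sup>2 + 4 * pi\<^sup>2 * v\<^sup>2"
      have A: "A > 0" unfolding A_def using that by (intro add_pos_nonneg) auto
      have "1 + (2 * pi * v / x)\<^sup>2 = A / x\<^sup>2"
        using that by (simp add: A_def field_simps power2_eq_square)
      moreover have "((\<lambda>v. arctan (2 * pi * v / x) / pi) has_real_derivative inverse (1 + (2 * pi * v / x)\<^sup>2) * (2 * pi / x) / pi) (at v)"
        using that by (auto intro!: derivative_eq_intros)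
      ultimately show ?thesis
        using that A unfolding A_def[symmetric] by (simp add: field_simps power2_eq_square)
    qed
    show "2 * x / (x\<^sup>2 + 4 * pi\<^sup>2 * v\<^sup>2) \<le> 2 * x / (x\<^sup>2 + 4 * pi\<^sup>2 * u\<^sup>2)" if "x > 0" "u > 0" "u \<le> v" for x u v
      using that by (intro divide_left_mono add_mono mult_left_mono power_mono mult_pos_pos add_pos_nonneg) auto
    show "(\<lambda>N. arctan (2 * pi * real N / x) / pi - arctan (2 * pi * 0 / x) / pi - (\<Sum>n<N. 2 * x / (x\<^sup>2 + 4 * pi\<^sup>2 * (real (Suc n))\<^sup>2))) \<longlonglongrightarrow> 1 / x - 1 / (exp x - 1)"
      if "x > 0" for x
    proof -
      have "filterlim (\<lambda>N. (2 * pi / x) * real N) at_top sequentially"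
        using that by (intro filterlim_tendsto_pos_mult_at_top[OF tendsto_const] filterlim_real_sequentially) auto
      then have "(\<lambda>N. arctan ((2 * pi / x) * real N)) \<longlonglongrightarrow> pi / 2"
        by (rule filterlim_compose[OF tendsto_arctan_at_top])
      then have "(\<lambda>N. arctan (2 * pi * real N / x)) \<longlonglongrightarrow> pi / 2" by (simp add: mult.assoc)
      then have "(\<lambda>N. arctan (2 * pi * real N / x) / pi - arctan (2 * pi * 0 / x) / pi - (\<Sum>n<N. 2 * x / (x\<^sup>2 + 4 * pi\<^sup>2 * (real (Suc n))\<^sup>2))) \<longlonglongrightarrow>
        pi / 2 / pi - arctan (2 * pi * 0 / x) / pi - (1 / (exp x - 1) - 1 / x + 1 / 2)"
        using coth_partial_fractions[OF that] by (intro tendsto_intros) (auto simp: sums_def)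
      then show ?thesis by simp
    qed
  qed (use s C in auto)
  then obtain W2 where W2: "W2 \<ge> 0" "zreg (of_real (1 - s)) = of_real (s * W2)" "J = ennreal (C * W2)" by auto
  have "Gamma s * W1 = C * W2"
    using W1 W2 C s by (simp add: Gamma_real_nonneg)
  then have "W2 = 2 * (2 * pi) powr (- s) * (cos (pi * s / 2) * Gamma s) * W1"
    using cs by (simp add: C_def powr_diff powr_minus field_simps)
  then show ?thesis using s unfolding W1(2) W2(2)
    by (simp add: field_simps)
qed

(* zeta to the left of the line 1 by the functional equation; the sine is written as rGamma factors
   so that the removable singularity at 0 disappears. *)
definition zleft :: "complex \<Rightarrow> complex" where
  "zleft s = - of_real pi * of_real (2 * pi) powr (s - 1) * rGamma (1 + s / 2) * rGamma (1 - s / 2) * Gamma (1 - s) * zreg (1 - s)"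

text \<open>Away from 0 the two \<open>rGamma\<close> factors combine to the sine of the usual
  functional equation, by the reflection formula for \<open>rGamma\<close>.\<close>

lemma zleft_altdef:
  assumes "s \<noteq> 0"
  shows "zleft s = 2 * of_real (2 * pi) powr (s - 1) * sin (of_real pi * s / 2) * Gamma (1 - s) * (zreg (1 - s) / (- s))"
proof -
  have "rGamma (s / 2) * rGamma (1 - s / 2) = sin (of_real pi * (s / 2)) / of_real pi"
    by (rule rGamma_reflection_complex)
  moreover have "rGamma (s / 2) = s / 2 * rGamma (1 + s / 2)"
    using rGamma_plus1[of "s / 2"] by (simp add: add.commute)
  ultimately have "sin (of_real pi * s / 2) = of_real pi * (s / 2 * rGamma (1 + s / 2) * rGamma (1 - s / 2))"
    by (simp add: field_simps)
  note sn = this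
  have "- p * P * a * b * g * z = 2 * P * (p * (s / 2 * a * b)) * g * (z / (- s))" for p P a b g z :: complex
    using assms by simp
  then show ?thesis unfolding zleft_def sn .
qed

lemma zreg_holomorphic_compose [holomorphic_intros]:
  assumes "f holomorphic_on A" "\<And>z. z \<in> A \<Longrightarrow> Re (f z) > 0"
  shows "(\<lambda>z. zreg (f z)) holomorphic_on A"
  using holomorphic_on_compose_gen[OF assms(1) zreg_holomorphic] assms(2) by (auto simp: o_def)

lemma zleft_holomorphic: "zleft holomorphic_on {s. Re s < 1}"
proof -
  have "1 - s \<notin> \<int>\<^sub>\<le>\<^sub>0" if "Re s < 1" for s
    using that by (auto elim!: nonpos_Ints_cases simp: complex_eq_iff)
  then show ?thesis unfolding zleft_def by (intro holomorphic_intros) auto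
qed

text \<open>Identity theorem on the strip: both sides are holomorphic there and agree on the real
  interval (0, 1), which accumulates at 1/2.\<close>

lemma zleft_eq_zreg:
  assumes "0 < Re s" "Re s < 1"
  shows "zleft s = zreg s / (s - 1)"
proof -
  let ?S = "{s. 0 < Re s} \<inter> {s. Re s < 1}"
  let ?U = "complex_of_real ` {0<..<1}"
  have "zleft s - zreg s / (s - 1) = 0"
  proof (rule analytic_continuation[where S = ?S and U = ?U and \<xi> = "1/2" and f = "\<lambda>s. zleft s - zreg s / (s - 1)"])
    show "(\<lambda>s. zleft s - zreg s / (s - 1)) holomorphic_on ?S"
      by (intro holomorphic_intros holomorphic_on_subset[OF zleft_holomorphic] holomorphic_on_subset[OF zreg_holomorphic]) auto
    show "open ?S" by (intro open_Int open_halfspace_Re_gt open_halfspace_Re_lt)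
    show "connected ?S"
      by (intro convex_connected convex_Int convex_halfspace_Re_gt convex_halfspace_Re_lt)
    have "(1/2 :: real) islimpt {0<..<1}"
      by (simp add: interior_limit_point)
    then have "complex_of_real (1/2) islimpt ?U"
      by (rule islimpt_isCont_image) (auto simp: eventually_at_filter intro!: always_eventually simp del: of_real_divide)
    then show "1/2 islimpt ?U" by simp
    fix z assume "z \<in> ?U"
    then obtain r where r: "0 < r" "r < 1" "z = of_real r" by auto
    have "zreg (of_real (1 - (1 - r))) / of_real (- (1 - r)) =
     2 * (2 * pi) powr (- (1 - r)) * of_real (cos (pi * (1 - r) / 2) * Gamma (1 - r)) * (zreg (of_real (1 - r)) / of_real ((1 - r) - 1))"
      using r by (intro zreg_functional_equation_real) auto
    also have "pi * (1 - r) / 2 = pi / 2 - pi * r / 2" by (simp add: field_simps)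
    finally have *: "zreg (of_real r) / of_real (r - 1) =
     2 * of_real ((2 * pi) powr (r - 1)) * of_real (sin (pi * r / 2) * Gamma (1 - r)) * (zreg (of_real (1 - r)) / of_real (-r))"
      by (simp add: cos_diff)
    have "zleft z = 2 * of_real (2 * pi) powr (z - 1) * sin (of_real pi * z / 2) * Gamma (1 - z) * (zreg (1 - z) / (- z))"
      using r by (intro zleft_altdef) auto
    also have "of_real (2 * pi) powr (z - 1) = complex_of_real ((2 * pi) powr (r - 1))"
      using powr_of_real[of "2 * pi" "r - 1"] by (simp add: r)
    also have "sin (of_real pi * z / 2) = of_real (sin (pi * r / 2))"
      by (simp add: r flip: sin_of_real)
    also have "Gamma (1 - z) = of_real (Gamma (1 - r))"
      using Gamma_complex_of_real[of "1 - r"] by (simp add: r)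
    finally show "zleft z - zreg z / (z - 1) = 0"
      using * by (simp add: r mult.assoc)
  qed (use assms in auto)
  then show ?thesis by simp
qed

section \<open>Identification of \<open>zeta\<close> with the explicit continuation\<close>

definition zeta_ext :: "complex \<Rightarrow> complex" where
  "zeta_ext s = (if s = 1 then 0 else if Re s > 0 then zreg s / (s - 1) else zleft s)"

lemma zeta_ext_holomorphic: "zeta_ext holomorphic_on - {1}"
proof -
  have 1: "zeta_ext holomorphic_on ({s. Re s > 0} - {1})"
  proof (rule holomorphic_transform[of "\<lambda>s. zreg s / (s - 1)"])
    show "(\<lambda>s. zreg s / (s - 1)) holomorphic_on ({s. Re s > 0} - {1})" by (intro holomorphic_intros) auto
  qed (auto simp: zeta_ext_def)
  have 2: "zeta_ext holomorphic_on {s. Re s < 1}"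
    by (rule holomorphic_transform[OF zleft_holomorphic]) (auto simp: zeta_ext_def zleft_eq_zreg)
  have "zeta_ext holomorphic_on ({s. Re s > 0} - {1}) \<union> {s. Re s < 1}"
    using 1 2 by (intro holomorphic_on_Un open_Diff open_halfspace_Re_gt open_halfspace_Re_lt) auto
  moreover have "({s. Re s > 0} - {1}) \<union> {s. Re s < 1} = - {1}" by auto
  ultimately show ?thesis by simp
qed

text \<open>Evaluates the definite description: \<open>zeta_ext\<close> is a witness, and any other
  witness agrees with it on Re s > 1 by the series, hence on the connected punctured plane by the
  identity theorem. The convention at 1 fixes the remaining value.\<close>

lemma zeta_eq_zeta_ext: "zeta = zeta_ext"
  unfolding zeta_def
proof (rule the_equality, safe)
  show "zeta_ext holomorphic_on - {1}" by (rule zeta_ext_holomorphic)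
  show "zeta_ext 1 = 0" by (simp add: zeta_ext_def)
  show "(\<lambda>n. 1 / of_nat (Suc n) powr s) sums zeta_ext s" if "Re s > 1" for s
    using dirichlet_sums_zreg[OF that] that by (auto simp: zeta_ext_def)
next
  fix f assume f: "f holomorphic_on - {1}" "f 1 = 0" "\<forall>s. 1 < Re s \<longrightarrow> (\<lambda>n. 1 / of_nat (Suc n) powr s) sums f s"
  have eq: "f s = zeta_ext s" if "Re s > 1" for s
    using f(3) that dirichlet_sums_zreg[OF that] sums_unique2 by (fastforce simp: zeta_ext_def)
  show "f = zeta_ext"
  proof
    fix s
    show "f s = zeta_ext s"
    proof (cases "s = 1")
      case False
      show ?thesis
      proof (rule analytic_continuation_open[where s = "{s. Re s > 1}" and s' = "- {1}" and f = f and g = zeta_ext])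
        show "connected (- {1 :: complex})" by (rule connected_punctured_universe) simp
        have "2 \<in> {s :: complex. Re s > 1}" by simp
        then show "{s :: complex. Re s > 1} \<noteq> {}" by blast
      qed (use f zeta_ext_holomorphic False eq in \<open>auto simp: open_halfspace_Re_gt\<close>)
    qed (use f in \<open>auto simp: zeta_ext_def\<close>)
  qed
qed

lemma zeta_holomorphic: "zeta holomorphic_on - {1}"
  using zeta_ext_holomorphic by (simp add: zeta_eq_zeta_ext)

lemma zeta_conv_zreg: "Re s > 0 \<Longrightarrow> s \<noteq> 1 \<Longrightarrow> zeta s = zreg s / (s - 1)"
  by (simp add: zeta_eq_zeta_ext zeta_ext_def)

lemma zeta_sums: "Re s > 1 \<Longrightarrow> (\<lambda>n. of_nat (Suc n) powr (-s)) sums zeta s"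
  using dirichlet_sums_zreg[of s] zeta_conv_zreg[of s] by (fastforce simp: powr_minus inverse_eq_divide)

lemma zeta_functional_equation:
  assumes "0 < Re s" "Re s < 1"
  shows "zeta (1 - s) = 2 * of_real (2 * pi) powr (- s) * cos (of_real pi * s / 2) * Gamma s * zeta s"
proof -
  have ne: "1 - s \<noteq> 0" "s \<noteq> 1" "s \<noteq> 0" using assms by auto
  have "zeta (1 - s) = zleft (1 - s)"
    using assms ne by (simp add: zeta_conv_zreg zleft_eq_zreg)
  also have "\<dots> = 2 * of_real (2 * pi) powr (- s) * sin (of_real pi * (1 - s) / 2) * Gamma s * (zreg s / (s - 1))"
    using zleft_altdef[OF ne(1)] by simp
  also have "of_real pi * (1 - s) / 2 = of_real pi / 2 - of_real pi * s / 2" by (simp add: field_simps)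
  also have "sin \<dots> = cos (of_real pi * s / 2)"
    by (simp add: cos_sin_eq)
  finally show ?thesis using assms ne by (simp add: zeta_conv_zreg)
qed

lemma zreg_cnj: "zreg (cnj s) = cnj (zreg s)" if "Re s > 0"
proof -
  have "zreg_term n (cnj s) = cnj (zreg_term n s)" for n
    using cnj_powr[of "of_nat (Suc n)"] cnj_powr[of "of_nat (Suc (Suc n))"]
    by (simp add: zreg_term_def del: of_nat_Suc)
  moreover have "summable (\<lambda>n. zreg_term n s)" using summable_zreg_term[OF that] by (rule summable_norm_cancel)
  ultimately show ?thesis
    unfolding zreg_def using sums_cnj[of "\<lambda>n. zreg_term n s"] by (auto simp: summable_sums sums_unique[symmetric])
qed

lemma zeta_cnj: "Re s > 0 \<Longrightarrow> zeta (cnj s) = cnj (zeta s)"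
  by (cases "s = 1") (auto simp: zeta_conv_zreg zreg_cnj zeta_eq_zeta_ext zeta_ext_def)

lemma norm_zreg_le:
  assumes "Re s > 0"
  shows "norm (zreg s) \<le> 1 + norm (s - 1) * norm s * (1 + 1 / Re s)"
proof -
  have "norm (zreg s - 1) \<le> norm (s - 1) * norm s * (1 + 1 / Re s)"
    using zreg_approx[OF assms, of 0] by simp
  moreover have "norm (zreg s) \<le> norm (zreg s - 1) + norm (1 :: complex)" by (metis norm_triangle_sub add.commute)
  ultimately show ?thesis by simp
qed

section \<open>The Mellin transform of the exponential function\<close>

lemma norm_Gamma_half_sq: "(norm (Gamma (Complex (1/2) t)))\<^sup>2 = pi / cosh (pi * t)"
proof -
  let ?w = "Complex (1/2) t"
  have "complex_of_real ((norm (Gamma ?w))\<^sup>2) = Gamma ?w * Gamma (1 - ?w)"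
    unfolding complex_norm_square cnj_Gamma by (simp add: complex_eq_iff Complex_eq)
  also have "\<dots> = of_real pi / sin (of_real pi * ?w)" by (rule Gamma_reflection_complex)
  also have "of_real pi * ?w = of_real (pi / 2) + \<i> * of_real (pi * t)" by (simp add: complex_eq_iff)
  also have "sin (of_real (pi / 2) + \<i> * of_real (pi * t)) = of_real (cosh (pi * t))"
  proof -
    have "sin (of_real (pi / 2) + \<i> * of_real (pi * t)) = cos (\<i> * of_real (pi * t))"
      unfolding sin_add sin_of_real cos_of_real by simp
    also have "\<i> * (\<i> * complex_of_real (pi * t)) = - of_real (pi * t)" by (simp add: complex_eq_iff)
    then have "cos (\<i> * of_real (pi * t)) = of_real (cosh (pi * t))"
      unfolding cos_exp_eq by (simp only: minus_minus exp_minus exp_of_real cosh_field_def) simp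
    finally show ?thesis .
  qed
  finally have "complex_of_real ((norm (Gamma ?w))\<^sup>2) = of_real (pi / cosh (pi * t))" by simp
  then show ?thesis by (simp only: of_real_eq_iff)
qed

lemma norm_Gamma_half_le: "norm (Gamma (Complex (1/2) t)) \<le> sqrt (2 * pi) * exp (- pi * \<bar>t\<bar> / 2)"
proof (rule power2_le_imp_le)
  have "exp (pi * \<bar>t\<bar>) \<le> 2 * cosh (pi * t)"
    by (cases "t \<ge> 0") (auto simp: cosh_def)
  then have "pi / cosh (pi * t) \<le> 2 * pi / exp (pi * \<bar>t\<bar>)"
    using cosh_real_pos[of "pi * t"] by (simp add: field_simps)
  also have "\<dots> = (sqrt (2 * pi) * exp (- pi * \<bar>t\<bar> / 2))\<^sup>2"
    by (simp add: power_mult_distrib exp_minus field_simps flip: exp_double)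
  finally show "(norm (Gamma (Complex (1/2) t)))\<^sup>2 \<le> (sqrt (2 * pi) * exp (- pi * \<bar>t\<bar> / 2))\<^sup>2"
    by (simp only: norm_Gamma_half_sq)
qed auto

lemma norm_Gamma_three_halves_le:
  "norm (Gamma (Complex (3/2) t)) \<le> sqrt (2 * pi) * (1 + \<bar>t\<bar>) * exp (- pi * \<bar>t\<bar> / 2)"
proof -
  have "Gamma (Complex (3/2) t) = Complex (1/2) t * Gamma (Complex (1/2) t)"
  proof -
    have "Complex (1/2) t \<notin> \<int>\<^sub>\<le>\<^sub>0" by (auto elim!: nonpos_Ints_cases simp: complex_eq_iff)
    from Gamma_plus1[OF this] show ?thesis
      by (simp add: Complex_eq add.commute)
  qed
  moreover have "norm (Complex (1/2) t) \<le> 1 + \<bar>t\<bar>"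
    using cmod_le[of "Complex (1/2) t"] by simp
  ultimately show ?thesis
    using mult_mono[OF _ norm_Gamma_half_le[of t], of "norm (Complex (1/2) t)" "1 + \<bar>t\<bar>"] by (simp add: norm_mult mult_ac)
qed

lemma norm_Gamma_ratio_mono:
  assumes "0 < a" "a \<le> b"
  shows "norm (Gamma (Complex a t)) / Gamma a \<le> norm (Gamma (Complex b t)) / Gamma b"
proof -
  have ratio: "(\<lambda>n. \<Prod>k=0..n. (x + real k) / norm (Complex x t + of_nat k)) \<longlonglongrightarrow> norm (Gamma (Complex x t)) / Gamma x" if "x > 0" for x
  proof -
    have "norm (Gamma_series (Complex x t) n) / Gamma_series x n = (\<Prod>k=0..n. (x + real k) / norm (Complex x t + of_nat k))" for n
    proof -
      have "norm (exp (Complex x t * of_real (ln (real n)))) = exp (x * ln (real n))" by simp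
      then show ?thesis
        by (simp add: Gamma_series_def norm_mult norm_divide pochhammer_Suc_prod prod_dividef prod_norm[symmetric] field_simps)
    qed
    moreover have "(\<lambda>n. norm (Gamma_series (Complex x t) n) / Gamma_series x n) \<longlonglongrightarrow> norm (Gamma (Complex x t)) / Gamma x"
      using Gamma_real_pos[OF that] by (intro tendsto_intros Gamma_series_LIMSEQ) auto
    ultimately show ?thesis by simp
  qed
  show ?thesis
  proof (rule LIMSEQ_le[OF ratio ratio])
    have "(\<Prod>k=0..n. (a + real k) / norm (Complex a t + of_nat k)) \<le> (\<Prod>k=0..n. (b + real k) / norm (Complex b t + of_nat k))" for n
    proof (intro prod_mono conjI)
      fix k
      define p q where "p = a + real k" and "q = b + real k"
      have pq: "0 < p" "p \<le> q" using assms by (auto simp: p_def q_def)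
      have n: "norm (Complex a t + of_nat k) = sqrt (p\<^sup>2 + t\<^sup>2)" "norm (Complex b t + of_nat k) = sqrt (q\<^sup>2 + t\<^sup>2)"
        by (simp_all add: cmod_def p_def q_def)
      have pos: "p\<^sup>2 + t\<^sup>2 > 0" "q\<^sup>2 + t\<^sup>2 > 0" using pq by (auto intro!: add_pos_nonneg)
      have "p * sqrt (q\<^sup>2 + t\<^sup>2) \<le> q * sqrt (p\<^sup>2 + t\<^sup>2)"
      proof (rule power2_le_imp_le)
        have "p\<^sup>2 * t\<^sup>2 \<le> q\<^sup>2 * t\<^sup>2" using pq by (intro mult_right_mono power_mono) auto
        then show "(p * sqrt (q\<^sup>2 + t\<^sup>2))\<^sup>2 \<le> (q * sqrt (p\<^sup>2 + t\<^sup>2))\<^sup>2"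
          using pos by (simp add: power_mult_distrib algebra_simps)
      qed (use pq in auto)
      then show "(a + real k) / norm (Complex a t + of_nat k) \<le> (b + real k) / norm (Complex b t + of_nat k)"
        unfolding n p_def[symmetric] q_def[symmetric] using pos by (simp add: field_simps)
    qed (use assms in auto)
    then show "\<exists>N. \<forall>n\<ge>N. (\<Prod>k=0..n. (a + real k) / norm (Complex a t + of_nat k)) \<le> (\<Prod>k=0..n. (b + real k) / norm (Complex b t + of_nat k))"
      by blast
  qed (use assms in auto)
qed

lemma norm_Gamma_strip:
  assumes "0 < a"
  obtains C where "C > 0"
    "\<And>w. a \<le> Re w \<Longrightarrow> Re w \<le> 3/2 \<Longrightarrow> norm (Gamma w) \<le> C * (1 + \<bar>Im w\<bar>) * exp (- pi * \<bar>Im w\<bar> / 2)"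
proof -
  have "continuous_on {a..3/2} (Gamma :: real \<Rightarrow> real)"
    using assms by (intro continuous_on_Gamma) (auto elim!: nonpos_Ints_cases)
  then have "bounded (Gamma ` {a..3/2 :: real})"
    by (intro compact_imp_bounded compact_continuous_image) auto
  then obtain K where K: "K > 0" "\<And>x. x \<in> {a..3/2 :: real} \<Longrightarrow> norm (Gamma x) \<le> K"
    unfolding bounded_pos by auto
  have G: "Gamma (3/2 :: real) > 0" by simp
  show ?thesis
  proof (rule that[of "K / Gamma (3/2) * sqrt (2 * pi)"])
    show "K / Gamma (3/2) * sqrt (2 * pi) > 0" using K G by simp
    fix w assume w: "a \<le> Re w" "Re w \<le> 3/2"
    define t where "t = Im w"
    have weq: "w = Complex (Re w) t" by (simp add: t_def)
    have pos: "Gamma (Re w) > 0" using w assms by simp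
    have "norm (Gamma w) \<le> Gamma (Re w) * (norm (Gamma (Complex (3/2) t)) / Gamma (3/2))"
      using norm_Gamma_ratio_mono[of "Re w" "3/2" t] w assms pos by (simp add: weq[symmetric] field_simps)
    also have "\<dots> \<le> K * ((sqrt (2 * pi) * (1 + \<bar>t\<bar>) * exp (- pi * \<bar>t\<bar> / 2)) / Gamma (3/2))"
      using K(2)[of "Re w"] w G K pos by (intro mult_mono divide_right_mono norm_Gamma_three_halves_le) auto
    finally show "norm (Gamma w) \<le> K / Gamma (3/2) * sqrt (2 * pi) * (1 + \<bar>Im w\<bar>) * exp (- pi * \<bar>Im w\<bar> / 2)"
      by (simp add: t_def mult_ac)
  qed
qed

section \<open>Moving vertical lines of integration\<close>

lemma contour_integral_rectpath_approx:
  fixes f :: "complex \<Rightarrow> complex"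
  assumes "a < b" "h < T" and cont: "continuous_on (path_image (rectpath (Complex a h) (Complex b T))) f"
    and B1: "\<And>x. x \<in> {a..b} \<Longrightarrow> norm (f (Complex x h)) \<le> B1"
    and B2: "\<And>x. x \<in> {a..b} \<Longrightarrow> norm (f (Complex x T)) \<le> B2"
  shows "norm (contour_integral (rectpath (Complex a h) (Complex b T)) f -
    \<i> * (integral {h..T} (\<lambda>y. f (Complex b y)) - integral {h..T} (\<lambda>y. f (Complex a y)))) \<le> (B1 + B2) * (b - a)"
proof -
  let ?p = "Complex a h" and ?q = "Complex b h" and ?r = "Complex b T" and ?s = "Complex a T"
  have eq: "rectpath ?p ?r = linepath ?p ?q +++ linepath ?q ?r +++ linepath ?r ?s +++ linepath ?s ?p"
    by (simp add: rectpath_def Let_def)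
  have img: "path_image (rectpath ?p ?r) = closed_segment ?p ?q \<union> closed_segment ?q ?r \<union> closed_segment ?r ?s \<union> closed_segment ?s ?p"
    unfolding eq by (simp add: path_image_join Un_assoc)
  have c: "continuous_on (closed_segment ?p ?q) f" "continuous_on (closed_segment ?q ?r) f"
    "continuous_on (closed_segment ?r ?s) f" "continuous_on (closed_segment ?s ?p) f"
    by (rule continuous_on_subset[OF cont]; auto simp: img)+
  note i = c[THEN contour_integrable_continuous_linepath]
  have B0: "B1 \<ge> 0" "B2 \<ge> 0" 
    using order_trans[OF norm_ge_zero B1[of a]] order_trans[OF norm_ge_zero B2[of a]] assms(1) by auto
  have "contour_integral (rectpath ?p ?r) f = contour_integral (linepath ?p ?q) f + contour_integral (linepath ?q ?r) f
      + contour_integral (linepath ?r ?s) f + contour_integral (linepath ?s ?p) f"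
    unfolding eq using i by (simp add: contour_integral_join valid_path_join contour_integrable_join add.assoc)
  also have "contour_integral (linepath ?q ?r) f = \<i> * integral {h..T} (\<lambda>y. f (Complex b y))"
    using assms by (intro contour_integral_linepath_same_Re) auto
  also have "contour_integral (linepath ?s ?p) f = - (\<i> * integral {h..T} (\<lambda>y. f (Complex a y)))"
  proof -
    have "contour_integral (linepath ?p ?s) f = \<i> * integral {h..T} (\<lambda>y. f (Complex a y))"
      using assms by (intro contour_integral_linepath_same_Re) auto
    then show ?thesis
      using contour_integral_reverse_linepath[of ?s ?p f] c(4) by simp
  qed
  finally have "contour_integral (rectpath ?p ?r) f - \<i> * (integral {h..T} (\<lambda>y. f (Complex b y)) - integral {h..T} (\<lambda>y. f (Complex a y)))
     = contour_integral (linepath ?p ?q) f + contour_integral (linepath ?r ?s) f"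
    by (simp add: algebra_simps)
  also have "norm \<dots> \<le> norm (contour_integral (linepath ?p ?q) f) + norm (contour_integral (linepath ?r ?s) f)"
    by (rule norm_triangle_ineq)
  also have "\<dots> \<le> B1 * norm (?q - ?p) + B2 * norm (?s - ?r)"
  proof (intro add_mono contour_integral_bound_linepath i B0)
    fix x assume "x \<in> closed_segment ?p ?q"
    then have "x = Complex (Re x) h \<and> Re x \<in> {a..b}"
      using assms(1) by (auto simp: closed_segment_same_Im closed_segment_eq_real_ivl complex_eq_iff)
    then show "norm (f x) \<le> B1" using B1 by metis
  next
    fix x assume "x \<in> closed_segment ?r ?s"
    then have "x = Complex (Re x) T \<and> Re x \<in> {a..b}"
      using assms(1) by (auto simp: closed_segment_same_Im closed_segment_eq_real_ivl complex_eq_iff)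
    then show "norm (f x) \<le> B2" using B2 by metis
  qed
  also have "\<dots> = (B1 + B2) * (b - a)"
    using assms(1) by (simp add: cmod_def algebra_simps)
  finally show ?thesis .
qed

lemma set_integral_symmetric_tendsto:
  fixes f :: "real \<Rightarrow> complex"
  assumes "integrable lborel f" "continuous_on UNIV f"
  shows "(\<lambda>n. integral {- real n..real n} f) \<longlonglongrightarrow> (\<integral>t. f t \<partial>lborel)"
proof -
  have U: "(\<Union>n. {- real n..real n}) = UNIV"
  proof -
    have "\<exists>n. x \<in> {- real n..real n}" for x :: real
    proof -
      obtain n where "\<bar>x\<bar> \<le> real n" using real_arch_simple by blast
      then show ?thesis by (intro exI[of _ n]) auto
    qed
    then show ?thesis by auto
  qed
  have "(\<lambda>n. LINT x:{- real n..real n}|lborel. f x) \<longlonglongrightarrow> (LINT x:(\<Union>n. {- real n..real n})|lborel. f x)"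
    by (rule set_integral_cont_up) (use assms U in \<open>auto simp: incseq_def set_integrable_def\<close>)
  also have "(LINT x:(\<Union>n. {- real n..real n})|lborel. f x) = (\<integral>t. f t \<partial>lborel)"
    by (simp add: U set_lebesgue_integral_def)
  also have "(\<lambda>n. LINT x:{- real n..real n}|lborel. f x) = (\<lambda>n. integral {- real n..real n} f)"
    using assms by (intro ext set_borel_integral_eq_integral)
      (auto intro!: integrable_mult_indicator simp: set_integrable_def)
  finally show ?thesis .
qed

text \<open>\<open>R\<close> is the common contour integral over all large rectangles, in the
  applications 2 pi i times a residue, or 0. \<open>B\<close> controls the horizontal sides, which
  disappear as the rectangles grow.\<close>

lemma vertical_line_shift:
  fixes f :: "complex \<Rightarrow> complex"
  assumes "a < b"
    and cont: "\<And>n. n \<ge> n0 \<Longrightarrow> continuous_on (path_image (rectpath (Complex a (- real n)) (Complex b (real n)))) f"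
    and R: "\<And>n. n \<ge> n0 \<Longrightarrow> contour_integral (rectpath (Complex a (- real n)) (Complex b (real n))) f = R"
    and B1: "\<And>n x. n \<ge> n0 \<Longrightarrow> x \<in> {a..b} \<Longrightarrow> norm (f (Complex x (- real n))) \<le> B (real n)"
    and B2: "\<And>n x. n \<ge> n0 \<Longrightarrow> x \<in> {a..b} \<Longrightarrow> norm (f (Complex x (real n))) \<le> B (real n)"
    and B: "(B \<longlongrightarrow> 0) at_top"
    and int: "integrable lborel (\<lambda>t. f (Complex a t))" "integrable lborel (\<lambda>t. f (Complex b t))"
    and cont': "continuous_on UNIV (\<lambda>t. f (Complex a t))" "continuous_on UNIV (\<lambda>t. f (Complex b t))"
  shows "\<i> * ((\<integral>t. f (Complex b t) \<partial>lborel) - (\<integral>t. f (Complex a t) \<partial>lborel)) = R"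
proof -
  define D where "D n = R - \<i> * (integral {- real n..real n} (\<lambda>y. f (Complex b y)) - integral {- real n..real n} (\<lambda>y. f (Complex a y)))" for n
  have "norm (D n) \<le> (B (real n) + B (real n)) * (b - a)" if "n \<ge> max n0 1" for n
    unfolding D_def using contour_integral_rectpath_approx[OF assms(1) _ cont B1 B2, of n] R[of n] that by auto
  then have "eventually (\<lambda>n. norm (D n) \<le> (B (real n) + B (real n)) * (b - a)) sequentially"
    unfolding eventually_sequentially by blast
  moreover have "(\<lambda>n. (B (real n) + B (real n)) * (b - a)) \<longlonglongrightarrow> (0 + 0) * (b - a)"
    by (intro tendsto_intros filterlim_compose[OF B filterlim_real_sequentially])
  ultimately have "D \<longlonglongrightarrow> 0"
    by (intro Lim_null_comparison[of D]) auto
  moreover have "D \<longlonglongrightarrow> R - \<i> * ((\<integral>t. f (Complex b t) \<partial>lborel) - (\<integral>t. f (Complex a t) \<partial>lborel))"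
    unfolding D_def by (intro tendsto_intros set_integral_symmetric_tendsto int cont')
  ultimately have "R - \<i> * ((\<integral>t. f (Complex b t) \<partial>lborel) - (\<integral>t. f (Complex a t) \<partial>lborel)) = 0"
    using LIMSEQ_unique by blast
  then show ?thesis by simp
qed

text \<open>The growth rate in Im w is the argument of z. The decay exp (- pi |Im w| / 2) of the
  Gamma function wins over it because the argument stays below pi / 2 when Re z > 0.\<close>

lemma norm_powr_neg_le:
  assumes "Re z > 0"
  shows "norm (z powr (-w)) \<le> norm z powr (- Re w) * exp (\<bar>Im (Ln z)\<bar> * \<bar>Im w\<bar>)"
proof -
  have z: "z \<noteq> 0" using assms by auto
  have "norm (z powr (-w)) = norm z powr (- Re w) * exp (Im w * Im (Ln z))"
    using z by (simp add: powr_def exp_add[symmetric] algebra_simps)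
  moreover have "Im w * Im (Ln z) \<le> \<bar>Im (Ln z)\<bar> * \<bar>Im w\<bar>"
    by (metis abs_ge_self abs_mult mult.commute)
  ultimately show ?thesis by (simp add: mult_left_mono)
qed

lemma norm_Gamma_shift:
  assumes "\<bar>Im w\<bar> \<ge> 1"
  shows "norm (Gamma w) \<le> norm (Gamma (w + of_nat k))"
proof (induction k)
  case (Suc k)
  have "w + of_nat k \<notin> \<int>\<^sub>\<le>\<^sub>0" using assms by (auto elim!: nonpos_Ints_cases simp: complex_eq_iff)
  then have "norm (Gamma (w + of_nat (Suc k))) = norm (w + of_nat k) * norm (Gamma (w + of_nat k))"
    using Gamma_plus1[of "w + of_nat k"] by (simp add: add_ac norm_mult)
  moreover have "norm (w + of_nat k) \<ge> 1"
    using abs_Im_le_cmod[of "w + of_nat k"] assms by simp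
  ultimately have "1 * norm (Gamma (w + of_nat k)) \<le> norm (Gamma (w + of_nat (Suc k)))"
    by (simp only: mult_right_mono norm_ge_zero)
  with Suc show ?case by simp
qed auto

section \<open>Integrable majorants\<close>

lemma integrable_exp_half_line:
  fixes d :: real
  assumes "d > 0"
  shows "integrable lborel (\<lambda>t. indicator {0..} t * exp (- d * t))"
proof (rule integrableI_nonneg)
  have "(\<integral>\<^sup>+t\<in>{0..}. ennreal (exp (- d * t)) \<partial>lborel) = ennreal (exp (- d * 0) / d)"
    by (rule nn_integral_has_integral_lebesgue'[OF _ has_integral_exp_minus_to_infinity]) (use assms in auto)
  moreover have "(\<integral>\<^sup>+t. ennreal (indicator {0..} t * exp (- d * t)) \<partial>lborel) = (\<integral>\<^sup>+t\<in>{0..}. ennreal (exp (- d * t)) \<partial>lborel)"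
    by (intro nn_integral_cong) (auto simp: indicator_def)
  ultimately show "(\<integral>\<^sup>+t. ennreal (indicator {0..} t * exp (- d * t)) \<partial>lborel) < \<infinity>" by simp
qed auto

lemma power_le_fact_exp:
  fixes x :: real
  assumes "x \<ge> 0"
  shows "x ^ n \<le> fact n * exp x"
proof -
  have "(\<Sum>k\<in>{n}. inverse (fact k) * x ^ k) \<le> (\<Sum>k. inverse (fact k) * x ^ k)"
    using assms by (intro sum_le_suminf summable_exp) auto
  then have "inverse (fact n) * x ^ n \<le> exp x"
    by (simp add: exp_def divide_inverse mult.commute)
  then show ?thesis by (simp add: field_simps)
qed

lemma poly_exp_le:
  fixes c x :: real
  assumes "c > 0" "x \<ge> 0"
  shows "(1 + x) ^ n * exp (- c * x) \<le> fact n * (2 / c) ^ n * exp (c / 2) * exp (- (c / 2) * x)"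
proof -
  have "(1 + x) ^ n = (2 / c) ^ n * ((c / 2) * (1 + x)) ^ n"
  proof -
    have "(2 / c) * ((c / 2) * (1 + x)) = 1 + x" using assms by (simp add: field_simps)
    then show ?thesis by (simp only: power_mult_distrib[symmetric])
  qed
  also have "\<dots> \<le> (2 / c) ^ n * (fact n * exp ((c / 2) * (1 + x)))"
    using assms by (intro mult_left_mono power_le_fact_exp) auto
  finally have "(1 + x) ^ n * exp (- c * x) \<le> (2 / c) ^ n * (fact n * exp ((c / 2) * (1 + x))) * exp (- c * x)"
    by (intro mult_right_mono) auto
  also have "\<dots> = (2 / c) ^ n * (fact n * (exp ((c / 2) * (1 + x)) * exp (- c * x)))"
    by simp
  also have "exp ((c / 2) * (1 + x)) * exp (- c * x) = exp (c / 2) * exp (- (c / 2) * x)"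
    unfolding exp_add[symmetric] by (simp add: field_simps)
  finally show ?thesis by (simp add: mult_ac)
qed

lemma integrable_poly_exp_abs: 
  fixes c :: real
  assumes "c > 0"
  shows "integrable lborel (\<lambda>t. (1 + \<bar>t\<bar>) ^ n * exp (- c * \<bar>t\<bar>))"
proof (rule Bochner_Integration.integrable_bound)
  define f where "f = (\<lambda>t::real. indicator {0..} t * exp (- (c / 2) * t))"
  define K where "K = fact n * (2 / c) ^ n * exp (c / 2)"
  have "integrable lborel f" unfolding f_def using assms by (intro integrable_exp_half_line) auto
  moreover from this have "integrable lborel (\<lambda>t. f (0 + (-1) * t))"
    by (intro lborel_integrable_real_affine) auto
  ultimately show "integrable lborel (\<lambda>t. K * (f t + f (0 + (-1) * t)))"
    by (intro integrable_mult_right Bochner_Integration.integrable_add)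
  show "AE t in lborel. norm ((1 + \<bar>t\<bar>) ^ n * exp (- c * \<bar>t\<bar>)) \<le> norm (K * (f t + f (0 + (-1) * t)))"
  proof (intro AE_I2)
    fix t :: real
    have K: "K \<ge> 0" using assms by (simp add: K_def)
    have "norm ((1 + \<bar>t\<bar>) ^ n * exp (- c * \<bar>t\<bar>)) \<le> K * exp (- (c / 2) * \<bar>t\<bar>)"
      using poly_exp_le[OF assms, of "\<bar>t\<bar>" n] by (simp add: K_def)
    also have "\<dots> \<le> K * (f t + f (0 + (-1) * t))"
      by (intro mult_left_mono K) (auto simp: f_def indicator_def)
    also have "\<dots> \<le> norm (K * (f t + f (0 + (-1) * t)))" by (simp add: abs_ge_self del: norm_mult)
    finally show "norm ((1 + \<bar>t\<bar>) ^ n * exp (- c * \<bar>t\<bar>)) \<le> norm (K * (f t + f (0 + (-1) * t)))" .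
  qed
qed measurable

text \<open>Integrand of the Cahen-Mellin integral for exp (- z). The integrals below run over t
  with w = Complex x t, without the factor i of the contour integral, so their value is 2 pi exp (-
  z).\<close>

definition mellin_exp :: "complex \<Rightarrow> complex \<Rightarrow> complex" where
  "mellin_exp z w = Gamma w * z powr (-w)"

text \<open>Lines at half odd integers stay between the poles. Each step to the left divides by at
  least j + 1/2 in modulus, so k steps gain a factor of factorial size.\<close>

lemma norm_Gamma_left:
  "norm (Gamma (Complex (1/2 - real k) t)) * (\<Prod>j<k. real j + 1/2) \<le> norm (Gamma (Complex (1/2) t))"
proof (induction k)
  case (Suc k)
  let ?w = "Complex (1/2 - real (Suc k)) t"
  have "?w \<notin> \<int>\<^sub>\<le>\<^sub>0"
  proof
    assume "?w \<in> \<int>\<^sub>\<le>\<^sub>0"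
    then obtain m where m: "?w = - of_nat m" by (elim nonpos_Ints_cases')
    from arg_cong[OF m, of Re] have "1 + 2 * real m = 2 * real (Suc k)" by simp
    then have "real (1 + 2 * m) = real (2 * Suc k)" by simp
    then have "1 + 2 * m = 2 * Suc k" by (simp only: of_nat_eq_iff)
    then show False by presburger
  qed
  from Gamma_plus1[OF this] have "Gamma (Complex (1/2 - real k) t) = ?w * Gamma ?w"
    by (simp add: Complex_eq algebra_simps)
  moreover have "norm ?w \<ge> real k + 1/2" using abs_Re_le_cmod[of ?w] by simp
  ultimately have "norm (Gamma ?w) * (real k + 1/2) \<le> norm (Gamma (Complex (1/2 - real k) t))"
    by (simp add: norm_mult mult.commute mult_right_mono)
  then have "norm (Gamma ?w) * (real k + 1/2) * (\<Prod>j<k. real j + 1/2) \<le> norm (Gamma (Complex (1/2 - real k) t)) * (\<Prod>j<k. real j + 1/2)"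
    by (intro mult_right_mono prod_nonneg) auto
  with Suc show ?case by (simp add: mult_ac)
qed auto

context
  fixes z :: complex and \<theta> :: real
  assumes z: "Re z > 0" and \<theta>: "\<theta> = \<bar>Im (Ln z)\<bar>"
begin

lemma theta_less: "\<theta> < pi / 2"
  using z \<theta> Re_Ln_pos_lt[of z] by (cases "z = 0") auto

lemma norm_mellin_exp_left:
  "norm (mellin_exp z (Complex (1/2 - real k) t)) \<le>
     norm z powr (real k - 1/2) / (\<Prod>j<k. real j + 1/2) * (sqrt (2 * pi) * exp (- (pi / 2 - \<theta>) * \<bar>t\<bar>))"
proof -
  have pos: "(\<Prod>j<k. real j + 1/2) > 0" by (intro prod_pos) auto
  have "norm (Gamma (Complex (1/2 - real k) t)) \<le> norm (Gamma (Complex (1/2) t)) / (\<Prod>j<k. real j + 1/2)"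
    using norm_Gamma_left[of k t] pos by (simp add: field_simps)
  also have "\<dots> \<le> sqrt (2 * pi) * exp (- pi * \<bar>t\<bar> / 2) / (\<Prod>j<k. real j + 1/2)"
    using pos by (intro divide_right_mono norm_Gamma_half_le) auto
  finally have "norm (mellin_exp z (Complex (1/2 - real k) t)) \<le>
     sqrt (2 * pi) * exp (- pi * \<bar>t\<bar> / 2) / (\<Prod>j<k. real j + 1/2) * (norm z powr (- (1/2 - real k)) * exp (\<theta> * \<bar>t\<bar>))"
    unfolding mellin_exp_def norm_mult using norm_powr_neg_le[OF z, of "Complex (1/2 - real k) t"] pos
    by (intro mult_mono) (auto simp: \<theta>)
  also have "\<dots> = norm z powr (real k - 1/2) / (\<Prod>j<k. real j + 1/2) * (sqrt (2 * pi) * (exp (- pi * \<bar>t\<bar> / 2) * exp (\<theta> * \<bar>t\<bar>)))"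
    by simp
  also have "exp (- pi * \<bar>t\<bar> / 2) * exp (\<theta> * \<bar>t\<bar>) = exp (- (pi / 2 - \<theta>) * \<bar>t\<bar>)"
    unfolding exp_add[symmetric] by (simp add: algebra_simps)
  finally show ?thesis .
qed

lemma mellin_exp_continuous_left: "continuous_on UNIV (\<lambda>t. mellin_exp z (Complex (1/2 - real k) t))"
proof -
  have nz: "z \<noteq> 0" using z by auto
  have ni: "Complex (1/2 - real k) t \<notin> \<int>\<^sub>\<le>\<^sub>0" for t
  proof
    assume "Complex (1/2 - real k) t \<in> \<int>\<^sub>\<le>\<^sub>0"
    then obtain m where m: "Complex (1/2 - real k) t = - of_nat m" by (elim nonpos_Ints_cases')
    from arg_cong[OF m, of Re] have "real (1 + 2 * m) = real (2 * k)" by simp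
    then have "1 + 2 * m = 2 * k" by (simp only: of_nat_eq_iff)
    then show False by presburger
  qed
  have "continuous_on UNIV (\<lambda>t. Gamma (Complex (1/2 - real k) t))"
    by (rule continuous_on_compose2[OF continuous_on_Gamma[of "range (\<lambda>t. Complex (1/2 - real k) t)"]])
       (use ni in \<open>auto simp: Complex_eq intro!: continuous_intros\<close>)
  then have "continuous_on UNIV (\<lambda>t. Gamma (Complex (1/2 - real k) t) * exp (- (Complex (1/2 - real k) t) * Ln z))"
    unfolding Complex_eq by (intro continuous_intros) auto
  then show ?thesis using nz by (simp add: mellin_exp_def powr_def)
qed

lemma mellin_exp_integrable_left: "integrable lborel (\<lambda>t. mellin_exp z (Complex (1/2 - real k) t))"
proof (rule Bochner_Integration.integrable_bound)
  show "integrable lborel (\<lambda>t. norm z powr (real k - 1/2) / (\<Prod>j<k. real j + 1/2) * (sqrt (2 * pi) * exp (- (pi / 2 - \<theta>) * \<bar>t\<bar>)))"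
    using integrable_poly_exp_abs[of "pi / 2 - \<theta>" 0] theta_less by (intro integrable_mult_right) auto
  show "(\<lambda>t. mellin_exp z (Complex (1/2 - real k) t)) \<in> borel_measurable lborel"
    using borel_measurable_continuous_onI[OF mellin_exp_continuous_left] by simp
  show "AE t in lborel. norm (mellin_exp z (Complex (1/2 - real k) t)) \<le> norm (norm z powr (real k - 1/2) / (\<Prod>j<k. real j + 1/2) * (sqrt (2 * pi) * exp (- (pi / 2 - \<theta>) * \<bar>t\<bar>)))"
    by (rule AE_I2, unfold real_norm_def, rule order_trans[OF norm_mellin_exp_left abs_ge_self])
qed

lemma mellin_exp_left_tendsto_0: "(\<lambda>k. \<integral>t. mellin_exp z (Complex (1/2 - real k) t) \<partial>lborel) \<longlonglongrightarrow> 0"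
proof -
  define K where "K = (\<integral>t. sqrt (2 * pi) * exp (- (pi / 2 - \<theta>) * \<bar>t\<bar>) \<partial>lborel)"
  have K: "K \<ge> 0" unfolding K_def by (intro integral_nonneg_AE) auto
  have bd: "norm (\<integral>t. mellin_exp z (Complex (1/2 - real k) t) \<partial>lborel) \<le> norm z powr (real k - 1/2) / (\<Prod>j<k. real j + 1/2) * K" for k
  proof -
    have "norm (\<integral>t. mellin_exp z (Complex (1/2 - real k) t) \<partial>lborel) \<le> (\<integral>t. norm z powr (real k - 1/2) / (\<Prod>j<k. real j + 1/2) * (sqrt (2 * pi) * exp (- (pi / 2 - \<theta>) * \<bar>t\<bar>)) \<partial>lborel)"
    proof (rule Bochner_Integration.integral_norm_bound_integral[OF mellin_exp_integrable_left])
      show "integrable lborel (\<lambda>t. norm z powr (real k - 1/2) / (\<Prod>j<k. real j + 1/2) * (sqrt (2 * pi) * exp (- (pi / 2 - \<theta>) * \<bar>t\<bar>)))"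
        using integrable_poly_exp_abs[of "pi / 2 - \<theta>" 0] theta_less by (intro integrable_mult_right) auto
    qed (rule norm_mellin_exp_left)
    then show ?thesis by (simp add: K_def)
  qed
  have P: "(\<Prod>j<Suc k. real j + 1/2) \<ge> fact k / 2" for k
  proof (induction k)
    case (Suc k)
    have "fact (Suc k) / 2 \<le> (fact k / 2) * (real (Suc k) + 1/2)" by (simp add: field_simps)
    also have "\<dots> \<le> (\<Prod>j<Suc k. real j + 1/2) * (real (Suc k) + 1/2)" using Suc by (intro mult_right_mono) auto
    finally show ?case by simp
  qed simp
  have "(\<lambda>k. 2 * norm z powr (1/2) * K * (inverse (fact k) * norm z ^ k)) \<longlonglongrightarrow> 2 * norm z powr (1/2) * K * 0"
    using summable_LIMSEQ_zero[OF summable_exp[of "norm z"]] by (intro tendsto_intros)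
  moreover have "norm (\<integral>t. mellin_exp z (Complex (1/2 - real (Suc k)) t) \<partial>lborel) \<le> 2 * norm z powr (1/2) * K * (inverse (fact k) * norm z ^ k)" for k
  proof -
    have z0: "norm z > 0" using z by auto
    have "norm (\<integral>t. mellin_exp z (Complex (1/2 - real (Suc k)) t) \<partial>lborel) \<le> norm z powr (real (Suc k) - 1/2) / (\<Prod>j<Suc k. real j + 1/2) * K"
      by (rule bd)
    also have "\<dots> \<le> norm z powr (real (Suc k) - 1/2) / (fact k / 2) * K"
      by (intro mult_right_mono divide_left_mono P K mult_pos_pos prod_pos) auto
    also have "real (Suc k) - 1/2 = 1/2 + real k" by simp
    also have "norm z powr (1/2 + real k) = norm z powr (1/2) * norm z ^ k"
      using z0 by (simp only: powr_add powr_realpow)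
    also have "norm z powr (1/2) * norm z ^ k / (fact k / 2) * K = 2 * norm z powr (1/2) * K * (inverse (fact k) * norm z ^ k)"
    proof -
      have "p * q / (f / 2) * K = 2 * p * K * (inverse f * q)" for p q f :: real
        by (cases "f = 0") (auto simp: field_simps)
      then show ?thesis .
    qed
    finally show ?thesis .
  qed
  ultimately have "(\<lambda>k. \<integral>t. mellin_exp z (Complex (1/2 - real (Suc k)) t) \<partial>lborel) \<longlonglongrightarrow> 0"
    unfolding mult_zero_right by (metis (no_types, lifting) Lim_null_comparison always_eventually)
  then show ?thesis by (rule LIMSEQ_imp_Suc)
qed

text \<open>Moving right by k + 1 lands in the strip from 1/2 to 3/2, where the decay of Gamma is
  known; for |Im w| \<ge> 1 the modulus of Gamma does not decrease on the way. Two powers of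
  \<open>norm z\<close> occur since \<open>norm z\<close> may lie on either side of 1.\<close>

lemma norm_mellin_exp_horizontal:
  assumes "\<And>w. 1/2 \<le> Re w \<Longrightarrow> Re w \<le> 3/2 \<Longrightarrow> norm (Gamma w) \<le> C * (1 + \<bar>Im w\<bar>) * exp (- pi * \<bar>Im w\<bar> / 2)"
    and "C > 0" "x \<in> {-1/2 - real k..1/2 - real k}" "\<bar>y\<bar> \<ge> 1"
  shows "norm (mellin_exp z (Complex x y)) \<le>
    C * (norm z powr (real k + 1/2) + norm z powr (real k - 1/2)) * ((1 + \<bar>y\<bar>) * exp (- (pi / 2 - \<theta>) * \<bar>y\<bar>))"
proof -
  have z0: "norm z > 0" using z by auto
  have "norm (Gamma (Complex x y)) \<le> norm (Gamma (Complex x y + of_nat (Suc k)))"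
    using assms(4) by (intro norm_Gamma_shift) auto
  also have "\<dots> \<le> C * (1 + \<bar>y\<bar>) * exp (- pi * \<bar>y\<bar> / 2)"
    using assms(1)[of "Complex x y + of_nat (Suc k)"] assms(3) by simp
  finally have G: "norm (Gamma (Complex x y)) \<le> C * (1 + \<bar>y\<bar>) * exp (- pi * \<bar>y\<bar> / 2)" .
  have "norm z powr (-x) \<le> norm z powr (real k + 1/2) + norm z powr (real k - 1/2)"
  proof (cases "norm z \<ge> 1")
    case True
    then have "norm z powr (-x) \<le> norm z powr (real k + 1/2)" using assms(3) by (intro powr_mono) auto
    then show ?thesis by (rule order_trans) simp
  next
    case False
    then have "norm z powr (-x) \<le> norm z powr (real k - 1/2)" using assms(3) z0 by (intro powr_mono') auto
    then show ?thesis by (rule order_trans) simp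
  qed
  then have "norm z powr (- Re (Complex x y)) * exp (\<bar>Im (Ln z)\<bar> * \<bar>Im (Complex x y)\<bar>) \<le> (norm z powr (real k + 1/2) + norm z powr (real k - 1/2)) * exp (\<theta> * \<bar>y\<bar>)"
    unfolding \<theta> by (intro mult_mono) auto
  with norm_powr_neg_le[OF z, of "Complex x y"]
  have Z: "norm (z powr (- Complex x y)) \<le> (norm z powr (real k + 1/2) + norm z powr (real k - 1/2)) * exp (\<theta> * \<bar>y\<bar>)"
    by (rule order_trans)
  have "norm (mellin_exp z (Complex x y)) \<le> (C * (1 + \<bar>y\<bar>) * exp (- pi * \<bar>y\<bar> / 2)) * ((norm z powr (real k + 1/2) + norm z powr (real k - 1/2)) * exp (\<theta> * \<bar>y\<bar>))"
    unfolding mellin_exp_def norm_mult using assms(2) by (intro mult_mono G Z) auto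
  also have "\<dots> = C * (norm z powr (real k + 1/2) + norm z powr (real k - 1/2)) * ((1 + \<bar>y\<bar>) * (exp (- pi * \<bar>y\<bar> / 2) * exp (\<theta> * \<bar>y\<bar>)))"
    by simp
  also have "exp (- pi * \<bar>y\<bar> / 2) * exp (\<theta> * \<bar>y\<bar>) = exp (- (pi / 2 - \<theta>) * \<bar>y\<bar>)"
    unfolding exp_add[symmetric] by (simp add: algebra_simps)
  finally show ?thesis .
qed

lemma poly_exp_tendsto_0: "((\<lambda>y. K * ((1 + \<bar>y\<bar>) * exp (- (pi / 2 - \<theta>) * \<bar>y\<bar>))) \<longlongrightarrow> 0) at_top"
proof -
  define c where "c = pi / 2 - \<theta>"
  have c: "c > 0" using theta_less by (simp add: c_def)
  have "((\<lambda>y. K * ((1 + \<bar>y\<bar>) * exp (- c * \<bar>y\<bar>))) \<longlongrightarrow> 0) at_top"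
    using c by real_asymp
  then show ?thesis by (simp add: c_def)
qed

lemma residue_mellin_exp: "residue (mellin_exp z) (- of_nat k) = (-z) ^ k / fact k"
proof (rule residue_simple')
  have nz: "z \<noteq> 0" using z by auto
  show "open (ball (- of_nat k :: complex) 1)" by simp
  show "- of_nat k \<in> ball (- of_nat k :: complex) 1" by simp
  have "w \<notin> \<int>\<^sub>\<le>\<^sub>0" if "w \<in> ball (- of_nat k) 1 - {- of_nat k}" for w :: complex
  proof
    assume "w \<in> \<int>\<^sub>\<le>\<^sub>0"
    then obtain m where m: "w = - of_nat m" by (elim nonpos_Ints_cases')
    have "dist (- of_nat k :: complex) w = norm (of_int (int m - int k) :: complex)"
      by (simp add: m dist_norm)
    also have "\<dots> = \<bar>of_int (int m - int k)\<bar>" by (simp only: norm_of_int)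
    finally have "\<bar>real_of_int (int m - int k)\<bar> < 1" using that by simp
    then have "\<bar>int m - int k\<bar> < 1" by linarith
    then show False using that m by simp
  qed
  then show "mellin_exp z holomorphic_on ball (- of_nat k) 1 - {- of_nat k}"
    unfolding mellin_exp_def using nz by (intro holomorphic_intros) auto
  have "((\<lambda>w. Gamma w * (w + of_nat k) * z powr (-w)) \<longlongrightarrow> (-1) ^ k / fact k * z powr (- (- of_nat k))) (at (- of_nat k))"
    using nz z by (intro tendsto_intros Gamma_residues) (auto simp: complex_nonpos_Reals_iff)
  also have "(-1) ^ k / fact k * z powr (- (- of_nat k)) = (-z) ^ k / fact k"
    using nz by (simp add: powr_nat' power_minus[of z])
  finally show "((\<lambda>w. mellin_exp z w * (w - - of_nat k)) \<longlongrightarrow> (-z) ^ k / fact k) (at (- of_nat k))"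
    by (simp add: mellin_exp_def mult_ac)
qed

lemma mellin_exp_holomorphic:
  "mellin_exp z holomorphic_on {w. - real k - 1 < Re w \<and> Re w < 1 - real k} - {- of_nat k}"
proof -
  have nz: "z \<noteq> 0" using z by auto
  have "w \<notin> \<int>\<^sub>\<le>\<^sub>0" if "w \<in> {w. - real k - 1 < Re w \<and> Re w < 1 - real k} - {- of_nat k}" for w :: complex
  proof
    assume "w \<in> \<int>\<^sub>\<le>\<^sub>0"
    then obtain m where m: "w = - of_nat m" by (elim nonpos_Ints_cases')
    then have "- real k - 1 < - real m" "- real m < 1 - real k" using that by auto
    then have "m = k" by linarith
    then show False using that m by simp
  qed
  then show ?thesis
    unfolding mellin_exp_def using nz by (intro holomorphic_intros) auto
qed

text \<open>The only pole between the two lines is w = - k, and its residue is the k-th term of the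
  series of exp (- z).\<close>

lemma mellin_exp_shift:
  "(\<integral>t. mellin_exp z (Complex (1/2 - real k) t) \<partial>lborel) - (\<integral>t. mellin_exp z (Complex (1/2 - real (Suc k)) t) \<partial>lborel) =
     2 * pi * ((-z) ^ k / fact k)"
proof -
  obtain C where C: "C > 0" "\<And>w. 1/2 \<le> Re w \<Longrightarrow> Re w \<le> 3/2 \<Longrightarrow> norm (Gamma w) \<le> C * (1 + \<bar>Im w\<bar>) * exp (- pi * \<bar>Im w\<bar> / 2)"
    using norm_Gamma_strip[of "1/2"] by auto
  define S where "S = {w. - real k - 1 < Re w \<and> Re w < 1 - real k}"
  have S_eq: "S = {w. - real k - 1 < Re w} \<inter> {w. Re w < 1 - real k}" by (auto simp: S_def)
  have S: "open S" "convex S"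
    unfolding S_eq by (intro open_Int open_halfspace_Re_gt open_halfspace_Re_lt convex_Int convex_halfspace_Re_gt convex_halfspace_Re_lt)+
  define B where "B = (\<lambda>y. C * (norm z powr (real k + 1/2) + norm z powr (real k - 1/2)) * ((1 + \<bar>y\<bar>) * exp (- (pi / 2 - \<theta>) * \<bar>y\<bar>)))"
  let ?a = "1/2 - real (Suc k)" and ?b = "1/2 - real k"
  let ?R = "\<lambda>n. rectpath (Complex ?a (- real n)) (Complex ?b (real n))"
  have img: "path_image (?R n) \<subseteq> S - {- of_nat k}" if "n \<ge> 1" for n
    using that by (subst path_image_rectpath) (auto simp: S_def)
  have "\<i> * ((\<integral>t. mellin_exp z (Complex ?b t) \<partial>lborel) - (\<integral>t. mellin_exp z (Complex ?a t) \<partial>lborel)) =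
     2 * pi * \<i> * ((-z) ^ k / fact k)"
  proof (rule vertical_line_shift[where ?n0.0 = 1 and B = B])
    fix n :: nat assume n: "n \<ge> 1"
    show "continuous_on (path_image (?R n)) (mellin_exp z)"
      using holomorphic_on_imp_continuous_on[OF mellin_exp_holomorphic] img[OF n] unfolding S_def
      by (rule continuous_on_subset)
    have "contour_integral (?R n) (mellin_exp z) = 2 * pi * \<i> * (\<Sum>p\<in>{- of_nat k}. winding_number (?R n) p * residue (mellin_exp z) p)"
    proof (rule Residue_theorem[of S])
      show "mellin_exp z holomorphic_on S - {- of_nat k}"
        using mellin_exp_holomorphic by (simp add: S_def)
      show "path_image (?R n) \<subseteq> S - {- of_nat k}" by (rule img[OF n])
      show "\<forall>w. w \<notin> S \<longrightarrow> winding_number (?R n) w = 0"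
        using n by (auto intro!: winding_number_rectpath_outside simp: in_cbox_complex_iff S_def)
    qed (use S in \<open>auto intro: convex_connected\<close>)
    also have "winding_number (?R n) (- of_nat k) = 1"
      using n by (intro winding_number_rectpath) (auto simp: in_box_complex_iff)
    then have "2 * pi * \<i> * (\<Sum>p\<in>{- of_nat k}. winding_number (?R n) p * residue (mellin_exp z) p) = 2 * pi * \<i> * ((-z) ^ k / fact k)"
      by (simp add: residue_mellin_exp)
    finally show "contour_integral (?R n) (mellin_exp z) = 2 * pi * \<i> * ((-z) ^ k / fact k)" .
    fix x assume x: "x \<in> {?a..?b}"
    show "norm (mellin_exp z (Complex x (- real n))) \<le> B (real n)" "norm (mellin_exp z (Complex x (real n))) \<le> B (real n)"
      using norm_mellin_exp_horizontal[OF C(2,1), of x k "- real n"] norm_mellin_exp_horizontal[OF C(2,1), of x k "real n"] x n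
      by (auto simp: B_def)
  next
    show "(B \<longlongrightarrow> 0) at_top" unfolding B_def by (rule poly_exp_tendsto_0)
  qed (auto intro: mellin_exp_integrable_left mellin_exp_continuous_left simp del: of_nat_Suc)
  also have "2 * pi * \<i> * ((-z) ^ k / fact k) = \<i> * (2 * pi * ((-z) ^ k / fact k))" by simp
  finally show ?thesis by (metis mult_left_cancel complex_i_not_zero)
qed

text \<open>Telescoping the shifts while the left line moves to minus infinity sums the exponential
  series term by term.\<close>

lemma mellin_exp_half: "(\<integral>t. mellin_exp z (Complex (1/2) t) \<partial>lborel) = 2 * pi * exp (-z)"
proof -
  let ?F = "\<lambda>k. \<integral>t. mellin_exp z (Complex (1/2 - real k) t) \<partial>lborel"
  have F: "?F 0 - ?F n = 2 * pi * (\<Sum>k<n. (-z) ^ k / fact k)" for n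
  proof (induction n)
    case (Suc n)
    have "?F 0 - ?F (Suc n) = (?F 0 - ?F n) + (?F n - ?F (Suc n))" by simp
    also have "\<dots> = 2 * pi * (\<Sum>k<Suc n. (-z) ^ k / fact k)"
      unfolding Suc mellin_exp_shift by (simp add: algebra_simps)
    finally show ?case .
  qed simp
  have "(\<lambda>n. ?F 0 - ?F n) \<longlonglongrightarrow> ?F 0 - 0"
    by (intro tendsto_intros mellin_exp_left_tendsto_0)
  moreover have "(\<lambda>n. 2 * pi * (\<Sum>k<n. (-z) ^ k / fact k)) \<longlonglongrightarrow> 2 * pi * exp (-z)"
    using exp_converges[of "-z"] by (intro tendsto_intros) (simp add: sums_def scaleR_conv_of_real divide_inverse mult.commute)
  ultimately have "?F 0 - 0 = 2 * pi * exp (-z)"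
    unfolding F using LIMSEQ_unique by blast
  then show ?thesis by simp
qed

end

text \<open>Linear growth is crude but harmless against the exponential decay of Gamma. The
  condition on Im w keeps the pole at distance at least 1.\<close>

lemma zeta_growth:
  assumes "a > 0"
  obtains C where "C > 0" "\<And>w. a \<le> Re w \<Longrightarrow> Re w \<le> b \<Longrightarrow> \<bar>Im w\<bar> \<ge> 1 \<Longrightarrow> norm (zeta w) \<le> C * (1 + \<bar>Im w\<bar>)"
proof (rule that[of "1 + (1 + \<bar>b\<bar>) * (1 + 1 / a)"])
  have pos: "1 + 1 / a \<ge> 0" using assms by simp
  then show "1 + (1 + \<bar>b\<bar>) * (1 + 1 / a) > 0" by (intro add_pos_nonneg mult_nonneg_nonneg) auto
  fix w assume w: "a \<le> Re w" "Re w \<le> b" "\<bar>Im w\<bar> \<ge> 1"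
  have w1: "norm (w - 1) \<ge> 1" using abs_Im_le_cmod[of "w - 1"] w by simp
  have wn: "norm w \<le> \<bar>b\<bar> + \<bar>Im w\<bar>" using cmod_le[of w] w assms by linarith
  have "norm (zeta w) = norm (zreg w) / norm (w - 1)"
    using w assms w1 by (subst zeta_conv_zreg) (auto simp: norm_divide)
  also have "\<dots> \<le> (1 + norm (w - 1) * norm w * (1 + 1 / Re w)) / norm (w - 1)"
    using w assms w1 by (intro divide_right_mono norm_zreg_le) auto
  also have "\<dots> = 1 / norm (w - 1) + norm w * (1 + 1 / Re w)"
  proof -
    have "norm (w - 1) \<noteq> 0" using w1 by auto
    then show ?thesis by (simp add: add_divide_distrib del: norm_eq_zero)
  qed
  also have "\<dots> \<le> 1 + (\<bar>b\<bar> + \<bar>Im w\<bar>) * (1 + 1 / a)"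
    using w assms w1 wn by (intro add_mono mult_mono divide_left_mono) (auto simp: divide_le_eq)
  also have "\<dots> \<le> (1 + (1 + \<bar>b\<bar>) * (1 + 1 / a)) * (1 + \<bar>Im w\<bar>)"
  proof -
    have "(\<bar>b\<bar> + \<bar>Im w\<bar>) * (1 + 1 / a) \<le> ((1 + \<bar>b\<bar>) * (1 + \<bar>Im w\<bar>)) * (1 + 1 / a)"
      using pos by (intro mult_right_mono) (auto simp: algebra_simps)
    then show ?thesis by (simp add: algebra_simps)
  qed
  finally show "norm (zeta w) \<le> (1 + (1 + \<bar>b\<bar>) * (1 + 1 / a)) * (1 + \<bar>Im w\<bar>)" .
qed

lemma zeta_vertical_continuous: 
  assumes "\<sigma> \<noteq> 1"
  shows "continuous_on A (\<lambda>t. zeta (Complex \<sigma> t))"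
  by (rule continuous_on_compose2[OF holomorphic_on_imp_continuous_on[OF zeta_holomorphic]])
     (use assms in \<open>auto simp: Complex_eq complex_eq_iff intro!: continuous_intros\<close>)

lemma mellin_exp_three_halves:
  fixes z :: complex
  assumes z: "Re z > 0"
  shows "integrable lborel (\<lambda>t. mellin_exp z (Complex (3/2) t))"
    and "(\<integral>t. mellin_exp z (Complex (3/2) t) \<partial>lborel) = 2 * pi * exp (-z)"
proof -
  define \<theta> where "\<theta> = \<bar>Im (Ln z)\<bar>"
  have \<theta>: "\<theta> < pi / 2" using theta_less[OF z \<theta>_def] .
  have z0: "norm z > 0" "z \<noteq> 0" using z by auto
  obtain C where C: "C > 0" "\<And>w. 1/2 \<le> Re w \<Longrightarrow> Re w \<le> 3/2 \<Longrightarrow> norm (Gamma w) \<le> C * (1 + \<bar>Im w\<bar>) * exp (- pi * \<bar>Im w\<bar> / 2)"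
    using norm_Gamma_strip[of "1/2"] by auto
  define K where "K = C * (1 + norm z powr (- (3/2)) + norm z powr (- (1/2)))"
  define B where "B = (\<lambda>y. K * ((1 + \<bar>y\<bar>) * exp (- (pi / 2 - \<theta>) * \<bar>y\<bar>)))"
  have bd: "norm (mellin_exp z (Complex x y)) \<le> B y" if "x \<in> {1/2..3/2}" for x y
  proof -
    have "norm z powr (-x) \<le> 1 + norm z powr (- (3/2)) + norm z powr (- (1/2))"
    proof (cases "norm z \<ge> 1")
      case True
      then have "norm z powr (-x) \<le> norm z powr (- (1/2))" using that by (intro powr_mono) auto
      then show ?thesis by (rule order_trans) simp
    next
      case False
      then have "norm z powr (-x) \<le> norm z powr (- (3/2))" using that z0 by (intro powr_mono') auto
      then show ?thesis by (rule order_trans) simp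
    qed
    then have "norm z powr (- Re (Complex x y)) * exp (\<bar>Im (Ln z)\<bar> * \<bar>Im (Complex x y)\<bar>) \<le> (1 + norm z powr (- (3/2)) + norm z powr (- (1/2))) * exp (\<theta> * \<bar>y\<bar>)"
      unfolding \<theta>_def by (intro mult_mono) auto
    with norm_powr_neg_le[OF z, of "Complex x y"]
    have Z: "norm (z powr (- Complex x y)) \<le> (1 + norm z powr (- (3/2)) + norm z powr (- (1/2))) * exp (\<theta> * \<bar>y\<bar>)"
      by (rule order_trans)
    have "norm (mellin_exp z (Complex x y)) \<le> (C * (1 + \<bar>y\<bar>) * exp (- pi * \<bar>y\<bar> / 2)) * ((1 + norm z powr (- (3/2)) + norm z powr (- (1/2))) * exp (\<theta> * \<bar>y\<bar>))"
      unfolding mellin_exp_def norm_mult using C(1) C(2)[of "Complex x y"] that by (intro mult_mono Z) auto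
    also have "\<dots> = K * ((1 + \<bar>y\<bar>) * (exp (- pi * \<bar>y\<bar> / 2) * exp (\<theta> * \<bar>y\<bar>)))"
      by (simp add: K_def)
    also have "exp (- pi * \<bar>y\<bar> / 2) * exp (\<theta> * \<bar>y\<bar>) = exp (- (pi / 2 - \<theta>) * \<bar>y\<bar>)"
      unfolding exp_add[symmetric] by (simp add: algebra_simps)
    finally show ?thesis by (simp add: B_def)
  qed
  have hol: "mellin_exp z holomorphic_on {w. Re w > 0}"
  proof -
    have "w \<notin> \<int>\<^sub>\<le>\<^sub>0" if "Re w > 0" for w using that by (auto elim!: nonpos_Ints_cases)
    then show ?thesis unfolding mellin_exp_def using z0 by (intro holomorphic_intros) auto
  qed
  have cont: "continuous_on UNIV (\<lambda>t. mellin_exp z (Complex x t))" if "x > 0" for x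
    by (rule continuous_on_compose2[OF holomorphic_on_imp_continuous_on[OF hol]])
       (use that in \<open>auto simp: Complex_eq intro!: continuous_intros\<close>)
  show int: "integrable lborel (\<lambda>t. mellin_exp z (Complex (3/2) t))"
  proof (rule Bochner_Integration.integrable_bound)
    show "integrable lborel B"
      unfolding B_def using integrable_poly_exp_abs[of "pi / 2 - \<theta>" 1] \<theta> by (intro integrable_mult_right) auto
    show "(\<lambda>t. mellin_exp z (Complex (3/2) t)) \<in> borel_measurable lborel"
      using borel_measurable_continuous_onI[OF cont[of "3/2"]] by simp
    show "AE t in lborel. norm (mellin_exp z (Complex (3/2) t)) \<le> norm (B t)"
      by (rule AE_I2, unfold real_norm_def, rule order_trans[OF bd abs_ge_self]) auto
  qed
  have "\<i> * ((\<integral>t. mellin_exp z (Complex (3/2) t) \<partial>lborel) - (\<integral>t. mellin_exp z (Complex (1/2) t) \<partial>lborel)) = 0"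
  proof (rule vertical_line_shift[where ?n0.0 = 1 and B = B])
    fix n :: nat assume n: "n \<ge> 1"
    let ?R = "rectpath (Complex (1/2) (- real n)) (Complex (3/2) (real n))"
    have img: "path_image ?R \<subseteq> {w. Re w > 0}"
      using n by (subst path_image_rectpath) auto
    show "continuous_on (path_image ?R) (mellin_exp z)"
      using holomorphic_on_imp_continuous_on[OF hol] img by (rule continuous_on_subset)
    have "(mellin_exp z has_contour_integral 0) ?R"
      by (rule Cauchy_theorem_convex_simple[OF hol convex_halfspace_Re_gt _ img]) auto
    then show "contour_integral ?R (mellin_exp z) = 0" by (rule contour_integral_unique)
    fix x :: real assume x: "x \<in> {1/2..3/2}"
    show "norm (mellin_exp z (Complex x (- real n))) \<le> B (real n)" "norm (mellin_exp z (Complex x (real n))) \<le> B (real n)"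
      using bd[OF x, of "- real n"] bd[OF x, of "real n"] by (auto simp: B_def)
  next
    show "(B \<longlongrightarrow> 0) at_top" unfolding B_def by (rule poly_exp_tendsto_0[OF z \<theta>_def])
    show "integrable lborel (\<lambda>t. mellin_exp z (Complex (1/2) t))"
      using mellin_exp_integrable_left[OF z \<theta>_def, of 0] by simp
  qed (auto intro: int cont)
  then show "(\<integral>t. mellin_exp z (Complex (3/2) t) \<partial>lborel) = 2 * pi * exp (-z)"
    using mellin_exp_half[OF z \<theta>_def] by simp
qed

text \<open>Only the upper halves of the two lines are exchanged, and starting at height 1 keeps
  away from poles on the real axis. The price is the bottom side, which does not vanish: it is the
  error \<open>B 1 * (b - a)\<close>.\<close>

lemma half_strip_shift:
  fixes f :: "complex \<Rightarrow> complex"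
  assumes "a < b" and hol: "f holomorphic_on {w. Im w > 0}"
    and B: "\<And>x y. x \<in> {a..b} \<Longrightarrow> y \<ge> 1 \<Longrightarrow> norm (f (Complex x y)) \<le> B y" "(B \<longlongrightarrow> 0) at_top"
    and int: "set_integrable lborel {1..} (\<lambda>t. f (Complex a t))" "set_integrable lborel {1..} (\<lambda>t. f (Complex b t))"
  shows "norm ((LINT t:{1..}|lborel. f (Complex b t)) - (LINT t:{1..}|lborel. f (Complex a t))) \<le> B 1 * (b - a)"
proof -
  have lim: "(\<lambda>n. integral {1..real n} g) \<longlonglongrightarrow> (LINT t:{1..}|lborel. g t)" if "set_integrable lborel {1..} g" for g :: "real \<Rightarrow> complex"
  proof -
    have "((\<lambda>T. LINT t:{1..T}|lborel. g t) \<longlongrightarrow> (LINT t:{1..}|lborel. g t)) at_top"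
      using that by (intro tendsto_set_lebesgue_integral_at_top) auto
    then have "(\<lambda>n. LINT t:{1..real n}|lborel. g t) \<longlonglongrightarrow> (LINT t:{1..}|lborel. g t)"
      by (rule filterlim_compose[OF _ filterlim_real_sequentially])
    moreover have "(LINT t:{1..T}|lborel. g t) = integral {1..T} g" for T
      by (rule set_borel_integral_eq_integral) (rule set_integrable_subset[OF that], auto)
    ultimately show ?thesis by simp
  qed
  let ?D = "\<lambda>n. integral {1..real n} (\<lambda>y. f (Complex b y)) - integral {1..real n} (\<lambda>y. f (Complex a y))"
  have "norm (?D n) \<le> (B 1 + B (real n)) * (b - a)" if "n \<ge> 2" for n
  proof -
    let ?R = "rectpath (Complex a 1) (Complex b (real n))"
    have img: "path_image ?R \<subseteq> {w. Im w > 0}"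
      using that assms(1) by (subst path_image_rectpath) auto
    have "(f has_contour_integral 0) ?R"
      by (rule Cauchy_theorem_convex_simple[OF hol convex_halfspace_Im_gt _ img]) auto
    then have "contour_integral ?R f = 0" by (rule contour_integral_unique)
    moreover have "norm (contour_integral ?R f - \<i> * ?D n) \<le> (B 1 + B (real n)) * (b - a)"
      using that assms(1) B(1) continuous_on_subset[OF holomorphic_on_imp_continuous_on[OF hol] img]
      by (intro contour_integral_rectpath_approx) auto
    ultimately show ?thesis by (simp add: norm_mult)
  qed
  then have ev: "eventually (\<lambda>n. norm (?D n) \<le> (B 1 + B (real n)) * (b - a)) sequentially"
    unfolding eventually_sequentially by blast
  have "(\<lambda>n. (B 1 + B (real n)) * (b - a)) \<longlonglongrightarrow> (B 1 + 0) * (b - a)"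
    by (intro tendsto_intros filterlim_compose[OF B(2) filterlim_real_sequentially])
  moreover have "(\<lambda>n. norm (?D n)) \<longlonglongrightarrow> norm ((LINT t:{1..}|lborel. f (Complex b t)) - (LINT t:{1..}|lborel. f (Complex a t)))"
    by (intro tendsto_intros lim int)
  ultimately show ?thesis
    using tendsto_le[OF sequentially_bot _ _ ev] by simp
qed

section \<open>The Laplace transform of the mean square\<close>

text \<open>
  The pair \<open>(a, m)\<close> stands for the positive integers \<open>a + 1\<close> and \<open>m + 1\<close>, so that
  \<open>zeta (w + 2\<sigma> - 1) zeta w\<close> is the sum of \<open>pair_weight \<sigma> p * pair_product p powr (-w)\<close>.
\<close>

definition pair_weight :: "real \<Rightarrow> nat \<times> nat \<Rightarrow> real" where
  "pair_weight \<sigma> p = real (Suc (fst p)) powr (1 - 2 * \<sigma>)"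

definition pair_product :: "nat \<times> nat \<Rightarrow> real" where
  "pair_product p = real (Suc (fst p)) * real (Suc (snd p))"

lemma pair_weight_pos: "pair_weight \<sigma> p > 0" by (simp add: pair_weight_def)
lemma pair_product_ge_1: "pair_product p \<ge> 1"
  unfolding pair_product_def using mult_mono[of 1 "real (Suc (fst p))" 1 "real (Suc (snd p))"] by simp
lemma pair_product_pos: "pair_product p > 0" using pair_product_ge_1[of p] by simp

abbreviation pairs :: "(nat \<times> nat) measure" where
  "pairs \<equiv> count_space UNIV"

lemma pair_dirichlet_series:
  assumes "Re w > 1" "\<sigma> \<ge> 1/2"
  shows "integrable pairs (\<lambda>p. of_real (pair_weight \<sigma> p) * of_real (pair_product p) powr (-w))"
    and "(\<integral>p. of_real (pair_weight \<sigma> p) * of_real (pair_product p) powr (-w) \<partial>pairs) = zeta (w + of_real (2 * \<sigma> - 1)) * zeta w"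
proof -
  define f g where "f = (\<lambda>a. of_nat (Suc a) powr (- (w + of_real (2 * \<sigma> - 1))))" and "g = (\<lambda>m. of_nat (Suc m) powr (-w))"
  have abs: "Infinite_Set_Sum.abs_summable_on (\<lambda>n. of_nat (Suc n) powr (-v)) UNIV" if "Re v > 1" for v :: complex
  proof -
    have "norm (of_nat (Suc n) powr (-v)) = real (Suc n) powr (- (Re v - 1) - 1)" for n
      by (subst norm_powr_real_powr) (auto simp del: of_nat_Suc)
    then show ?thesis
      unfolding abs_summable_on_nat_iff' using summable_zreg_bound[of "Re v - 1"] that by simp
  qed
  have val: "infsetsum (\<lambda>n. of_nat (Suc n) powr (-v)) UNIV = zeta v" if "Re v > 1" for v :: complex
    using infsetsum_nat'[OF abs[OF that]] sums_unique[OF zeta_sums[OF that]] by simp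
  have eq: "of_real (pair_weight \<sigma> p) * of_real (pair_product p) powr (-w) = (case p of (a, m) \<Rightarrow> f a * g m)" for p
  proof -
    obtain a m where p: "p = (a, m)" by fastforce
    define A M where "A = real (Suc a)" and "M = real (Suc m)"
    have AM: "A > 0" "M > 0" "of_nat (Suc a) = complex_of_real A" "of_nat (Suc m) = complex_of_real M" by (auto simp: A_def M_def)
    have 1: "complex_of_real (A * M) powr (-w) = of_real A powr (-w) * of_real M powr (-w)"
      using AM by (simp add: powr_times_real_left)
    have 2: "complex_of_real (A powr (1 - 2 * \<sigma>)) = of_real A powr (of_real (1 - 2 * \<sigma>))"
      using AM by (simp only: powr_of_real less_imp_le)
    have 3: "of_real A powr (- (w + of_real (2 * \<sigma> - 1))) = of_real A powr (of_real (1 - 2 * \<sigma>)) * of_real A powr (-w)"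
      by (simp add: powr_add[symmetric])
    have "of_real (pair_weight \<sigma> p) * of_real (pair_product p) powr (-w) = of_real (A powr (1 - 2 * \<sigma>)) * complex_of_real (A * M) powr (-w)"
      by (simp add: p pair_weight_def pair_product_def A_def M_def)
    also have "\<dots> = f a * g m"
      unfolding 1 2 f_def g_def AM(3,4) 3 by (simp add: mult_ac)
    finally show ?thesis by (simp add: p)
  qed
  have fs: "Infinite_Set_Sum.abs_summable_on f UNIV" and gs: "Infinite_Set_Sum.abs_summable_on g UNIV"
    unfolding f_def g_def by (rule abs; use assms in simp)+
  have "Infinite_Set_Sum.abs_summable_on (\<lambda>(a, m). f a * g m) (UNIV \<times> UNIV)"
    using fs gs by (intro abs_summable_on_product) auto
  then show "integrable pairs (\<lambda>p. of_real (pair_weight \<sigma> p) * of_real (pair_product p) powr (-w))"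
    unfolding eq Infinite_Set_Sum.abs_summable_on_def by simp
  have "infsetsum (\<lambda>(a, m). f a * g m) (UNIV \<times> UNIV) = infsetsum f UNIV * infsetsum g UNIV"
    using fs gs by (intro infsetsum_product) auto
  also have "infsetsum f UNIV = zeta (w + of_real (2 * \<sigma> - 1))"
    unfolding f_def by (rule val) (use assms in simp)
  also have "infsetsum g UNIV = zeta w"
    unfolding g_def by (rule val) (use assms in simp)
  finally show "(\<integral>p. of_real (pair_weight \<sigma> p) * of_real (pair_product p) powr (-w) \<partial>pairs) = zeta (w + of_real (2 * \<sigma> - 1)) * zeta w"
    unfolding eq infsetsum_def by simp
qed

lemma pair_weight_integrable:
  assumes "\<sigma> \<ge> 1/2"
  shows "integrable pairs (\<lambda>p. pair_weight \<sigma> p * pair_product p powr (- (3/2)))"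
proof -
  have "integrable pairs (\<lambda>p. norm (of_real (pair_weight \<sigma> p) * of_real (pair_product p) powr (- (3/2)) :: complex))"
    using assms by (intro integrable_norm pair_dirichlet_series(1)) auto
  moreover have "norm (of_real (pair_weight \<sigma> p) * of_real (pair_product p) powr (- (3/2)) :: complex) = pair_weight \<sigma> p * pair_product p powr (- (3/2))" for p
  proof -
    have "norm (complex_of_real (pair_product p) powr (- (3/2))) = pair_product p powr (- (3/2))"
      using pair_product_pos[of p] by (subst norm_powr_real_powr) auto
    then show ?thesis using pair_weight_pos[of \<sigma> p] by (simp add: norm_mult)
  qed
  ultimately show ?thesis by simp
qed

lemma mellin_exp_scale:
  fixes z :: complex
  assumes "r > 0" "z \<noteq> 0"
  shows "mellin_exp (of_real r * z) w = of_real r powr (-w) * mellin_exp z w"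
proof -
  have "Ln (of_real r * z) = of_real (ln r) + Ln z"
    using assms by (simp add: Ln_times_of_real Ln_of_real)
  then have "- w * Ln (of_real r * z) = - w * Ln (of_real r) + - w * Ln z"
    using assms by (simp add: Ln_of_real algebra_simps)
  then have "(of_real r * z) powr (-w) = of_real r powr (-w) * z powr (-w)"
    using assms by (simp only: powr_def exp_add) simp
  then show ?thesis by (simp add: mellin_exp_def)
qed

text \<open>The exponent matches \<open>pair_weight_integrable\<close>: it exceeds 1, so the sum
  over pairs converges, and it is the source of the powers -3/2 of the Laplace parameter
  below.\<close>

lemma exp_neg_le_powr:
  fixes y :: real
  assumes "y > 0"
  shows "exp (-y) \<le> 2 * y powr (- (3/2))"
proof -
  have "y powr (3/2) \<le> 2 * exp y"
  proof (cases "y \<le> 1")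
    case True
    then have "y powr (3/2) \<le> 1" using assms powr_mono2[of "3/2" y 1] by simp
    moreover have "1 \<le> exp y" using assms by simp
    ultimately show ?thesis by linarith
  next
    case False
    then have "y powr (3/2) \<le> y powr 2" using assms by (intro powr_mono) auto
    also have "\<dots> = y ^ 2" using assms by (simp add: powr_numeral)
    also have "\<dots> \<le> fact 2 * exp y" using assms by (intro power_le_fact_exp) auto
    finally show ?thesis by simp
  qed
  then have "y powr (3/2) * exp (-y) \<le> 2" by (simp add: exp_minus field_simps)
  then show ?thesis using assms by (simp add: powr_minus field_simps)
qed

lemma pair_exp_integrable:
  assumes "\<sigma> \<ge> 1/2" "Re z > 0"
  shows "integrable pairs (\<lambda>p. of_real (pair_weight \<sigma> p) * exp (- of_real (pair_product p) * z))"
proof (rule Bochner_Integration.integrable_bound, safe intro!: AE_I2)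
  show "integrable pairs (\<lambda>p. 2 * Re z powr (- (3/2)) * (pair_weight \<sigma> p * pair_product p powr (- (3/2))))"
    by (intro integrable_mult_right pair_weight_integrable assms)
  fix p
  have "norm (of_real (pair_weight \<sigma> p) * exp (- of_real (pair_product p) * z)) = pair_weight \<sigma> p * exp (- (pair_product p * Re z))"
    using pair_weight_pos[of \<sigma> p] by (simp add: norm_mult)
  also have "\<dots> \<le> pair_weight \<sigma> p * (2 * (pair_product p * Re z) powr (- (3/2)))"
    using pair_weight_pos[of \<sigma> p] pair_product_pos[of p] assms by (intro mult_left_mono exp_neg_le_powr) auto
  also have "\<dots> = 2 * Re z powr (- (3/2)) * (pair_weight \<sigma> p * pair_product p powr (- (3/2)))"
    using pair_product_pos[of p] assms by (simp add: powr_mult)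
  finally show "norm (of_real (pair_weight \<sigma> p) * exp (- of_real (pair_product p) * z)) \<le> norm (2 * Re z powr (- (3/2)) * (pair_weight \<sigma> p * pair_product p powr (- (3/2))))"
    by (rule order_trans) simp
qed simp

text \<open>Fubini for pairs times the line Re w = 3/2. Summing first gives the product of the two
  zeta values; integrating first gives, by scaling, the Cahen-Mellin integral at
  \<open>pair_product p\<close> times z for each pair.\<close>

lemma pair_mellin:
  fixes z :: complex
  assumes \<sigma>: "\<sigma> \<ge> 1/2" and z: "Re z > 0"
  defines "H \<equiv> (\<lambda>t. mellin_exp z (Complex (3/2) t) * (zeta (Complex (3/2) t + of_real (2 * \<sigma> - 1)) * zeta (Complex (3/2) t)))"
  shows "integrable lborel H" "(\<integral>t. H t \<partial>lborel) = 2 * pi * (\<integral>p. of_real (pair_weight \<sigma> p) * exp (- of_real (pair_product p) * z) \<partial>pairs)"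
proof -
  let ?N = pairs
  interpret N: sigma_finite_measure ?N by (rule sigma_finite_measure_count_space)
  interpret P: pair_sigma_finite ?N lborel ..
  have z0: "z \<noteq> 0" using z by auto
  define F where "F = (\<lambda>(p, t). of_real (pair_weight \<sigma> p) * mellin_exp (of_real (pair_product p) * z) (Complex (3/2) t))"
  have Re_pos: "Re (of_real (pair_product p) * z) > 0" for p using z pair_product_pos[of p] by simp
  note int = mellin_exp_three_halves(1)[OF Re_pos]
  have F: "F (p, t) = (of_real (pair_weight \<sigma> p) * of_real (pair_product p) powr (- Complex (3/2) t)) * mellin_exp z (Complex (3/2) t)" for p t
    unfolding F_def using mellin_exp_scale[OF pair_product_pos z0] by (simp only: prod.case mult.assoc)
  have nF: "norm (F (p, t)) = (pair_weight \<sigma> p * pair_product p powr (- (3/2))) * norm (mellin_exp z (Complex (3/2) t))" for p t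
  proof -
    have "norm (complex_of_real (pair_product p) powr (- Complex (3/2) t)) = pair_product p powr (- (3/2))"
      using pair_product_pos[of p] by (subst norm_powr_real_powr) auto
    then show ?thesis unfolding F using pair_weight_pos[of \<sigma> p] by (simp add: norm_mult)
  qed
  have [measurable]: "F \<in> borel_measurable (?N \<Otimes>\<^sub>M lborel)"
    using borel_measurable_integrable[OF int] unfolding F_def
    by (intro measurable_pair_measure_countable1) auto
  have intF: "integrable (?N \<Otimes>\<^sub>M lborel) F"
  proof (rule P.Fubini_integrable)
    have "integrable ?N (\<lambda>p. (pair_weight \<sigma> p * pair_product p powr (- (3/2))) * (\<integral>t. norm (mellin_exp z (Complex (3/2) t)) \<partial>lborel))"
      using pair_weight_integrable[OF \<sigma>] by (rule integrable_mult_left)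
    then show "integrable ?N (\<lambda>p. \<integral>t. norm (F (p, t)) \<partial>lborel)"
      unfolding nF by simp
    show "AE p in ?N. integrable lborel (\<lambda>t. F (p, t))"
      unfolding F_def using int by (intro AE_I2) auto
  qed measurable
  have inner: "(\<integral>p. F (p, t) \<partial>?N) = H t" for t
  proof -
    have "(\<integral>p. F (p, t) \<partial>?N) = (\<integral>p. of_real (pair_weight \<sigma> p) * of_real (pair_product p) powr (- Complex (3/2) t) \<partial>pairs) * mellin_exp z (Complex (3/2) t)"
      unfolding F by simp
    then show ?thesis using \<sigma> by (simp add: pair_dirichlet_series(2) H_def mult_ac)
  qed
  have ints: "integrable (?N \<Otimes>\<^sub>M lborel) (case_prod (\<lambda>p t. F (p, t)))"
    using intF by simp
  show "integrable lborel H"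
    using P.integrable_snd[OF ints] by (simp add: inner)
  have "(\<integral>t. H t \<partial>lborel) = (\<integral>p. (\<integral>t. F (p, t) \<partial>lborel) \<partial>?N)"
    using P.integral_snd[OF ints] P.integral_fst[OF ints] by (simp add: inner)
  also have "\<dots> = (\<integral>p. 2 * pi * (of_real (pair_weight \<sigma> p) * exp (- of_real (pair_product p) * z)) \<partial>?N)"
  proof (intro Bochner_Integration.integral_cong refl)
    fix p show "(\<integral>t. F (p, t) \<partial>lborel) = 2 * pi * (of_real (pair_weight \<sigma> p) * exp (- of_real (pair_product p) * z))"
      unfolding F_def using mellin_exp_three_halves(2)[OF Re_pos[of p]] by simp
  qed
  also have "\<dots> = 2 * pi * (\<integral>p. of_real (pair_weight \<sigma> p) * exp (- of_real (pair_product p) * z) \<partial>pairs)"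
    by simp
  finally show "(\<integral>t. H t \<partial>lborel) = 2 * pi * (\<integral>p. of_real (pair_weight \<sigma> p) * exp (- of_real (pair_product p) * z) \<partial>pairs)" .
qed

(* The direction just off the positive imaginary axis at which the Mellin integral reproduces a Laplace transform. *)
definition zrot :: "complex \<Rightarrow> complex" where
  "zrot s = 2 * of_real pi * \<i> * exp (- \<i> * s)"

text \<open>The disc norm s \<le> 1 keeps the imaginary part pi/2 - Re s in the range of the
  principal logarithm. Thus Re s is the distance of the argument from the critical value pi/2, and
  this distance becomes the damping of the Laplace transform.\<close>

lemma Ln_zrot:
  assumes "Re s > 0" "norm s \<le> 1"
  shows "Ln (zrot s) = of_real (ln (2 * pi)) + \<i> * of_real (pi / 2) - \<i> * s"
proof (rule Ln_unique)
  have "exp (\<i> * of_real (pi / 2)) = \<i>" unfolding cis_conv_exp[symmetric] by simp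
  moreover have "exp (complex_of_real (ln (2 * pi))) = 2 * of_real pi" by (simp add: exp_of_real)
  ultimately show "exp (of_real (ln (2 * pi)) + \<i> * of_real (pi / 2) - \<i> * s) = zrot s"
    unfolding zrot_def exp_diff exp_add by (simp add: exp_minus field_simps)
  have "\<bar>Re s\<bar> \<le> 1" using abs_Re_le_cmod[of s] assms by linarith
  moreover have "pi > 3" using pi_gt3 .
  ultimately show "- pi < Im (of_real (ln (2 * pi)) + \<i> * of_real (pi / 2) - \<i> * s)"
    "Im (of_real (ln (2 * pi)) + \<i> * of_real (pi / 2) - \<i> * s) \<le> pi"
    using assms by (auto simp: field_simps)
qed

lemma zrot_nonzero: "zrot s \<noteq> 0" by (simp add: zrot_def)

lemma Re_zrot_pos:
  assumes "Re s > 0" "norm s \<le> 1"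
  shows "Re (zrot s) > 0"
proof -
  have "\<bar>Im (Ln (zrot s))\<bar> < pi / 2"
    unfolding Ln_zrot[OF assms] using abs_Re_le_cmod[of s] assms pi_gt3 by auto
  then show ?thesis using Re_Ln_pos_lt[OF zrot_nonzero, of s] by simp
qed

lemma zrot_powr:
  assumes "Re s > 0" "norm s \<le> 1"
  shows "zrot s powr (-w) = of_real (2 * pi) powr (-w) * exp (- \<i> * of_real pi * w / 2) * exp (\<i> * s * w)"
proof -
  have "zrot s powr (-w) = exp (-w * of_real (ln (2 * pi)) + - \<i> * of_real pi * w / 2 + \<i> * s * w)"
    using zrot_nonzero[of s] by (simp add: powr_def Ln_zrot[OF assms] algebra_simps)
  moreover have "of_real (2 * pi) powr (-w) = exp (-w * of_real (ln (2 * pi)))"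
    by (simp add: powr_def Ln_of_real[of "2 * pi", symmetric])
  ultimately show ?thesis by (simp only: exp_add)
qed

lemma norm_zrot_powr:
  assumes "Re s > 0" "norm s \<le> 1" "0 \<le> x" "x \<le> 3/2"
  shows "norm (zrot s powr (- Complex x y)) \<le> exp (3/2) * exp (pi / 2 * y - Re s * y)"
proof -
  have "norm (zrot s powr (- Complex x y)) = exp (- x * ln (2 * pi) - x * Im s + (pi / 2 * y - Re s * y))"
    using zrot_nonzero[of s] by (simp add: powr_def Ln_zrot[OF assms(1,2)] algebra_simps)
  also have "\<dots> \<le> exp (3/2 + (pi / 2 * y - Re s * y))"
  proof -
    have "ln (2 * pi) \<ge> 0" using pi_gt3 by (intro ln_ge_zero) auto
    then have "x * ln (2 * pi) \<ge> 0" using assms by simp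
    moreover have "\<bar>x * Im s\<bar> \<le> (3/2) * 1"
      unfolding abs_mult using assms abs_Im_le_cmod[of s] by (intro mult_mono) auto
    ultimately show ?thesis by simp
  qed
  finally show ?thesis by (simp add: exp_add)
qed

lemma norm_inverse_one_plus_le:
  fixes q :: complex
  assumes "Re q \<ge> 0"
  shows "norm (1 / (1 + q) - 1) \<le> norm q"
proof -
  have "1 \<le> norm (1 + q)" using abs_Re_le_cmod[of "1 + q"] assms by simp
  moreover from this have "1 + q \<noteq> 0" by auto
  then have "1 / (1 + q) - 1 = - q / (1 + q)" by (simp add: field_simps)
  ultimately show ?thesis by (simp add: norm_divide divide_le_eq mult_le_cancel_left1)
qed

lemma set_integrable_half_line_bound:
  fixes f :: "real \<Rightarrow> complex"
  assumes "continuous_on {1..} f" "c > 0" "\<And>t. t \<ge> 1 \<Longrightarrow> norm (f t) \<le> K * ((1 + \<bar>t\<bar>) ^ n * exp (- c * \<bar>t\<bar>))"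
  shows "set_integrable lborel {1..} f"
proof (rule set_integrable_bound)
  show "set_integrable lborel {1..} (\<lambda>t. K * ((1 + \<bar>t\<bar>) ^ n * exp (- c * \<bar>t\<bar>)))"
    unfolding set_integrable_def
    by (intro integrable_mult_indicator integrable_mult_right integrable_poly_exp_abs assms) auto
  show "set_borel_measurable lborel {1..} f"
    using assms(1) by (simp add: set_borel_measurable_def borel_measurable_continuous_on_indicator)
  show "AE t in lborel. t \<in> {1..} \<longrightarrow> norm (f t) \<le> norm (K * ((1 + \<bar>t\<bar>) ^ n * exp (- c * \<bar>t\<bar>)))"
    using assms(3) by (intro AE_I2 impI order_trans[OF _ abs_ge_self[of "K * _"], folded real_norm_def]) auto
qed

context
  fixes \<sigma> :: real
  assumes \<sigma>: "1/2 \<le> \<sigma>" "\<sigma> < 1"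
begin

abbreviation kern :: "complex \<Rightarrow> complex \<Rightarrow> complex" where
  "kern s w \<equiv> mellin_exp (zrot s) w * (zeta (w + of_real (2 * \<sigma> - 1)) * zeta w)"

text \<open>For y \<ge> 1 the decay of Gamma and the growth of the rotated power cancel up to exp (-
  Re s * y); for y \<le> 1 the power stays bounded and the full decay of Gamma survives. The cube
  collects one linear factor from Gamma and two from zeta. It matters that \<open>K\<close> does not
  depend on s.\<close>

lemma kern_bound:
  obtains K where "K > 0"
    "\<And>s x y. Re s > 0 \<Longrightarrow> norm s \<le> 1 \<Longrightarrow> x \<in> {1 - \<sigma>..3/2} \<Longrightarrow> y \<ge> 1 \<Longrightarrow>
       norm (kern s (Complex x y)) \<le> K * ((1 + \<bar>y\<bar>) ^ 3 * exp (- Re s * \<bar>y\<bar>))"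
    "\<And>s y. Re s > 0 \<Longrightarrow> norm s \<le> 1 \<Longrightarrow> y \<le> 1 \<Longrightarrow>
       norm (kern s (Complex (3/2) y)) \<le> K * ((1 + \<bar>y\<bar>) ^ 3 * exp (- (pi / 2) * \<bar>y\<bar>))"
proof -
  obtain C where C: "C > 0" "\<And>w. 1 - \<sigma> \<le> Re w \<Longrightarrow> Re w \<le> 3/2 \<Longrightarrow> norm (Gamma w) \<le> C * (1 + \<bar>Im w\<bar>) * exp (- pi * \<bar>Im w\<bar> / 2)"
    using norm_Gamma_strip[of "1 - \<sigma>"] \<sigma> by auto
  \<comment> \<open>The upper limit 5/2 covers the shifted argument, since 3/2 + 2\<sigma> - 1 <
    5/2.\<close>
  obtain D where D: "D > 0" "\<And>w. 1 - \<sigma> \<le> Re w \<Longrightarrow> Re w \<le> 5/2 \<Longrightarrow> \<bar>Im w\<bar> \<ge> 1 \<Longrightarrow> norm (zeta w) \<le> D * (1 + \<bar>Im w\<bar>)"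
    using zeta_growth[of "1 - \<sigma>" "5/2"] \<sigma> by auto
  have bz: "norm (zeta w) \<le> norm (zeta (of_real (Re w)))" if "Re w > 1" for w
  proof -
    have n: "norm (of_nat (Suc n) powr (-v)) = real (Suc n) powr (- (Re v - 1) - 1)" for n and v :: complex
      by (subst norm_powr_real_powr) (auto simp del: of_nat_Suc)
    have "norm (zeta w) \<le> (\<Sum>n. norm (of_nat (Suc n) powr (-w)))"
      unfolding sums_unique[OF zeta_sums[OF that]] unfolding n
      using summable_zreg_bound[of "Re w - 1"] that n
      by (metis (no_types, lifting) diff_gt_0_iff_gt ext summable_norm)
    also have "\<dots> = (\<Sum>n. Re (of_nat (Suc n) powr (- of_real (Re w))))"
    proof -
      have "of_nat (Suc k) powr (- complex_of_real (Re w)) = of_real (real (Suc k) powr (- Re w))" for k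
        using powr_of_real[of "real (Suc k)" "- Re w"] by (simp del: of_nat_Suc)
      then show ?thesis unfolding n by simp
    qed
    also have "\<dots> = Re (zeta (of_real (Re w)))"
      using sums_unique[OF sums_Re[OF zeta_sums[of "of_real (Re w)"]]] that by simp
    also have "\<dots> \<le> norm (zeta (of_real (Re w)))" by (rule complex_Re_le_cmod)
    finally show ?thesis .
  qed
  define Z where "Z = 1 + norm (zeta (of_real (3/2 + (2 * \<sigma> - 1)))) * norm (zeta (of_real (3/2)))"
  have Z: "Z > 0" by (simp add: Z_def add_pos_nonneg)
  define K where "K = C * exp (3/2) * D\<^sup>2 + C * exp (3/2) * exp (pi / 2) * Z"
  have K: "K > 0" unfolding K_def using C D Z by (intro add_pos_pos mult_pos_pos) auto
  show ?thesis
  proof (rule that[OF K])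
    fix s x and y :: real assume s: "Re s > 0" "norm s \<le> 1" and x: "x \<in> {1 - \<sigma>..3/2}" and y: "y \<ge> 1"
    have "norm (kern s (Complex x y)) = norm (Gamma (Complex x y)) * norm (zrot s powr (- Complex x y)) * (norm (zeta (Complex x y + of_real (2 * \<sigma> - 1))) * norm (zeta (Complex x y)))"
      by (simp add: mellin_exp_def norm_mult)
    also have "\<dots> \<le> (C * (1 + \<bar>y\<bar>) * exp (- pi * \<bar>y\<bar> / 2)) * (exp (3/2) * exp (pi / 2 * y - Re s * y)) * ((D * (1 + \<bar>y\<bar>)) * (D * (1 + \<bar>y\<bar>)))"
      using C D(1) C(2)[of "Complex x y"] D(2)[of "Complex x y"] D(2)[of "Complex x y + of_real (2 * \<sigma> - 1)"] x y \<sigma> s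
      by (intro mult_mono norm_zrot_powr mult_nonneg_nonneg) auto
    also have "\<dots> = C * exp (3/2) * D\<^sup>2 * ((1 + \<bar>y\<bar>) ^ 3 * (exp (- pi * \<bar>y\<bar> / 2) * exp (pi / 2 * y - Re s * y)))"
      by (simp add: power2_eq_square power3_eq_cube)
    also have "exp (- pi * \<bar>y\<bar> / 2) * exp (pi / 2 * y - Re s * y) = exp (- Re s * \<bar>y\<bar>)"
      unfolding exp_add[symmetric] using y by simp
    also have "C * exp (3/2) * D\<^sup>2 * ((1 + \<bar>y\<bar>) ^ 3 * exp (- Re s * \<bar>y\<bar>)) \<le> K * ((1 + \<bar>y\<bar>) ^ 3 * exp (- Re s * \<bar>y\<bar>))"
      unfolding K_def using C D Z by (intro mult_right_mono) auto
    finally show "norm (kern s (Complex x y)) \<le> K * ((1 + \<bar>y\<bar>) ^ 3 * exp (- Re s * \<bar>y\<bar>))" .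
  next
    fix s and y :: real assume s: "Re s > 0" "norm s \<le> 1" and y: "y \<le> 1"
    have "norm (kern s (Complex (3/2) y)) = norm (Gamma (Complex (3/2) y)) * norm (zrot s powr (- Complex (3/2) y)) * (norm (zeta (Complex (3/2) y + of_real (2 * \<sigma> - 1))) * norm (zeta (Complex (3/2) y)))"
      by (simp add: mellin_exp_def norm_mult)
    also have "\<dots> \<le> (C * (1 + \<bar>y\<bar>) * exp (- pi * \<bar>y\<bar> / 2)) * (exp (3/2) * exp (pi / 2)) * Z"
    proof (intro mult_mono mult_nonneg_nonneg)
      show "norm (Gamma (Complex (3/2) y)) \<le> C * (1 + \<bar>y\<bar>) * exp (- pi * \<bar>y\<bar> / 2)"
        using C(2)[of "Complex (3/2) y"] \<sigma> by simp
      have "pi / 2 * y - Re s * y = (pi / 2 - Re s) * y" by (simp add: algebra_simps)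
      also have "\<dots> \<le> (pi / 2 - Re s) * 1"
        using y s pi_gt3 complex_Re_le_cmod[of s] by (intro mult_left_mono) auto
      also have "\<dots> \<le> pi / 2" using s by simp
      finally have "exp (pi / 2 * y - Re s * y) \<le> exp (pi / 2)" by simp
      then show "norm (zrot s powr (- Complex (3/2) y)) \<le> exp (3/2) * exp (pi / 2)"
        using norm_zrot_powr[OF s, of "3/2" y] by (simp add: order_trans[OF _ mult_left_mono])
      have "norm (zeta (Complex (3/2) y + of_real (2 * \<sigma> - 1))) * norm (zeta (Complex (3/2) y)) \<le> norm (zeta (of_real (3/2 + (2 * \<sigma> - 1)))) * norm (zeta (of_real (3/2)))"
        using bz[of "Complex (3/2) y + of_real (2 * \<sigma> - 1)"] bz[of "Complex (3/2) y"] \<sigma> by (intro mult_mono) auto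
      then show "norm (zeta (Complex (3/2) y + of_real (2 * \<sigma> - 1))) * norm (zeta (Complex (3/2) y)) \<le> Z"
        by (simp add: Z_def)
    qed (use C in auto)
    also have "\<dots> = C * exp (3/2) * exp (pi / 2) * Z * ((1 + \<bar>y\<bar>) * exp (- (pi / 2) * \<bar>y\<bar>))" by simp
    also have "\<dots> \<le> K * ((1 + \<bar>y\<bar>) ^ 3 * exp (- (pi / 2) * \<bar>y\<bar>))"
    proof (intro mult_mono mult_right_mono)
      show "C * exp (3/2) * exp (pi / 2) * Z \<le> K" unfolding K_def using C D by simp
      show "1 + \<bar>y\<bar> \<le> (1 + \<bar>y\<bar>) ^ 3" using power_increasing[of 1 3 "1 + \<bar>y\<bar>"] by simp
    qed (use K in auto)
    finally show "norm (kern s (Complex (3/2) y)) \<le> K * ((1 + \<bar>y\<bar>) ^ 3 * exp (- (pi / 2) * \<bar>y\<bar>))" .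
  qed
qed

text \<open>On Re w = 1 - \<sigma> the shifted argument is \<sigma> + i t and 1 - w is its
  conjugate, so the functional equation turns the two zeta factors into |zeta|^2. The rotated power
  contributes exp (- s t) and one of the two exponentials of the cosine; the other one is the
  correction 1 + exp (i pi w). It has modulus at least 1, because pi (1 - \<sigma>) \<le> pi/2 makes
  the real part of the exponential nonnegative, and it tends to 1 exponentially fast.\<close>

lemma kern_critical:
  assumes s: "Re s > 0" "norm s \<le> 1"
  defines "w \<equiv> \<lambda>t. Complex (1 - \<sigma>) t"
  shows "kern s (w t) = exp (\<i> * s * of_real (1 - \<sigma>)) *
    (of_real ((norm (zeta (Complex \<sigma> t)))\<^sup>2) * exp (- s * of_real t) * (1 / (1 + exp (\<i> * of_real pi * w t))))"
    and "Re (exp (\<i> * of_real pi * w t)) \<ge> 0" and "norm (exp (\<i> * of_real pi * w t)) = exp (- pi * t)"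
proof -
  show n: "norm (exp (\<i> * of_real pi * w t)) = exp (- pi * t)" for t
    by (simp add: w_def)
  show re: "Re (exp (\<i> * of_real pi * w t)) \<ge> 0" for t
  proof -
    have "0 \<le> pi * (1 - \<sigma>)" "pi * (1 - \<sigma>) \<le> pi * (1/2)" using \<sigma> by (intro mult_nonneg_nonneg mult_left_mono; simp)+
    then have "cos (pi * (1 - \<sigma>)) \<ge> 0" by (intro cos_ge_zero) (use pi_gt_zero in linarith)+
    then show ?thesis by (simp add: w_def Re_exp)
  qed
  let ?q = "exp (\<i> * of_real pi * w t)"
  have q1: "1 + ?q \<noteq> 0" using re[of t] by (auto simp: complex_eq_iff)
  \<comment> \<open>This is where the direction of \<open>zrot\<close> comes from: its power
    supplies one exponential of the cosine in the functional equation.\<close>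
  have e0: "exp (- \<i> * of_real pi * w t / 2) * (1 + ?q) = 2 * cos (of_real pi * w t / 2)"
  proof -
    have "exp (- \<i> * of_real pi * w t / 2) * ?q = exp (\<i> * (of_real pi * w t / 2))"
      unfolding exp_add[symmetric] by (simp add: algebra_simps)
    then show ?thesis unfolding cos_exp_eq by (simp add: algebra_simps)
  qed
  have FE: "zeta (1 - w t) = 2 * of_real (2 * pi) powr (- w t) * cos (of_real pi * w t / 2) * Gamma (w t) * zeta (w t)"
    by (rule zeta_functional_equation) (use \<sigma> in \<open>auto simp: w_def\<close>)
  have "1 - w t = cnj (Complex \<sigma> t)" by (simp add: w_def complex_eq_iff)
  then have cz: "zeta (1 - w t) = cnj (zeta (Complex \<sigma> t))"
    using zeta_cnj[of "Complex \<sigma> t"] \<sigma> by simp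
  have ww: "w t + of_real (2 * \<sigma> - 1) = Complex \<sigma> t" by (simp add: w_def complex_eq_iff)
  have isw: "exp (\<i> * s * w t) = exp (\<i> * s * of_real (1 - \<sigma>)) * exp (- s * of_real t)"
    unfolding exp_add[symmetric] by (simp add: w_def Complex_eq algebra_simps)
  have "kern s (w t) * (1 + ?q) = Gamma (w t) * of_real (2 * pi) powr (- w t) * zeta (w t) * (exp (- \<i> * of_real pi * w t / 2) * (1 + ?q)) * exp (\<i> * s * w t) * zeta (Complex \<sigma> t)"
    unfolding mellin_exp_def zrot_powr[OF s] ww by (simp add: mult_ac)
  also have "\<dots> = zeta (1 - w t) * zeta (Complex \<sigma> t) * exp (\<i> * s * w t)"
    unfolding e0 FE by (simp add: mult_ac)
  also have "zeta (1 - w t) * zeta (Complex \<sigma> t) = of_real ((norm (zeta (Complex \<sigma> t)))\<^sup>2)"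
    unfolding cz complex_norm_square by (simp add: mult.commute)
  finally show "kern s (w t) = exp (\<i> * s * of_real (1 - \<sigma>)) *
    (of_real ((norm (zeta (Complex \<sigma> t)))\<^sup>2) * exp (- s * of_real t) * (1 / (1 + exp (\<i> * of_real pi * w t))))"
    unfolding isw using q1 by (simp add: field_simps)
qed

lemma zeta_laplace_formula:
  obtains C where
    "\<And>s. Re s > 0 \<Longrightarrow> norm s \<le> 1 \<Longrightarrow>
       set_integrable lborel {0..} (\<lambda>t. of_real ((norm (zeta (Complex \<sigma> t)))\<^sup>2) * exp (- s * of_real t))"
    "\<And>s. Re s > 0 \<Longrightarrow> norm s \<le> 1 \<Longrightarrow>
       norm ((LINT t:{0..}|lborel. of_real ((norm (zeta (Complex \<sigma> t)))\<^sup>2) * exp (- s * of_real t)) -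
         2 * pi * exp (- \<i> * s * of_real (1 - \<sigma>)) * (\<integral>p. of_real (pair_weight \<sigma> p) * exp (- of_real (pair_product p) * zrot s) \<partial>pairs)) \<le> C"
proof -
  obtain K where K: "K > 0"
    "\<And>s x y. Re s > 0 \<Longrightarrow> norm s \<le> 1 \<Longrightarrow> x \<in> {1 - \<sigma>..3/2} \<Longrightarrow> y \<ge> 1 \<Longrightarrow>
       norm (kern s (Complex x y)) \<le> K * ((1 + \<bar>y\<bar>) ^ 3 * exp (- Re s * \<bar>y\<bar>))"
    "\<And>s y. Re s > 0 \<Longrightarrow> norm s \<le> 1 \<Longrightarrow> y \<le> 1 \<Longrightarrow>
       norm (kern s (Complex (3/2) y)) \<le> K * ((1 + \<bar>y\<bar>) ^ 3 * exp (- (pi / 2) * \<bar>y\<bar>))"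
    using kern_bound by blast
  obtain D where D: "D > 0" "\<And>w. \<sigma> \<le> Re w \<Longrightarrow> Re w \<le> \<sigma> \<Longrightarrow> \<bar>Im w\<bar> \<ge> 1 \<Longrightarrow> norm (zeta w) \<le> D * (1 + \<bar>Im w\<bar>)"
    using zeta_growth[of \<sigma> \<sigma>] \<sigma> by auto
  define g where "g = (\<lambda>t. (norm (zeta (Complex \<sigma> t)))\<^sup>2)"
  have g_cont: "continuous_on A g" for A
    unfolding g_def using \<sigma> by (intro continuous_intros zeta_vertical_continuous) auto
  have g_bd: "g t \<le> D\<^sup>2 * (1 + \<bar>t\<bar>)\<^sup>2" if "t \<ge> 1" for t
    using power_mono[OF D(2)[of "Complex \<sigma> t"], of 2] that by (simp add: g_def power_mult_distrib)
  define I1 where "I1 = (\<integral>y. K * ((1 + \<bar>y\<bar>) ^ 3 * exp (- (pi / 2) * \<bar>y\<bar>)) \<partial>lborel)"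
  define I2 where "I2 = (LINT t:{1..}|lborel. g t * exp (- pi * t))"
  define I3 where "I3 = (LINT t:{0..<1}|lborel. g t)"
  have g1: "set_integrable lborel {0..1} g"
    using borel_integrable_atLeastAtMost'[OF g_cont] .
  then have g01: "set_integrable lborel {0..<1} g"
    by (rule set_integrable_subset) auto
  have gpi: "set_integrable lborel {1..} (\<lambda>t. g t * exp (- pi * t))"
  proof (rule set_integrable_bound)
    show "set_integrable lborel {1..} (\<lambda>t. D\<^sup>2 * ((1 + \<bar>t\<bar>) ^ 2 * exp (- pi * \<bar>t\<bar>)))"
      unfolding set_integrable_def
      by (intro integrable_mult_indicator integrable_mult_right integrable_poly_exp_abs) auto
    show "set_borel_measurable lborel {1..} (\<lambda>t. g t * exp (- pi * t))"
    proof -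
      have "(\<lambda>t. indicator {1..} t *\<^sub>R (g t * exp (- pi * t))) \<in> borel_measurable borel"
        by (intro borel_measurable_continuous_on_indicator continuous_intros g_cont) auto
      then show ?thesis by (simp add: set_borel_measurable_def)
    qed
    show "AE t in lborel. t \<in> {1..} \<longrightarrow> norm (g t * exp (- pi * t)) \<le> norm (D\<^sup>2 * ((1 + \<bar>t\<bar>) ^ 2 * exp (- pi * \<bar>t\<bar>)))"
    proof (intro AE_I2 impI)
      fix t :: real assume t: "t \<in> {1..}"
      have "g t * exp (- pi * t) \<le> D\<^sup>2 * (1 + \<bar>t\<bar>)\<^sup>2 * exp (- pi * t)"
        using g_bd[of t] t by (intro mult_right_mono) auto
      moreover have "g t \<ge> 0" by (simp add: g_def)
      ultimately show "norm (g t * exp (- pi * t)) \<le> norm (D\<^sup>2 * ((1 + \<bar>t\<bar>) ^ 2 * exp (- pi * \<bar>t\<bar>)))"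
        using t by (simp add: abs_mult mult.assoc)
    qed
  qed
  have *: "set_integrable lborel {0..} (\<lambda>t. of_real (g t) * exp (- s * of_real t)) \<and>
       norm ((LINT t:{0..}|lborel. of_real (g t) * exp (- s * of_real t)) -
         2 * pi * exp (- \<i> * s * of_real (1 - \<sigma>)) * (\<integral>p. of_real (pair_weight \<sigma> p) * exp (- of_real (pair_product p) * zrot s) \<partial>pairs)) \<le>
       exp 1 * (I1 + 8 * K * (1/2 + \<sigma>)) + exp 1 * (exp 1 * (I2 + I3))"
    if s: "Re s > 0" "norm s \<le> 1" for s
  proof -
    define e where "e = exp (\<i> * s * of_real (1 - \<sigma>))"
    have eb: "norm e \<le> exp 1" "norm (exp (- \<i> * s * of_real (1 - \<sigma>))) \<le> exp 1"
    proof -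
      have "\<bar>Im s * (1 - \<sigma>)\<bar> \<le> 1 * 1" unfolding abs_mult using \<sigma> s abs_Im_le_cmod[of s] by (intro mult_mono) auto
      then show "norm e \<le> exp 1" "norm (exp (- \<i> * s * of_real (1 - \<sigma>))) \<le> exp 1" by (auto simp: e_def)
    qed
    have ee: "exp (- \<i> * s * of_real (1 - \<sigma>)) * e = 1"
      unfolding e_def exp_add[symmetric] by simp
    let ?f = "\<lambda>t. of_real (g t) * exp (- s * of_real t)"
    have f_cont: "continuous_on A ?f" for A using g_cont by (intro continuous_intros) auto
    have f_norm: "norm (?f t) = g t * exp (- Re s * t)" for t
      by (simp add: norm_mult norm_power g_def)
    have f1: "set_integrable lborel {1..} ?f"
    proof (rule set_integrable_half_line_bound[OF f_cont s(1)])
      fix t :: real assume t: "t \<ge> 1"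
      show "norm (?f t) \<le> D\<^sup>2 * ((1 + \<bar>t\<bar>) ^ 2 * exp (- Re s * \<bar>t\<bar>))"
        unfolding f_norm using mult_right_mono[OF g_bd[OF t], of "exp (- Re s * t)"] t by simp
    qed
    have "set_integrable lborel {0..1} ?f"
      using borel_integrable_atLeastAtMost'[OF f_cont] .
    then have f0: "set_integrable lborel {0..<1} ?f"
      by (rule set_integrable_subset) auto
    have un: "{0::real..} = {0..<1} \<union> {1..}" "{0..<1::real} \<inter> {1..} = {}" by auto
    have f: "set_integrable lborel {0..} ?f"
      unfolding un by (rule set_integrable_Un[OF f0 f1]) auto
    have split: "(LINT t:{0..}|lborel. ?f t) = (LINT t:{0..<1}|lborel. ?f t) + (LINT t:{1..}|lborel. ?f t)"
      unfolding un by (rule set_integral_Un[OF _ f0 f1]) auto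
    have b3: "norm (LINT t:{0..<1}|lborel. ?f t) \<le> I3"
    proof -
      have "norm (LINT t:{0..<1}|lborel. ?f t) \<le> (LINT t:{0..<1}|lborel. norm (?f t))"
        by (rule set_integral_norm_bound[OF f0])
      also have "\<dots> \<le> I3"
        unfolding I3_def
      proof (rule set_integral_mono)
        show "set_integrable lborel {0..<1} (\<lambda>t. norm (?f t))" using f0 by (rule set_integrable_norm)
        fix t :: real assume "t \<in> {0..<1}"
        then have "exp (- Re s * t) \<le> 1" using s by simp
        then show "norm (?f t) \<le> g t" unfolding f_norm by (simp add: g_def mult_left_le)
      qed (rule g01)
      finally show ?thesis .
    qed
    define H where "H = (\<lambda>t. kern s (Complex (3/2) t))"
    have zs: "\<sigma> \<ge> 1/2" "Re (zrot s) > 0" using \<sigma> Re_zrot_pos[OF s] by auto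
    have intH: "integrable lborel H" and valH: "(\<integral>t. H t \<partial>lborel) = 2 * pi * (\<integral>p. of_real (pair_weight \<sigma> p) * exp (- of_real (pair_product p) * zrot s) \<partial>pairs)"
      unfolding H_def using pair_mellin[OF zs] by auto
    have setH: "set_integrable lborel A H" if "A \<in> sets borel" for A
      unfolding set_integrable_def using intH that by (intro integrable_mult_indicator) auto
    have splitH: "(\<integral>t. H t \<partial>lborel) = (LINT t:{..<1}|lborel. H t) + (LINT t:{1..}|lborel. H t)"
    proof -
      have "(\<integral>t. H t \<partial>lborel) = (LINT t:{..<1} \<union> {1..}|lborel. H t)"
      proof -
        have "{..<1} \<union> {1..} = (UNIV :: real set)" by auto
        then show ?thesis by (simp add: set_lebesgue_integral_def)
      qed
      also have "\<dots> = (LINT t:{..<1}|lborel. H t) + (LINT t:{1..}|lborel. H t)"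
        by (intro set_integral_Un setH) auto
      finally show ?thesis .
    qed
    have b1: "norm (LINT t:{..<1}|lborel. H t) \<le> I1"
    proof -
      have "norm (LINT t:{..<1}|lborel. H t) \<le> (\<integral>y. K * ((1 + \<bar>y\<bar>) ^ 3 * exp (- (pi / 2) * \<bar>y\<bar>)) \<partial>lborel)"
        unfolding set_lebesgue_integral_def
      proof (rule Bochner_Integration.integral_norm_bound_integral)
        show "integrable lborel (\<lambda>t. indicator {..<1} t *\<^sub>R H t)" using setH[of "{..<1}"] by (simp add: set_integrable_def)
        show "integrable lborel (\<lambda>y. K * ((1 + \<bar>y\<bar>) ^ 3 * exp (- (pi / 2) * \<bar>y\<bar>)))"
          by (intro integrable_mult_right integrable_poly_exp_abs) auto
        show "norm (indicator {..<1} t *\<^sub>R H t) \<le> K * ((1 + \<bar>t\<bar>) ^ 3 * exp (- (pi / 2) * \<bar>t\<bar>))" for t :: real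
          using K(3)[OF s, of t] K(1) by (auto simp: H_def indicator_def)
      qed
      then show ?thesis by (simp add: I1_def)
    qed
    have b2: "norm ((LINT t:{1..}|lborel. H t) - (LINT t:{1..}|lborel. kern s (Complex (1 - \<sigma>) t))) \<le> 8 * K * (1/2 + \<sigma>)"
    proof -
      have hol: "kern s holomorphic_on {w. Im w > 0}"
      proof -
        have "w \<notin> \<int>\<^sub>\<le>\<^sub>0" if "Im w > 0" for w using that by (auto elim!: nonpos_Ints_cases)
        then have "mellin_exp (zrot s) holomorphic_on {w. Im w > 0}"
          unfolding mellin_exp_def using zrot_nonzero by (intro holomorphic_intros) auto
        moreover have "zeta holomorphic_on {w. Im w > 0}"
          by (rule holomorphic_on_subset[OF zeta_holomorphic]) auto
        moreover have "(\<lambda>w. zeta (w + of_real (2 * \<sigma> - 1))) holomorphic_on {w. Im w > 0}"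
          by (rule holomorphic_on_compose_gen[of _ _ zeta "- {1}", unfolded o_def])
             (use zeta_holomorphic in \<open>auto intro!: holomorphic_intros simp: complex_eq_iff\<close>)
        ultimately show ?thesis by (intro holomorphic_intros)
      qed
      have int: "set_integrable lborel {1..} (\<lambda>t. kern s (Complex x t))" if x: "x \<in> {1 - \<sigma>..3/2}" for x
      proof (rule set_integrable_half_line_bound[OF _ s(1) K(2)[OF s x]])
        show "continuous_on {1..} (\<lambda>t. kern s (Complex x t))"
          by (rule continuous_on_compose2[OF holomorphic_on_imp_continuous_on[OF hol]])
             (auto simp: Complex_eq intro!: continuous_intros)
      qed
      have "norm ((LINT t:{1..}|lborel. kern s (Complex (3/2) t)) - (LINT t:{1..}|lborel. kern s (Complex (1 - \<sigma>) t))) \<le> (K * ((1 + \<bar>1\<bar>) ^ 3 * exp (- Re s * \<bar>1\<bar>))) * (3/2 - (1 - \<sigma>))"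
      proof (rule half_strip_shift[OF _ hol K(2)[OF s]])
        have "Re s > 0" by (rule s)
        then show "((\<lambda>y. K * ((1 + \<bar>y\<bar>) ^ 3 * exp (- Re s * \<bar>y\<bar>))) \<longlongrightarrow> 0) at_top" by real_asymp
      qed (use \<sigma> int in auto)
      also have "\<dots> \<le> (K * (8 * 1)) * (1/2 + \<sigma>)"
        using K(1) s \<sigma> by (intro mult_mono mult_left_mono) auto
      finally show ?thesis by (simp add: H_def mult_ac)
    qed
    let ?q = "\<lambda>t. exp (\<i> * of_real pi * Complex (1 - \<sigma>) t)"
    have crit: "kern s (Complex (1 - \<sigma>) t) = e * (?f t * (1 / (1 + ?q t)))" for t
      unfolding kern_critical(1)[OF s] e_def g_def ..
    have b4: "norm ((LINT t:{1..}|lborel. kern s (Complex (1 - \<sigma>) t)) - e * (LINT t:{1..}|lborel. ?f t)) \<le> exp 1 * I2"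
    proof -
      have nq: "1 + ?q t \<noteq> 0" for t using kern_critical(2)[OF s, of t] by (auto simp: complex_eq_iff)
      have bd: "norm (?f t * (1 / (1 + ?q t) - 1)) \<le> g t * exp (- pi * t)" if "t \<ge> 1" for t
      proof -
        have "norm (?f t) \<le> g t * 1"
          unfolding f_norm using s that by (intro mult_left_mono) (auto simp: g_def)
        moreover have "norm (1 / (1 + ?q t) - 1) \<le> exp (- pi * t)"
          using norm_inverse_one_plus_le[OF kern_critical(2)[OF s]] kern_critical(3)[OF s] by simp
        ultimately show ?thesis unfolding norm_mult by (intro mult_mono) (auto simp: g_def norm_mult)
      qed
      have meas: "set_borel_measurable lborel {1..} (\<lambda>t. ?f t * (1 / (1 + ?q t) - 1))"
      proof -
        have "continuous_on {1..} (\<lambda>t. ?f t * (1 / (1 + ?q t) - 1))"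
          using nq unfolding Complex_eq by (intro continuous_intros f_cont) auto
        then show ?thesis by (simp add: set_borel_measurable_def borel_measurable_continuous_on_indicator)
      qed
      have i4: "set_integrable lborel {1..} (\<lambda>t. ?f t * (1 / (1 + ?q t) - 1))"
        by (rule set_integrable_bound[OF gpi meas]) (use bd in \<open>auto simp: g_def\<close>)
      have ek: "kern s (Complex (1 - \<sigma>) t) = e * (?f t * (1 / (1 + ?q t) - 1) + ?f t)" for t
        unfolding crit by (simp add: algebra_simps)
      have "(LINT t:{1..}|lborel. kern s (Complex (1 - \<sigma>) t)) = e * ((LINT t:{1..}|lborel. ?f t * (1 / (1 + ?q t) - 1)) + (LINT t:{1..}|lborel. ?f t))"
        unfolding ek using i4 f1 by (simp only: set_integral_mult_right set_integral_add)
      then have "norm ((LINT t:{1..}|lborel. kern s (Complex (1 - \<sigma>) t)) - e * (LINT t:{1..}|lborel. ?f t)) = norm e * norm (LINT t:{1..}|lborel. ?f t * (1 / (1 + ?q t) - 1))"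
        by (simp add: algebra_simps norm_mult)
      also have "\<dots> \<le> exp 1 * I2"
      proof (intro mult_mono eb)
        have "norm (LINT t:{1..}|lborel. ?f t * (1 / (1 + ?q t) - 1)) \<le> (LINT t:{1..}|lborel. norm (?f t * (1 / (1 + ?q t) - 1)))"
          by (rule set_integral_norm_bound[OF i4])
        also have "\<dots> \<le> I2"
          unfolding I2_def using bd by (intro set_integral_mono set_integrable_norm i4 gpi) auto
        finally show "norm (LINT t:{1..}|lborel. ?f t * (1 / (1 + ?q t) - 1)) \<le> I2" .
      qed auto
      finally show ?thesis .
    qed
    let ?S = "\<integral>p. of_real (pair_weight \<sigma> p) * exp (- of_real (pair_product p) * zrot s) \<partial>pairs"
    let ?L = "LINT t:{0..}|lborel. ?f t"
    have "norm (e * ?L - 2 * pi * ?S) \<le> exp 1 * (I2 + I3) + (I1 + 8 * K * (1/2 + \<sigma>))"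
    proof -
      define A1 A2 A3 A4 A5 where "A1 = (LINT t:{0..<1}|lborel. ?f t)" "A2 = (LINT t:{1..}|lborel. ?f t)"
        "A3 = (LINT t:{..<1}|lborel. H t)" "A4 = (LINT t:{1..}|lborel. H t)" "A5 = (LINT t:{1..}|lborel. kern s (Complex (1 - \<sigma>) t))"
      have "e * ?L - 2 * pi * ?S = e * A1 - (A5 - e * A2) - (A4 - A5) - A3"
        unfolding split splitH valH[symmetric] A1_A2_A3_A4_A5_def by (simp add: algebra_simps)
      also have "norm \<dots> \<le> norm (e * A1) + norm (A5 - e * A2) + norm (A4 - A5) + norm A3"
        by (intro order_trans[OF norm_triangle_ineq4] add_mono order_refl)
      also have "\<dots> \<le> exp 1 * I3 + exp 1 * I2 + 8 * K * (1/2 + \<sigma>) + I1"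
        unfolding norm_mult using b1 b2 b3 b4 eb by (intro add_mono mult_mono) (auto simp: A1_A2_A3_A4_A5_def)
      finally show ?thesis by (simp add: algebra_simps)
    qed
    then have "norm (exp (- \<i> * s * of_real (1 - \<sigma>))) * norm (e * ?L - 2 * pi * ?S) \<le> exp 1 * (exp 1 * (I2 + I3) + (I1 + 8 * K * (1/2 + \<sigma>)))"
      using eb by (intro mult_mono) auto
    also have "norm (exp (- \<i> * s * of_real (1 - \<sigma>))) * norm (e * ?L - 2 * pi * ?S) = norm (exp (- \<i> * s * of_real (1 - \<sigma>)) * e * ?L - 2 * pi * exp (- \<i> * s * of_real (1 - \<sigma>)) * ?S)"
      unfolding norm_mult[symmetric] by (simp only: right_diff_distrib mult_ac)
    finally show ?thesis using f unfolding ee by (simp add: distrib_left add_ac)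
  qed
  show ?thesis
    by (rule that) (use * in \<open>auto simp: g_def\<close>)
qed

end

section \<open>A Tauberian comparison\<close>

definition poisson_cdf :: "nat \<Rightarrow> real \<Rightarrow> real" where
  "poisson_cdf k t = (\<Sum>j\<le>k. t ^ j / fact j * exp (- t))"

lemma exp_real_sums: "(\<lambda>j. (t::real) ^ j / fact j) sums exp t"
  using exp_converges[of t] by (simp add: divide_inverse mult.commute)

lemma poisson_cdf_nonneg: "t \<ge> 0 \<Longrightarrow> poisson_cdf k t \<ge> 0"
  unfolding poisson_cdf_def by (intro sum_nonneg) auto

lemma exp_partial_sum_le:
  fixes t :: real
  assumes "t \<ge> 0"
  shows "(\<Sum>j\<le>k. t ^ j / fact j) \<le> exp t"
  using sum_le_suminf[OF sums_summable[OF exp_real_sums[of t]], of "{..k}"] assms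
  by (simp add: sums_unique[OF exp_real_sums, symmetric])

lemma poisson_cdf_le_1: "t \<ge> 0 \<Longrightarrow> poisson_cdf k t \<le> 1"
  using mult_right_mono[OF exp_partial_sum_le[of t k], of "exp (-t)"]
  unfolding poisson_cdf_def sum_distrib_right[symmetric] by (simp flip: exp_add)

text \<open>As a function of t the distribution function is a smoothed indicator of t \<le> k.
  Chernoff's method: the weights (1 - \<eta>)^j are paid for by exp (k (\<eta> + 2\<eta>^2)), since
  ln (1 - \<eta>) \<ge> - \<eta> - 2\<eta>^2 and j \<le> k. The threshold 1 + 4\<eta> leaves a
  surplus, so that besides the smallness in k a damping factor in t remains; with it the tail can be
  integrated against an infinite measure.\<close>

lemma poisson_cdf_upper:
  assumes "0 < \<eta>" "\<eta> \<le> 1/2" "t \<ge> real k * (1 + 4 * \<eta>)"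
  shows "poisson_cdf k t \<le> exp (- real k * \<eta>\<^sup>2 / 2) * exp (- (\<eta>\<^sup>2 / 2) * t)"
proof -
  have "real k * (1 + 4 * \<eta>) \<ge> 0" using assms by simp
  then have t0: "t \<ge> 0" using assms(3) by linarith
  have "(\<Sum>j\<le>k. t ^ j / fact j) \<le> (\<Sum>j\<le>k. ((1 - \<eta>) * t) ^ j / fact j * exp (real k * (\<eta> + 2 * \<eta>\<^sup>2)))"
  proof (rule sum_mono)
    fix j assume j: "j \<in> {..k}"
    have "1 \<le> (1 - \<eta>) ^ j * exp (real k * (\<eta> + 2 * \<eta>\<^sup>2))"
    proof -
      have "- (\<eta> + 2 * \<eta>\<^sup>2) \<le> ln (1 - \<eta>)" using ln_one_minus_pos_lower_bound[of \<eta>] assms by simp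
      then have "- (real j * (\<eta> + 2 * \<eta>\<^sup>2)) \<le> real j * ln (1 - \<eta>)" by (metis minus_mult_right mult_left_mono of_nat_0_le_iff)
      moreover have "real j * (\<eta> + 2 * \<eta>\<^sup>2) \<le> real k * (\<eta> + 2 * \<eta>\<^sup>2)" using j assms by (intro mult_right_mono) auto
      ultimately have "0 \<le> real j * ln (1 - \<eta>) + real k * (\<eta> + 2 * \<eta>\<^sup>2)" by linarith
      then have "1 \<le> exp (real j * ln (1 - \<eta>) + real k * (\<eta> + 2 * \<eta>\<^sup>2))" by simp
      also have "\<dots> = (1 - \<eta>) ^ j * exp (real k * (\<eta> + 2 * \<eta>\<^sup>2))"
        using assms by (simp add: exp_add exp_of_nat_mult)
      finally show ?thesis .
    qed
    then have "t ^ j / fact j * 1 \<le> t ^ j / fact j * ((1 - \<eta>) ^ j * exp (real k * (\<eta> + 2 * \<eta>\<^sup>2)))"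
      using t0 by (intro mult_left_mono) auto
    then show "t ^ j / fact j \<le> ((1 - \<eta>) * t) ^ j / fact j * exp (real k * (\<eta> + 2 * \<eta>\<^sup>2))"
      by (simp add: power_mult_distrib mult_ac)
  qed
  also have "\<dots> \<le> exp ((1 - \<eta>) * t) * exp (real k * (\<eta> + 2 * \<eta>\<^sup>2))"
    unfolding sum_distrib_right[symmetric] using assms t0 by (intro mult_right_mono exp_partial_sum_le) auto
  finally have "poisson_cdf k t \<le> exp ((1 - \<eta>) * t) * exp (real k * (\<eta> + 2 * \<eta>\<^sup>2)) * exp (-t)"
    unfolding poisson_cdf_def sum_distrib_right[symmetric] by (intro mult_right_mono) auto
  also have "\<dots> = exp (- \<eta> * t + real k * (\<eta> + 2 * \<eta>\<^sup>2))"
    unfolding exp_add[symmetric] by (simp add: algebra_simps)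
  also have "\<dots> \<le> exp (- real k * \<eta>\<^sup>2 / 2 + - (\<eta>\<^sup>2 / 2) * t)"
  proof -
    have "\<eta>\<^sup>2 \<le> \<eta> * (1/2)" unfolding power2_eq_square using assms by (intro mult_left_mono) auto
    then have h: "\<eta> - \<eta>\<^sup>2 / 2 \<ge> 0" using assms by linarith
    have "real k * (1 + 4 * \<eta>) * (\<eta> - \<eta>\<^sup>2 / 2) \<le> t * (\<eta> - \<eta>\<^sup>2 / 2)"
      by (rule mult_right_mono[OF assms(3) h])
    moreover have "real k * (1 + 4 * \<eta>) * (\<eta> - \<eta>\<^sup>2 / 2) = real k * (\<eta> + 5/2 * \<eta>\<^sup>2) + real k * (\<eta>\<^sup>2 * (1 - 2 * \<eta>))"
      by (simp add: power2_eq_square field_simps)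
    moreover have "real k * (\<eta>\<^sup>2 * (1 - 2 * \<eta>)) \<ge> 0" using assms by (intro mult_nonneg_nonneg) auto
    ultimately have "real k * (\<eta> + 5/2 * \<eta>\<^sup>2) \<le> t * (\<eta> - \<eta>\<^sup>2 / 2)" by linarith
    then show ?thesis by (simp add: algebra_simps)
  qed
  also have "\<dots> = exp (- real k * \<eta>\<^sup>2 / 2) * exp (- (\<eta>\<^sup>2 / 2) * t)" by (rule exp_add)
  finally show ?thesis .
qed

text \<open>Chernoff's method for j > k with the weights (1 + \<eta>)^j. The threshold 1 - 2\<eta>
  makes the exponent \<eta> t - k (\<eta> - \<eta>^2) at most - k \<eta>^2.\<close>

lemma poisson_cdf_lower:
  assumes "0 < \<eta>" "\<eta> \<le> 1/2" "0 \<le> t" "t \<le> real k * (1 - 2 * \<eta>)"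
  shows "1 - poisson_cdf k t \<le> exp (- real k * \<eta>\<^sup>2)"
proof -
  have s1: "(\<lambda>j. t ^ j / fact j * exp (- t)) sums 1"
    using sums_mult2[OF exp_real_sums[of t], of "exp (-t)"] by (simp add: exp_minus)
  have s2: "(\<lambda>j. ((1 + \<eta>) * t) ^ j / fact j * exp (- t) * exp (- (real k * (\<eta> - \<eta>\<^sup>2)))) sums (exp ((1 + \<eta>) * t) * exp (- t) * exp (- (real k * (\<eta> - \<eta>\<^sup>2))))"
    by (intro sums_mult2 exp_real_sums)
  have "1 - poisson_cdf k t = (\<Sum>j. t ^ (j + Suc k) / fact (j + Suc k) * exp (- t))"
    using suminf_split_initial_segment[OF sums_summable[OF s1], of "Suc k"] sums_unique[OF s1]
    by (simp add: poisson_cdf_def lessThan_Suc_atMost)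
  also have "\<dots> \<le> (\<Sum>j. ((1 + \<eta>) * t) ^ (j + Suc k) / fact (j + Suc k) * exp (- t) * exp (- (real k * (\<eta> - \<eta>\<^sup>2))))"
  proof (rule suminf_le)
    show "summable (\<lambda>j. t ^ (j + Suc k) / fact (j + Suc k) * exp (- t))"
      by (rule summable_ignore_initial_segment[OF sums_summable[OF s1]])
    show "summable (\<lambda>j. ((1 + \<eta>) * t) ^ (j + Suc k) / fact (j + Suc k) * exp (- t) * exp (- (real k * (\<eta> - \<eta>\<^sup>2))))"
      by (rule summable_ignore_initial_segment[OF sums_summable[OF s2]])
    fix j
    define m where "m = j + Suc k"
    have "1 \<le> (1 + \<eta>) ^ m * exp (- (real k * (\<eta> - \<eta>\<^sup>2)))"
    proof -
      have "\<eta> - \<eta>\<^sup>2 \<le> ln (1 + \<eta>)" using ln_one_plus_pos_lower_bound[of \<eta>] assms by simp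
      then have "real k * (\<eta> - \<eta>\<^sup>2) \<le> real k * ln (1 + \<eta>)" by (intro mult_left_mono) auto
      also have "\<dots> \<le> real m * ln (1 + \<eta>)" using assms by (intro mult_right_mono) (auto simp: m_def)
      finally have "0 \<le> real m * ln (1 + \<eta>) + - (real k * (\<eta> - \<eta>\<^sup>2))" by linarith
      then have "1 \<le> exp (real m * ln (1 + \<eta>) + - (real k * (\<eta> - \<eta>\<^sup>2)))" by simp
      also have "\<dots> = (1 + \<eta>) ^ m * exp (- (real k * (\<eta> - \<eta>\<^sup>2)))"
        using assms unfolding exp_add by (simp add: exp_of_nat_mult)
      finally show ?thesis .
    qed
    then have "t ^ m / fact m * exp (- t) * 1 \<le> t ^ m / fact m * exp (- t) * ((1 + \<eta>) ^ m * exp (- (real k * (\<eta> - \<eta>\<^sup>2))))"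
      using assms by (intro mult_left_mono) auto
    then show "t ^ (j + Suc k) / fact (j + Suc k) * exp (- t) \<le> ((1 + \<eta>) * t) ^ (j + Suc k) / fact (j + Suc k) * exp (- t) * exp (- (real k * (\<eta> - \<eta>\<^sup>2)))"
      unfolding m_def[symmetric] by (simp add: power_mult_distrib mult_ac)
  qed
  also have "\<dots> \<le> (\<Sum>j. ((1 + \<eta>) * t) ^ j / fact j * exp (- t) * exp (- (real k * (\<eta> - \<eta>\<^sup>2))))"
    using suminf_split_initial_segment[OF sums_summable[OF s2], of "Suc k"] assms by (simp add: sum_nonneg)
  also have "\<dots> = exp ((1 + \<eta>) * t) * exp (- t) * exp (- (real k * (\<eta> - \<eta>\<^sup>2)))"
    using s2 by (rule sums_unique[symmetric])
  also have "\<dots> = exp (\<eta> * t - real k * (\<eta> - \<eta>\<^sup>2))"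
    unfolding exp_add[symmetric] by (simp add: algebra_simps)
  also have "\<dots> \<le> exp (- real k * \<eta>\<^sup>2)"
    using mult_left_mono[OF assms(4), of \<eta>] assms(1) by (simp add: algebra_simps power2_eq_square)
  finally show ?thesis .
qed

section \<open>Laplace transforms of measures and their Taylor coefficients\<close>

lemma power_series_coeff_bound:
  fixes a :: "nat \<Rightarrow> complex"
  assumes sums: "\<And>u. norm u < 1 \<Longrightarrow> (\<lambda>n. a n * u ^ n) sums f u"
    and r: "0 < r" "r < 1" and B: "\<And>u. norm u = r \<Longrightarrow> norm (f u) \<le> B"
  shows "norm (a n) \<le> B / r ^ n"
proof -
  have hol: "f holomorphic_on ball 0 1"
    by (rule power_series_holomorphic[where a = a]) (use sums in simp)
  have "f has_fps_expansion Abs_fps a"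
  proof (rule has_fps_expansionI)
    have "eventually (\<lambda>u. u \<in> ball 0 1) (nhds (0 :: complex))" by (intro eventually_nhds_in_open) auto
    then show "\<forall>\<^sub>F u in nhds 0. (\<lambda>n. fps_nth (Abs_fps a) n * u ^ n) sums f u"
      by eventually_elim (use sums in auto)
  qed
  then have "a n = (deriv ^^ n) f 0 / fact n"
    using fps_nth_fps_expansion[of f "Abs_fps a" n] by simp
  moreover have "norm ((deriv ^^ n) f 0) \<le> fact n * B / r ^ n"
  proof (rule Cauchy_inequality)
    show "f holomorphic_on ball 0 r" by (rule holomorphic_on_subset[OF hol]) (use r in auto)
    show "continuous_on (cball 0 r) f"
      by (rule continuous_on_subset[OF holomorphic_on_imp_continuous_on[OF hol]]) (use r in auto)
  qed (use r B in \<open>auto simp: norm_minus_commute\<close>)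
  ultimately show ?thesis by (simp add: norm_divide divide_le_eq mult.commute)
qed

definition laplace :: "'a measure \<Rightarrow> ('a \<Rightarrow> real) \<Rightarrow> complex \<Rightarrow> complex" where
  "laplace M \<tau> s = (\<integral>x. exp (- s * of_real (\<tau> x)) \<partial>M)"

text \<open>Abstracts the two sides of the comparison: the density |zeta|^2 on the half line with
  the height as \<tau>, and the weighted pairs with 2 pi times their product as \<tau>. The total
  mass may be infinite; the damped mass is finite.\<close>

locale laplace_measure =
  fixes M :: "'a measure" and \<tau> :: "'a \<Rightarrow> real"
  assumes meas [measurable]: "\<tau> \<in> borel_measurable M"
    and nonneg: "\<And>x. x \<in> space M \<Longrightarrow> 0 \<le> \<tau> x"
    and int: "\<And>\<delta>. \<delta> > 0 \<Longrightarrow> integrable M (\<lambda>x. exp (- \<delta> * \<tau> x))"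
begin

definition cum :: "real \<Rightarrow> real" where
  "cum X = measure M {x \<in> space M. \<tau> x \<le> X}"

definition L :: "real \<Rightarrow> real" where
  "L \<delta> = (\<integral>x. exp (- \<delta> * \<tau> x) \<partial>M)"

text \<open>The Taylor coefficients, in u at 0, of the Laplace transform at s = lam (1 - u). At the
  same time they are averages of the mass with Poisson weights of mean lam * \<tau>, and this double
  role drives the comparison.\<close>

definition coef :: "real \<Rightarrow> nat \<Rightarrow> real" where
  "coef lam j = (\<integral>x. (lam * \<tau> x) ^ j / fact j * exp (- (lam * \<tau> x)) \<partial>M)"

lemma coef_integrable:
  assumes "lam > 0"
  shows "integrable M (\<lambda>x. (lam * \<tau> x) ^ j / fact j * exp (- (lam * \<tau> x)))"
proof (rule Bochner_Integration.integrable_bound)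
  show "integrable M (\<lambda>x. 2 ^ j * exp (- (lam / 2) * \<tau> x))"
    using assms by (intro integrable_mult_right int) auto
  show "AE x in M. norm ((lam * \<tau> x) ^ j / fact j * exp (- (lam * \<tau> x))) \<le> norm (2 ^ j * exp (- (lam / 2) * \<tau> x))"
  proof (rule AE_I2)
    fix x assume x: "x \<in> space M"
    define y where "y = lam * \<tau> x / 2"
    have y: "y \<ge> 0" using nonneg[OF x] assms by (simp add: y_def)
    have "(2 * y) ^ j / fact j * exp (- (2 * y)) = 2 ^ j * (y ^ j / fact j) * exp (- (2 * y))"
      by (simp add: power_mult_distrib)
    also have "\<dots> \<le> 2 ^ j * exp y * exp (- (2 * y))"
      using power_le_fact_exp[OF y, of j] by (intro mult_right_mono mult_left_mono) (auto simp: field_simps)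
    also have "\<dots> = 2 ^ j * exp (- y)" by (simp add: mult.assoc exp_add[symmetric])
    finally have a: "(2 * y) ^ j / fact j * exp (- (2 * y)) \<le> 2 ^ j * exp (- y)" .
    have b: "(2 * y) ^ j / fact j * exp (- (2 * y)) \<ge> 0" using y by simp
    have e1: "lam * \<tau> x = 2 * y" and e2: "- (lam / 2) * \<tau> x = - y" by (auto simp: y_def)
    show "norm ((lam * \<tau> x) ^ j / fact j * exp (- (lam * \<tau> x))) \<le> norm (2 ^ j * exp (- (lam / 2) * \<tau> x))"
      unfolding e1 e2 by (simp only: real_norm_def abs_of_nonneg[OF b]) (rule order_trans[OF a abs_ge_self])
  qed
qed measurable

lemma coef_sum: 
  assumes "lam > 0"
  shows "(\<Sum>j\<le>k. coef lam j) = (\<integral>x. poisson_cdf k (lam * \<tau> x) \<partial>M)"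
    and "integrable M (\<lambda>x. poisson_cdf k (lam * \<tau> x))"
  unfolding coef_def poisson_cdf_def using coef_integrable[OF assms]
  by (auto simp: Bochner_Integration.integral_sum)

text \<open>Expands exp (lam * u * \<tau>) and integrates term by term; the partial sums of the
  norms are dominated by exp (- lam (1 - norm u) \<tau>), which is integrable because norm u <
  1.\<close>

lemma laplace_power_series:
  assumes "lam > 0" "norm u < 1"
  shows "(\<lambda>j. of_real (coef lam j) * u ^ j) sums laplace M \<tau> (of_real lam * (1 - u))"
proof -
  define F :: "nat \<Rightarrow> 'a \<Rightarrow> complex" where "F = (\<lambda>j x. of_real ((lam * \<tau> x) ^ j / fact j * exp (- (lam * \<tau> x))) * u ^ j)"
  have exps: "(\<lambda>j. F j x) sums exp (- (of_real lam * (1 - u)) * of_real (\<tau> x))" for x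
  proof -
    have "(\<lambda>j. (of_real (lam * \<tau> x) * u) ^ j /\<^sub>R fact j * of_real (exp (- (lam * \<tau> x)))) sums (exp (of_real (lam * \<tau> x) * u) * of_real (exp (- (lam * \<tau> x))))"
      by (intro sums_mult2 exp_converges)
    also have "exp (of_real (lam * \<tau> x) * u) * of_real (exp (- (lam * \<tau> x))) = exp (- (of_real lam * (1 - u)) * of_real (\<tau> x))"
      unfolding exp_of_real[symmetric] exp_add[symmetric] by (simp add: algebra_simps)
    also have "(\<lambda>j. (of_real (lam * \<tau> x) * u) ^ j /\<^sub>R fact j * of_real (exp (- (lam * \<tau> x)))) = (\<lambda>j. F j x)"
      by (simp add: F_def fun_eq_iff power_mult_distrib scaleR_conv_of_real divide_inverse)
    finally show ?thesis .
  qed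
  have intF: "integrable M (F j)" for j
    unfolding F_def by (intro integrable_mult_left integrable_of_real coef_integrable assms)
  have nF: "norm (F j x) = (lam * norm u * \<tau> x) ^ j / fact j * exp (- (lam * \<tau> x))" if "x \<in> space M" for j x
    unfolding F_def norm_mult norm_power norm_of_real
    using nonneg[OF that] assms by (simp add: power_mult_distrib)
  have nsum: "(\<lambda>j. norm (F j x)) sums exp (- (lam * (1 - norm u)) * \<tau> x)" if "x \<in> space M" for x
    unfolding nF[OF that] using sums_mult2[OF exp_real_sums[of "lam * norm u * \<tau> x"], of "exp (- (lam * \<tau> x))"]
    by (simp add: exp_add[symmetric] algebra_simps)
  have d: "lam * (1 - norm u) > 0" using assms by simp
  have "(\<lambda>j. integral\<^sup>L M (F j)) sums (\<integral>x. (\<Sum>j. F j x) \<partial>M)"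
  proof (rule sums_integral[OF intF])
    show "AE x in M. summable (\<lambda>j. norm (F j x))"
      using nsum by (intro AE_I2) (auto dest: sums_summable)
    show "summable (\<lambda>j. \<integral>x. norm (F j x) \<partial>M)"
    proof (rule summableI_nonneg_bounded)
      fix n
      have "(\<Sum>j<n. \<integral>x. norm (F j x) \<partial>M) = (\<integral>x. (\<Sum>j<n. norm (F j x)) \<partial>M)"
        using intF by (subst Bochner_Integration.integral_sum) auto
      also have "\<dots> \<le> L (lam * (1 - norm u))"
        unfolding L_def
      proof (rule integral_mono_AE)
        show "AE x in M. (\<Sum>j<n. norm (F j x)) \<le> exp (- (lam * (1 - norm u)) * \<tau> x)"
        proof (rule AE_I2)
          fix x assume x: "x \<in> space M"
          show "(\<Sum>j<n. norm (F j x)) \<le> exp (- (lam * (1 - norm u)) * \<tau> x)"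
            using sum_le_suminf[OF sums_summable[OF nsum[OF x]], of "{..<n}"] by (simp add: sums_unique[OF nsum[OF x], symmetric])
        qed
      qed (use intF int[OF d] in auto)
      finally show "(\<Sum>j<n. \<integral>x. norm (F j x) \<partial>M) \<le> L (lam * (1 - norm u))" .
    qed auto
  qed
  also have "(\<integral>x. (\<Sum>j. F j x) \<partial>M) = laplace M \<tau> (of_real lam * (1 - u))"
    unfolding laplace_def using sums_unique[OF exps] by simp
  also have "(\<lambda>j. integral\<^sup>L M (F j)) = (\<lambda>j. of_real (coef lam j) * u ^ j)"
    by (simp only: F_def coef_def integral_mult_left_zero integral_complex_of_real)
  finally show ?thesis .
qed

lemma cum_set_fmeasurable:
  "{x \<in> space M. \<tau> x \<le> X} \<in> fmeasurable M" "cum X \<le> exp (\<delta> * X) * L \<delta>" if "\<delta> > 0"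
proof -
  let ?A = "{x \<in> space M. \<tau> x \<le> X}"
  have A: "?A \<in> sets M" by measurable
  have le: "indicator ?A x \<le> exp (\<delta> * X) * exp (- \<delta> * \<tau> x)" if "x \<in> space M" for x
    using that \<open>\<delta> > 0\<close> by (auto simp: indicator_def exp_add[symmetric] algebra_simps)
  have I: "integrable M (\<lambda>x. exp (\<delta> * X) * exp (- \<delta> * \<tau> x))" using int[OF that] by (rule integrable_mult_right)
  have i1: "integrable M (indicator ?A :: 'a \<Rightarrow> real)"
    by (rule Bochner_Integration.integrable_bound[OF I]) (use A le in \<open>auto intro!: AE_I2 simp: indicator_def\<close>)
  then show "?A \<in> fmeasurable M"
    using A by (simp add: integrable_indicator_iff fmeasurable_def Int_absorb1 sets.sets_into_space)
  have "cum X = (\<integral>x. indicator ?A x \<partial>M)" unfolding cum_def using A by (simp add: sets.sets_into_space Int_absorb1)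
  also have "\<dots> \<le> (\<integral>x. exp (\<delta> * X) * exp (- \<delta> * \<tau> x) \<partial>M)"
    using i1 I le by (intro integral_mono) auto
  finally show "cum X \<le> exp (\<delta> * X) * L \<delta>" by (simp add: L_def)
qed

lemma indicator_cum: "integrable M (indicator {x \<in> space M. \<tau> x \<le> X} :: 'a \<Rightarrow> real)"
  "(\<integral>x. indicator {x \<in> space M. \<tau> x \<le> X} x \<partial>M) = cum X"
  using cum_set_fmeasurable(1)[of 1 X] by (auto simp: cum_def integrable_indicator_iff fmeasurable_def Int_absorb1 sets.sets_into_space)

lemma cum_nonneg: "cum X \<ge> 0" by (simp add: cum_def)

text \<open>The points with \<tau> \<le> X lie to the left of the cut-off k, so
  \<open>poisson_cdf_lower\<close> gives them almost full weight.\<close>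

lemma coef_sum_lower:
  assumes "0 < \<eta>" "\<eta> \<le> 1/2" "lam > 0" "lam * X \<le> real k * (1 - 2 * \<eta>)"
  shows "(1 - exp (- real k * \<eta>\<^sup>2)) * cum X \<le> (\<Sum>j\<le>k. coef lam j)"
proof -
  have "(1 - exp (- real k * \<eta>\<^sup>2)) * cum X = (\<integral>x. (1 - exp (- real k * \<eta>\<^sup>2)) * indicator {x \<in> space M. \<tau> x \<le> X} x \<partial>M)"
    by (simp add: cum_def Int_absorb1)
  also have "\<dots> \<le> (\<integral>x. poisson_cdf k (lam * \<tau> x) \<partial>M)"
  proof (rule integral_mono)
    fix x assume x: "x \<in> space M"
    show "(1 - exp (- real k * \<eta>\<^sup>2)) * indicator {x \<in> space M. \<tau> x \<le> X} x \<le> poisson_cdf k (lam * \<tau> x)"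
    proof (cases "\<tau> x \<le> X")
      case True
      have "lam * \<tau> x \<le> real k * (1 - 2 * \<eta>)" using mult_left_mono[OF True, of lam] assms by linarith
      from poisson_cdf_lower[OF assms(1,2) _ this] show ?thesis using True x nonneg[OF x] assms by simp
    next
      case False
      then show ?thesis using poisson_cdf_nonneg[of "lam * \<tau> x" k] nonneg[OF x] assms by simp
    qed
  qed (use coef_sum(2)[OF assms(3)] indicator_cum(1) in auto)
  finally show ?thesis using coef_sum(1)[OF assms(3)] by simp
qed

text \<open>Points with \<tau> \<le> X count at most once. Those beyond lie to the right of the
  cut-off, and the damping in \<open>poisson_cdf_upper\<close> turns their total into a Laplace
  transform.\<close>

lemma coef_sum_upper:
  assumes "0 < \<eta>" "\<eta> \<le> 1/2" "lam > 0" "real k * (1 + 4 * \<eta>) \<le> lam * X"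
  shows "(\<Sum>j\<le>k. coef lam j) \<le> cum X + exp (- real k * \<eta>\<^sup>2 / 2) * L (\<eta>\<^sup>2 / 2 * lam)"
proof -
  have d: "\<eta>\<^sup>2 / 2 * lam > 0" using assms by simp
  have "(\<Sum>j\<le>k. coef lam j) = (\<integral>x. poisson_cdf k (lam * \<tau> x) \<partial>M)" by (rule coef_sum(1)[OF assms(3)])
  also have "\<dots> \<le> (\<integral>x. indicator {x \<in> space M. \<tau> x \<le> X} x + exp (- real k * \<eta>\<^sup>2 / 2) * exp (- (\<eta>\<^sup>2 / 2 * lam) * \<tau> x) \<partial>M)"
  proof (rule integral_mono)
    fix x assume x: "x \<in> space M"
    show "poisson_cdf k (lam * \<tau> x) \<le> indicator {x \<in> space M. \<tau> x \<le> X} x + exp (- real k * \<eta>\<^sup>2 / 2) * exp (- (\<eta>\<^sup>2 / 2 * lam) * \<tau> x)"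
    proof (cases "\<tau> x \<le> X")
      case True
      then show ?thesis using poisson_cdf_le_1[of "lam * \<tau> x" k] nonneg[OF x] assms x
        by (simp add: add_increasing2)
    next
      case False
      have "real k * (1 + 4 * \<eta>) \<le> lam * \<tau> x"
        using mult_left_mono[of X "\<tau> x" lam] False assms by linarith
      from poisson_cdf_upper[OF assms(1,2) this] show ?thesis using False by (simp add: mult.assoc)
    qed
  qed (use coef_sum(2)[OF assms(3)] indicator_cum(1) int[OF d] in auto)
  also have "\<dots> = cum X + exp (- real k * \<eta>\<^sup>2 / 2) * L (\<eta>\<^sup>2 / 2 * lam)"
    using indicator_cum int[OF d] by (simp add: L_def)
  finally show ?thesis .
qed

end

text \<open>Stated in one direction so that it can be applied twice with the measures exchanged.
  Cauchy's inequality on a circle inside the unit disc bounds the difference of each pair of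
  coefficients by the difference of the transforms; the sum of the first coefficients is compared
  with the cumulative mass by the two Chernoff bounds, at the price of stretching the argument by
  12\<eta>.\<close>

lemma tauberian_comparison:
  fixes M :: "'a measure" and N :: "'b measure"
  assumes M: "laplace_measure M \<tau>" and N: "laplace_measure N \<rho>" and C: "C \<ge> 0"
    and LM: "\<And>\<delta>. 0 < \<delta> \<Longrightarrow> \<delta> \<le> 1 \<Longrightarrow> laplace_measure.L M \<tau> \<delta> \<le> C * \<delta> powr (- (3/2))"
    and LN: "\<And>\<delta>. 0 < \<delta> \<Longrightarrow> \<delta> \<le> 1 \<Longrightarrow> laplace_measure.L N \<rho> \<delta> \<le> C * \<delta> powr (- (3/2))"
    and close: "\<And>s. Re s > 0 \<Longrightarrow> norm s \<le> 1 \<Longrightarrow> (norm s)\<^sup>2 \<le> Re s / 6 \<Longrightarrow>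
      norm (laplace M \<tau> s - laplace N \<rho> s) \<le> C * (1 + (norm s)\<^sup>2 * Re s powr (- (5/2)) + norm s * Re s powr (- (3/2)))"
  shows "eventually (\<lambda>X. laplace_measure.cum M \<tau> X \<le>
    laplace_measure.cum N \<rho> (X * (1 + 12 * X powr (- (1/25)))) + 5000 * C * X powr (9/10)) at_top"
proof -
  interpret M: laplace_measure M \<tau> by fact
  interpret N: laplace_measure N \<rho> by fact
  have "eventually (\<lambda>X::real. X \<ge> 1) at_top" by (rule eventually_ge_at_top)
  moreover have "eventually (\<lambda>X::real. X powr (- (1/25)) \<le> 1/4) at_top" by real_asymp
  moreover have "eventually (\<lambda>X::real. 4 * (2 * X powr (1/10))\<^sup>2 / X\<^sup>2 \<le> 1 / (24 * X)) at_top" by real_asymp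
  moreover have "eventually (\<lambda>X::real. 2 * (2 * X powr (1/10)) / X \<le> 1) at_top" by real_asymp
  moreover have "eventually (\<lambda>X::real. X powr (3/2) * exp (- (X powr (1/50)) / 2) \<le> X powr (9/10)) at_top" by real_asymp
  ultimately show ?thesis
  proof eventually_elim
    case (elim X)
    \<comment> \<open>\<eta> is the relative blur and k the cut-off index of the coefficients. They
      are balanced so that k \<eta>^2 \<ge> X powr (1/50) makes the Chernoff terms smaller than any
      power of X, while the total k^3 sqrt X of the Cauchy bounds stays below X powr (9/10).\<close>
    define \<eta> where "\<eta> = X powr (- (1/25))"
    define k where "k = nat \<lceil>X powr (1/10)\<rceil>"
    \<comment> \<open>Places lam * X exactly at the threshold of
      \<open>poisson_cdf_lower\<close>.\<close>
    define lam where "lam = real k * (1 - 2 * \<eta>) / X"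
    define Y where "Y = X * (1 + 12 * \<eta>)"
    have X: "X \<ge> 1" "X > 0" using elim by auto
    have \<eta>: "0 < \<eta>" "\<eta> \<le> 1/4" using elim by (auto simp: \<eta>_def)
    have X1: "X powr (1/10) \<ge> 1" using X by (intro ge_one_powr_ge_zero) auto
    then have kX: "X powr (1/10) \<le> real k" "real k \<le> 2 * X powr (1/10)" by (auto simp: k_def) linarith+
    then have k1: "real k \<ge> 1" using X1 by linarith
    have lam: "lam > 0" unfolding lam_def using k1 \<eta> X by auto
    have lam_le: "lam \<le> real k / X"
      unfolding lam_def using \<eta> X k1 by (intro divide_right_mono) (auto simp: mult_le_cancel_left1)
    have lam_ge: "real k / (2 * X) \<le> lam"
    proof -
      have "real k / (2 * X) = real k * (1/2) / X" by simp
      also have "\<dots> \<le> lam" unfolding lam_def using \<eta> X by (intro divide_right_mono mult_left_mono) auto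
      finally show ?thesis .
    qed
    \<comment> \<open>By Bernoulli r ^ j \<ge> 1/2 for j \<le> k, so dividing by r ^ j costs a
      factor 2 only; and 1 - r is still of order 1/k, which keeps Re s \<ge> 1 / (4 X) on the
      circle.\<close>
    define r where "r = 1 - 1 / (2 * real k)"
    have r: "0 < r" "r < 1" using k1 by (auto simp: r_def field_simps)
    \<comment> \<open>145 = 1 + 128 + 16, the three terms of the closeness bound for norm s \<le> 2
      k / X and Re s \<ge> 1 / (4 X).\<close>
    define B where "B = 145 * C * (real k)\<^sup>2 * sqrt X"
    have k2: "real k \<le> (real k)\<^sup>2" "1 \<le> (real k)\<^sup>2" using self_le_power[of "real k" 2] one_le_power[of "real k" 2] k1 by auto
    have sq1: "sqrt X \<ge> 1" using X by simp
    have four: "(1 / (4 * X)) powr (- (3/2)) = 8 * (X * sqrt X)" "(1 / (4 * X)) powr (- (5/2)) = 32 * (X\<^sup>2 * sqrt X)"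
    proof -
      have s2: "(4::real) powr (1/2) = 2" using powr_half_sqrt[of 4] by simp
      have a: "(1 / (4 * X)) powr (- p) = 4 powr p * X powr p" for p
        using X by (simp add: powr_minus_divide powr_divide powr_mult)
      have "(4::real) powr (3/2) = 4 powr (1 + 1/2)" by simp
      also have "\<dots> = 8" unfolding powr_add s2 by simp
      finally have b: "(4::real) powr (3/2) = 8" .
      have "(4::real) powr (5/2) = 4 powr (2 + 1/2)" by simp
      also have "\<dots> = 32" unfolding powr_add s2 by simp
      finally have c: "(4::real) powr (5/2) = 32" .
      have "X powr (3/2) = X powr (1 + 1/2)" by simp
      also have "\<dots> = X * sqrt X" unfolding powr_add using X by (simp add: powr_half_sqrt)
      finally have d: "X powr (3/2) = X * sqrt X" .
      have "X powr (5/2) = X powr (2 + 1/2)" by simp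
      also have "\<dots> = X\<^sup>2 * sqrt X" unfolding powr_add using X by (simp add: powr_half_sqrt)
      finally have e: "X powr (5/2) = X\<^sup>2 * sqrt X" .
      show "(1 / (4 * X)) powr (- (3/2)) = 8 * (X * sqrt X)" unfolding a b d ..
      show "(1 / (4 * X)) powr (- (5/2)) = 32 * (X\<^sup>2 * sqrt X)" unfolding a c e ..
    qed
    have coef: "\<bar>M.coef lam j - N.coef lam j\<bar> \<le> B / r ^ j" for j
    proof -
      have "norm (complex_of_real (M.coef lam j - N.coef lam j)) \<le> B / r ^ j"
      proof (rule power_series_coeff_bound[OF _ r])
        fix u :: complex assume "norm u < 1"
        from sums_diff[OF M.laplace_power_series[OF lam this] N.laplace_power_series[OF lam this]]
        show "(\<lambda>j. complex_of_real (M.coef lam j - N.coef lam j) * u ^ j) sums (laplace M \<tau> (of_real lam * (1 - u)) - laplace N \<rho> (of_real lam * (1 - u)))"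
          by (simp add: left_diff_distrib)
      next
        fix u :: complex assume u: "norm u = r"
        define s where "s = of_real lam * (1 - u)"
        have Re1: "Re u \<le> r" using complex_Re_le_cmod[of u] u by simp
        have "1 / (4 * X) = (real k / (2 * X)) * (1 / (2 * real k))" using k1 X by (simp add: field_simps)
        also have "\<dots> \<le> lam * (1 / (2 * real k))" using lam_ge k1 by (intro mult_right_mono) auto
        also have "\<dots> = lam * (1 - r)" by (simp add: r_def)
        also have "\<dots> \<le> lam * (1 - Re u)" using Re1 lam by (intro mult_left_mono) auto
        finally have Res: "1 / (4 * X) \<le> Re s" by (simp add: s_def)
        have Res0: "Re s > 0" using Res X by (smt (verit) divide_pos_pos)
        have "norm s = lam * norm (1 - u)" using lam by (simp add: s_def norm_mult)
        also have "\<dots> \<le> lam * 2" using lam norm_triangle_ineq4[of 1 u] u r by (intro mult_left_mono) auto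
        also have "\<dots> \<le> 2 * (real k / X)" using lam_le by simp
        finally have ns: "norm s \<le> 2 * (real k / X)" .
        have ns2: "(norm s)\<^sup>2 \<le> 4 * (real k)\<^sup>2 / X\<^sup>2"
          using power_mono[OF ns, of 2] by (simp add: power_mult_distrib power_divide)
        have n1: "norm s \<le> 1"
        proof -
          have "2 * (real k / X) \<le> 2 * (2 * X powr (1/10)) / X" using kX X by (simp add: divide_right_mono)
          then show ?thesis using ns elim(4) by linarith
        qed
        \<comment> \<open>There is room: the square has order at most X powr (-9/5), while Re s is
          at least of order 1/X.\<close>
        have n2: "(norm s)\<^sup>2 \<le> Re s / 6"
        proof -
          have "4 * (real k)\<^sup>2 / X\<^sup>2 \<le> 4 * (2 * X powr (1/10))\<^sup>2 / X\<^sup>2"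
            using kX by (intro divide_right_mono mult_left_mono power_mono) auto
          also have "\<dots> \<le> 1 / (24 * X)" using elim(3) .
          also have "\<dots> = 1 / (4 * X) / 6" by simp
          also have "\<dots> \<le> Re s / 6" using Res by (intro divide_right_mono) auto
          finally show ?thesis using ns2 by linarith
        qed
        have p5: "Re s powr (- (5/2)) \<le> 32 * (X\<^sup>2 * sqrt X)"
          using powr_mono2'[of "- (5/2)", OF _ _ Res] X by (simp add: four)
        have p3: "Re s powr (- (3/2)) \<le> 8 * (X * sqrt X)"
          using powr_mono2'[of "- (3/2)", OF _ _ Res] X by (simp add: four)
        have t2: "(norm s)\<^sup>2 * Re s powr (- (5/2)) \<le> (4 * (real k)\<^sup>2 / X\<^sup>2) * (32 * (X\<^sup>2 * sqrt X))"
          using ns2 p5 by (intro mult_mono) auto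
        have t1: "norm s * Re s powr (- (3/2)) \<le> (2 * (real k / X)) * (8 * (X * sqrt X))"
          using ns p3 X by (intro mult_mono) auto
        have "norm (laplace M \<tau> s - laplace N \<rho> s) \<le> C * (1 + (norm s)\<^sup>2 * Re s powr (- (5/2)) + norm s * Re s powr (- (3/2)))"
          by (rule close[OF Res0 n1 n2])
        also have "\<dots> \<le> C * (1 + (4 * (real k)\<^sup>2 / X\<^sup>2) * (32 * (X\<^sup>2 * sqrt X)) + (2 * (real k / X)) * (8 * (X * sqrt X)))"
          using C t1 t2 by (intro mult_left_mono add_mono) auto
        also have "\<dots> = C * (1 + 128 * ((real k)\<^sup>2 * sqrt X) + 16 * (real k * sqrt X))"
          using X by (simp add: power2_eq_square)
        also have "\<dots> \<le> C * (1 * ((real k)\<^sup>2 * sqrt X) + 128 * ((real k)\<^sup>2 * sqrt X) + 16 * ((real k)\<^sup>2 * sqrt X))"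
        proof (rule mult_left_mono[OF _ C])
          have "1 \<le> (real k)\<^sup>2 * sqrt X" using mult_mono[OF k2(2) sq1] by simp
          moreover have "real k * sqrt X \<le> (real k)\<^sup>2 * sqrt X" using k2 X by (intro mult_right_mono) auto
          ultimately show "1 + 128 * ((real k)\<^sup>2 * sqrt X) + 16 * (real k * sqrt X) \<le> 1 * ((real k)\<^sup>2 * sqrt X) + 128 * ((real k)\<^sup>2 * sqrt X) + 16 * ((real k)\<^sup>2 * sqrt X)"
            by linarith
        qed
        also have "\<dots> = B" by (simp add: B_def)
        finally show "norm (laplace M \<tau> (of_real lam * (1 - u)) - laplace N \<rho> (of_real lam * (1 - u))) \<le> B"
          by (simp add: s_def)
      qed
      then show ?thesis by (simp only: norm_of_real)
    qed
    have B0: "B \<ge> 0" using C X by (simp add: B_def)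
    have rk: "B / r ^ j \<le> 2 * B" if "j \<le> k" for j
    proof -
      have "1/2 \<le> 1 + real k * (- 1 / (2 * real k))" using k1 by simp
      also have "\<dots> \<le> (1 + (- 1 / (2 * real k))) ^ k" by (rule Bernoulli_inequality) (use k1 in \<open>simp add: field_simps\<close>)
      also have "\<dots> = r ^ k" by (simp add: r_def)
      also have "\<dots> \<le> r ^ j" using r that by (intro power_decreasing) auto
      finally have "1/2 \<le> r ^ j" .
      then have "B / r ^ j \<le> B / (1/2)" using B0 r by (intro divide_left_mono) auto
      then show ?thesis by simp
    qed
    have "(\<Sum>j\<le>k. M.coef lam j) - (\<Sum>j\<le>k. N.coef lam j) = (\<Sum>j\<le>k. M.coef lam j - N.coef lam j)"
      by (simp add: sum_subtractf)
    also have "\<dots> \<le> (\<Sum>j\<le>k. 2 * B)"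
    proof (rule sum_mono)
      fix j assume "j \<in> {..k}"
      then show "M.coef lam j - N.coef lam j \<le> 2 * B" using coef[of j] rk[of j] by simp
    qed
    also have "\<dots> \<le> 4 * real k * B" using k1 B0 mult_right_mono[OF k1, of B] by (simp add: algebra_simps)
    also have "\<dots> = 580 * C * (real k) ^ 3 * sqrt X" by (simp add: B_def power2_eq_square power3_eq_cube)
    also have "\<dots> \<le> 580 * C * (2 * X powr (1/10)) ^ 3 * sqrt X"
      using C kX X by (intro mult_right_mono mult_left_mono power_mono) auto
    also have "\<dots> = 4640 * C * X powr (8/10)"
    proof -
      have "(X powr (1/10)) ^ 3 = X powr (3/10)" using X by (simp add: powr_realpow[symmetric] powr_powr)
      moreover have "X powr (3/10) * sqrt X = X powr (8/10)" using X by (simp add: powr_half_sqrt[symmetric] powr_add[symmetric])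
      ultimately show ?thesis by (simp add: power_mult_distrib mult.assoc)
    qed
    also have "\<dots> \<le> 4640 * C * X powr (9/10)"
      using C X by (intro mult_left_mono powr_mono) auto
    finally have main: "(\<Sum>j\<le>k. M.coef lam j) \<le> (\<Sum>j\<le>k. N.coef lam j) + 4640 * C * X powr (9/10)" by simp
    have low: "(1 - exp (- real k * \<eta>\<^sup>2)) * M.cum X \<le> (\<Sum>j\<le>k. M.coef lam j)"
      using \<eta> lam X by (intro M.coef_sum_lower) (auto simp: lam_def)
    have up: "(\<Sum>j\<le>k. N.coef lam j) \<le> N.cum Y + exp (- real k * \<eta>\<^sup>2 / 2) * N.L (\<eta>\<^sup>2 / 2 * lam)"
    proof (rule N.coef_sum_upper)
      \<comment> \<open>This amounts to 24\<eta>^2 \<le> 6\<eta>, that is \<eta> \<le> 1/4; the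
        number 12 is chosen to absorb both Chernoff thresholds.\<close>
      have "(1 + 4 * \<eta>) \<le> (1 - 2 * \<eta>) * (1 + 12 * \<eta>)"
        using \<eta> mult_left_mono[OF \<eta>(2), of "24 * \<eta>"] by (simp add: algebra_simps)
      then have "real k * (1 + 4 * \<eta>) \<le> real k * ((1 - 2 * \<eta>) * (1 + 12 * \<eta>))" by (intro mult_left_mono) auto
      then show "real k * (1 + 4 * \<eta>) \<le> lam * Y" using X by (simp add: lam_def Y_def)
    qed (use \<eta> lam in auto)
    have k\<eta>: "X powr (1/50) \<le> real k * \<eta>\<^sup>2"
    proof -
      have "\<eta>\<^sup>2 = X powr (- (2/25))" using X by (simp add: \<eta>_def powr_realpow[symmetric] powr_powr)
      moreover have "X powr (1/50) = X powr (1/10) * X powr (- (2/25))" by (simp add: powr_add[symmetric])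
      ultimately show ?thesis using kX by (simp add: mult_right_mono)
    qed
    have e1: "exp (- real k * \<eta>\<^sup>2 / 2) \<le> exp (- (X powr (1/50)) / 2)" using k\<eta> by simp
    have e2: "exp (- real k * \<eta>\<^sup>2) \<le> exp (- (X powr (1/50)) / 2)"
    proof -
      have "X powr (1/50) \<ge> 0" by simp
      then show ?thesis using k\<eta> by (simp del: powr_ge_zero)
    qed
    have LNb: "N.L (\<eta>\<^sup>2 / 2 * lam) \<le> 8 * C * X powr (3/2)"
    proof -
      have x50: "1 \<le> X powr (1/50)" using X by (intro ge_one_powr_ge_zero) auto
      have ge: "1 / (4 * X) \<le> \<eta>\<^sup>2 / 2 * lam"
      proof -
        have "1 / (4 * X) \<le> real k * \<eta>\<^sup>2 / (4 * X)" using k\<eta> x50 X by (intro divide_right_mono) auto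
        also have "\<dots> = \<eta>\<^sup>2 / 2 * (real k / (2 * X))" by simp
        also have "\<dots> \<le> \<eta>\<^sup>2 / 2 * lam" using lam_ge by (intro mult_left_mono) auto
        finally show ?thesis .
      qed
      have "\<eta>\<^sup>2 \<le> (1/4)\<^sup>2" using \<eta> by (intro power_mono) auto
      moreover have "lam \<le> 1"
      proof -
        have "real k / X \<le> 2 * X powr (1/10) / X" using kX X by (intro divide_right_mono) auto
        then have "2 * (real k / X) \<le> 1" using elim(4) by simp
        then show ?thesis using lam_le by linarith
      qed
      ultimately have "\<eta>\<^sup>2 / 2 * lam \<le> 1 * 1" using lam by (intro mult_mono) (auto simp: power2_eq_square)
      then have "N.L (\<eta>\<^sup>2 / 2 * lam) \<le> C * (\<eta>\<^sup>2 / 2 * lam) powr (- (3/2))"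
        using \<eta> lam by (intro LN) auto
      also have "\<dots> \<le> C * (1 / (4 * X)) powr (- (3/2))"
        using C X ge by (intro mult_left_mono powr_mono2') auto
      also have "\<dots> = 8 * C * X powr (3/2)"
      proof -
        have "X powr (3/2) = X powr (1 + 1/2)" by simp
        also have "\<dots> = X * sqrt X" unfolding powr_add using X by (simp add: powr_half_sqrt)
        finally show ?thesis unfolding four by simp
      qed
      finally show ?thesis .
    qed
    \<comment> \<open>A crude bound is enough, since it is only multiplied by the exponentially
      small defect of the lower Chernoff estimate.\<close>
    have cumb: "M.cum X \<le> 3 * C * X powr (3/2)"
    proof -
      have "M.cum X \<le> exp ((1 / X) * X) * M.L (1 / X)" using X by (intro M.cum_set_fmeasurable) auto
      also have "\<dots> \<le> 3 * (C * (1 / X) powr (- (3/2)))"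
      proof (intro mult_mono LM)
        show "exp ((1 / X) * X) \<le> 3" using X exp_le by simp
      qed (use X C in \<open>auto simp: M.L_def intro!: integral_nonneg_AE\<close>)
      also have "(1 / X) powr (- (3/2)) = X powr (3/2)" using X by (simp add: powr_minus_divide powr_divide)
      finally show ?thesis by simp
    qed
    have "M.cum X = (1 - exp (- real k * \<eta>\<^sup>2)) * M.cum X + exp (- real k * \<eta>\<^sup>2) * M.cum X" by (simp add: algebra_simps)
    also have "\<dots> \<le> (N.cum Y + exp (- real k * \<eta>\<^sup>2 / 2) * N.L (\<eta>\<^sup>2 / 2 * lam) + 4640 * C * X powr (9/10)) + exp (- real k * \<eta>\<^sup>2) * M.cum X"
      using low main up by linarith
    also have "\<dots> \<le> (N.cum Y + exp (- (X powr (1/50)) / 2) * (8 * C * X powr (3/2)) + 4640 * C * X powr (9/10)) + exp (- (X powr (1/50)) / 2) * (3 * C * X powr (3/2))"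
      using LNb cumb e1 e2 M.cum_nonneg C
      by (intro add_mono mult_mono order_refl) (auto simp: N.L_def M.cum_def intro!: integral_nonneg_AE)
    also have "\<dots> = N.cum Y + 4640 * C * X powr (9/10) + 11 * C * (X powr (3/2) * exp (- (X powr (1/50)) / 2))" by simp
    also have "\<dots> \<le> N.cum Y + 4640 * C * X powr (9/10) + 11 * C * X powr (9/10)"
      using elim(5) C by (intro add_mono mult_left_mono order_refl) auto
    also have "\<dots> \<le> N.cum Y + 5000 * C * X powr (9/10)" using C by simp
    finally show ?case by (simp add: Y_def \<eta>_def)
  qed
qed

section \<open>The mean square in the critical strip\<close>

lemma mult_exp_neg_le_powr:
  fixes y :: real
  assumes "y > 0"
  shows "y * exp (-y) \<le> 6 * y powr (- (3/2))"
proof -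
  have "y powr (5/2) \<le> 6 * exp y"
  proof (cases "y \<le> 1")
    case True
    then have "y powr (5/2) \<le> 1" using assms powr_mono2[of "5/2" y 1] by simp
    moreover have "1 \<le> exp y" using assms by simp
    ultimately show ?thesis by linarith
  next
    case False
    then have "y powr (5/2) \<le> y powr 3" using assms by (intro powr_mono) auto
    also have "\<dots> = y ^ 3" using assms by (simp add: powr_numeral)
    also have "\<dots> \<le> fact 3 * exp y" using assms by (intro power_le_fact_exp) auto
    finally show ?thesis by (simp add: fact_numeral)
  qed
  then have "y powr (5/2) * exp (-y) \<le> 6" by (simp add: exp_minus field_simps)
  also have "y powr (5/2) = y * y powr (3/2)"
    using powr_add[of y 1 "3/2"] assms by simp
  finally show ?thesis using assms by (simp add: powr_minus field_simps)
qed

lemma norm_integral_le: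
  fixes f :: "'a \<Rightarrow> 'b :: {banach, second_countable_topology}"
  assumes "integrable M f" "integrable M g" "\<And>x. norm (f x) \<le> g x"
  shows "norm (\<integral>x. f x \<partial>M) \<le> (\<integral>x. g x \<partial>M)"
  by (rule order_trans[OF integral_norm_bound integral_mono]) (use assms in auto)

lemma norm_exp_minus_1_le: "norm (exp (z :: complex) - 1) \<le> exp (norm z) * norm z"
  using Taylor_exp_field[of z 0] by simp

text \<open>Expanding zrot s = 2 pi i exp (- i s) gives 2 pi i + 2 pi s plus a quadratic remainder.
  Since \<open>pair_product p\<close> is an integer n, the constant term disappears in the
  exponential and the real frequency 2 pi n is left. The condition (norm s)^2 \<le> Re s / 6 ensures
  that the remainder uses up at most half of the decay exp (- 2 pi n Re s).\<close>

lemma zrot_exp_close: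
  assumes "Re s > 0" "norm s \<le> 1" "(norm s)\<^sup>2 \<le> Re s / 6"
  shows "norm (exp (- of_real (pair_product p) * zrot s) - exp (- s * of_real (2 * pi * pair_product p))) \<le>
    36 * (norm s)\<^sup>2 * Re s powr (- (5/2)) * pair_product p powr (- (3/2))"
proof -
  define n where "n = pair_product p"
  define R where "R = exp (- \<i> * s) - (1 - \<i> * s)"
  define X where "X = - 2 * of_real pi * \<i> * of_real n * R"
  define y where "y = pi * n * Re s"
  obtain m :: nat where m: "n = real m" unfolding n_def pair_product_def of_nat_mult[symmetric] by blast
  have n: "n > 0" using pair_product_pos[of p] by (simp add: n_def)
  have y: "y > 0" using n assms by (simp add: y_def)
  have "norm R \<le> exp (norm s) * (norm s)\<^sup>2"
    using Taylor_exp_field[of "- \<i> * s" 1] by (simp add: R_def norm_mult power2_eq_square)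
  also have "\<dots> \<le> 3 * (norm s)\<^sup>2"
  proof -
    have "exp (norm s) \<le> exp 1" using assms by simp
    then show ?thesis using exp_le by (intro mult_right_mono) (linarith, simp)
  qed
  finally have R: "norm R \<le> 3 * (norm s)\<^sup>2" .
  have nX: "norm X = 2 * pi * n * norm R" using n by (simp add: X_def norm_mult)
  also have "\<dots> \<le> 2 * pi * n * (3 * (norm s)\<^sup>2)" using R n by (intro mult_left_mono) auto
  finally have X1: "norm X \<le> 6 * pi * n * (norm s)\<^sup>2" by simp
  also have "\<dots> \<le> 6 * pi * n * (Re s / 6)" using assms n by (intro mult_left_mono) auto
  finally have X2: "norm X \<le> y" by (simp add: y_def)
  have one: "exp (- 2 * of_real pi * \<i> * of_real n) = 1"
    unfolding m using exp_integer_2pi[of "- of_nat m"] by (simp add: mult_ac)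
  have "- of_real n * zrot s = - 2 * of_real pi * \<i> * of_real n + - s * of_real (2 * pi * n) + X"
    by (simp add: zrot_def X_def R_def algebra_simps)
  then have "exp (- of_real n * zrot s) = exp (- s * of_real (2 * pi * n)) * exp X"
    using one by (simp only: exp_add mult_1_left)
  then have "exp (- of_real n * zrot s) - exp (- s * of_real (2 * pi * n)) = exp (- s * of_real (2 * pi * n)) * (exp X - 1)"
    by (simp add: algebra_simps)
  also have "norm \<dots> = exp (- 2 * y) * norm (exp X - 1)"
    by (simp add: norm_mult y_def mult_ac)
  also have "\<dots> \<le> exp (- 2 * y) * (exp y * (6 * pi * n * (norm s)\<^sup>2))"
    using X1 X2 by (intro mult_left_mono order_trans[OF norm_exp_minus_1_le] mult_mono) auto
  also have "\<dots> = exp (- y) * (6 * pi * n * (norm s)\<^sup>2)"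
    by (simp add: exp_add[symmetric] mult.assoc[symmetric])
  also have "\<dots> = 6 * (norm s)\<^sup>2 / Re s * (y * exp (- y))"
    using assms by (simp add: y_def)
  also have "\<dots> \<le> 6 * (norm s)\<^sup>2 / Re s * (6 * y powr (- (3/2)))"
    using y assms by (intro mult_left_mono mult_exp_neg_le_powr) auto
  also have "y powr (- (3/2)) \<le> (n * Re s) powr (- (3/2))"
  proof (rule powr_mono2')
    have "1 * (n * Re s) \<le> pi * (n * Re s)" using n assms pi_gt3 by (intro mult_right_mono) auto
    then show "n * Re s \<le> y" by (simp add: y_def mult.assoc)
  qed (use n assms in auto)
  then have "6 * (norm s)\<^sup>2 / Re s * (6 * y powr (- (3/2))) \<le> 6 * (norm s)\<^sup>2 / Re s * (6 * (n * Re s) powr (- (3/2)))"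
    using assms by (intro mult_left_mono) auto
  also have "\<dots> = 36 * (norm s)\<^sup>2 * (Re s powr (- (3/2)) / Re s) * n powr (- (3/2))"
    using n assms by (simp add: powr_mult)
  also have "Re s powr (- (3/2)) / Re s = Re s powr (- (5/2))"
    using powr_diff[of "Re s" "- (3/2)" 1] assms by simp
  finally show ?thesis by (simp add: n_def)
qed

section \<open>The two measures under comparison\<close>

definition zeta_measure :: "real \<Rightarrow> real measure" where
  "zeta_measure \<sigma> = density lborel (\<lambda>t. ennreal (indicator {0..} t * (norm (zeta (Complex \<sigma> t)))\<^sup>2))"

definition pair_measure :: "real \<Rightarrow> (nat \<times> nat) measure" where
  "pair_measure \<sigma> = density pairs (\<lambda>p. ennreal (2 * pi * pair_weight \<sigma> p))"

definition pair_freq :: "nat \<times> nat \<Rightarrow> real" where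
  "pair_freq p = 2 * pi * pair_product p"

context
  fixes \<sigma> :: real
  assumes \<sigma>: "1/2 \<le> \<sigma>" "\<sigma> < 1"
begin

lemma zeta_measurable [measurable]: "(\<lambda>t. zeta (Complex \<sigma> t)) \<in> borel_measurable borel"
  using zeta_vertical_continuous[of \<sigma> UNIV] \<sigma> by (intro borel_measurable_continuous_onI) auto

lemma integrable_zeta_measure:
  fixes f :: "real \<Rightarrow> 'b :: {banach, second_countable_topology}"
  assumes "f \<in> borel_measurable borel"
  shows "integrable (zeta_measure \<sigma>) f \<longleftrightarrow> set_integrable lborel {0..} (\<lambda>t. (norm (zeta (Complex \<sigma> t)))\<^sup>2 *\<^sub>R f t)"
    and "integral\<^sup>L (zeta_measure \<sigma>) f = (LINT t:{0..}|lborel. (norm (zeta (Complex \<sigma> t)))\<^sup>2 *\<^sub>R f t)"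
  unfolding zeta_measure_def set_integrable_def set_lebesgue_integral_def using assms
  by (subst integrable_density integral_density; simp)+

lemma integrable_pair_measure:
  fixes f :: "nat \<times> nat \<Rightarrow> 'b :: {banach, second_countable_topology}"
  shows "integrable (pair_measure \<sigma>) f \<longleftrightarrow> integrable pairs (\<lambda>p. (2 * pi * pair_weight \<sigma> p) *\<^sub>R f p)"
    and "integral\<^sup>L (pair_measure \<sigma>) f = (\<integral>p. (2 * pi * pair_weight \<sigma> p) *\<^sub>R f p \<partial>pairs)"
  unfolding pair_measure_def using pair_weight_pos[of \<sigma>]
  by (subst integrable_density integral_density; force intro!: AE_I2 simp: less_imp_le)+

lemma laplace_measure_pair: "laplace_measure (pair_measure \<sigma>) pair_freq"
proof
  show "pair_freq \<in> borel_measurable (pair_measure \<sigma>)" by (simp add: pair_measure_def)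
  show "0 \<le> pair_freq p" for p using pair_product_pos[of p] by (simp add: pair_freq_def)
  fix \<delta> :: real assume d: "\<delta> > 0"
  have "integrable pairs (\<lambda>p. norm (of_real (pair_weight \<sigma> p) * exp (- of_real (pair_product p) * of_real (2 * pi * \<delta>)) :: complex))"
    using \<sigma> d by (intro integrable_norm pair_exp_integrable) auto
  then have "integrable pairs (\<lambda>p. 2 * pi * (pair_weight \<sigma> p * exp (- (pair_product p * (2 * pi * \<delta>)))))"
    using pair_weight_pos[of \<sigma>] by (intro integrable_mult_right) (simp add: norm_mult less_imp_le)
  then show "integrable (pair_measure \<sigma>) (\<lambda>p. exp (- \<delta> * pair_freq p))"
    by (simp add: integrable_pair_measure pair_freq_def mult_ac)
qed

lemma laplace_pair:
  fixes s :: complex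
  shows "laplace (pair_measure \<sigma>) pair_freq s = 2 * pi * (\<integral>p. of_real (pair_weight \<sigma> p) * exp (- s * of_real (2 * pi * pair_product p)) \<partial>pairs)"
proof -
  have "laplace (pair_measure \<sigma>) pair_freq s = (\<integral>p. 2 * pi * (of_real (pair_weight \<sigma> p) * exp (- s * of_real (2 * pi * pair_product p))) \<partial>pairs)"
    unfolding laplace_def integrable_pair_measure(2) pair_freq_def scaleR_conv_of_real by (simp add: mult.assoc)
  then show ?thesis by simp
qed

text \<open>The locale asks for a nonnegative \<tau> on the whole space, here the real line;
  \<open>abs\<close> agrees with the identity where the density lives. The formula for the transform
  requires norm s \<le> 1, so integrability for large \<delta> is inherited from min \<delta>
  1.\<close>

lemma laplace_measure_zeta: "laplace_measure (zeta_measure \<sigma>) abs"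
proof
  show "abs \<in> borel_measurable (zeta_measure \<sigma>)" by (simp add: zeta_measure_def)
  fix \<delta> :: real assume d: "\<delta> > 0"
  obtain C0 where C: "\<And>s. Re s > 0 \<Longrightarrow> norm s \<le> 1 \<Longrightarrow>
       set_integrable lborel {0..} (\<lambda>t. of_real ((norm (zeta (Complex \<sigma> t)))\<^sup>2) * exp (- s * of_real t))"
    and "\<And>s. Re s > 0 \<Longrightarrow> norm s \<le> 1 \<Longrightarrow>
       norm ((LINT t:{0..}|lborel. of_real ((norm (zeta (Complex \<sigma> t)))\<^sup>2) * exp (- s * of_real t)) -
         2 * pi * exp (- \<i> * s * of_real (1 - \<sigma>)) * (\<integral>p. of_real (pair_weight \<sigma> p) * exp (- of_real (pair_product p) * zrot s) \<partial>pairs)) \<le> C0"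
    by (rule zeta_laplace_formula[OF \<sigma>]) blast
  define e where "e = min \<delta> 1"
  have e: "e > 0" "e \<le> 1" "e \<le> \<delta>" using d by (auto simp: e_def)
  have "set_integrable lborel {0..} (\<lambda>t. norm (of_real ((norm (zeta (Complex \<sigma> t)))\<^sup>2) * exp (- of_real e * of_real t) :: complex))"
    using e by (intro set_integrable_norm C) auto
  then have I: "set_integrable lborel {0..} (\<lambda>t. (norm (zeta (Complex \<sigma> t)))\<^sup>2 * exp (- e * t))"
    by (simp add: norm_mult norm_power)
  have "set_integrable lborel {0..} (\<lambda>t. (norm (zeta (Complex \<sigma> t)))\<^sup>2 *\<^sub>R exp (- \<delta> * \<bar>t\<bar>))"
  proof (rule set_integrable_bound[OF I])
    show "AE t in lborel. t \<in> {0..} \<longrightarrow> norm ((norm (zeta (Complex \<sigma> t)))\<^sup>2 *\<^sub>R exp (- \<delta> * \<bar>t\<bar>)) \<le> norm ((norm (zeta (Complex \<sigma> t)))\<^sup>2 * exp (- e * t))"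
      using e by (auto intro!: AE_I2 mult_left_mono mult_right_mono simp: abs_mult)
  qed (simp add: set_borel_measurable_def)
  then show "integrable (zeta_measure \<sigma>) (\<lambda>t. exp (- \<delta> * \<bar>t\<bar>))"
    by (subst integrable_zeta_measure(1)) auto
qed auto

lemma laplace_zeta:
  fixes s :: complex
  shows "laplace (zeta_measure \<sigma>) abs s = (LINT t:{0..}|lborel. of_real ((norm (zeta (Complex \<sigma> t)))\<^sup>2) * exp (- s * of_real t))"
  unfolding laplace_def
  by (subst integrable_zeta_measure(2)) (auto simp: scaleR_conv_of_real set_lebesgue_integral_def indicator_def intro!: Bochner_Integration.integral_cong)

lemma cum_zeta:
  assumes "X \<ge> 0"
  shows "laplace_measure.cum (zeta_measure \<sigma>) abs X = integral {0..X} (\<lambda>t. (norm (zeta (Complex \<sigma> t)))\<^sup>2)"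
proof -
  interpret laplace_measure "zeta_measure \<sigma>" abs by (rule laplace_measure_zeta)
  have "cum X = (\<integral>t. indicator {t. \<bar>t\<bar> \<le> X} t \<partial>zeta_measure \<sigma>)"
    using indicator_cum(2)[of X] by (simp add: zeta_measure_def)
  also have "\<dots> = (LINT t:{0..}|lborel. (norm (zeta (Complex \<sigma> t)))\<^sup>2 *\<^sub>R indicator {t. \<bar>t\<bar> \<le> X} t)"
    by (rule integrable_zeta_measure(2)) measurable
  also have "\<dots> = (LINT t:{0..X}|lborel. (norm (zeta (Complex \<sigma> t)))\<^sup>2)"
    unfolding set_lebesgue_integral_def by (intro Bochner_Integration.integral_cong) (auto simp: indicator_def)
  also have "\<dots> = integral {0..X} (\<lambda>t. (norm (zeta (Complex \<sigma> t)))\<^sup>2)"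
    using \<sigma> by (intro set_borel_integral_eq_integral borel_integrable_atLeastAtMost' continuous_intros zeta_vertical_continuous) auto
  finally show ?thesis .
qed

lemma norm_pair_laplace_le:
  assumes "Re s > 0"
  shows "norm (\<integral>p. of_real (pair_weight \<sigma> p) * exp (- s * of_real (2 * pi * pair_product p)) \<partial>pairs) \<le>
    2 * (\<integral>p. pair_weight \<sigma> p * pair_product p powr (- (3/2)) \<partial>pairs) * Re s powr (- (3/2))"
proof -
  have "norm (\<integral>p. of_real (pair_weight \<sigma> p) * exp (- s * of_real (2 * pi * pair_product p)) \<partial>pairs) \<le> (\<integral>p. 2 * Re s powr (- (3/2)) * (pair_weight \<sigma> p * pair_product p powr (- (3/2))) \<partial>pairs)"
  proof (rule norm_integral_le)
    show "integrable pairs (\<lambda>p. of_real (pair_weight \<sigma> p) * exp (- s * of_real (2 * pi * pair_product p)))"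
      using pair_exp_integrable[of \<sigma> "s * of_real (2 * pi)"] \<sigma> assms by (simp add: mult_ac)
    show "integrable pairs (\<lambda>p. 2 * Re s powr (- (3/2)) * (pair_weight \<sigma> p * pair_product p powr (- (3/2))))"
      using \<sigma> by (intro integrable_mult_right pair_weight_integrable)
    fix p
    have "norm (of_real (pair_weight \<sigma> p) * exp (- s * of_real (2 * pi * pair_product p))) = pair_weight \<sigma> p * exp (- (2 * pi * pair_product p * Re s))"
      using pair_weight_pos[of \<sigma> p] by (simp add: norm_mult mult_ac)
    also have "\<dots> \<le> pair_weight \<sigma> p * (2 * (2 * pi * pair_product p * Re s) powr (- (3/2)))"
      using pair_weight_pos[of \<sigma> p] pair_product_pos[of p] assms by (intro mult_left_mono exp_neg_le_powr) auto
    also have "\<dots> \<le> pair_weight \<sigma> p * (2 * (pair_product p * Re s) powr (- (3/2)))"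
    proof (intro mult_left_mono powr_mono2')
      have "1 * (pair_product p * Re s) \<le> (2 * pi) * (pair_product p * Re s)" using pair_product_pos[of p] assms pi_gt3 by (intro mult_right_mono) auto
      then show "pair_product p * Re s \<le> 2 * pi * pair_product p * Re s" by simp
    qed (use pair_weight_pos[of \<sigma> p] pair_product_pos[of p] assms in auto)
    also have "\<dots> = 2 * Re s powr (- (3/2)) * (pair_weight \<sigma> p * pair_product p powr (- (3/2)))"
      using pair_product_pos[of p] assms by (simp add: powr_mult)
    finally show "norm (of_real (pair_weight \<sigma> p) * exp (- s * of_real (2 * pi * pair_product p))) \<le> 2 * Re s powr (- (3/2)) * (pair_weight \<sigma> p * pair_product p powr (- (3/2)))" .
  qed
  also have "\<dots> = 2 * Re s powr (- (3/2)) * (\<integral>p. pair_weight \<sigma> p * pair_product p powr (- (3/2)) \<partial>pairs)" by simp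
  finally show ?thesis by (simp only: mult_ac)
qed

text \<open>Three sources of error: the bounded one of \<open>zeta_laplace_formula\<close>, the
  replacement of \<open>zrot s\<close> by its linear part with (norm s)^2 Re s powr (- 5/2), and the
  removal of the factor exp (- i s (1 - \<sigma>)), which differs from 1 by O(norm s), from a sum of
  size Re s powr (- 3/2).\<close>

lemma laplace_close:
  obtains C where "C > 0"
    "\<And>s. Re s > 0 \<Longrightarrow> norm s \<le> 1 \<Longrightarrow> (norm s)\<^sup>2 \<le> Re s / 6 \<Longrightarrow>
      norm (laplace (zeta_measure \<sigma>) abs s - laplace (pair_measure \<sigma>) pair_freq s) \<le> C * (1 + (norm s)\<^sup>2 * Re s powr (- (5/2)) + norm s * Re s powr (- (3/2)))"
    "\<And>s. Re s > 0 \<Longrightarrow> norm (laplace (pair_measure \<sigma>) pair_freq s) \<le> C * Re s powr (- (3/2))"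
proof -
  obtain C0 where "\<And>s. Re s > 0 \<Longrightarrow> norm s \<le> 1 \<Longrightarrow>
       set_integrable lborel {0..} (\<lambda>t. of_real ((norm (zeta (Complex \<sigma> t)))\<^sup>2) * exp (- s * of_real t))"
    and C0: "\<And>s. Re s > 0 \<Longrightarrow> norm s \<le> 1 \<Longrightarrow>
       norm ((LINT t:{0..}|lborel. of_real ((norm (zeta (Complex \<sigma> t)))\<^sup>2) * exp (- s * of_real t)) -
         2 * pi * exp (- \<i> * s * of_real (1 - \<sigma>)) * (\<integral>p. of_real (pair_weight \<sigma> p) * exp (- of_real (pair_product p) * zrot s) \<partial>pairs)) \<le> C0"
    by (rule zeta_laplace_formula[OF \<sigma>]) blast
  define B where "B = (\<integral>p. pair_weight \<sigma> p * pair_product p powr (- (3/2)) \<partial>pairs)"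
  have B: "B \<ge> 0" unfolding B_def using pair_weight_pos[of \<sigma>] by (intro integral_nonneg_AE AE_I2) (simp add: less_imp_le)
  define C where "C = \<bar>C0\<bar> + 2 * pi * (3 * (36 * B)) + 2 * pi * (3 * (2 * B)) + 1"
  have C: "C > 0" unfolding C_def using B by (intro add_nonneg_pos add_nonneg_nonneg) auto
  show ?thesis
  proof (rule that[OF C])
    fix s assume "Re s > 0"
    then have "norm (laplace (pair_measure \<sigma>) pair_freq s) \<le> 2 * pi * (2 * B * Re s powr (- (3/2)))"
      unfolding laplace_pair norm_mult B_def by (intro mult_mono norm_pair_laplace_le) auto
    also have "\<dots> = (2 * pi * (2 * B)) * Re s powr (- (3/2))" by simp
    also have "\<dots> \<le> C * Re s powr (- (3/2))"
    proof (rule mult_right_mono)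
      have "2 * pi * (2 * B) \<le> 2 * pi * (3 * (2 * B))" using B by (intro mult_left_mono) auto
      moreover have "2 * pi * (3 * (36 * B)) \<ge> 0" using B by simp
      ultimately show "2 * pi * (2 * B) \<le> C" unfolding C_def by linarith
    qed simp
    finally show "norm (laplace (pair_measure \<sigma>) pair_freq s) \<le> C * Re s powr (- (3/2))" .
  next
    fix s assume s: "Re s > 0" "norm s \<le> 1" "(norm s)\<^sup>2 \<le> Re s / 6"
    define e where "e = exp (- \<i> * s * of_real (1 - \<sigma>))"
    define S' S where "S' = (\<integral>p. of_real (pair_weight \<sigma> p) * exp (- of_real (pair_product p) * zrot s) \<partial>pairs)"
      and "S = (\<integral>p. of_real (pair_weight \<sigma> p) * exp (- s * of_real (2 * pi * pair_product p)) \<partial>pairs)"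
    have ns: "norm (- \<i> * s * of_real (1 - \<sigma>)) \<le> norm s"
      unfolding norm_mult norm_of_real using \<sigma> by (simp add: mult_left_le)
    have e3: "exp (norm (- \<i> * s * of_real (1 - \<sigma>))) \<le> 3"
    proof -
      have "exp (norm (- \<i> * s * of_real (1 - \<sigma>))) \<le> exp 1" using ns s by (subst exp_le_cancel_iff) linarith
      then show ?thesis using exp_le by linarith
    qed
    have e_norm: "norm e \<le> 3" unfolding e_def using norm_exp[of "- \<i> * s * of_real (1 - \<sigma>)"] e3 by linarith
    have e1: "norm (e - 1) \<le> 3 * norm s"
      unfolding e_def by (rule order_trans[OF norm_exp_minus_1_le]) (intro mult_mono e3 ns; simp)
    have i1: "integrable pairs (\<lambda>p. of_real (pair_weight \<sigma> p) * exp (- of_real (pair_product p) * zrot s))"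
      using \<sigma> Re_zrot_pos[OF s(1,2)] by (intro pair_exp_integrable) auto
    have i2: "integrable pairs (\<lambda>p. of_real (pair_weight \<sigma> p) * exp (- s * of_real (2 * pi * pair_product p)))"
      using pair_exp_integrable[of \<sigma> "s * of_real (2 * pi)"] \<sigma> s by (simp add: mult_ac)
    have "norm (S' - S) = norm (\<integral>p. of_real (pair_weight \<sigma> p) * (exp (- of_real (pair_product p) * zrot s) - exp (- s * of_real (2 * pi * pair_product p))) \<partial>pairs)"
      unfolding S'_def S_def right_diff_distrib using i1 i2 by simp
    also have "\<dots> \<le> (\<integral>p. 36 * (norm s)\<^sup>2 * Re s powr (- (5/2)) * (pair_weight \<sigma> p * pair_product p powr (- (3/2))) \<partial>pairs)"
    proof (rule norm_integral_le)
      show "integrable pairs (\<lambda>p. of_real (pair_weight \<sigma> p) * (exp (- of_real (pair_product p) * zrot s) - exp (- s * of_real (2 * pi * pair_product p))))"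
        unfolding right_diff_distrib using i1 i2 by (intro Bochner_Integration.integrable_diff)
      show "integrable pairs (\<lambda>p. 36 * (norm s)\<^sup>2 * Re s powr (- (5/2)) * (pair_weight \<sigma> p * pair_product p powr (- (3/2))))"
        using \<sigma> by (intro integrable_mult_right pair_weight_integrable)
      fix p
      have "pair_weight \<sigma> p * norm (exp (- of_real (pair_product p) * zrot s) - exp (- s * of_real (2 * pi * pair_product p))) \<le> pair_weight \<sigma> p * (36 * (norm s)\<^sup>2 * Re s powr (- (5/2)) * pair_product p powr (- (3/2)))"
        using pair_weight_pos[of \<sigma> p] by (intro mult_left_mono zrot_exp_close s) auto
      then show "norm (of_real (pair_weight \<sigma> p) * (exp (- of_real (pair_product p) * zrot s) - exp (- s * of_real (2 * pi * pair_product p)))) \<le> 36 * (norm s)\<^sup>2 * Re s powr (- (5/2)) * (pair_weight \<sigma> p * pair_product p powr (- (3/2)))"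
        using pair_weight_pos[of \<sigma> p] unfolding norm_mult by (simp add: mult_ac)
    qed
    also have "\<dots> = 36 * B * ((norm s)\<^sup>2 * Re s powr (- (5/2)))" by (simp add: B_def)
    finally have SS: "norm (S' - S) \<le> 36 * B * ((norm s)\<^sup>2 * Re s powr (- (5/2)))" .
    have S: "norm S \<le> 2 * B * Re s powr (- (3/2))"
      unfolding S_def B_def by (rule norm_pair_laplace_le[OF s(1)])
    have c0: "norm (laplace (zeta_measure \<sigma>) abs s - 2 * pi * e * S') \<le> \<bar>C0\<bar>"
      using C0[OF s(1,2)] unfolding laplace_zeta e_def S'_def by linarith
    have "laplace (zeta_measure \<sigma>) abs s - laplace (pair_measure \<sigma>) pair_freq s =
      (laplace (zeta_measure \<sigma>) abs s - 2 * pi * e * S') + (2 * pi) * (e * (S' - S)) + (2 * pi) * ((e - 1) * S)"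
      unfolding laplace_pair S_def[symmetric] by (simp add: algebra_simps)
    also have "norm \<dots> \<le> norm (laplace (zeta_measure \<sigma>) abs s - 2 * pi * e * S') + norm ((2 * pi) * (e * (S' - S))) + norm ((2 * pi) * ((e - 1) * S))"
      by (intro order_trans[OF norm_triangle_ineq] add_mono order_refl)
    also have "\<dots> \<le> \<bar>C0\<bar> + 2 * pi * (3 * (36 * B * ((norm s)\<^sup>2 * Re s powr (- (5/2))))) + 2 * pi * ((3 * norm s) * (2 * B * Re s powr (- (3/2))))"
    proof (intro add_mono c0)
      show "norm ((2 * pi) * (e * (S' - S))) \<le> 2 * pi * (3 * (36 * B * ((norm s)\<^sup>2 * Re s powr (- (5/2)))))"
        unfolding norm_mult using e_norm SS by (intro mult_mono) auto
      show "norm ((2 * pi) * ((e - 1) * S)) \<le> 2 * pi * ((3 * norm s) * (2 * B * Re s powr (- (3/2))))"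
        unfolding norm_mult using e1 S by (intro mult_mono) auto
    qed
    also have "\<dots> = \<bar>C0\<bar> * 1 + (2 * pi * (3 * (36 * B))) * ((norm s)\<^sup>2 * Re s powr (- (5/2))) + (2 * pi * (3 * (2 * B))) * (norm s * Re s powr (- (3/2)))"
      by simp
    also have "\<dots> \<le> C * 1 + C * ((norm s)\<^sup>2 * Re s powr (- (5/2))) + C * (norm s * Re s powr (- (3/2)))"
    proof (intro add_mono mult_right_mono)
      have "2 * pi * (3 * (36 * B)) \<ge> 0" "2 * pi * (3 * (2 * B)) \<ge> 0" using B by auto
      then show "\<bar>C0\<bar> \<le> C" "2 * pi * (3 * (36 * B)) \<le> C" "2 * pi * (3 * (2 * B)) \<le> C" unfolding C_def by linarith+
    qed auto
    finally show "norm (laplace (zeta_measure \<sigma>) abs s - laplace (pair_measure \<sigma>) pair_freq s) \<le> C * (1 + (norm s)\<^sup>2 * Re s powr (- (5/2)) + norm s * Re s powr (- (3/2)))"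
      by (simp add: distrib_left)
  qed
qed

definition pair_cum :: "real \<Rightarrow> real" where
  "pair_cum = laplace_measure.cum (pair_measure \<sigma>) pair_freq"

definition mean_square :: "real \<Rightarrow> real" where
  "mean_square X = integral {0..X} (\<lambda>t. (norm (zeta (Complex \<sigma> t)))\<^sup>2)"

text \<open>Both directions of the Tauberian comparison. The growth hypothesis is direct for the
  pairs; for |zeta|^2 it is derived from the pairs by closeness at real parameters.\<close>

lemma mean_square_comparison:
  obtains K where "K \<ge> 0"
    "eventually (\<lambda>X. mean_square X \<le> pair_cum (X * (1 + 12 * X powr (- (1/25)))) + K * X powr (9/10)) at_top"
    "eventually (\<lambda>X. pair_cum X \<le> mean_square (X * (1 + 12 * X powr (- (1/25)))) + K * X powr (9/10)) at_top"
proof -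
  let ?M = "zeta_measure \<sigma>" and ?N = "pair_measure \<sigma>"
  interpret M: laplace_measure ?M abs by (rule laplace_measure_zeta)
  interpret N: laplace_measure ?N pair_freq by (rule laplace_measure_pair)
  obtain C where C: "C > 0"
    "\<And>s. Re s > 0 \<Longrightarrow> norm s \<le> 1 \<Longrightarrow> (norm s)\<^sup>2 \<le> Re s / 6 \<Longrightarrow>
      norm (laplace ?M abs s - laplace ?N pair_freq s) \<le> C * (1 + (norm s)\<^sup>2 * Re s powr (- (5/2)) + norm s * Re s powr (- (3/2)))"
    "\<And>s. Re s > 0 \<Longrightarrow> norm (laplace ?N pair_freq s) \<le> C * Re s powr (- (3/2))"
    by (rule laplace_close) blast
  have real: "laplace P \<tau> (of_real d) = of_real (\<integral>x. exp (- d * \<tau> x) \<partial>P)" for P :: "'c measure" and \<tau> d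
    unfolding laplace_def integral_complex_of_real[symmetric] by (simp flip: exp_of_real)
  have NL: "N.L d \<le> C * d powr (- (3/2))" if "d > 0" for d
  proof -
    have "N.L d \<le> norm (laplace ?N pair_freq (of_real d))" unfolding real N.L_def by simp
    also have "\<dots> \<le> C * d powr (- (3/2))" using C(3)[of "of_real d"] that by simp
    finally show ?thesis .
  qed
  have LMb: "M.L d \<le> (144 * C) * d powr (- (3/2))" if d: "0 < d" "d \<le> 1" for d
  proof -
    \<comment> \<open>A real parameter lies in the region of closeness only if e^2 \<le> e / 6, that
      is e \<le> 1/6. As the transform decreases, passing from d to d / 6 costs a factor 6 powr
      (3/2), at most 36, whence 144 = 4 * 36.\<close>
    define e where "e = d / 6"
    have e: "0 < e" "e \<le> 1/6" "e \<le> d" using d by (auto simp: e_def)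
    have p1: "e powr (- (1/2)) \<le> e powr (- (3/2))" "1 \<le> e powr (- (3/2))"
      using e powr_mono'[of "- (3/2)" "- (1/2)" e] powr_mono2'[of "- (3/2)" e 1] by simp_all
    have "M.L d \<le> M.L e"
      unfolding M.L_def using d e by (intro integral_mono M.int) (auto intro: mult_right_mono)
    also have "M.L e \<le> norm (laplace ?M abs (of_real e))" unfolding real M.L_def by simp
    also have "\<dots> \<le> norm (laplace ?N pair_freq (of_real e)) + norm (laplace ?M abs (of_real e) - laplace ?N pair_freq (of_real e))"
      by (metis norm_triangle_sub add.commute)
    also have "\<dots> \<le> C * e powr (- (3/2)) + C * (1 + e\<^sup>2 * e powr (- (5/2)) + e * e powr (- (3/2)))"
      using C(2)[of "of_real e"] C(3)[of "of_real e"] e by (intro add_mono) (auto simp: power2_eq_square)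
    also have "e\<^sup>2 * e powr (- (5/2)) = e powr (- (1/2))"
      using e powr_add[of e 2 "- (5/2)"] by simp
    also have "e * e powr (- (3/2)) = e powr (- (1/2))"
      using e powr_add[of e 1 "- (3/2)"] by simp
    also have "C * e powr (- (3/2)) + C * (1 + e powr (- (1/2)) + e powr (- (1/2))) \<le> C * e powr (- (3/2)) + C * (e powr (- (3/2)) + e powr (- (3/2)) + e powr (- (3/2)))"
      using C(1) p1 by (intro add_mono mult_left_mono order_refl) auto
    also have "\<dots> = 4 * C * e powr (- (3/2))" by simp
    also have "e powr (- (3/2)) = d powr (- (3/2)) * 6 powr (3/2)"
      using d by (simp add: e_def powr_divide powr_minus_divide)
    also have "4 * C * (d powr (- (3/2)) * 6 powr (3/2)) \<le> 4 * C * (d powr (- (3/2)) * 36)"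
      using C(1) powr_mono[of "3/2" 2 "6::real"] by (intro mult_left_mono) auto
    finally show ?thesis by simp
  qed
  have NL': "N.L d \<le> (144 * C) * d powr (- (3/2))" if "0 < d" "d \<le> 1" for d
    by (rule order_trans[OF NL[OF that(1)]]) (use C(1) in auto)
  have close: "norm (laplace ?M abs s - laplace ?N pair_freq s) \<le> (144 * C) * (1 + (norm s)\<^sup>2 * Re s powr (- (5/2)) + norm s * Re s powr (- (3/2)))"
    if "Re s > 0" "norm s \<le> 1" "(norm s)\<^sup>2 \<le> Re s / 6" for s
    by (rule order_trans[OF C(2)[OF that]], rule mult_right_mono) (use C(1) in auto)
  then have close': "norm (laplace ?N pair_freq s - laplace ?M abs s) \<le> (144 * C) * (1 + (norm s)\<^sup>2 * Re s powr (- (5/2)) + norm s * Re s powr (- (3/2)))"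
    if "Re s > 0" "norm s \<le> 1" "(norm s)\<^sup>2 \<le> Re s / 6" for s
    using that by (simp add: norm_minus_commute)
  have C144: "144 * C \<ge> 0" using C(1) by simp
  have pos: "eventually (\<lambda>X::real. X \<ge> 1) at_top" by (rule eventually_ge_at_top)
  have ev1: "eventually (\<lambda>X. M.cum X \<le> N.cum (X * (1 + 12 * X powr (- (1/25)))) + 5000 * (144 * C) * X powr (9/10)) at_top"
    by (rule tauberian_comparison[OF laplace_measure_zeta laplace_measure_pair C144 LMb NL' close])
  have ev2: "eventually (\<lambda>X. N.cum X \<le> M.cum (X * (1 + 12 * X powr (- (1/25)))) + 5000 * (144 * C) * X powr (9/10)) at_top"
    by (rule tauberian_comparison[OF laplace_measure_pair laplace_measure_zeta C144 NL' LMb close'])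
  show ?thesis
  proof (rule that[of "5000 * (144 * C)"])
    show "eventually (\<lambda>X. mean_square X \<le> pair_cum (X * (1 + 12 * X powr (- (1/25)))) + 5000 * (144 * C) * X powr (9/10)) at_top"
      using ev1 pos
      by eventually_elim (simp add: cum_zeta mean_square_def pair_cum_def)
    show "eventually (\<lambda>X. pair_cum X \<le> mean_square (X * (1 + 12 * X powr (- (1/25)))) + 5000 * (144 * C) * X powr (9/10)) at_top"
      using ev2 pos
      by eventually_elim (simp add: cum_zeta mean_square_def pair_cum_def)
  qed (use C144 in simp)
qed

end

section \<open>Elementary divisor sums\<close>

definition hyperbola_set :: "real \<Rightarrow> (nat \<times> nat) set" where
  "hyperbola_set Y = {p. pair_product p \<le> Y}"

lemma hyperbola_set_eq:
  assumes "Y \<ge> 0"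
  shows "hyperbola_set Y = Sigma {..<nat \<lfloor>Y\<rfloor>} (\<lambda>a. {..<nat \<lfloor>Y / real (Suc a)\<rfloor>})"
proof -
  have "real (Suc a) * real (Suc m) \<le> Y \<longleftrightarrow> a < nat \<lfloor>Y\<rfloor> \<and> m < nat \<lfloor>Y / real (Suc a)\<rfloor>" for a m
  proof -
    have "m < nat \<lfloor>Y / real (Suc a)\<rfloor> \<longleftrightarrow> int (Suc m) \<le> \<lfloor>Y / real (Suc a)\<rfloor>" by linarith
    also have "\<dots> \<longleftrightarrow> real (Suc m) \<le> Y / real (Suc a)" by (simp only: le_floor_iff of_int_of_nat_eq)
    also have "\<dots> \<longleftrightarrow> real (Suc a) * real (Suc m) \<le> Y" by (simp add: field_simps)
    finally have 1: "m < nat \<lfloor>Y / real (Suc a)\<rfloor> \<longleftrightarrow> real (Suc a) * real (Suc m) \<le> Y" .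
    have "a < nat \<lfloor>Y\<rfloor>" if "real (Suc a) * real (Suc m) \<le> Y"
    proof -
      have "real (Suc a) * 1 \<le> real (Suc a) * real (Suc m)" by (intro mult_left_mono) auto
      then have "real (Suc a) \<le> Y" using that by (metis mult_1_right order_trans)
      then have "of_int (int (Suc a)) \<le> Y" by simp
      then have "int (Suc a) \<le> \<lfloor>Y\<rfloor>" by (simp only: le_floor_iff)
      then show ?thesis by linarith
    qed
    then show ?thesis using 1 by blast
  qed
  then show ?thesis by (auto simp: hyperbola_set_def pair_product_def simp del: of_nat_Suc)
qed

lemma finite_hyperbola_set: "finite (hyperbola_set Y)"
proof (cases "Y \<ge> 0")
  case False
  then have "hyperbola_set Y = {}" using pair_product_pos by (auto simp: hyperbola_set_def not_le) (meson less_trans not_le pair_product_pos)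
  then show ?thesis by simp
qed (simp add: hyperbola_set_eq)

lemma sum_hyperbola_set:
  fixes g :: "nat \<Rightarrow> real"
  assumes "Y \<ge> 0"
  shows "(\<Sum>p\<in>hyperbola_set Y. g (fst p)) = (\<Sum>a<nat \<lfloor>Y\<rfloor>. g a * of_int \<lfloor>Y / real (Suc a)\<rfloor>)"
proof -
  let ?B = "\<lambda>a. {..<nat \<lfloor>Y / real (Suc a)\<rfloor>}"
  have "(\<Sum>p\<in>hyperbola_set Y. g (fst p)) = (\<Sum>(a, m)\<in>Sigma {..<nat \<lfloor>Y\<rfloor>} ?B. g a)"
    unfolding hyperbola_set_eq[OF assms] by (simp add: case_prod_unfold)
  also have "\<dots> = (\<Sum>a<nat \<lfloor>Y\<rfloor>. \<Sum>m\<in>?B a. g a)"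
    by (subst sum.Sigma) auto
  also have "\<dots> = (\<Sum>a<nat \<lfloor>Y\<rfloor>. g a * of_int \<lfloor>Y / real (Suc a)\<rfloor>)"
    using assms by (intro sum.cong) (auto simp: mult.commute)
  finally show ?thesis .
qed

lemma pair_cum_eq:
  assumes "1/2 \<le> \<sigma>" "\<sigma> < 1"
  shows "pair_cum \<sigma> X = 2 * pi * (\<Sum>p\<in>hyperbola_set (X / (2 * pi)). pair_weight \<sigma> p)"
proof -
  interpret laplace_measure "pair_measure \<sigma>" pair_freq by (rule laplace_measure_pair[OF assms])
  have "pair_cum \<sigma> X = (\<integral>p. indicator {p. pair_freq p \<le> X} p \<partial>pair_measure \<sigma>)"
    unfolding pair_cum_def[OF assms] using indicator_cum(2)[of X] by (simp add: pair_measure_def)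
  also have "\<dots> = (\<integral>p. (2 * pi * pair_weight \<sigma> p) *\<^sub>R indicator {p. pair_freq p \<le> X} p \<partial>pairs)"
    by (rule integrable_pair_measure(2)[OF assms])
  also have "\<dots> = (\<integral>p. (2 * pi * pair_weight \<sigma> p) * indicator (hyperbola_set (X / (2 * pi))) p \<partial>pairs)"
    by (intro Bochner_Integration.integral_cong) (auto simp: hyperbola_set_def pair_freq_def indicator_def field_simps)
  also have "\<dots> = (\<Sum>p\<in>hyperbola_set (X / (2 * pi)). 2 * pi * pair_weight \<sigma> p)"
  proof -
    have eq: "{p. (2 * pi * pair_weight \<sigma> p) * indicator (hyperbola_set (X / (2 * pi))) p \<noteq> (0::real)} = hyperbola_set (X / (2 * pi))"
      using pair_weight_pos[of \<sigma>] by (auto simp: indicator_def less_imp_neq[symmetric])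
    have "(\<integral>p. (2 * pi * pair_weight \<sigma> p) * indicator (hyperbola_set (X / (2 * pi))) p \<partial>pairs) =
       (\<Sum>p | p \<in> UNIV \<and> (2 * pi * pair_weight \<sigma> p) * indicator (hyperbola_set (X / (2 * pi))) p \<noteq> (0::real). (2 * pi * pair_weight \<sigma> p) * indicator (hyperbola_set (X / (2 * pi))) p)"
      by (rule lebesgue_integral_count_space_finite_support) (simp add: eq[simplified] finite_hyperbola_set)
    also have "\<dots> = (\<Sum>p\<in>hyperbola_set (X / (2 * pi)). 2 * pi * pair_weight \<sigma> p)"
      by (intro sum.cong) (use eq in auto)
    finally show ?thesis .
  qed
  finally show ?thesis by (simp add: sum_distrib_left)
qed

lemma sum_powr_neg_le:
  fixes p :: real
  assumes p: "0 < p" "p < 1"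
  shows "(\<Sum>n<N. real (Suc n) powr (-p)) \<le> real N powr (1 - p) / (1 - p)"
proof (induction N)
  case (Suc N)
  show ?case
  proof (cases "N = 0")
    case True
    then show ?thesis using p by simp
  next
    case False
    have "\<exists>\<xi>. \<xi> > real N \<and> \<xi> < real (Suc N) \<and> real (Suc N) powr (1 - p) / (1 - p) - real N powr (1 - p) / (1 - p) = (real (Suc N) - real N) * \<xi> powr (-p)"
      using False p by (intro MVT2) (auto intro!: derivative_eq_intros)
    then obtain \<xi> where xi: "\<xi> > real N" "\<xi> < real (Suc N)"
      "real (Suc N) powr (1 - p) / (1 - p) - real N powr (1 - p) / (1 - p) = \<xi> powr (-p)" by auto
    have "real (Suc N) powr (-p) \<le> \<xi> powr (-p)"
      using xi p False by (intro powr_mono2') auto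
    then show ?thesis using Suc xi(3) by (simp del: of_nat_Suc)
  qed
qed simp

definition zeta_r :: "real \<Rightarrow> real" where "zeta_r x = Re (zeta (of_real x))"

lemma zeta_r_sums:
  assumes "x > 1"
  shows "(\<lambda>n. real (Suc n) powr (-x)) sums zeta_r x"
proof -
  have "of_nat (Suc k) powr (- complex_of_real x) = of_real (real (Suc k) powr (-x))" for k
    using powr_of_real[of "real (Suc k)" "-x"] by (simp del: of_nat_Suc)
  then show ?thesis
    using sums_Re[OF zeta_sums[of "of_real x"]] assms by (simp add: zeta_r_def del: of_nat_Suc)
qed

lemma zeta_r_pos: "x > 1 \<Longrightarrow> zeta_r x > 0"
  using suminf_pos[OF sums_summable[OF zeta_r_sums[of x]]] sums_unique[OF zeta_r_sums[of x]] by simp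

text \<open>For fixed first component a the number of pairs is the floor of Y / a. Dropping the
  floor costs the sum of a powr (1 - 2\<sigma>) up to Y, completing the series for zeta(2\<sigma>)
  costs Y times its tail; both are O(Y powr (2 - 2\<sigma>)).\<close>

lemma pair_cum_asymp:
  assumes \<sigma>: "1/2 < \<sigma>" "\<sigma> < 1"
  obtains K where "K \<ge> 0" "\<And>X. X \<ge> 1 \<Longrightarrow> \<bar>pair_cum \<sigma> X - zeta_r (2 * \<sigma>) * X\<bar> \<le> K * X powr (2 - 2 * \<sigma>)"
proof -
  define p where "p = 2 * \<sigma> - 1"
  have p: "0 < p" "p < 1" using \<sigma> by (auto simp: p_def)
  define K where "K = 1 / (1 - p) + (1 + 1 / p)"
  have K: "K \<ge> 0" using p by (simp add: K_def)
  have main: "\<bar>(\<Sum>q\<in>hyperbola_set Y. pair_weight \<sigma> q) - zeta_r (2 * \<sigma>) * Y\<bar> \<le> K * Y powr (1 - p)" if Y: "Y > 0" for Y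
  proof -
    define n where "n = nat \<lfloor>Y\<rfloor>"
    have n: "real n \<le> Y" "Y \<le> real (Suc n)" using Y by (auto simp: n_def) linarith
    have "(\<Sum>q\<in>hyperbola_set Y. pair_weight \<sigma> q) = (\<Sum>a<n. real (Suc a) powr (-p) * of_int \<lfloor>Y / real (Suc a)\<rfloor>)"
      unfolding pair_weight_def n_def using sum_hyperbola_set[of Y "\<lambda>a. real (Suc a) powr (1 - 2 * \<sigma>)"] Y by (simp add: p_def)
    also have "\<dots> = (\<Sum>a<n. Y * real (Suc a) powr (- (2 * \<sigma>)) - real (Suc a) powr (-p) * frac (Y / real (Suc a)))"
    proof (intro sum.cong refl)
      fix a
      have "real (Suc a) powr (- (2 * \<sigma>)) = real (Suc a) powr (-p) / real (Suc a)"
        using powr_diff[of "real (Suc a)" "-p" 1] by (simp add: p_def del: of_nat_Suc)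
      then show "real (Suc a) powr (-p) * of_int \<lfloor>Y / real (Suc a)\<rfloor> = Y * real (Suc a) powr (- (2 * \<sigma>)) - real (Suc a) powr (-p) * frac (Y / real (Suc a))"
        by (simp add: frac_def algebra_simps del: of_nat_Suc)
    qed
    also have "\<dots> = Y * (\<Sum>a<n. real (Suc a) powr (- (2 * \<sigma>))) - (\<Sum>a<n. real (Suc a) powr (-p) * frac (Y / real (Suc a)))"
      by (simp add: sum_subtractf sum_distrib_left)
    finally have eq: "(\<Sum>q\<in>hyperbola_set Y. pair_weight \<sigma> q) = Y * (\<Sum>a<n. real (Suc a) powr (- (2 * \<sigma>))) - (\<Sum>a<n. real (Suc a) powr (-p) * frac (Y / real (Suc a)))" .
    have fr: "0 \<le> (\<Sum>a<n. real (Suc a) powr (-p) * frac (Y / real (Suc a)))"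
      by (intro sum_nonneg) auto
    have "(\<Sum>a<n. real (Suc a) powr (-p) * frac (Y / real (Suc a))) \<le> (\<Sum>a<n. real (Suc a) powr (-p) * 1)"
      by (intro sum_mono mult_left_mono less_imp_le[OF frac_lt_1]) auto
    also have "\<dots> \<le> real n powr (1 - p) / (1 - p)" using sum_powr_neg_le[OF p, of n] by simp
    also have "\<dots> \<le> Y powr (1 - p) / (1 - p)" using n p by (intro divide_right_mono powr_mono2) auto
    finally have fr2: "(\<Sum>a<n. real (Suc a) powr (-p) * frac (Y / real (Suc a))) \<le> Y powr (1 - p) / (1 - p)" .
    have s: "(\<lambda>n. real (Suc n) powr (- (2 * \<sigma>))) sums zeta_r (2 * \<sigma>)" using \<sigma> by (intro zeta_r_sums) auto
    have tail: "zeta_r (2 * \<sigma>) - (\<Sum>a<n. real (Suc a) powr (- (2 * \<sigma>))) = (\<Sum>m. real (Suc (m + n)) powr (- p - 1))"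
      using suminf_split_initial_segment[OF sums_summable[OF s], of n] sums_unique[OF s] by (simp add: p_def)
    have "(\<Sum>m. real (Suc (m + n)) powr (- p - 1)) \<le> (1 + 1 / p) * real (Suc n) powr (- p)"
      by (rule powr_neg_tail_le[OF p(1)])
    also have "\<dots> \<le> (1 + 1 / p) * Y powr (- p)"
      using n p Y by (intro mult_left_mono powr_mono2') auto
    finally have "Y * (zeta_r (2 * \<sigma>) - (\<Sum>a<n. real (Suc a) powr (- (2 * \<sigma>)))) \<le> Y * ((1 + 1 / p) * Y powr (- p))"
      unfolding tail using Y by (intro mult_left_mono) auto
    also have "\<dots> = (1 + 1 / p) * Y powr (1 - p)" using Y powr_add[of Y 1 "-p"] by simp
    finally have t2: "Y * (zeta_r (2 * \<sigma>) - (\<Sum>a<n. real (Suc a) powr (- (2 * \<sigma>)))) \<le> (1 + 1 / p) * Y powr (1 - p)" .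
    have "0 \<le> (\<Sum>m. real (Suc (m + n)) powr (- p - 1))"
      by (intro suminf_nonneg summable_ignore_initial_segment[OF summable_zreg_bound[OF p(1)]]) auto
    then have t1: "0 \<le> Y * (zeta_r (2 * \<sigma>) - (\<Sum>a<n. real (Suc a) powr (- (2 * \<sigma>))))"
      unfolding tail using Y by simp
    have "K * Y powr (1 - p) = Y powr (1 - p) / (1 - p) + (1 + 1 / p) * Y powr (1 - p)"
      by (simp add: K_def distrib_right)
    moreover have "(\<Sum>q\<in>hyperbola_set Y. pair_weight \<sigma> q) - zeta_r (2 * \<sigma>) * Y = - (Y * (zeta_r (2 * \<sigma>) - (\<Sum>a<n. real (Suc a) powr (- (2 * \<sigma>))))) - (\<Sum>a<n. real (Suc a) powr (-p) * frac (Y / real (Suc a)))"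
      unfolding eq by (simp add: algebra_simps)
    ultimately show ?thesis using fr fr2 t1 t2 by linarith
  qed
  show ?thesis
  proof (rule that[of "2 * pi * K"])
    fix X :: real assume X: "X \<ge> 1"
    define Y where "Y = X / (2 * pi)"
    have "X / (2 * pi) \<le> X / 1" using X pi_gt3 by (intro divide_left_mono) auto
    then have Y: "Y > 0" "Y \<le> X" using X by (simp_all add: Y_def)
    have "X = 2 * pi * Y" by (simp add: Y_def)
    then have zX: "zeta_r (2 * \<sigma>) * X = 2 * pi * (zeta_r (2 * \<sigma>) * Y)" by (metis mult.left_commute)
    have "pair_cum \<sigma> X = 2 * pi * (\<Sum>q\<in>hyperbola_set Y. pair_weight \<sigma> q)"
      using \<sigma> by (simp add: pair_cum_eq Y_def)
    then have "pair_cum \<sigma> X - zeta_r (2 * \<sigma>) * X = 2 * pi * ((\<Sum>q\<in>hyperbola_set Y. pair_weight \<sigma> q) - zeta_r (2 * \<sigma>) * Y)"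
      unfolding zX by (simp only: right_diff_distrib)
    then have "\<bar>pair_cum \<sigma> X - zeta_r (2 * \<sigma>) * X\<bar> = 2 * pi * \<bar>(\<Sum>q\<in>hyperbola_set Y. pair_weight \<sigma> q) - zeta_r (2 * \<sigma>) * Y\<bar>"
      by (simp add: abs_mult)
    also have "\<dots> \<le> 2 * pi * (K * Y powr (1 - p))" by (intro mult_left_mono main Y) auto
    also have "\<dots> \<le> 2 * pi * (K * X powr (1 - p))" using K p Y by (intro mult_left_mono powr_mono2) auto
    finally show "\<bar>pair_cum \<sigma> X - zeta_r (2 * \<sigma>) * X\<bar> \<le> 2 * pi * K * X powr (2 - 2 * \<sigma>)" by (simp add: p_def)
  qed (use K in auto)
qed

text \<open>Dirichlet's hyperbola method: each pair has a component of index below q, the root of Y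
  rounded down, the swap of components exchanges the two cases, and the pairs with both components
  small form a full square.\<close>

lemma card_hyperbola_set:
  assumes "Y \<ge> 1"
  defines "q \<equiv> nat \<lfloor>sqrt Y\<rfloor>"
  shows "real (card (hyperbola_set Y)) = 2 * (\<Sum>a<q. of_int \<lfloor>Y / real (Suc a)\<rfloor>) - (real q)\<^sup>2"
proof -
  define A1 A2 where "A1 = {p \<in> hyperbola_set Y. fst p < q}" and "A2 = {p \<in> hyperbola_set Y. snd p < q}"
  have q: "real q \<le> sqrt Y" "sqrt Y < real (Suc q)" using assms by (auto simp: q_def) linarith
  have q2: "real q * real q \<le> Y" using mult_mono[OF q(1) q(1)] assms by simp
  have fin: "finite A1" "finite A2" using finite_hyperbola_set by (auto simp: A1_def A2_def)
  have "hyperbola_set Y = A1 \<union> A2"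
  proof -
    have "fst p < q \<or> snd p < q" if "p \<in> hyperbola_set Y" for p
    proof (rule ccontr)
      assume "\<not> (fst p < q \<or> snd p < q)"
      then have "real (Suc q) * real (Suc q) \<le> pair_product p" unfolding pair_product_def by (intro mult_mono) auto
      moreover have "sqrt Y * sqrt Y < real (Suc q) * real (Suc q)"
        by (intro mult_strict_mono) (use q(2) assms(1) in \<open>simp_all del: of_nat_Suc\<close>)
      ultimately show False using that assms by (simp add: hyperbola_set_def)
    qed
    then show ?thesis by (auto simp: A1_def A2_def)
  qed
  moreover have "A1 \<inter> A2 = {..<q} \<times> {..<q}"
  proof -
    have "pair_product p \<le> Y" if "fst p < q" "snd p < q" for p
    proof -
      have "pair_product p \<le> real q * real q" unfolding pair_product_def using that by (intro mult_mono) auto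
      then show ?thesis using q2 by linarith
    qed
    then show ?thesis by (auto simp: A1_def A2_def hyperbola_set_def)
  qed
  moreover have "card A2 = card A1"
  proof (rule bij_betw_same_card[of prod.swap])
    show "bij_betw prod.swap A2 A1"
      by (rule bij_betw_byWitness[where f' = prod.swap]) (auto simp: A1_def A2_def hyperbola_set_def pair_product_def mult.commute)
  qed
  moreover have "card A1 + card A2 = card (A1 \<union> A2) + card (A1 \<inter> A2)" using fin by (rule card_Un_Int)
  ultimately have c: "2 * card A1 = card (hyperbola_set Y) + q * q" by (simp add: card_cartesian_product)
  have "A1 = Sigma {..<q} (\<lambda>a. {..<nat \<lfloor>Y / real (Suc a)\<rfloor>})"
  proof -
    have "real q \<le> Y"
    proof (cases "q = 0")
      case False
      then have "real q * 1 \<le> real q * real q" by (intro mult_left_mono) auto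
      then show ?thesis using q2 by linarith
    qed (use assms in simp)
    then have "q \<le> nat \<lfloor>Y\<rfloor>" by (simp add: le_nat_floor)
    then show ?thesis unfolding A1_def using assms by (subst hyperbola_set_eq) auto
  qed
  then have "real (card A1) = (\<Sum>a<q. of_int \<lfloor>Y / real (Suc a)\<rfloor>)"
    using assms by simp
  with c show ?thesis
    by (metis (no_types, lifting) add_diff_cancel_right' of_nat_add of_nat_mult of_nat_numeral power2_eq_square)
qed

text \<open>The floors in the hyperbola formula are replaced by harmonic numbers at the cost of at
  most sqrt Y fractional parts. Twice the harmonic number of q contributes ln Y + 2 gamma, and the
  square contributes -1 since q / sqrt Y tends to 1.\<close>

lemma card_hyperbola_set_asymp: "((\<lambda>Y. real (card (hyperbola_set Y)) / Y - ln Y) \<longlongrightarrow> 2 * euler_mascheroni - 1) at_top"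
proof -
  define q where "q = (\<lambda>Y::real. nat \<lfloor>sqrt Y\<rfloor>)"
  define F where "F = (\<lambda>Y. (\<Sum>a<q Y. frac (Y / real (Suc a))))"
  have q_top: "filterlim q at_top at_top"
    unfolding q_def
    by (rule filterlim_compose[OF filterlim_nat_sequentially], rule filterlim_compose[OF filterlim_floor_sequentially], rule sqrt_at_top)
  have q_bd: "sqrt Y - 1 \<le> real (q Y) \<and> real (q Y) \<le> sqrt Y" if "Y \<ge> 1" for Y
    using that unfolding q_def by auto
  have ratio: "((\<lambda>Y. real (q Y) / sqrt Y) \<longlongrightarrow> 1) at_top"
  proof (rule tendsto_sandwich)
    show "eventually (\<lambda>Y. (sqrt Y - 1) / sqrt Y \<le> real (q Y) / sqrt Y) at_top"
      using eventually_ge_at_top[of 1] by eventually_elim (use q_bd in \<open>auto intro: divide_right_mono\<close>)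
    show "eventually (\<lambda>Y. real (q Y) / sqrt Y \<le> 1) at_top"
      using eventually_ge_at_top[of 1] by eventually_elim (use q_bd in \<open>auto simp: divide_le_eq\<close>)
    show "((\<lambda>Y. (sqrt Y - 1) / sqrt Y) \<longlongrightarrow> 1) at_top" by real_asymp
  qed simp
  have "((\<lambda>Y. 2 * (harm (q Y) - ln (real (q Y))) + 2 * ln (real (q Y) / sqrt Y) - 2 * (F Y / Y) - (real (q Y) / sqrt Y)\<^sup>2) \<longlongrightarrow>
     2 * euler_mascheroni + 2 * ln 1 - 2 * 0 - 1\<^sup>2) at_top"
  proof (intro tendsto_intros ratio)
    show "((\<lambda>Y. harm (q Y) - ln (real (q Y))) \<longlongrightarrow> (euler_mascheroni :: real)) at_top"
      by (rule filterlim_compose[OF euler_mascheroni_LIMSEQ q_top])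
    show "((\<lambda>Y. F Y / Y) \<longlongrightarrow> 0) at_top"
    proof (rule tendsto_sandwich)
      show "eventually (\<lambda>Y. 0 \<le> F Y / Y) at_top"
        using eventually_ge_at_top[of 1] by eventually_elim (auto simp: F_def intro!: divide_nonneg_nonneg sum_nonneg)
      show "eventually (\<lambda>Y. F Y / Y \<le> sqrt Y / Y) at_top"
        using eventually_ge_at_top[of 1]
      proof eventually_elim
        case (elim Y)
        have "F Y \<le> (\<Sum>a<q Y. 1)" unfolding F_def by (intro sum_mono less_imp_le[OF frac_lt_1])
        also have "\<dots> \<le> sqrt Y" using q_bd[OF elim] by simp
        finally show ?case using elim by (intro divide_right_mono) auto
      qed
      show "((\<lambda>Y. sqrt Y / Y) \<longlongrightarrow> (0::real)) at_top" by real_asymp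
    qed simp
  qed auto
  moreover have "eventually (\<lambda>Y. 2 * (harm (q Y) - ln (real (q Y))) + 2 * ln (real (q Y) / sqrt Y) - 2 * (F Y / Y) - (real (q Y) / sqrt Y)\<^sup>2 =
     real (card (hyperbola_set Y)) / Y - ln Y) at_top"
    using eventually_ge_at_top[of 4]
  proof eventually_elim
    case (elim Y)
    have Y: "Y \<ge> 1" using elim by simp
    \<comment> \<open>With Y \<ge> 4 the number q is positive, so that the logarithm of q / sqrt Y
      splits.\<close>
    have "sqrt 4 \<le> sqrt Y" using elim by (intro real_sqrt_le_mono) auto
    then have q0: "real (q Y) > 0" using q_bd[OF Y] by simp
    have "(\<Sum>a<q Y. of_int \<lfloor>Y / real (Suc a)\<rfloor>) = (\<Sum>a<q Y. Y * inverse (real (Suc a)) - frac (Y / real (Suc a)))"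
      by (simp add: frac_def divide_inverse)
    also have "\<dots> = Y * harm (q Y) - F Y"
    proof -
      have "harm (q Y) = (\<Sum>a<q Y. inverse (real (Suc a)))"
        unfolding harm_def by (rule sum.reindex_bij_witness[of _ Suc "\<lambda>n. n - 1"]) auto
      then show ?thesis by (simp add: sum_subtractf sum_distrib_left F_def)
    qed
    finally have "real (card (hyperbola_set Y)) = 2 * (Y * harm (q Y) - F Y) - (real (q Y))\<^sup>2"
      using card_hyperbola_set[OF Y] by (simp add: q_def)
    then have "real (card (hyperbola_set Y)) / Y = 2 * harm (q Y) - 2 * (F Y / Y) - (real (q Y))\<^sup>2 / Y"
      using Y by (simp add: diff_divide_distrib right_diff_distrib)
    moreover have "ln (real (q Y) / sqrt Y) = ln (real (q Y)) - ln Y / 2"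
      using q0 Y by (simp add: ln_div ln_sqrt)
    moreover have "(real (q Y) / sqrt Y)\<^sup>2 = (real (q Y))\<^sup>2 / Y" using Y by (simp add: power_divide)
    ultimately show ?case by simp
  qed
  ultimately have "((\<lambda>Y. real (card (hyperbola_set Y)) / Y - ln Y) \<longlongrightarrow> 2 * euler_mascheroni + 2 * ln 1 - 2 * 0 - 1\<^sup>2) at_top"
    by (rule Lim_transform_eventually)
  then show ?thesis by simp
qed

lemma pair_cum_half_asymp:
  "((\<lambda>X. pair_cum (1/2) X / X - ln X) \<longlongrightarrow> 2 * euler_mascheroni - 1 - ln (2 * pi)) at_top"
proof -
  have top: "filterlim (\<lambda>X. X / (2 * pi)) at_top at_top"
    by real_asymp
  have "((\<lambda>X. (real (card (hyperbola_set (X / (2 * pi)))) / (X / (2 * pi)) - ln (X / (2 * pi))) - ln (2 * pi)) \<longlongrightarrow> (2 * euler_mascheroni - 1) - ln (2 * pi)) at_top"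
    by (intro tendsto_diff filterlim_compose[OF card_hyperbola_set_asymp top] tendsto_const)
  moreover have "eventually (\<lambda>X. (real (card (hyperbola_set (X / (2 * pi)))) / (X / (2 * pi)) - ln (X / (2 * pi))) - ln (2 * pi) = pair_cum (1/2) X / X - ln X) at_top"
    using eventually_gt_at_top[of 0]
  proof eventually_elim
    case (elim X)
    have "pair_cum (1/2) X = 2 * pi * real (card (hyperbola_set (X / (2 * pi))))"
      by (simp add: pair_cum_eq pair_weight_def)
    then show ?case using elim by (simp add: ln_div)
  qed
  ultimately show ?thesis by (rule Lim_transform_eventually)
qed

section \<open>Asymptotics of the mean square\<close>

lemma mean_square_mono:
  assumes "1/2 \<le> \<sigma>" "\<sigma> < 1" "X \<le> Y"
  shows "mean_square \<sigma> X \<le> mean_square \<sigma> Y"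
  unfolding mean_square_def[OF assms(1,2)] using assms
  by (intro integral_subset_le integrable_continuous_interval continuous_intros zeta_vertical_continuous) auto

text \<open>The lower bound inverts the second comparison: at the argument X (1 - 24 X powr (-
  1/25)) the stretched argument is still at most X. The number 24 is twice 12, which leaves room for
  the lower order terms.\<close>

lemma mean_square_sandwich:
  assumes "1/2 \<le> \<sigma>" "\<sigma> < 1"
  obtains K where "K \<ge> 0"
    "eventually (\<lambda>X. mean_square \<sigma> X \<le> pair_cum \<sigma> (X * (1 + 12 * X powr (- (1/25)))) + K * X powr (9/10)) at_top"
    "eventually (\<lambda>X. pair_cum \<sigma> (X * (1 - 24 * X powr (- (1/25)))) - K * X powr (9/10) \<le> mean_square \<sigma> X) at_top"
proof -
  obtain K where K: "K \<ge> 0"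
    "eventually (\<lambda>X. mean_square \<sigma> X \<le> pair_cum \<sigma> (X * (1 + 12 * X powr (- (1/25)))) + K * X powr (9/10)) at_top"
    "eventually (\<lambda>X. pair_cum \<sigma> X \<le> mean_square \<sigma> (X * (1 + 12 * X powr (- (1/25)))) + K * X powr (9/10)) at_top"
    by (rule mean_square_comparison[OF assms]) blast
  show ?thesis
  proof (rule that[OF K(1,2)])
    have "filterlim (\<lambda>X::real. X * (1 - 24 * X powr (- (1/25)))) at_top at_top" by real_asymp
    then have "eventually (\<lambda>X. pair_cum \<sigma> (X * (1 - 24 * X powr (- (1/25)))) \<le>
       mean_square \<sigma> (X * (1 - 24 * X powr (- (1/25))) * (1 + 12 * (X * (1 - 24 * X powr (- (1/25)))) powr (- (1/25)))) + K * (X * (1 - 24 * X powr (- (1/25)))) powr (9/10)) at_top"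
      by (rule eventually_compose_filterlim[OF K(3)])
    moreover have "eventually (\<lambda>X::real. X * (1 - 24 * X powr (- (1/25))) * (1 + 12 * (X * (1 - 24 * X powr (- (1/25)))) powr (- (1/25))) \<le> X) at_top"
      by real_asymp
    moreover have "eventually (\<lambda>X::real. (X * (1 - 24 * X powr (- (1/25)))) powr (9/10) \<le> X powr (9/10)) at_top"
      by real_asymp
    ultimately show "eventually (\<lambda>X. pair_cum \<sigma> (X * (1 - 24 * X powr (- (1/25)))) - K * X powr (9/10) \<le> mean_square \<sigma> X) at_top"
    proof eventually_elim
      case (elim X)
      have "K * (X * (1 - 24 * X powr (- (1/25)))) powr (9/10) \<le> K * X powr (9/10)"
        using elim(3) K(1) by (intro mult_left_mono)
      then show ?case using elim(1) mean_square_mono[OF assms elim(2)] by linarith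
    qed
  qed
qed

text \<open>The stretching factor differs from 1 by a negative power of X, which stays negligible
  after multiplication by ln X. Hence the sandwich preserves even the linear term.\<close>

theorem mean_square_half_asymp:
  "((\<lambda>X. mean_square (1/2) X / X - ln X) \<longlongrightarrow> 2 * euler_mascheroni - 1 - ln (2 * pi)) at_top"
proof -
  define A :: real where "A = 2 * euler_mascheroni - 1 - ln (2 * pi)"
  obtain K where K: "K \<ge> 0"
    "eventually (\<lambda>X. mean_square (1/2) X \<le> pair_cum (1/2) (X * (1 + 12 * X powr (- (1/25)))) + K * X powr (9/10)) at_top"
    "eventually (\<lambda>X. pair_cum (1/2) (X * (1 - 24 * X powr (- (1/25)))) - K * X powr (9/10) \<le> mean_square (1/2) X) at_top"
    by (rule mean_square_sandwich[of "1/2"]) auto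
  define g where "g = (\<lambda>X. pair_cum (1/2) X / X - ln X)"
  have g: "(g \<longlongrightarrow> A) at_top" unfolding g_def A_def by (rule pair_cum_half_asymp)
  \<comment> \<open>Treats both sides of the sandwich at once; w is the stretching factor and c is K
    or -K.\<close>
  have lim: "((\<lambda>X. pair_cum (1/2) (X * w X) / X + c * X powr (9/10) / X - ln X) \<longlongrightarrow> A) at_top"
    if w: "(w \<longlongrightarrow> 1) at_top" "((\<lambda>X. w X * ln (X * w X) - ln X) \<longlongrightarrow> 0) at_top" "filterlim (\<lambda>X. X * w X) at_top at_top" for w and c :: real
  proof -
    have "((\<lambda>X. w X * g (X * w X) + (w X * ln (X * w X) - ln X) + c * (X powr (9/10) / X)) \<longlongrightarrow> 1 * A + 0 + c * 0) at_top"
    proof (intro tendsto_add tendsto_mult w tendsto_const filterlim_compose[OF g])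
      show "((\<lambda>X::real. X powr (9/10) / X) \<longlongrightarrow> 0) at_top" by real_asymp
    qed
    moreover have "eventually (\<lambda>X. w X * g (X * w X) + (w X * ln (X * w X) - ln X) + c * (X powr (9/10) / X) =
       pair_cum (1/2) (X * w X) / X + c * X powr (9/10) / X - ln X) at_top"
      using eventually_gt_at_top[of 0] w(3)[unfolded filterlim_at_top_dense, rule_format, of 0]
      by eventually_elim (auto simp: g_def right_diff_distrib zero_less_mult_iff)
    ultimately have "((\<lambda>X. pair_cum (1/2) (X * w X) / X + c * X powr (9/10) / X - ln X) \<longlongrightarrow> 1 * A + 0 + c * 0) at_top"
      by (rule Lim_transform_eventually)
    then show ?thesis by simp
  qed
  have "((\<lambda>X. mean_square (1/2) X / X - ln X) \<longlongrightarrow> A) at_top"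
  proof (rule tendsto_sandwich)
    show "eventually (\<lambda>X. pair_cum (1/2) (X * (1 - 24 * X powr (- (1/25)))) / X + (-K) * X powr (9/10) / X - ln X \<le> mean_square (1/2) X / X - ln X) at_top"
      using K(3) eventually_gt_at_top[of 0]
    proof eventually_elim
      case (elim X)
      from divide_right_mono[OF elim(1), of X] elim(2) show ?case by (simp add: diff_divide_distrib)
    qed
    show "eventually (\<lambda>X. mean_square (1/2) X / X - ln X \<le> pair_cum (1/2) (X * (1 + 12 * X powr (- (1/25)))) / X + K * X powr (9/10) / X - ln X) at_top"
      using K(2) eventually_gt_at_top[of 0]
    proof eventually_elim
      case (elim X)
      from divide_right_mono[OF elim(1), of X] elim(2) show ?case by (simp add: add_divide_distrib)
    qed
    show "((\<lambda>X. pair_cum (1/2) (X * (1 - 24 * X powr (- (1/25)))) / X + (-K) * X powr (9/10) / X - ln X) \<longlongrightarrow> A) at_top"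
      by (rule lim; real_asymp)
    show "((\<lambda>X. pair_cum (1/2) (X * (1 + 12 * X powr (- (1/25)))) / X + K * X powr (9/10) / X - ln X) \<longlongrightarrow> A) at_top"
      by (rule lim; real_asymp)
  qed
  then show ?thesis by (simp add: A_def)
qed

text \<open>The pair sum has a power saving error and the stretching factor costs a negative power
  of X, so the total error is o(X / ln X). This rate is what an interval of length X / ln X
  requires.\<close>

lemma mean_square_right_asymp:
  assumes \<sigma>: "1/2 < \<sigma>" "\<sigma> < 1"
  shows "((\<lambda>X. (mean_square \<sigma> X - zeta_r (2 * \<sigma>) * X) * ln X / X) \<longlongrightarrow> 0) at_top"
proof -
  define Z where "Z = zeta_r (2 * \<sigma>)"
  have \<sigma>': "1/2 \<le> \<sigma>" using \<sigma> by simp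
  obtain K where K: "K \<ge> 0"
    "eventually (\<lambda>X. mean_square \<sigma> X \<le> pair_cum \<sigma> (X * (1 + 12 * X powr (- (1/25)))) + K * X powr (9/10)) at_top"
    "eventually (\<lambda>X. pair_cum \<sigma> (X * (1 - 24 * X powr (- (1/25)))) - K * X powr (9/10) \<le> mean_square \<sigma> X) at_top"
    by (rule mean_square_sandwich[OF \<sigma>' \<sigma>(2)]) auto
  obtain K' where K': "K' \<ge> 0" "\<And>X. X \<ge> 1 \<Longrightarrow> \<bar>pair_cum \<sigma> X - Z * X\<bar> \<le> K' * X powr (2 - 2 * \<sigma>)"
    unfolding Z_def by (rule pair_cum_asymp[OF \<sigma>]) auto
  define g where "g = (\<lambda>X. (pair_cum \<sigma> X - Z * X) * ln X / X)"
  have g: "(g \<longlongrightarrow> 0) at_top"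
  proof (rule Lim_null_comparison)
    show "eventually (\<lambda>X. norm (g X) \<le> K' * (X powr (2 - 2 * \<sigma>) * ln X / X)) at_top"
      using eventually_ge_at_top[of 1]
    proof eventually_elim
      case (elim X)
      have "norm (g X) = \<bar>pair_cum \<sigma> X - Z * X\<bar> * (ln X / X)" using elim by (simp add: g_def abs_mult)
      also have "\<dots> \<le> K' * X powr (2 - 2 * \<sigma>) * (ln X / X)" using elim by (intro mult_right_mono K') auto
      finally show ?case by simp
    qed
    have "2 - 2 * \<sigma> < 1" using \<sigma> by simp
    then have "((\<lambda>X. X powr (2 - 2 * \<sigma>) * ln X / X) \<longlongrightarrow> 0) at_top" by real_asymp
    then have "((\<lambda>X. K' * (X powr (2 - 2 * \<sigma>) * ln X / X)) \<longlongrightarrow> K' * 0) at_top" by (intro tendsto_mult tendsto_const)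
    then show "((\<lambda>X. K' * (X powr (2 - 2 * \<sigma>) * ln X / X)) \<longlongrightarrow> 0) at_top" by simp
  qed
  have lim: "((\<lambda>X. (pair_cum \<sigma> (X * w X) + c * X powr (9/10) - Z * X) * ln X / X) \<longlongrightarrow> 0) at_top"
    if w: "((\<lambda>X. w X * (ln X / ln (X * w X))) \<longlongrightarrow> 1) at_top" "((\<lambda>X. (w X - 1) * ln X) \<longlongrightarrow> 0) at_top" "filterlim (\<lambda>X. X * w X) at_top at_top" for w and c :: real
  proof -
    have "((\<lambda>X. g (X * w X) * (w X * (ln X / ln (X * w X))) + Z * ((w X - 1) * ln X) + c * (X powr (9/10) * ln X / X)) \<longlongrightarrow> 0 * 1 + Z * 0 + c * 0) at_top"
    proof (intro tendsto_add tendsto_mult w tendsto_const filterlim_compose[OF g])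
      show "((\<lambda>X::real. X powr (9/10) * ln X / X) \<longlongrightarrow> 0) at_top" by real_asymp
    qed
    moreover have "eventually (\<lambda>X. g (X * w X) * (w X * (ln X / ln (X * w X))) + Z * ((w X - 1) * ln X) + c * (X powr (9/10) * ln X / X) =
       (pair_cum \<sigma> (X * w X) + c * X powr (9/10) - Z * X) * ln X / X) at_top"
      using eventually_gt_at_top[of 0] w(3)[unfolded filterlim_at_top_dense, rule_format, of 1]
    proof eventually_elim
      case (elim X)
      define U where "U = X * w X"
      have U: "U > 1" "w X = U / X" using elim by (auto simp: U_def)
      have lu: "ln U \<noteq> 0" using U by simp
      show ?case unfolding U_def[symmetric] U(2) g_def using elim(1) U(1) lu
        by (simp add: field_simps)
    qed
    ultimately have "((\<lambda>X. (pair_cum \<sigma> (X * w X) + c * X powr (9/10) - Z * X) * ln X / X) \<longlongrightarrow> 0 * 1 + Z * 0 + c * 0) at_top"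
      by (rule Lim_transform_eventually)
    then show ?thesis by simp
  qed
  have "((\<lambda>X. (mean_square \<sigma> X - Z * X) * ln X / X) \<longlongrightarrow> 0) at_top"
  proof (rule tendsto_sandwich)
    show "eventually (\<lambda>X. (pair_cum \<sigma> (X * (1 - 24 * X powr (- (1/25)))) + (-K) * X powr (9/10) - Z * X) * ln X / X \<le> (mean_square \<sigma> X - Z * X) * ln X / X) at_top"
      using K(3) eventually_ge_at_top[of 1]
      by eventually_elim (intro divide_right_mono mult_right_mono, auto)
    show "eventually (\<lambda>X. (mean_square \<sigma> X - Z * X) * ln X / X \<le> (pair_cum \<sigma> (X * (1 + 12 * X powr (- (1/25)))) + K * X powr (9/10) - Z * X) * ln X / X) at_top"
      using K(2) eventually_ge_at_top[of 1]
      by eventually_elim (intro divide_right_mono mult_right_mono, auto)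
    show "((\<lambda>X. (pair_cum \<sigma> (X * (1 - 24 * X powr (- (1/25)))) + (-K) * X powr (9/10) - Z * X) * ln X / X) \<longlongrightarrow> 0) at_top"
      by (rule lim; real_asymp)
    show "((\<lambda>X. (pair_cum \<sigma> (X * (1 + 12 * X powr (- (1/25)))) + K * X powr (9/10) - Z * X) * ln X / X) \<longlongrightarrow> 0) at_top"
      by (rule lim; real_asymp)
  qed
  then show ?thesis by (simp add: Z_def)
qed

section \<open>The mean square to the right of the critical line\<close>

definition dirichlet_poly :: "real \<Rightarrow> nat \<Rightarrow> real \<Rightarrow> complex" where
  "dirichlet_poly \<sigma> N t = (\<Sum>k<N. of_nat (Suc k) powr (- Complex \<sigma> t))"

definition harm_sum :: "nat \<Rightarrow> real" where
  "harm_sum N = (\<Sum>k<N. 1 / real (Suc k))"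

text \<open>\<open>zreg_approx\<close> divided by s - 1. The length is at least of order t^2, so the
  remainder norm s / M is O(1/t); the boundary term M powr (1 - s) / (s - 1) is O(1/t) because
  \<sigma> \<ge> 1. An error 1/t costs a single logarithm after integration.\<close>

lemma zeta_dirichlet_poly_approx:
  assumes "\<sigma> \<ge> 1" "t \<ge> 1" "t \<le> T" "T\<^sup>2 \<le> real (Suc N)"
  shows "norm (zeta (Complex \<sigma> t) - dirichlet_poly \<sigma> N t) \<le> (2 * \<sigma> + 3) / t"
proof -
  define s where "s = Complex \<sigma> t"
  define M where "M = real (Suc N)"
  have s: "Re s = \<sigma>" "Re s > 0" "s \<noteq> 1" "s - 1 \<noteq> 0" using assms by (auto simp: s_def complex_eq_iff)
  have M1: "M \<ge> 1" by (simp add: M_def)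
  have ns: "t \<le> norm (s - 1)" using abs_Im_le_cmod[of "s - 1"] by (simp add: s_def)
  have ns2: "norm s \<le> \<sigma> + t" using cmod_le[of s] assms by (simp add: s_def)
  have le1: "M powr (1 - \<sigma>) \<le> 1" using M1 assms(1) powr_mono[of "1 - \<sigma>" 0 M] by simp
  have Mp: "M powr (- \<sigma>) \<le> 1 / M" using powr_mono[of "-\<sigma>" "-1" M] M1 assms(1) by (simp add: powr_minus_divide)
  have T: "T \<ge> 1" using assms by simp
  have tT: "t * t \<le> M" using assms mult_mono[of t T t T] by (simp add: power2_eq_square M_def)
  have M': "1 / M \<le> 1 / (t * t)" using tT assms(2) by (intro divide_left_mono mult_pos_pos) (use M1 in auto)
  have "zeta s - dirichlet_poly \<sigma> N t = (zreg s - ((s - 1) * dirichlet_poly \<sigma> N t + of_nat (Suc N) powr (1 - s))) / (s - 1) + of_nat (Suc N) powr (1 - s) / (s - 1)"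
    using s zeta_conv_zreg[of s] by (simp add: diff_divide_distrib add_divide_distrib)
  also have "norm \<dots> \<le> norm ((zreg s - ((s - 1) * dirichlet_poly \<sigma> N t + of_nat (Suc N) powr (1 - s))) / (s - 1)) + norm (of_nat (Suc N) powr (1 - s) / (s - 1))"
    by (rule norm_triangle_ineq)
  also have "norm ((zreg s - ((s - 1) * dirichlet_poly \<sigma> N t + of_nat (Suc N) powr (1 - s))) / (s - 1)) \<le>
      norm (s - 1) * norm s * (1 + 1 / Re s) * M powr (- Re s) / norm (s - 1)"
    unfolding norm_divide dirichlet_poly_def s_def[symmetric] M_def by (intro divide_right_mono zreg_approx s(2)) auto
  also have "\<dots> = norm s * ((1 + 1 / \<sigma>) * M powr (- \<sigma>))" using s by simp
  also have "\<dots> \<le> (\<sigma> + t) * (2 * (1 / (t * t)))"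
    using assms ns2 Mp M' by (intro mult_mono) auto
  also have "\<dots> \<le> ((2 * \<sigma> + 2) * t) * (1 / (t * t))"
  proof -
    have "\<sigma> + t \<le> (\<sigma> + 1) * t" using mult_left_mono[of 1 t \<sigma>] assms by (simp add: algebra_simps)
    then have "(\<sigma> + t) * 2 \<le> (2 * \<sigma> + 2) * t" by (simp add: algebra_simps)
    then have "(\<sigma> + t) * 2 * (1 / (t * t)) \<le> ((2 * \<sigma> + 2) * t) * (1 / (t * t))"
      by (rule mult_right_mono) (simp add: zero_le_mult_iff)
    then show ?thesis by (simp only: mult.assoc)
  qed
  also have "\<dots> = (2 * \<sigma> + 2) / t" using assms by simp
  also have "norm (of_nat (Suc N) powr (1 - s) / (s - 1)) = M powr (1 - \<sigma>) / norm (s - 1)"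
    by (subst norm_divide, subst norm_powr_real_powr) (auto simp: s_def M_def)
  also have "\<dots> \<le> 1 / t" using assms ns le1 by (intro frac_le) auto
  finally show ?thesis by (simp add: s_def add_divide_distrib)
qed

lemma dirichlet_poly_term:
  "of_nat (Suc k) powr (- Complex \<sigma> t) =
     Complex (real (Suc k) powr (-\<sigma>) * cos (t * ln (real (Suc k)))) (- (real (Suc k) powr (-\<sigma>) * sin (t * ln (real (Suc k)))))"
proof -
  define x where "x = real (Suc k)"
  have x: "x > 0" by (simp add: x_def)
  have "complex_of_real x powr (- Complex \<sigma> t) = exp (- Complex \<sigma> t * of_real (ln x))"
    using x by (simp add: powr_def Ln_of_real)
  also have "\<dots> = Complex (x powr (-\<sigma>) * cos (t * ln x)) (- (x powr (-\<sigma>) * sin (t * ln x)))"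
    using x by (simp add: complex_eq_iff Re_exp Im_exp powr_def)
  finally show ?thesis by (simp add: x_def)
qed

lemma norm_dirichlet_poly_sq:
  "(norm (dirichlet_poly \<sigma> N t))\<^sup>2 = (\<Sum>j<N. \<Sum>k<N. real (Suc j) powr (-\<sigma>) * real (Suc k) powr (-\<sigma>) * cos (t * (ln (real (Suc j)) - ln (real (Suc k)))))"
proof -
  have "Re (dirichlet_poly \<sigma> N t) = (\<Sum>k<N. real (Suc k) powr (-\<sigma>) * cos (t * ln (real (Suc k))))"
    "Im (dirichlet_poly \<sigma> N t) = - (\<Sum>k<N. real (Suc k) powr (-\<sigma>) * sin (t * ln (real (Suc k))))"
    unfolding dirichlet_poly_def dirichlet_poly_term by (simp_all add: sum_negf)
  then have "(norm (dirichlet_poly \<sigma> N t))\<^sup>2 =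
      (\<Sum>j<N. \<Sum>k<N. real (Suc j) powr (-\<sigma>) * cos (t * ln (real (Suc j))) * (real (Suc k) powr (-\<sigma>) * cos (t * ln (real (Suc k))))) +
      (\<Sum>j<N. \<Sum>k<N. real (Suc j) powr (-\<sigma>) * sin (t * ln (real (Suc j))) * (real (Suc k) powr (-\<sigma>) * sin (t * ln (real (Suc k)))))"
    unfolding cmod_power2 by (simp only: power2_minus power2_eq_square sum_product minus_mult_minus)
  also have "\<dots> = (\<Sum>j<N. \<Sum>k<N. real (Suc j) powr (-\<sigma>) * real (Suc k) powr (-\<sigma>) * cos (t * (ln (real (Suc j)) - ln (real (Suc k)))))"
    unfolding sum.distrib[symmetric] by (intro sum.cong refl) (simp add: right_diff_distrib cos_diff algebra_simps)
  finally show ?thesis .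
qed

text \<open>The inequality ln x \<le> x - 1 at the quotient of the smaller by the larger number
  bounds the frequency from below.\<close>

lemma inverse_ln_quotient_le:
  assumes "j < k"
  shows "1 / \<bar>ln (real (Suc j)) - ln (real (Suc k))\<bar> \<le> real (Suc k) / (real k - real j)"
proof -
  have "1 - real (Suc j) / real (Suc k) \<le> - ln (real (Suc j) / real (Suc k))"
    using ln_le_minus_one[of "real (Suc j) / real (Suc k)"] by (simp del: of_nat_Suc)
  also have "1 - real (Suc j) / real (Suc k) = (real k - real j) / real (Suc k)"
    by (simp add: diff_divide_distrib[symmetric] divide_simps)
  also have "- ln (real (Suc j) / real (Suc k)) = \<bar>ln (real (Suc j)) - ln (real (Suc k))\<bar>"
    using assms by (subst ln_div) auto
  finally have *: "(real k - real j) / real (Suc k) \<le> \<bar>ln (real (Suc j)) - ln (real (Suc k))\<bar>" .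
  have "0 < (real k - real j) / real (Suc k)" using assms by simp
  from le_imp_inverse_le[OF * this] show ?thesis by (simp add: inverse_eq_divide)
qed

text \<open>The factor Suc k lost in \<open>inverse_ln_quotient_le\<close> cancels against the
  weight of the larger index. The right side is symmetrised so that later sums need no distinction
  between j < k and k < j.\<close>

lemma dirichlet_poly_weight_le:
  assumes "j \<noteq> k" "\<sigma> \<ge> 1"
  shows "real (Suc j) powr (-\<sigma>) * real (Suc k) powr (-\<sigma>) * (2 / \<bar>ln (real (Suc j)) - ln (real (Suc k))\<bar>) \<le>
     2 * (1 / real (Suc j) * (1 / \<bar>real j - real k\<bar>) + 1 / real (Suc k) * (1 / \<bar>real j - real k\<bar>))"
proof -
  have main: "real (Suc j) powr (-\<sigma>) * real (Suc k) powr (-\<sigma>) * (2 / \<bar>ln (real (Suc j)) - ln (real (Suc k))\<bar>) \<le>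
     2 * (1 / real (Suc j) * (1 / \<bar>real j - real k\<bar>))" if jk: "j < k" for j k
  proof -
    have p: "real (Suc i) powr (-\<sigma>) \<le> 1 / real (Suc i)" for i
      using powr_mono[of "-\<sigma>" "-1" "real (Suc i)"] assms(2) by (simp add: powr_minus_divide)
    have "real (Suc j) powr (-\<sigma>) * real (Suc k) powr (-\<sigma>) * (2 / \<bar>ln (real (Suc j)) - ln (real (Suc k))\<bar>) \<le>
        1 / real (Suc j) * (1 / real (Suc k)) * (2 * (real (Suc k) / (real k - real j)))"
    proof (intro mult_mono p)
      show "2 / \<bar>ln (real (Suc j)) - ln (real (Suc k))\<bar> \<le> 2 * (real (Suc k) / (real k - real j))"
        using mult_left_mono[OF inverse_ln_quotient_le[OF jk], of 2] by simp
    qed auto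
    also have "\<dots> = 2 * (1 / real (Suc j) * (1 / \<bar>real j - real k\<bar>))"
    proof -
      have "1 / u * (1 / v) * (2 * (v / w)) = 2 * (1 / u * (1 / w))" if "v \<noteq> 0" for u v w :: real
        using that by simp
      from this[of "real (Suc k)" "real (Suc j)" "real k - real j"] show ?thesis using jk by (simp del: of_nat_Suc)
    qed
    finally show ?thesis .
  qed
  show ?thesis
  proof (cases "j < k")
    case True
    have "0 \<le> 1 / real (Suc k) * (1 / \<bar>real j - real k\<bar>)" by simp
    then show ?thesis using main[OF True] unfolding distrib_left by linarith
  next
    case False
    then have "k < j" using assms by simp
    have "0 \<le> 1 / real (Suc j) * (1 / \<bar>real j - real k\<bar>)" by simp
    then show ?thesis
      using main[OF \<open>k < j\<close>] unfolding distrib_left abs_minus_commute[of "real k" "real j"]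
        abs_minus_commute[of "ln (real (Suc k))"] mult.commute[of "real (Suc k) powr _" "real (Suc j) powr _"] by linarith
  qed
qed

lemma harm_sum_mono: "M \<le> N \<Longrightarrow> harm_sum M \<le> harm_sum N"
  unfolding harm_sum_def by (intro sum_mono2) auto

lemma harm_sum_nonneg: "harm_sum N \<ge> 0" unfolding harm_sum_def by (intro sum_nonneg) auto

text \<open>A small power in place of the logarithm: with N of order T^2 its square is of order T
  powr (2/5), far below T / ln T.\<close>

lemma harm_sum_le: "harm_sum N \<le> 10 * real N powr (1/10)"
proof -
  have "harm_sum N \<le> (\<Sum>n<N. real (Suc n) powr (-(9/10)))"
    unfolding harm_sum_def
  proof (intro sum_mono)
    fix n
    show "1 / real (Suc n) \<le> real (Suc n) powr (-(9/10))"
      using powr_mono[of "-1" "-(9/10)" "real (Suc n)"] by (simp add: powr_minus_divide)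
  qed
  also have "\<dots> \<le> real N powr (1 - 9/10) / (1 - 9/10)" by (rule sum_powr_neg_le) auto
  finally show ?thesis by simp
qed

lemma sum_inverse_distance_le:
  assumes "j < N"
  shows "(\<Sum>k\<in>{..<N} - {j}. 1 / \<bar>real j - real k\<bar>) \<le> 2 * harm_sum N"
proof -
  have eq: "{..<N} - {j} = {..<j} \<union> {Suc j..<N}" using assms by auto
  have "(\<Sum>k<j. 1 / \<bar>real j - real k\<bar>) = (\<Sum>k<j. 1 / real (Suc (j - Suc k)))"
    by (intro sum.cong refl) (auto simp: of_nat_diff)
  also have "\<dots> = harm_sum j"
    unfolding harm_sum_def by (rule sum.nat_diff_reindex)
  finally have 1: "(\<Sum>k<j. 1 / \<bar>real j - real k\<bar>) \<le> harm_sum N" using harm_sum_mono[of j N] assms by simp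
  have "(\<Sum>k=Suc j..<N. 1 / \<bar>real j - real k\<bar>) = (\<Sum>i=0..<N - Suc j. 1 / \<bar>real j - real (i + Suc j)\<bar>)"
    using sum.shift_bounds_nat_ivl[of "\<lambda>k. 1 / \<bar>real j - real k\<bar>" 0 "Suc j" "N - Suc j"] assms by simp
  also have "\<dots> = harm_sum (N - Suc j)"
    unfolding harm_sum_def by (intro sum.cong) auto
  finally have 2: "(\<Sum>k=Suc j..<N. 1 / \<bar>real j - real k\<bar>) \<le> harm_sum N" using harm_sum_mono[of "N - Suc j" N] by simp
  have "(\<Sum>k\<in>{..<N} - {j}. 1 / \<bar>real j - real k\<bar>) = (\<Sum>k<j. 1 / \<bar>real j - real k\<bar>) + (\<Sum>k=Suc j..<N. 1 / \<bar>real j - real k\<bar>)"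
    unfolding eq by (rule sum.union_disjoint) auto
  then show ?thesis using 1 2 by simp
qed

lemma sum_off_diagonal_le:
  "(\<Sum>j<N. \<Sum>k\<in>{..<N} - {j}. 1 / real (Suc j) * (1 / \<bar>real j - real k\<bar>)) \<le> 2 * (harm_sum N)\<^sup>2"
proof -
  have "(\<Sum>j<N. \<Sum>k\<in>{..<N} - {j}. 1 / real (Suc j) * (1 / \<bar>real j - real k\<bar>)) \<le> (\<Sum>j<N. 1 / real (Suc j) * (2 * harm_sum N))"
    unfolding sum_distrib_left[symmetric] by (intro sum_mono mult_left_mono sum_inverse_distance_le) auto
  also have "\<dots> = 2 * (harm_sum N)\<^sup>2"
    unfolding sum_distrib_right[symmetric] harm_sum_def[symmetric] by (simp add: power2_eq_square)
  finally show ?thesis .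
qed

lemma integral_cos_bound:
  fixes w T :: real
  assumes "w \<noteq> 0" "1 \<le> T"
  shows "\<bar>integral {1..T} (\<lambda>t. cos (t * w))\<bar> \<le> 2 / \<bar>w\<bar>"
proof -
  have "((\<lambda>t. cos (t * w)) has_integral (sin (T * w) / w - sin (1 * w) / w)) {1..T}"
    using assms by (intro fundamental_theorem_of_calculus)
      (auto intro!: derivative_eq_intros simp flip: has_real_derivative_iff_has_vector_derivative)
  then have "integral {1..T} (\<lambda>t. cos (t * w)) = (sin (T * w) - sin w) / w"
    by (simp add: integral_unique diff_divide_distrib)
  also have "\<bar>\<dots>\<bar> \<le> 2 / \<bar>w\<bar>"
    unfolding abs_divide using abs_sin_le_one[of "T * w"] abs_sin_le_one[of w] by (intro divide_right_mono) linarith+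
  finally show ?thesis .
qed

text \<open>The diagonal gives the main term. Off the diagonal the cosine integrates to at most 2
  over the frequency, and the symmetrised weights reduce the double sum to products of two harmonic
  sums.\<close>

lemma dirichlet_poly_mean_square:
  assumes "\<sigma> \<ge> 1" "T \<ge> 1"
  shows "(\<lambda>t. (norm (dirichlet_poly \<sigma> N t))\<^sup>2) integrable_on {1..T}"
    and "\<bar>integral {1..T} (\<lambda>t. (norm (dirichlet_poly \<sigma> N t))\<^sup>2) - (T - 1) * (\<Sum>k<N. real (Suc k) powr (-(2*\<sigma>)))\<bar> \<le> 8 * (harm_sum N)\<^sup>2"
proof -
  define c where "c = (\<lambda>j k. real (Suc j) powr (-\<sigma>) * real (Suc k) powr (-\<sigma>))"
  define l where "l = (\<lambda>j k. ln (real (Suc j)) - ln (real (Suc k)))"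
  have eq: "(\<lambda>t. (norm (dirichlet_poly \<sigma> N t))\<^sup>2) = (\<lambda>t. \<Sum>j<N. \<Sum>k<N. c j k * cos (t * l j k))"
    unfolding norm_dirichlet_poly_sq c_def l_def ..
  have int: "(\<lambda>t. c j k * cos (t * l j k)) integrable_on {1..T}" for j k
    by (intro integrable_continuous_interval continuous_intros)
  show "(\<lambda>t. (norm (dirichlet_poly \<sigma> N t))\<^sup>2) integrable_on {1..T}"
    unfolding eq by (intro integrable_sum int) auto
  have "integral {1..T} (\<lambda>t. (norm (dirichlet_poly \<sigma> N t))\<^sup>2) = (\<Sum>j<N. \<Sum>k<N. c j k * integral {1..T} (\<lambda>t. cos (t * l j k)))"
    unfolding eq by (simp add: integral_sum integrable_sum int)
  also have "\<dots> = (\<Sum>j<N. c j j * integral {1..T} (\<lambda>t. cos (t * l j j)) + (\<Sum>k\<in>{..<N} - {j}. c j k * integral {1..T} (\<lambda>t. cos (t * l j k))))"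
    by (intro sum.cong refl sum.remove) auto
  also have "\<dots> = (\<Sum>j<N. (T - 1) * real (Suc j) powr (-(2*\<sigma>))) + (\<Sum>j<N. \<Sum>k\<in>{..<N} - {j}. c j k * integral {1..T} (\<lambda>t. cos (t * l j k)))"
    unfolding sum.distrib using assms by (simp add: c_def l_def powr_add[symmetric] mult.commute)
  finally have "integral {1..T} (\<lambda>t. (norm (dirichlet_poly \<sigma> N t))\<^sup>2) - (T - 1) * (\<Sum>k<N. real (Suc k) powr (-(2*\<sigma>))) =
      (\<Sum>j<N. \<Sum>k\<in>{..<N} - {j}. c j k * integral {1..T} (\<lambda>t. cos (t * l j k)))"
    by (simp add: sum_distrib_left)
  also have "\<bar>\<dots>\<bar> \<le> (\<Sum>j<N. \<Sum>k\<in>{..<N} - {j}. \<bar>c j k * integral {1..T} (\<lambda>t. cos (t * l j k))\<bar>)"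
    by (intro order.trans[OF sum_abs] sum_mono sum_abs)
  also have "\<dots> \<le> (\<Sum>j<N. \<Sum>k\<in>{..<N} - {j}. 2 * (1 / real (Suc j) * (1 / \<bar>real j - real k\<bar>) + 1 / real (Suc k) * (1 / \<bar>real j - real k\<bar>)))"
  proof (intro sum_mono)
    fix j k assume "k \<in> {..<N} - {j}"
    then have jk: "j \<noteq> k" by auto
    have l0: "l j k \<noteq> 0" using jk by (simp add: l_def)
    have "\<bar>c j k * integral {1..T} (\<lambda>t. cos (t * l j k))\<bar> = c j k * \<bar>integral {1..T} (\<lambda>t. cos (t * l j k))\<bar>"
      by (simp add: abs_mult c_def)
    also have "\<dots> \<le> c j k * (2 / \<bar>l j k\<bar>)"
      by (intro mult_left_mono integral_cos_bound l0 assms) (simp add: c_def)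
    also have "\<dots> \<le> 2 * (1 / real (Suc j) * (1 / \<bar>real j - real k\<bar>) + 1 / real (Suc k) * (1 / \<bar>real j - real k\<bar>))"
      unfolding c_def l_def by (rule dirichlet_poly_weight_le[OF jk assms(1)])
    finally show "\<bar>c j k * integral {1..T} (\<lambda>t. cos (t * l j k))\<bar> \<le> \<dots>" .
  qed
  also have "\<dots> = 2 * ((\<Sum>j<N. \<Sum>k\<in>{..<N} - {j}. 1 / real (Suc j) * (1 / \<bar>real j - real k\<bar>)) + (\<Sum>j<N. \<Sum>k\<in>{..<N} - {j}. 1 / real (Suc k) * (1 / \<bar>real j - real k\<bar>)))"
    by (simp only: sum_distrib_left sum.distrib distrib_left)
  also have "(\<Sum>j<N. \<Sum>k\<in>{..<N} - {j}. 1 / real (Suc k) * (1 / \<bar>real j - real k\<bar>)) = (\<Sum>k<N. \<Sum>j\<in>{..<N} - {k}. 1 / real (Suc k) * (1 / \<bar>real k - real j\<bar>))"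
  proof -
    have "(\<Sum>j<N. \<Sum>k\<in>{..<N} - {j}. f j k) = (\<Sum>k<N. \<Sum>j\<in>{..<N} - {k}. f j k)" for f :: "nat \<Rightarrow> nat \<Rightarrow> real"
      unfolding sum.Sigma[OF finite_lessThan ballI[OF finite_Diff[OF finite_lessThan]]]
      by (rule sum.reindex_bij_witness[of _ prod.swap prod.swap]) auto
    from this[of "\<lambda>j k. 1 / real (Suc k) * (1 / \<bar>real j - real k\<bar>)"] show ?thesis
      by (subst abs_minus_commute)
  qed
  also have "2 * ((\<Sum>j<N. \<Sum>k\<in>{..<N} - {j}. 1 / real (Suc j) * (1 / \<bar>real j - real k\<bar>)) + \<dots>) \<le> 2 * (2 * (harm_sum N)\<^sup>2 + 2 * (harm_sum N)\<^sup>2)"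
    by (intro mult_left_mono add_mono sum_off_diagonal_le) auto
  finally show "\<bar>integral {1..T} (\<lambda>t. (norm (dirichlet_poly \<sigma> N t))\<^sup>2) - (T - 1) * (\<Sum>k<N. real (Suc k) powr (-(2*\<sigma>)))\<bar> \<le> 8 * (harm_sum N)\<^sup>2"
    by simp
qed

lemma norm_dirichlet_poly_le:
  assumes "\<sigma> \<ge> 1"
  shows "norm (dirichlet_poly \<sigma> N t) \<le> harm_sum N"
  unfolding dirichlet_poly_def harm_sum_def
proof (rule sum_norm_le)
  fix k
  have "norm (of_nat (Suc k) powr (- Complex \<sigma> t)) = real (Suc k) powr (-\<sigma>)"
    by (subst norm_powr_real_powr) auto
  also have "\<dots> \<le> 1 / real (Suc k)"
    using powr_mono[of "-\<sigma>" "-1" "real (Suc k)"] assms by (simp add: powr_minus_divide)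
  finally show "norm (of_nat (Suc k) powr (- Complex \<sigma> t)) \<le> 1 / real (Suc k)" .
qed

lemma integrable_zeta_square:
  assumes "0 < a"
  shows "(\<lambda>t. (norm (zeta (Complex \<sigma> t)))\<^sup>2) integrable_on {a..b}"
proof (intro integrable_continuous_interval continuous_intros)
  have "continuous_on {a..b} (\<lambda>t. Complex \<sigma> t)" unfolding complex_of_real_i[symmetric] Complex_eq by (intro continuous_intros)
  moreover have "(\<lambda>t. Complex \<sigma> t) ` {a..b} \<subseteq> - {1}" using assms by (auto simp: complex_eq_iff)
  ultimately show "continuous_on {a..b} (\<lambda>t. zeta (Complex \<sigma> t))"
    using continuous_on_compose2[OF holomorphic_on_imp_continuous_on[OF zeta_holomorphic]] by blast
qed

text \<open>Here N is T^2 rounded up. The difference |zeta|^2 - |polynomial|^2 factors into a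
  difference at most C / t and a sum at most 2 H + C, so it integrates to a multiple of ln T. The
  constants 40 and 3200 come from H \<le> 20 T powr (1/5).\<close>

lemma zeta_mean_square_right:
  assumes "\<sigma> \<ge> 1" "T \<ge> 1"
  shows "\<bar>integral {1..T} (\<lambda>t. (norm (zeta (Complex \<sigma> t)))\<^sup>2) - zeta_r (2 * \<sigma>) * T\<bar> \<le>
    (40 * (2 * \<sigma> + 3) * T powr (1/5) + (2 * \<sigma> + 3)\<^sup>2) * ln T + 3200 * T powr (2/5) + zeta_r (2 * \<sigma>) + 2"
proof -
  define N where "N = nat \<lceil>T\<^sup>2\<rceil>"
  have N: "T\<^sup>2 \<le> real N" "real N \<le> 2 * T\<^sup>2"
  proof -
    have "1 \<le> T\<^sup>2" using assms(2) by (rule one_le_power)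
    then show "T\<^sup>2 \<le> real N" "real N \<le> 2 * T\<^sup>2"
      using of_int_ceiling_le_add_one[of "T\<^sup>2"] unfolding N_def by linarith+
  qed
  define C where "C = 2 * \<sigma> + 3"
  define H where "H = harm_sum N"
  define S where "S = (\<Sum>k<N. real (Suc k) powr (-(2*\<sigma>)))"
  define A where "A = integral {1..T} (\<lambda>t. (norm (zeta (Complex \<sigma> t)))\<^sup>2)"
  define B where "B = integral {1..T} (\<lambda>t. (norm (dirichlet_poly \<sigma> N t))\<^sup>2)"
  have C0: "C > 0" using assms by (simp add: C_def)
  have H0: "H \<ge> 0" by (simp add: H_def harm_sum_nonneg)
  have lnint: "((\<lambda>t. (2 * H * C + C\<^sup>2) * (1 / t)) has_integral (2 * H * C + C\<^sup>2) * (ln T - ln 1)) {1..T}"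
    using assms by (intro has_integral_mult_right fundamental_theorem_of_calculus)
      (auto intro!: derivative_eq_intros simp flip: has_real_derivative_iff_has_vector_derivative)
  have "\<bar>A - B\<bar> = norm (integral {1..T} (\<lambda>t. (norm (zeta (Complex \<sigma> t)))\<^sup>2 - (norm (dirichlet_poly \<sigma> N t))\<^sup>2))"
    unfolding A_def B_def by (subst integral_diff) (auto intro: integrable_zeta_square dirichlet_poly_mean_square assms)
  also have "\<dots> \<le> integral {1..T} (\<lambda>t. (2 * H * C + C\<^sup>2) * (1 / t))"
  proof (intro Henstock_Kurzweil_Integration.integral_norm_bound_integral ballI)
    show "(\<lambda>t. (norm (zeta (Complex \<sigma> t)))\<^sup>2 - (norm (dirichlet_poly \<sigma> N t))\<^sup>2) integrable_on {1..T}"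
      by (intro integrable_diff integrable_zeta_square dirichlet_poly_mean_square assms) auto
    show "(\<lambda>t. (2 * H * C + C\<^sup>2) * (1 / t)) integrable_on {1..T}" using lnint by blast
    fix t assume t: "t \<in> {1..T}"
    define z d where "z = norm (zeta (Complex \<sigma> t))" and "d = norm (dirichlet_poly \<sigma> N t)"
    have zd: "\<bar>z - d\<bar> \<le> C / t"
      unfolding z_def d_def C_def
      by (rule order.trans[OF norm_triangle_ineq3 zeta_dirichlet_poly_approx[of _ _ T]]) (use assms t N in auto)
    have d: "d \<le> H" "0 \<le> d" unfolding d_def H_def by (auto intro: norm_dirichlet_poly_le assms)
    have Ct: "C / t \<le> C" using t C0 by (simp add: divide_le_eq)
    have "z + d \<le> 2 * H + C" using zd d Ct by linarith
    moreover have "0 \<le> z + d" by (simp add: z_def d_def)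
    ultimately have "\<bar>z - d\<bar> * (z + d) \<le> C / t * (2 * H + C)"
      using zd C0 t by (intro mult_mono) auto
    moreover have "\<bar>z\<^sup>2 - d\<^sup>2\<bar> = \<bar>z - d\<bar> * (z + d)"
      using \<open>0 \<le> z + d\<close> by (simp add: power2_eq_square square_diff_square_factored abs_mult)
    ultimately show "norm ((norm (zeta (Complex \<sigma> t)))\<^sup>2 - (norm (dirichlet_poly \<sigma> N t))\<^sup>2) \<le> (2 * H * C + C\<^sup>2) * (1 / t)"
      unfolding z_def[symmetric] d_def[symmetric] by (simp add: algebra_simps power2_eq_square add_divide_distrib)
  qed
  also have "\<dots> = (2 * H * C + C\<^sup>2) * ln T" using lnint by (simp add: integral_unique)
  finally have AB: "\<bar>A - B\<bar> \<le> (2 * H * C + C\<^sup>2) * ln T" .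
  have BS: "\<bar>B - (T - 1) * S\<bar> \<le> 8 * H\<^sup>2"
    unfolding B_def S_def H_def by (rule dirichlet_poly_mean_square[OF assms])
  have H20: "H \<le> 20 * T powr (1/5)"
  proof -
    have "H \<le> 10 * real N powr (1/10)" unfolding H_def by (rule harm_sum_le)
    also have "real N powr (1/10) \<le> (2 * T\<^sup>2) powr (1/10)" using N by (intro powr_mono2) auto
    also have "\<dots> = 2 powr (1/10) * T powr (1/5)"
      using assms by (simp add: powr_mult powr_powr flip: powr_numeral)
    also have "2 powr (1/10) \<le> (2::real)" using powr_mono[of "1/10" 1 "2::real"] by simp
    finally show ?thesis by (simp add: mult_right_mono)
  qed
  have HH: "8 * H\<^sup>2 \<le> 3200 * T powr (2/5)"
  proof -
    have "H\<^sup>2 \<le> (20 * T powr (1/5))\<^sup>2" by (intro power_mono H20 H0)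
    also have "\<dots> = 400 * T powr (2/5)" using assms by (simp add: power_mult_distrib power2_eq_square powr_add[symmetric])
    finally show ?thesis by simp
  qed
  have AB': "(2 * H * C + C\<^sup>2) * ln T \<le> (40 * C * T powr (1/5) + C\<^sup>2) * ln T"
    using H20 C0 assms by (intro mult_right_mono add_mono) auto
  define p where "p = 2 * \<sigma> - 1"
  have p: "p \<ge> 1" using assms by (simp add: p_def)
  have s: "(\<lambda>n. real (Suc n) powr (- (2 * \<sigma>))) sums zeta_r (2 * \<sigma>)" using assms by (intro zeta_r_sums) auto
  have tail: "zeta_r (2 * \<sigma>) - S = (\<Sum>m. real (Suc (m + N)) powr (- p - 1))"
    using suminf_split_initial_segment[OF sums_summable[OF s], of N] sums_unique[OF s] by (simp add: p_def S_def)
  have "0 \<le> (\<Sum>m. real (Suc (m + N)) powr (- p - 1))"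
    using p by (intro suminf_nonneg summable_ignore_initial_segment[OF summable_zreg_bound]) auto
  then have t0: "0 \<le> T * (zeta_r (2 * \<sigma>) - S)" unfolding tail using assms by simp
  have "zeta_r (2 * \<sigma>) - S \<le> (1 + 1 / p) * real (Suc N) powr (- p)"
    unfolding tail using p by (intro powr_neg_tail_le) auto
  also have "\<dots> \<le> 2 * real (Suc N) powr (-1)" using p by (intro mult_mono powr_mono) auto
  also have "\<dots> \<le> 2 * (1 / T)"
  proof -
    have "T \<le> real (Suc N)" using N assms power_increasing[of 1 2 T] by simp
    then show ?thesis using assms by (simp add: powr_minus_divide frac_le del: of_nat_Suc)
  qed
  finally have "T * (zeta_r (2 * \<sigma>) - S) \<le> T * (2 * (1 / T))" using assms by (intro mult_left_mono) auto
  then have t1: "T * (zeta_r (2 * \<sigma>) - S) \<le> 2" using assms by simp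
  have S0: "0 \<le> S" "S \<le> zeta_r (2 * \<sigma>)" using t0 assms by (auto simp: S_def zero_le_mult_iff intro: sum_nonneg)
  have "A - zeta_r (2 * \<sigma>) * T = (A - B) + (B - (T - 1) * S) - S - T * (zeta_r (2 * \<sigma>) - S)"
    by (simp add: algebra_simps)
  then have "\<bar>A - zeta_r (2 * \<sigma>) * T\<bar> \<le> (40 * C * T powr (1/5) + C\<^sup>2) * ln T + 3200 * T powr (2/5) + zeta_r (2 * \<sigma>) + 2"
    using AB AB' BS HH t0 t1 S0 by linarith
  then show ?thesis by (simp add: A_def C_def)
qed

text \<open>Integration starts at 1 because for \<sigma> = 1 the segment from 0 meets the pole. For
  \<sigma> < 1 the part over [0, 1] is a constant, which the weight ln X / X removes.\<close>

theorem zeta_mean_square_asymp: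
  assumes \<sigma>: "1/2 < \<sigma>"
  shows "((\<lambda>X. (integral {1..X} (\<lambda>t. (norm (zeta (Complex \<sigma> t)))\<^sup>2) - zeta_r (2 * \<sigma>) * X) * ln X / X) \<longlongrightarrow> 0) at_top"
proof (cases "\<sigma> < 1")
  case True
  define c where "c = integral {0..1} (\<lambda>t. (norm (zeta (Complex \<sigma> t)))\<^sup>2)"
  have lim: "((\<lambda>X. (mean_square \<sigma> X - zeta_r (2 * \<sigma>) * X) * ln X / X - c * (ln X / X)) \<longlongrightarrow> 0 - c * 0) at_top"
    by (intro tendsto_diff mean_square_right_asymp \<sigma> True tendsto_mult tendsto_const) real_asymp
  have "eventually (\<lambda>X. (mean_square \<sigma> X - zeta_r (2 * \<sigma>) * X) * ln X / X - c * (ln X / X) =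
     (integral {1..X} (\<lambda>t. (norm (zeta (Complex \<sigma> t)))\<^sup>2) - zeta_r (2 * \<sigma>) * X) * ln X / X) at_top"
    using eventually_ge_at_top[of 1]
  proof eventually_elim
    case (elim X)
    have "(\<lambda>t. (norm (zeta (Complex \<sigma> t)))\<^sup>2) integrable_on {0..X}"
      using \<sigma> True by (intro integrable_continuous_interval continuous_intros zeta_vertical_continuous) auto
    from Henstock_Kurzweil_Integration.integral_combine[OF _ elim this]
    have "mean_square \<sigma> X = c + integral {1..X} (\<lambda>t. (norm (zeta (Complex \<sigma> t)))\<^sup>2)"
      using \<sigma> True by (simp add: mean_square_def c_def)
    then show ?case by (simp add: diff_divide_distrib algebra_simps add_divide_distrib)
  qed
  from Lim_transform_eventually[OF lim this] show ?thesis by simp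
next
  case False
  then have \<sigma>1: "\<sigma> \<ge> 1" by simp
  define C where "C = 2 * \<sigma> + 3"
  define D where "D = zeta_r (2 * \<sigma>) + 2"
  show ?thesis
  proof (rule Lim_null_comparison)
    show "eventually (\<lambda>X. norm ((integral {1..X} (\<lambda>t. (norm (zeta (Complex \<sigma> t)))\<^sup>2) - zeta_r (2 * \<sigma>) * X) * ln X / X)
       \<le> 40 * C * (X powr (1/5) * ln X * ln X / X) + C\<^sup>2 * (ln X * ln X / X) + 3200 * (X powr (2/5) * ln X / X) + D * (ln X / X)) at_top"
      using eventually_ge_at_top[of 1]
    proof eventually_elim
      case (elim X)
      have "norm ((integral {1..X} (\<lambda>t. (norm (zeta (Complex \<sigma> t)))\<^sup>2) - zeta_r (2 * \<sigma>) * X) * ln X / X) =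
         \<bar>integral {1..X} (\<lambda>t. (norm (zeta (Complex \<sigma> t)))\<^sup>2) - zeta_r (2 * \<sigma>) * X\<bar> * (ln X / X)"
        using elim by (simp add: abs_mult)
      also have "\<dots> \<le> ((40 * C * X powr (1/5) + C\<^sup>2) * ln X + 3200 * X powr (2/5) + zeta_r (2 * \<sigma>) + 2) * (ln X / X)"
        unfolding C_def using elim by (intro mult_right_mono zeta_mean_square_right \<sigma>1) auto
      also have "\<dots> = 40 * C * (X powr (1/5) * ln X * ln X / X) + C\<^sup>2 * (ln X * ln X / X) + 3200 * (X powr (2/5) * ln X / X) + D * (ln X / X)"
        by (simp add: D_def algebra_simps add_divide_distrib)
      finally show ?case .
    qed
    have "((\<lambda>X. 40 * C * (X powr (1/5) * ln X * ln X / X) + C\<^sup>2 * (ln X * ln X / X) + 3200 * (X powr (2/5) * ln X / X) + D * (ln X / X)) \<longlongrightarrow> 40 * C * 0 + C\<^sup>2 * 0 + 3200 * 0 + D * 0) at_top"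
      by (intro tendsto_add tendsto_mult tendsto_const; real_asymp)
    then show "((\<lambda>X. 40 * C * (X powr (1/5) * ln X * ln X / X) + C\<^sup>2 * (ln X * ln X / X) + 3200 * (X powr (2/5) * ln X / X) + D * (ln X / X)) \<longlongrightarrow> 0) at_top" by simp
  qed
qed

section \<open>Jacob's ladders\<close>

definition truncated_Gamma :: "real \<Rightarrow> real \<Rightarrow> real" where
  "truncated_Gamma p R = integral {0..R} (\<lambda>u. u powr p * exp (- u))"

lemma truncated_Gamma_tendsto:
  assumes "p > -1"
  shows "(truncated_Gamma p \<longlongrightarrow> Gamma (p + 1)) at_top"
proof -
  have "((\<lambda>t. t powr p * exp (- t)) has_integral Gamma (p + 1)) {0..}"
    using Gamma_integral_real[of "p + 1"] assms by (simp add: exp_minus divide_inverse[symmetric])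
  then have i: "(\<lambda>t. t powr p * exp (- t)) integrable_on {0..}" "integral {0..} (\<lambda>t. t powr p * exp (- t)) = Gamma (p + 1)"
    by (auto simp: has_integral_iff)
  have s: "set_integrable lebesgue {0..} (\<lambda>t. t powr p * exp (- t))"
    by (rule nonnegative_absolutely_integrable_1[OF i(1)]) auto
  have "((\<lambda>b. set_lebesgue_integral lebesgue {0..b} (\<lambda>t. t powr p * exp (- t))) \<longlongrightarrow> set_lebesgue_integral lebesgue {0..} (\<lambda>t. t powr p * exp (- t))) at_top"
    by (rule tendsto_set_lebesgue_integral_at_top[OF _ s]) auto
  moreover have "set_lebesgue_integral lebesgue {0..b} (\<lambda>t. t powr p * exp (- t)) = truncated_Gamma p b" for b
    unfolding truncated_Gamma_def by (rule set_lebesgue_integral_eq_integral, rule set_integrable_subset[OF s]) auto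
  moreover have "set_lebesgue_integral lebesgue {0..} (\<lambda>t. t powr p * exp (- t)) = Gamma (p + 1)"
    using set_lebesgue_integral_eq_integral(2)[OF s] i by simp
  ultimately show ?thesis by simp
qed

lemma truncated_Gamma_integral:
  assumes "p > -1"
  shows "((\<lambda>u. u powr p * exp (- u)) has_integral truncated_Gamma p R) {0..R}"
proof -
  have "((\<lambda>t. t powr p * exp (- t)) has_integral Gamma (p + 1)) {0..}"
    using Gamma_integral_real[of "p + 1"] assms by (simp add: exp_minus divide_inverse[symmetric])
  then have "(\<lambda>t. t powr p * exp (- t)) absolutely_integrable_on {0..}"
    by (intro nonnegative_absolutely_integrable_1) auto
  then have "(\<lambda>t. t powr p * exp (- t)) absolutely_integrable_on {0..R}"
    by (rule set_integrable_subset) auto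
  then show ?thesis unfolding truncated_Gamma_def by (simp add: set_lebesgue_integral_eq_integral(1) integrable_integral)
qed

lemma truncated_Gamma_1:
  assumes "R \<ge> 0"
  shows "truncated_Gamma 1 R = 1 - (R + 1) * exp (- R)"
proof -
  have "((\<lambda>u. u * exp (- u)) has_integral (- (R + 1) * exp (- R) - (- (0 + 1) * exp (- 0)))) {0..R}"
    using assms by (intro fundamental_theorem_of_calculus)
      (auto intro!: derivative_eq_intros simp: algebra_simps simp flip: has_real_derivative_iff_has_vector_derivative)
  moreover have "truncated_Gamma 1 R = integral {0..R} (\<lambda>u. u * exp (- u))"
    unfolding truncated_Gamma_def by (intro integral_cong) auto
  ultimately show ?thesis by (simp add: integral_unique algebra_simps)
qed

text \<open>The inequality ln x \<le> x - 1 at u powr h and u powr (-h). Difference quotients of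
  powers replace the logarithm, so that only Gamma integrals occur; as h tends to 0 they produce the
  derivative of Gamma at 2.\<close>

lemma u_ln_u_bounds:
  fixes u h :: real
  assumes "u \<ge> 0" "h > 0"
  shows "u * ln u \<le> (u powr (1 + h) - u) / h" "(u - u powr (1 - h)) / h \<le> u * ln u"
proof -
  have "u * ln u \<le> (u powr (1 + h) - u) / h \<and> (u - u powr (1 - h)) / h \<le> u * ln u"
  proof (cases "u = 0")
    case False
    then have u: "u > 0" using assms by simp
    have "h * ln u \<le> u powr h - 1" using ln_le_minus_one[of "u powr h"] u by (simp add: ln_powr)
    then have "u * (h * ln u) \<le> u * (u powr h - 1)" using u by (intro mult_left_mono) auto
    then have 1: "u * ln u * h \<le> u powr (1 + h) - u" using u by (simp add: powr_add algebra_simps)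
    have "- h * ln u \<le> u powr (-h) - 1" using ln_le_minus_one[of "u powr (-h)"] u by (simp add: ln_powr)
    then have "u * (- h * ln u) \<le> u * (u powr (-h) - 1)" using u by (intro mult_left_mono) auto
    then have 2: "u - u powr (1 - h) \<le> u * ln u * h" using u by (simp add: powr_diff powr_minus_divide algebra_simps)
    show ?thesis using 1 2 assms(2) by (simp add: pos_le_divide_eq pos_divide_le_eq)
  qed simp
  then show "u * ln u \<le> (u powr (1 + h) - u) / h" "(u - u powr (1 - h)) / h \<le> u * ln u" by auto
qed

lemma Gamma_diff_quotient:
  "((\<lambda>h::real. (Gamma (2 + h) - 1) / h) \<longlongrightarrow> 1 - euler_mascheroni) (at 0)"
proof -
  have "(2::real) \<notin> \<int>\<^sub>\<le>\<^sub>0" by (auto elim!: nonpos_Ints_cases)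
  then have "(Gamma has_field_derivative Gamma 2 * Digamma 2) (at (2::real))"
    by (rule has_field_derivative_Gamma)
  moreover have "Gamma (2::real) = 1" using Gamma_fact[of 1] by (simp add: fact_numeral)
  moreover have "Digamma (2::real) = 1 - euler_mascheroni"
    using Digamma_plus1[of "1::real"] by simp
  ultimately show ?thesis by (simp add: DERIV_def)
qed

abbreviation half_sq :: "real \<Rightarrow> real" where
  "half_sq t \<equiv> (norm (zeta (Complex (1/2) t)))\<^sup>2"

abbreviation half_ms :: "real \<Rightarrow> real" where
  "half_ms \<equiv> mean_square (1/2)"

lemma continuous_half_sq [continuous_intros]: "continuous_on A half_sq"
  by (intro continuous_intros zeta_vertical_continuous) auto

lemma half_ms_eq: "half_ms X = integral {0..X} half_sq"
  by (simp add: mean_square_def)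

lemma half_ms_nonneg: "half_ms X \<ge> 0"
  unfolding half_ms_eq by (intro integral_nonneg integrable_continuous_interval continuous_intros) auto

lemma half_ms_deriv:
  assumes "x \<in> {0..b}"
  shows "(half_ms has_real_derivative half_sq x) (at x within {0..b})"
  unfolding half_ms_eq[abs_def] has_real_derivative_iff_has_vector_derivative
  by (rule integral_has_vector_derivative[OF continuous_half_sq assms])

lemma continuous_half_ms: "continuous_on {0..b} half_ms"
  by (rule DERIV_continuous_on) (rule half_ms_deriv)

text \<open>The parameter 1 / y is the ladder's 2 / phi when phi = 2 y.\<close>

definition truncated_laplace :: "real \<Rightarrow> real \<Rightarrow> real" where
  "truncated_laplace y b = integral {0..b} (\<lambda>t. half_sq t * exp (- (1 / y) * t))"

text \<open>Integration by parts after the scaling t = y u moves the weight from the density to its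
  primitive, the mean square, for which asymptotics are known.\<close>

lemma truncated_laplace_eq:
  assumes y: "y > 0" and R: "R \<ge> 0"
  shows "((\<lambda>u. half_ms (y * u) * exp (- u)) has_integral (truncated_laplace y (y * R) / y) * y - half_ms (y * R) * exp (- R)) {0..R}"
proof -
  have "((\<lambda>t. half_sq t * exp (- (1 / y) * t)) has_integral truncated_laplace y (y * R)) {0..y * R}"
    unfolding truncated_laplace_def by (intro integrable_integral integrable_continuous_interval continuous_intros)
  from has_integral_stretch_real[OF this, of y]
  have 1: "((\<lambda>u. half_sq (y * u) * exp (- u)) has_integral truncated_laplace y (y * R) / y) {0..R}"
    using y by simp
  have d: "((\<lambda>u. half_ms (y * u) * exp (- u)) has_real_derivative
     half_sq (y * u) * y * exp (- u) - half_ms (y * u) * exp (- u)) (at u within {0..R})" if "u \<in> {0..R}" for u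
  proof -
    have "y * u \<in> {0..y * R}" "(\<lambda>u. y * u) ` {0..R} \<subseteq> {0..y * R}" using that y R by auto
    then have "(half_ms has_real_derivative half_sq (y * u)) (at (y * u) within (\<lambda>u. y * u) ` {0..R})"
      by (intro DERIV_subset[OF half_ms_deriv])
    then have "((half_ms \<circ> (\<lambda>u. y * u)) has_real_derivative half_sq (y * u) * y) (at u within {0..R})"
      by (rule DERIV_image_chain) (auto intro!: derivative_eq_intros)
    then show ?thesis
      unfolding o_def by (auto intro!: derivative_eq_intros)
  qed
  have "((\<lambda>u. half_sq (y * u) * y * exp (- u) - half_ms (y * u) * exp (- u)) has_integral
     half_ms (y * R) * exp (- R) - half_ms (y * 0) * exp (- 0)) {0..R}"
    using d R by (intro fundamental_theorem_of_calculus) (auto simp flip: has_real_derivative_iff_has_vector_derivative)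
  from has_integral_diff[OF has_integral_mult_left[OF 1, of y] this] show ?thesis
    by (simp add: half_ms_eq mult_ac)
qed

text \<open>Makes the asymptotic formula valid on the whole half line by absorbing a bounded range
  into C, so that it can be integrated from 0.\<close>

lemma half_ms_bounds:
  assumes "\<epsilon> > 0"
  defines "A \<equiv> 2 * euler_mascheroni - 1 - ln (2 * pi)"
  obtains C where "C \<ge> 0" "\<And>X. X \<ge> 0 \<Longrightarrow> \<bar>half_ms X - X * ln X - A * X\<bar> \<le> \<epsilon> * X + C"
proof -
  have "eventually (\<lambda>X. dist (half_ms X / X - ln X) A < \<epsilon>) at_top"
    using tendstoD[OF mean_square_half_asymp assms(1)] by (simp add: A_def)
  then obtain X0 where X0: "X0 \<ge> 1" "\<And>X. X \<ge> X0 \<Longrightarrow> \<bar>half_ms X / X - ln X - A\<bar> < \<epsilon>"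
    unfolding eventually_at_top_linorder dist_real_def by (metis max.bounded_iff max.cobounded1 max.cobounded2)
  \<comment> \<open>The summands bound, for X < X0, the mean square, then X ln X, then A X.\<close>
  define C where "C = half_ms X0 + X0 * X0 + 1 + \<bar>A\<bar> * X0"
  note pos = half_ms_nonneg
  show ?thesis
  proof (rule that[of C])
    show "C \<ge> 0" using X0 pos[of X0] by (simp add: C_def)
    fix X :: real assume X: "X \<ge> 0"
    show "\<bar>half_ms X - X * ln X - A * X\<bar> \<le> \<epsilon> * X + C"
    proof (cases "X \<ge> X0")
      case True
      then have "\<bar>half_ms X / X - ln X - A\<bar> * X \<le> \<epsilon> * X" using X0(2)[OF True] X by (intro mult_right_mono) auto
      moreover have "\<bar>half_ms X / X - ln X - A\<bar> * X = \<bar>(half_ms X / X - ln X - A) * X\<bar>" using X by (simp add: abs_mult)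
      moreover have "(half_ms X / X - ln X - A) * X = half_ms X - X * ln X - A * X"
        using True X0 by (simp add: algebra_simps)
      ultimately show ?thesis using \<open>C \<ge> 0\<close> by simp
    next
      case False
      have 1: "half_ms X \<le> half_ms X0" using False by (intro mean_square_mono) auto
      have 2: "\<bar>A * X\<bar> \<le> \<bar>A\<bar> * X0" using False X by (auto simp: abs_mult intro!: mult_left_mono)
      have 3: "\<bar>X * ln X\<bar> \<le> X0 * X0 + 1"
      proof (cases "X = 0")
        case False
        then have X': "X > 0" using X by simp
        have "X * ln X \<le> X * X" using X' ln_le_minus_one[OF X'] by (intro mult_left_mono) auto
        also have "\<dots> \<le> X0 * X0" using \<open>\<not> X \<ge> X0\<close> X by (intro mult_mono) auto
        finally have u: "X * ln X \<le> X0 * X0" .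
        have "- ln X \<le> 1 / X - 1" using ln_le_minus_one[of "1 / X"] X' by (simp add: ln_div)
        then have "X * (- ln X) \<le> X * (1 / X - 1)" using X' by (intro mult_left_mono) auto
        also have "\<dots> \<le> 1" using X' by (simp add: right_diff_distrib)
        finally show ?thesis using u mult_nonneg_nonneg[of X0 X0] X0 by linarith
      qed simp
      have "\<epsilon> * X \<ge> 0" using X assms by simp
      then show ?thesis using 1 2 3 pos[of X] by (simp add: C_def)
    qed
  qed
qed

text \<open>Both bounds of \<open>half_ms_bounds\<close> are inserted at X = y u, where X ln X = y
  (u ln y + u ln u), and integrated against exp (- u). The number h stays free and is chosen later;
  the lower bound discards the nonnegative boundary term.\<close>

lemma truncated_laplace_bounds:
  assumes "\<epsilon> > 0" "0 < h" "h < 1"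
  defines "A \<equiv> 2 * euler_mascheroni - 1 - ln (2 * pi)"
  obtains C where "C \<ge> 0"
    "\<And>y R. y > 0 \<Longrightarrow> R \<ge> 0 \<Longrightarrow> truncated_laplace y (y * R) / y \<le> half_ms (y * R) * exp (- R) / y +
       ((ln y + A + \<epsilon>) * truncated_Gamma 1 R + (truncated_Gamma (1 + h) R - truncated_Gamma 1 R) / h + C / y * truncated_Gamma 0 R)"
    "\<And>y R. y > 0 \<Longrightarrow> R \<ge> 0 \<Longrightarrow> (ln y + A - \<epsilon>) * truncated_Gamma 1 R + (truncated_Gamma 1 R - truncated_Gamma (1 - h) R) / h - C / y * truncated_Gamma 0 R \<le> truncated_laplace y (y * R) / y"
proof -
  obtain C where C: "C \<ge> 0" "\<And>X. X \<ge> 0 \<Longrightarrow> \<bar>half_ms X - X * ln X - A * X\<bar> \<le> \<epsilon> * X + C"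
    unfolding A_def by (rule half_ms_bounds[OF assms(1)]) blast
  have g: "((\<lambda>u. u powr p * exp (- u)) has_integral truncated_Gamma p R) {0..R}" if "p \<ge> 0" for p R
    using that by (intro truncated_Gamma_integral) auto
  show ?thesis
  proof (rule that[OF C(1)])
    fix y R :: real assume y: "y > 0" and R: "R \<ge> 0"
    have b: "\<bar>half_ms (y * u) / y - u * ln y - u * ln u - A * u\<bar> \<le> \<epsilon> * u + C / y" if u: "u \<ge> 0" for u
    proof -
      have "(y * u) * ln (y * u) = y * (u * ln y + u * ln u)"
        using y u by (cases "u = 0") (auto simp: ln_mult algebra_simps)
      then have "half_ms (y * u) / y - u * ln y - u * ln u - A * u = (half_ms (y * u) - (y * u) * ln (y * u) - A * (y * u)) / y"
        using y by (simp add: diff_divide_distrib)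
      also have "\<bar>\<dots>\<bar> = \<bar>half_ms (y * u) - (y * u) * ln (y * u) - A * (y * u)\<bar> / y" using y by (simp add: abs_divide)
      also have "\<dots> \<le> (\<epsilon> * (y * u) + C) / y" using y u by (intro divide_right_mono C(2)) auto
      also have "\<dots> = \<epsilon> * u + C / y" using y by (simp add: add_divide_distrib)
      finally show ?thesis .
    qed
    have i: "((\<lambda>u. half_ms (y * u) * exp (- u) / y) has_integral truncated_laplace y (y * R) / y - half_ms (y * R) * exp (- R) / y) {0..R}"
      using has_integral_divide[OF truncated_laplace_eq[OF y R], of y] y by (simp add: diff_divide_distrib)
    have up: "((\<lambda>u. (ln y + A + \<epsilon>) * (u powr 1 * exp (- u)) + (u powr (1 + h) * exp (- u) - u powr 1 * exp (- u)) / h + C / y * (u powr 0 * exp (- u)))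
       has_integral ((ln y + A + \<epsilon>) * truncated_Gamma 1 R + (truncated_Gamma (1 + h) R - truncated_Gamma 1 R) / h + C / y * truncated_Gamma 0 R)) {0..R}"
      using assms by (intro has_integral_add has_integral_diff has_integral_mult_right has_integral_divide g) auto
    have lo: "((\<lambda>u. (ln y + A - \<epsilon>) * (u powr 1 * exp (- u)) + (u powr 1 * exp (- u) - u powr (1 - h) * exp (- u)) / h - C / y * (u powr 0 * exp (- u)))
       has_integral ((ln y + A - \<epsilon>) * truncated_Gamma 1 R + (truncated_Gamma 1 R - truncated_Gamma (1 - h) R) / h - C / y * truncated_Gamma 0 R)) {0..R}"
      using assms by (intro has_integral_add has_integral_diff has_integral_mult_right has_integral_divide g) auto
    have pos: "half_ms (y * R) * exp (- R) / y \<ge> 0"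
      using y half_ms_nonneg[of "y * R"] by simp
    have bounds: "half_ms (y * u) * exp (- u) / y \<le> (ln y + A + \<epsilon>) * (u powr 1 * exp (- u)) + (u powr (1 + h) * exp (- u) - u powr 1 * exp (- u)) / h + C / y * (u powr 0 * exp (- u))"
      "(ln y + A - \<epsilon>) * (u powr 1 * exp (- u)) + (u powr 1 * exp (- u) - u powr (1 - h) * exp (- u)) / h - C / y * (u powr 0 * exp (- u)) \<le> half_ms (y * u) * exp (- u) / y"
      if u: "u > 0" for u
    proof -
      have "half_ms (y * u) / y \<le> (ln y + A + \<epsilon>) * u + (u powr (1 + h) - u) / h + C / y"
        using b[of u] u_ln_u_bounds(1)[of u h] u assms unfolding distrib_right by (simp add: mult.commute[of u "ln y"])
      from mult_right_mono[OF this, of "exp (- u)"]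
      show "half_ms (y * u) * exp (- u) / y \<le> (ln y + A + \<epsilon>) * (u powr 1 * exp (- u)) + (u powr (1 + h) * exp (- u) - u powr 1 * exp (- u)) / h + C / y * (u powr 0 * exp (- u))"
        using u by (simp add: algebra_simps diff_divide_distrib)
      have "(ln y + A - \<epsilon>) * u + (u - u powr (1 - h)) / h - C / y \<le> half_ms (y * u) / y"
        using b[of u] u_ln_u_bounds(2)[of u h] u assms unfolding distrib_right left_diff_distrib by (simp add: mult.commute[of u "ln y"])
      from mult_right_mono[OF this, of "exp (- u)"]
      show "(ln y + A - \<epsilon>) * (u powr 1 * exp (- u)) + (u powr 1 * exp (- u) - u powr (1 - h) * exp (- u)) / h - C / y * (u powr 0 * exp (- u)) \<le> half_ms (y * u) * exp (- u) / y"
        using u by (simp add: algebra_simps diff_divide_distrib)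
    qed
    have pw0: "u = 0 \<or> u > 0" if "u \<in> {0..R}" for u using that by auto
    have "truncated_laplace y (y * R) / y - half_ms (y * R) * exp (- R) / y \<le> (ln y + A + \<epsilon>) * truncated_Gamma 1 R + (truncated_Gamma (1 + h) R - truncated_Gamma 1 R) / h + C / y * truncated_Gamma 0 R"
    proof (rule has_integral_le[OF i up])
      fix u assume "u \<in> {0..R}"
      from pw0[OF this] show "half_ms (y * u) * exp (- u) / y \<le> (ln y + A + \<epsilon>) * (u powr 1 * exp (- u)) + (u powr (1 + h) * exp (- u) - u powr 1 * exp (- u)) / h + C / y * (u powr 0 * exp (- u))"
        using bounds(1)[of u] by (elim disjE) (simp add: half_ms_eq, blast)
    qed
    then show "truncated_laplace y (y * R) / y \<le> half_ms (y * R) * exp (- R) / y +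
       ((ln y + A + \<epsilon>) * truncated_Gamma 1 R + (truncated_Gamma (1 + h) R - truncated_Gamma 1 R) / h + C / y * truncated_Gamma 0 R)" by simp
    have "(ln y + A - \<epsilon>) * truncated_Gamma 1 R + (truncated_Gamma 1 R - truncated_Gamma (1 - h) R) / h - C / y * truncated_Gamma 0 R \<le> truncated_laplace y (y * R) / y - half_ms (y * R) * exp (- R) / y"
    proof (rule has_integral_le[OF lo i])
      fix u assume "u \<in> {0..R}"
      from pw0[OF this] show "(ln y + A - \<epsilon>) * (u powr 1 * exp (- u)) + (u powr 1 * exp (- u) - u powr (1 - h) * exp (- u)) / h - C / y * (u powr 0 * exp (- u)) \<le> half_ms (y * u) * exp (- u) / y"
        using bounds(2)[of u] by (elim disjE) (simp add: half_ms_eq, blast)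
    qed
    then show "(ln y + A - \<epsilon>) * truncated_Gamma 1 R + (truncated_Gamma 1 R - truncated_Gamma (1 - h) R) / h - C / y * truncated_Gamma 0 R \<le> truncated_laplace y (y * R) / y"
      using pos by linarith
  qed
qed

text \<open>The limit is A + (1 - gamma) with A the linear coefficient of the mean square. The
  condition on R has the form that the bound \<mu>(y) \<ge> 7 y ln y provides at 2 y. It makes the
  boundary term vanish, and the truncation of the main term ln y times the Gamma integral negligible
  in spite of the logarithm.\<close>

theorem truncated_laplace_asymp:
  fixes R :: "real \<Rightarrow> real"
  assumes R: "eventually (\<lambda>y. R y \<ge> 14 * ln y) at_top"
  shows "((\<lambda>y. truncated_laplace y (y * R y) / y - ln y) \<longlongrightarrow> euler_mascheroni - ln (2 * pi)) at_top"
proof -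
  define A :: real where "A = 2 * euler_mascheroni - 1 - ln (2 * pi)"
  have Rlim: "filterlim R at_top at_top"
    by (rule filterlim_at_top_mono[OF _ R]) real_asymp
  \<comment> \<open>Half of exp (- R) is kept as this power saving; the other half pays for the
    polynomial factors in R.\<close>
  have expR: "exp (- (R y / 2)) \<le> y powr (-7)" if "R y \<ge> 14 * ln y" "y > 0" for y
    using that by (simp add: powr_def)
  have g1: "((\<lambda>y. ln y * (truncated_Gamma 1 (R y) - 1)) \<longlongrightarrow> 0) at_top"
  proof (rule Lim_null_comparison)
    show "eventually (\<lambda>y. norm (ln y * (truncated_Gamma 1 (R y) - 1)) \<le> 2 * (ln y * y powr (-7))) at_top"
      using R eventually_ge_at_top[of 1]
    proof eventually_elim
      case (elim y)
      have R0: "R y \<ge> 0" using elim by (smt (verit) ln_ge_zero)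
      have "exp (- R y) * (R y + 1) \<le> exp (- R y) * (2 * exp (R y / 2))"
        using exp_ge_add_one_self[of "R y / 2"] by (intro mult_left_mono) (linarith, simp)
      also have "\<dots> = 2 * exp (- (R y / 2))" by (simp add: exp_add[symmetric])
      also have "\<dots> \<le> 2 * y powr (-7)" using expR[of y] elim by simp
      finally have "\<bar>truncated_Gamma 1 (R y) - 1\<bar> \<le> 2 * y powr (-7)"
        using R0 by (simp add: truncated_Gamma_1 abs_mult mult.commute)
      then have "ln y * \<bar>truncated_Gamma 1 (R y) - 1\<bar> \<le> ln y * (2 * y powr (-7))"
        using elim by (intro mult_left_mono) auto
      then show ?case using elim by (simp add: abs_mult)
    qed
    show "((\<lambda>y::real. 2 * (ln y * y powr (-7))) \<longlongrightarrow> 0) at_top" by real_asymp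
  qed
  have bd: "((\<lambda>y. half_ms (y * R y) * exp (- R y) / y) \<longlongrightarrow> 0) at_top"
  proof (rule Lim_null_comparison)
    have "eventually (\<lambda>X. dist (half_ms X / X - ln X) A < 1) at_top"
      using tendstoD[OF mean_square_half_asymp] by (simp add: A_def)
    moreover have "eventually (\<lambda>X::real. ln X + \<bar>A\<bar> + 1 \<le> X) at_top" by real_asymp
    ultimately have "eventually (\<lambda>X. half_ms X \<le> X * X) at_top"
      using eventually_gt_at_top[of 0]
    proof eventually_elim
      case (elim X)
      have "half_ms X / X \<le> X" using elim(1,2) unfolding dist_real_def by linarith
      then show ?case using elim(3) by (simp add: pos_divide_le_eq)
    qed
    moreover have "filterlim (\<lambda>y. y * R y) at_top at_top"
      by (intro filterlim_at_top_mult_at_top filterlim_ident Rlim)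
    ultimately have "eventually (\<lambda>y. half_ms (y * R y) \<le> (y * R y) * (y * R y)) at_top"
      by (rule eventually_compose_filterlim)
    then show "eventually (\<lambda>y. norm (half_ms (y * R y) * exp (- R y) / y) \<le> 8 * (y * y powr (-7))) at_top"
      using R eventually_ge_at_top[of 1]
    proof eventually_elim
      case (elim y)
      have R0: "R y \<ge> 0" using elim by (smt (verit) ln_ge_zero)
      have "(R y / 2) ^ 2 \<le> fact 2 * exp (R y / 2)" using R0 by (intro power_le_fact_exp) auto
      then have "R y * R y \<le> 8 * exp (R y / 2)" by (simp add: power2_eq_square fact_numeral)
      then have "R y * R y * exp (- R y) \<le> 8 * exp (R y / 2) * exp (- R y)" by (intro mult_right_mono) auto
      also have "\<dots> = 8 * exp (- (R y / 2))" by (simp add: exp_add[symmetric])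
      also have "\<dots> \<le> 8 * y powr (-7)" using expR[of y] elim by simp
      finally have RR: "R y * R y * exp (- R y) \<le> 8 * y powr (-7)" .
      have "norm (half_ms (y * R y) * exp (- R y) / y) = half_ms (y * R y) * exp (- R y) / y" using elim half_ms_nonneg[of "y * R y"] by simp
      also have "\<dots> \<le> (y * R y) * (y * R y) * exp (- R y) / y" using elim by (intro divide_right_mono mult_right_mono) auto
      also have "\<dots> = y * (R y * R y * exp (- R y))" using elim by simp
      also have "\<dots> \<le> y * (8 * y powr (-7))" using elim by (intro mult_left_mono RR) auto
      finally show ?case by simp
    qed
    show "((\<lambda>y::real. 8 * (y * y powr (-7))) \<longlongrightarrow> 0) at_top" by real_asymp
  qed
  have R0: "eventually (\<lambda>y. R y \<ge> 0) at_top" using Rlim by (simp add: filterlim_at_top)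
  have Gam2: "Gamma (2::real) = 1" using Gamma_fact[of 1] by (simp add: fact_numeral)
  have gl: "((\<lambda>y. truncated_Gamma p (R y)) \<longlongrightarrow> Gamma (p + 1)) at_top" if "p > -1" for p
    by (rule filterlim_compose[OF truncated_Gamma_tendsto[OF that] Rlim])
  have gl1: "((\<lambda>y. truncated_Gamma 1 (R y)) \<longlongrightarrow> 1) at_top" using gl[of 1] Gam2 by simp
  have Cy: "((\<lambda>y. C / y) \<longlongrightarrow> 0) at_top" for C :: real by real_asymp
  have q: "((\<lambda>h::real. (Gamma (2 + h) - 1) / h) \<longlongrightarrow> 1 - euler_mascheroni) (at_right 0)"
    by (rule tendsto_mono[OF at_le Gamma_diff_quotient]) auto
  have "filterlim (\<lambda>h::real. - h) (at 0) (at_right 0)"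
    unfolding filterlim_at by (auto intro!: tendsto_eq_intros simp: eventually_at_filter)
  from filterlim_compose[OF Gamma_diff_quotient this]
  have q': "((\<lambda>h::real. (1 - Gamma (2 - h)) / h) \<longlongrightarrow> 1 - euler_mascheroni) (at_right 0)"
    by (simp add: minus_divide_left)
  have h01: "eventually (\<lambda>h::real. 0 < h \<and> h < 1) (at_right 0)"
    by (auto simp: eventually_at_right_field intro: exI[of _ 1])
  have AA: "euler_mascheroni - ln (2 * pi) = A + (1 - euler_mascheroni)" by (simp add: A_def)
  show ?thesis unfolding AA
  proof (rule order_tendstoI)
    fix a :: real assume a: "A + (1 - euler_mascheroni) < a"
    \<comment> \<open>Half of the gap: one part is spent on the mean square, the other on the
      difference quotient of Gamma.\<close>
    define \<epsilon> where "\<epsilon> = (a - (A + (1 - euler_mascheroni))) / 2"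
    have \<epsilon>: "\<epsilon> > 0" using a by (simp add: \<epsilon>_def)
    have "eventually (\<lambda>h. (Gamma (2 + h) - 1) / h < 1 - euler_mascheroni + \<epsilon>) (at_right 0)"
      by (rule order_tendstoD[OF q]) (use \<epsilon> in simp)
    from eventually_happens[OF eventually_conj[OF this h01]]
    obtain h where h: "(Gamma (2 + h) - 1) / h < 1 - euler_mascheroni + \<epsilon>" "0 < h" "h < 1" by (auto simp: trivial_limit_at_right_real)
    obtain C where C: "\<And>y R. y > 0 \<Longrightarrow> R \<ge> 0 \<Longrightarrow> truncated_laplace y (y * R) / y \<le> half_ms (y * R) * exp (- R) / y +
       ((ln y + A + \<epsilon>) * truncated_Gamma 1 R + (truncated_Gamma (1 + h) R - truncated_Gamma 1 R) / h + C / y * truncated_Gamma 0 R)"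
      using truncated_laplace_bounds[OF \<epsilon> h(2,3)] unfolding A_def by metis
    have "((\<lambda>y. half_ms (y * R y) * exp (- R y) / y + (ln y * (truncated_Gamma 1 (R y) - 1) + (A + \<epsilon>) * truncated_Gamma 1 (R y) +
       (truncated_Gamma (1 + h) (R y) - truncated_Gamma 1 (R y)) / h + C / y * truncated_Gamma 0 (R y))) \<longlongrightarrow>
       0 + (0 + (A + \<epsilon>) * 1 + (Gamma (1 + h + 1) - 1) / h + 0 * Gamma (0 + 1))) at_top"
      using h by (intro tendsto_add tendsto_mult tendsto_diff tendsto_divide tendsto_const bd g1 gl gl1 Cy) auto
    moreover have "0 + (0 + (A + \<epsilon>) * 1 + (Gamma (1 + h + 1) - 1) / h + 0 * Gamma (0 + 1)) < a"
      using h(1) by (simp add: \<epsilon>_def add.commute field_simps)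
    ultimately have "eventually (\<lambda>y. half_ms (y * R y) * exp (- R y) / y + (ln y * (truncated_Gamma 1 (R y) - 1) + (A + \<epsilon>) * truncated_Gamma 1 (R y) +
       (truncated_Gamma (1 + h) (R y) - truncated_Gamma 1 (R y)) / h + C / y * truncated_Gamma 0 (R y)) < a) at_top"
      by (rule order_tendstoD)
    then show "eventually (\<lambda>y. truncated_laplace y (y * R y) / y - ln y < a) at_top"
      using R0 eventually_gt_at_top[of 0]
    proof eventually_elim
      case (elim y)
      from C[OF elim(3,2)] elim(1) show ?case unfolding right_diff_distrib distrib_right by simp
    qed
  next
    fix a :: real assume a: "a < A + (1 - euler_mascheroni)"
    define \<epsilon> where "\<epsilon> = ((A + (1 - euler_mascheroni)) - a) / 2"
    have \<epsilon>: "\<epsilon> > 0" using a by (simp add: \<epsilon>_def)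
    have "eventually (\<lambda>h. 1 - euler_mascheroni - \<epsilon> < (1 - Gamma (2 - h)) / h) (at_right 0)"
      by (rule order_tendstoD[OF q']) (use \<epsilon> in simp)
    from eventually_happens[OF eventually_conj[OF this h01]]
    obtain h where h: "1 - euler_mascheroni - \<epsilon> < (1 - Gamma (2 - h)) / h" "0 < h" "h < 1" by (auto simp: trivial_limit_at_right_real)
    obtain C where C: "\<And>y R. y > 0 \<Longrightarrow> R \<ge> 0 \<Longrightarrow> (ln y + A - \<epsilon>) * truncated_Gamma 1 R + (truncated_Gamma 1 R - truncated_Gamma (1 - h) R) / h - C / y * truncated_Gamma 0 R \<le> truncated_laplace y (y * R) / y"
      using truncated_laplace_bounds[OF \<epsilon> h(2,3)] unfolding A_def by metis
    have "((\<lambda>y. ln y * (truncated_Gamma 1 (R y) - 1) + (A - \<epsilon>) * truncated_Gamma 1 (R y) +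
       (truncated_Gamma 1 (R y) - truncated_Gamma (1 - h) (R y)) / h - C / y * truncated_Gamma 0 (R y)) \<longlongrightarrow>
       0 + (A - \<epsilon>) * 1 + (1 - Gamma (1 - h + 1)) / h - 0 * Gamma (0 + 1)) at_top"
      using h by (intro tendsto_add tendsto_mult tendsto_diff tendsto_divide tendsto_const g1 gl gl1 Cy) auto
    moreover have "a < 0 + (A - \<epsilon>) * 1 + (1 - Gamma (1 - h + 1)) / h - 0 * Gamma (0 + 1)"
    proof -
      have "1 - h + 1 = 2 - h" by simp
      then show ?thesis using h(1) unfolding \<epsilon>_def by (simp only:) argo
    qed
    ultimately have "eventually (\<lambda>y. a < ln y * (truncated_Gamma 1 (R y) - 1) + (A - \<epsilon>) * truncated_Gamma 1 (R y) +
       (truncated_Gamma 1 (R y) - truncated_Gamma (1 - h) (R y)) / h - C / y * truncated_Gamma 0 (R y)) at_top"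
      by (rule order_tendstoD)
    then show "eventually (\<lambda>y. a < truncated_laplace y (y * R y) / y - ln y) at_top"
      using R0 eventually_gt_at_top[of 0]
    proof eventually_elim
      case (elim y)
      from C[OF elim(3,2)] elim(1) show ?case unfolding right_diff_distrib left_diff_distrib distrib_right by simp
    qed
  qed
qed

section \<open>The inverse of a ladder\<close>

lemma norm_hardy_Z: "cmod (hardy_Z t) = cmod (zeta (Complex (1/2) t))"
  by (simp add: hardy_Z_def norm_mult)

lemma half_ms_at_top: "filterlim half_ms at_top at_top"
proof (rule filterlim_at_top_mono)
  define A :: real where "A = 2 * euler_mascheroni - 1 - ln (2 * pi)"
  show "filterlim (\<lambda>X::real. X) at_top at_top" by (rule filterlim_ident)
  have "eventually (\<lambda>X. dist (half_ms X / X - ln X) A < 1) at_top"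
    using tendstoD[OF mean_square_half_asymp] by (simp add: A_def)
  moreover have "eventually (\<lambda>X::real. \<bar>A\<bar> + 2 \<le> ln X) at_top" by real_asymp
  ultimately show "eventually (\<lambda>X. X \<le> half_ms X) at_top"
    using eventually_gt_at_top[of 0]
  proof eventually_elim
    case (elim X)
    have "1 \<le> half_ms X / X" using elim(1,2) unfolding dist_real_def by linarith
    then show ?case using elim(3) by (simp add: pos_le_divide_eq)
  qed
qed

lemma half_ms_mono: "X \<le> Y \<Longrightarrow> half_ms X \<le> half_ms Y"
  by (rule mean_square_mono) auto

lemma half_ms_surj:
  assumes "0 \<le> T0" "half_ms T0 \<le> K"
  obtains X where "X \<ge> T0" "half_ms X = K"
proof -
  obtain b where b: "half_ms b \<ge> K" "b \<ge> T0"
    using eventually_conj[OF half_ms_at_top[unfolded filterlim_at_top, rule_format, of K] eventually_ge_at_top[of T0]]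
    by (auto simp: eventually_at_top_linorder)
  have "continuous_on {T0..b} half_ms"
    by (rule continuous_on_subset[OF continuous_half_ms[of b]]) (use assms in auto)
  then show ?thesis using IVT'[OF assms(2) b] that by blast
qed

text \<open>A larger parameter damps strictly less, and the range of integration is at least as
  long, so equal integrals leave no room for any mass. Thus the right member of the ladder equation
  determines its parameter; it is the source of injectivity.\<close>

lemma weighted_half_sq_unique:
  assumes "0 < p" "p < q" "m \<le> n" "0 < n"
    and eq: "integral {0..m} (\<lambda>t. half_sq t * exp (- (2 / p) * t)) = integral {0..n} (\<lambda>t. half_sq t * exp (- (2 / q) * t))"
  shows "half_ms n = 0"
proof -
  define f where "f = (\<lambda>p t. half_sq t * exp (- (2 / p) * t))"
  have fd: "(\<lambda>t. half_sq t * exp (- (2 / p) * t)) = f p" for p by (simp only: f_def)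
  have c: "continuous_on A (f p)" for p A unfolding f_def by (intro continuous_intros)
  have i: "f p integrable_on {a..b}" for p a b by (rule integrable_continuous_interval[OF c])
  have le: "exp (- (2 / p) * t) < exp (- (2 / q) * t)" if "t > 0" for t
    using that assms(1,2) by (simp add: divide_strict_left_mono)
  have le': "f p t \<le> f q t" if "t \<ge> 0" for t
    using le[of t] that unfolding f_def by (cases "t = 0") (auto intro!: mult_left_mono)
  have "integral {0..m} (f p) \<le> integral {0..n} (f p)"
    using assms by (intro integral_subset_le i) (auto simp: f_def)
  then have "integral {0..n} (\<lambda>t. f q t - f p t) \<le> 0"
    using eq[unfolded fd] by (simp add: integral_diff i)
  moreover have "integral {0..n} (\<lambda>t. f q t - f p t) \<ge> 0"
    by (intro integral_nonneg integrable_diff i) (use le' in auto)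
  ultimately have "integral {0..n} (\<lambda>t. f q t - f p t) = 0" by simp
  then have z: "\<forall>t\<in>{0..n}. f q t - f p t = 0"
    by (subst (asm) integral_eq_0_iff) (use le' assms c in \<open>auto intro: continuous_intros\<close>)
  have "half_sq t = 0" if "t \<in> {0..n} - {0}" for t
  proof -
    have "half_sq t * (exp (- (2 / q) * t) - exp (- (2 / p) * t)) = 0"
      using bspec[OF z, of t] that unfolding f_def right_diff_distrib by blast
    moreover have "exp (- (2 / q) * t) - exp (- (2 / p) * t) \<noteq> 0" using le[of t] that by auto
    ultimately show ?thesis unfolding mult_eq_0_iff by blast
  qed
  then have "integral {0..n} half_sq = integral {0..n} (\<lambda>t. 0)"
    by (intro integral_spike[of "{0}"]) auto
  then show ?thesis by (simp add: half_ms_eq)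
qed

text \<open>\<open>inv_into\<close> is meaningful only on the image of the ladder, so each large y
  must be shown to be attained. Any preimage T satisfies the integral equation with phi T = 2 y, and
  this equation is all that is used about it afterwards.\<close>

theorem jacobs_ladder_inverse:
  assumes "jacobs_ladder T0 \<phi>1"
  obtains R where "eventually (\<lambda>y. R y \<ge> 14 * ln y) at_top"
    "eventually (\<lambda>y. inv_into {T0..} \<phi>1 y \<ge> 0 \<and> half_ms (inv_into {T0..} \<phi>1 y) = truncated_laplace y (y * R y)) at_top"
proof -
  obtain \<mu> \<phi> y0 where T0: "0 \<le> T0" and y0: "0 < y0" and mono: "mono_on {y0..} \<mu>"
    and mu: "\<And>y. y \<ge> y0 \<Longrightarrow> \<mu> y \<ge> 7 * y * ln y"
    and ph: "\<And>T. T \<ge> T0 \<Longrightarrow> \<phi> T \<ge> y0" "\<And>T. T \<ge> T0 \<Longrightarrow> \<phi>1 T = \<phi> T / 2"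
      "\<And>T. T \<ge> T0 \<Longrightarrow> integral {0..\<mu> (\<phi> T)} (\<lambda>t. half_sq t * exp (- (2 / \<phi> T) * t)) = half_ms T"
    using assms unfolding jacobs_ladder_def norm_hardy_Z half_ms_eq[symmetric] by blast
  \<comment> \<open>Chosen so that the upper limit y * R y is \<mu> at phi = 2 y.\<close>
  define R where "R = (\<lambda>y. \<mu> (2 * y) / y)"
  have R: "R y \<ge> 14 * ln y" if "y > 0" "2 * y \<ge> y0" for y
  proof -
    have "14 * ln y \<le> 14 * ln (2 * y)" using that by simp
    also have "\<dots> = 7 * (2 * y) * ln (2 * y) / y" using that by simp
    also have "\<dots> \<le> R y" unfolding R_def using that mu[of "2 * y"] by (intro divide_right_mono) auto
    finally show ?thesis .
  qed
  have Rev: "eventually (\<lambda>y. R y \<ge> 14 * ln y) at_top"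
    using eventually_gt_at_top[of 0] eventually_ge_at_top[of "y0/2"] by eventually_elim (rule R, auto)
  have K: "truncated_laplace y (y * R y) = integral {0..\<mu> (2 * y)} (\<lambda>t. half_sq t * exp (- (2 / (2 * y)) * t))" if "y > 0" for y
    using that by (simp add: truncated_laplace_def R_def)
  have Kinf: "filterlim (\<lambda>y. truncated_laplace y (y * R y)) at_top at_top"
  proof (rule filterlim_at_top_mono)
    define A :: real where "A = euler_mascheroni - ln (2 * pi)"
    show "filterlim (\<lambda>X::real. X) at_top at_top" by (rule filterlim_ident)
    have "eventually (\<lambda>y. dist (truncated_laplace y (y * R y) / y - ln y) A < 1) at_top"
      using tendstoD[OF truncated_laplace_asymp[OF Rev]] by (simp add: A_def)
    moreover have "eventually (\<lambda>X::real. \<bar>A\<bar> + 2 \<le> ln X) at_top" by real_asymp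
    ultimately show "eventually (\<lambda>y. y \<le> truncated_laplace y (y * R y)) at_top"
      using eventually_gt_at_top[of 0]
    proof eventually_elim
      case (elim X)
      have "1 \<le> truncated_laplace X (X * R X) / X" using elim(1,2) unfolding dist_real_def by linarith
      then show ?case using elim(3) by (simp add: pos_le_divide_eq)
    qed
  qed
  have muinf: "filterlim (\<lambda>y. \<mu> (2 * y)) at_top at_top"
  proof (rule filterlim_at_top_mono)
    show "filterlim (\<lambda>y::real. 7 * (2 * y) * ln (2 * y)) at_top at_top" by real_asymp
    show "eventually (\<lambda>y. 7 * (2 * y) * ln (2 * y) \<le> \<mu> (2 * y)) at_top"
      using eventually_ge_at_top[of "y0/2"] by eventually_elim (rule mu, auto)
  qed
  have "eventually (\<lambda>y. inv_into {T0..} \<phi>1 y \<ge> 0 \<and> half_ms (inv_into {T0..} \<phi>1 y) = truncated_laplace y (y * R y)) at_top"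
    using eventually_gt_at_top[of 0] eventually_ge_at_top[of "y0/2"]
      Kinf[unfolded filterlim_at_top, rule_format, of "half_ms T0"]
      muinf[unfolded filterlim_at_top_dense, rule_format, of 0]
      filterlim_compose[OF half_ms_at_top muinf, unfolded filterlim_at_top_dense, rule_format, of 0]
  proof eventually_elim
    case (elim y)
    \<comment> \<open>The candidate preimage: by continuity the mean square takes the value of the
      transform at 2 y. The ladder equation at X then equates two truncated transforms, and
      monotonicity of \<mu> orders their ranges as \<open>weighted_half_sq_unique\<close> demands,
      whence phi X = 2 y.\<close>
    obtain X where X: "X \<ge> T0" "half_ms X = truncated_laplace y (y * R y)"
      by (rule half_ms_surj[OF T0 elim(3)])
    have pX: "\<phi> X \<ge> y0" "\<phi> X > 0" using ph(1)[OF X(1)] y0 by auto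
    have eq: "integral {0..\<mu> (\<phi> X)} (\<lambda>t. half_sq t * exp (- (2 / \<phi> X) * t)) = integral {0..\<mu> (2 * y)} (\<lambda>t. half_sq t * exp (- (2 / (2 * y)) * t))"
      using ph(3)[OF X(1)] X(2) K[OF elim(1)] by simp
    have "\<phi> X = 2 * y"
    proof (rule ccontr)
      assume "\<phi> X \<noteq> 2 * y"
      then consider "\<phi> X < 2 * y" | "2 * y < \<phi> X" by linarith
      then show False
      proof cases
        case 1
        have "\<mu> (\<phi> X) \<le> \<mu> (2 * y)" using 1 pX by (intro mono_onD[OF mono]) auto
        from weighted_half_sq_unique[OF pX(2) 1 this elim(4) eq] show False using elim(5) by simp
      next
        case 2
        have m: "\<mu> (2 * y) \<le> \<mu> (\<phi> X)" using 2 elim pX by (intro mono_onD[OF mono]) auto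
        have "half_ms (\<mu> (\<phi> X)) = 0"
          by (rule weighted_half_sq_unique[OF _ 2 m _ eq[symmetric]]) (use elim m in auto)
        then show False using half_ms_mono[OF m] elim(5) by simp
      qed
    qed
    then have y: "y \<in> \<phi>1 ` {T0..}" using ph(2)[OF X(1)] X(1) by force
    define T where "T = inv_into {T0..} \<phi>1 y"
    have T: "T \<ge> T0" "\<phi>1 T = y" using inv_into_into[OF y] f_inv_into_f[OF y] by (auto simp: T_def)
    have "\<phi> T = 2 * y" using ph(2)[OF T(1)] T(2) by simp
    then have "half_ms T = truncated_laplace y (y * R y)" using ph(3)[OF T(1)] K[OF elim(1)] by simp
    then show ?case using T(1) T0 by (simp add: T_def)
  qed
  with Rev show ?thesis by (rule that)
qed

text \<open>Here k y is the truncated transform and T y the inverse of the ladder. The increment of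
  the mean square is k y minus its value at y, with linear coefficient (gamma - ln (2 pi)) - (2
  gamma - 1 - ln (2 pi)) = 1 - gamma. The position of T y follows by solving the asymptotic formula
  at T y for the ratio r = T y / y.\<close>

lemma ladder_step:
  fixes T k :: "real \<Rightarrow> real"
  defines "A \<equiv> 2 * euler_mascheroni - 1 - ln (2 * pi)"
  assumes k: "((\<lambda>y. k y / y - ln y) \<longlongrightarrow> euler_mascheroni - ln (2 * pi)) at_top"
    and T: "eventually (\<lambda>y. T y \<ge> 0 \<and> half_ms (T y) = k y) at_top"
  shows "eventually (\<lambda>y. y < T y) at_top"
    and "((\<lambda>y. integral {y..T y} half_sq / y) \<longlongrightarrow> 1 - euler_mascheroni) at_top"
    and "((\<lambda>y. T y / y) \<longlongrightarrow> 1) at_top"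
    and "((\<lambda>y. (T y / y - 1) * ln y) \<longlongrightarrow> 1 - euler_mascheroni) at_top"
proof -
  have g: "(1 - euler_mascheroni :: real) > 0" using euler_mascheroni_less_13_over_22 by simp
  have "((\<lambda>y. (k y / y - ln y) - (half_ms y / y - ln y)) \<longlongrightarrow> (euler_mascheroni - ln (2 * pi)) - (2 * euler_mascheroni - 1 - ln (2 * pi))) at_top"
    by (intro tendsto_diff k mean_square_half_asymp)
  then have d: "((\<lambda>y. (k y - half_ms y) / y) \<longlongrightarrow> 1 - euler_mascheroni) at_top"
    by (simp add: diff_divide_distrib)
  show gt: "eventually (\<lambda>y. y < T y) at_top"
    using order_tendstoD(1)[OF d g] T eventually_gt_at_top[of 0]
  proof eventually_elim
    case (elim y)
    then have "half_ms y < half_ms (T y)" by (simp add: zero_less_divide_iff)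
    then show ?case using half_ms_mono[of "T y" y] by linarith
  qed
  have "eventually (\<lambda>y. (k y - half_ms y) / y = integral {y..T y} half_sq / y) at_top"
    using T gt eventually_gt_at_top[of 0]
  proof eventually_elim
    case (elim y)
    have "half_ms y + integral {y..T y} half_sq = half_ms (T y)"
      unfolding half_ms_eq using elim
      by (intro Henstock_Kurzweil_Integration.integral_combine integrable_continuous_interval continuous_intros) auto
    then show ?case using elim by simp
  qed
  from Lim_transform_eventually[OF d this]
  show "((\<lambda>y. integral {y..T y} half_sq / y) \<longlongrightarrow> 1 - euler_mascheroni) at_top" .
  have Tinf: "filterlim T at_top at_top"
    by (rule filterlim_at_top_mono[OF filterlim_ident]) (use gt in eventually_elim, auto)
  define h where "h = (\<lambda>X. half_ms X / X - ln X)"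
  have h: "((\<lambda>y. h (T y)) \<longlongrightarrow> A) at_top"
    unfolding h_def A_def by (rule filterlim_compose[OF mean_square_half_asymp Tinf])
  define r where "r = (\<lambda>y. T y / y)"
  have r1: "eventually (\<lambda>y. 1 \<le> r y) at_top"
    using gt eventually_gt_at_top[of 0] by eventually_elim (simp add: r_def)
  have key: "eventually (\<lambda>y. k y / y = r y * (ln y + ln (r y) + h (T y))) at_top"
    using T gt eventually_gt_at_top[of 0]
  proof eventually_elim
    case (elim y)
    have "ln (T y) = ln y + ln (r y)" using elim by (simp add: r_def ln_div)
    then have "r y * (ln y + ln (r y) + h (T y)) = r y * (half_ms (T y) / T y)" by (simp add: h_def)
    also have "\<dots> = k y / y" using elim by (simp add: r_def)
    finally show ?case ..
  qed
  have lninf: "filterlim (\<lambda>y::real. ln y) at_infinity at_top"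
    by (rule filterlim_at_top_imp_at_infinity[OF ln_at_top])
  have kl: "((\<lambda>y. (k y / y - ln y) / ln y) \<longlongrightarrow> 0) at_top"
    by (rule tendsto_divide_0[OF k lninf])
  have hl: "((\<lambda>y. h (T y) / ln y) \<longlongrightarrow> 0) at_top"
    by (rule tendsto_divide_0[OF h lninf])
  have q: "((\<lambda>y. (1 + (k y / y - ln y) / ln y) / (1 + h (T y) / ln y)) \<longlongrightarrow> (1 + 0) / (1 + 0)) at_top"
    by (intro tendsto_divide tendsto_add tendsto_const kl hl) auto
  have "1/2 < (1 + 0 :: real)" by simp
  from order_tendstoD(1)[OF tendsto_add[OF tendsto_const hl] this]
  have hp: "eventually (\<lambda>y. 1/2 < 1 + h (T y) / ln y) at_top" .
  \<comment> \<open>Since r \<ge> 1, dropping ln (r y) from \<open>key\<close> bounds r from above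
    by a quotient that tends to 1; r \<ge> 1 itself closes the sandwich.\<close>
  have "eventually (\<lambda>y. r y \<le> (1 + (k y / y - ln y) / ln y) / (1 + h (T y) / ln y)) at_top"
    using key r1 hp eventually_gt_at_top[of 1]
  proof eventually_elim
    case (elim y)
    have l: "ln y > 0" using elim by simp
    have "r y * (ln y + h (T y)) \<le> k y / y"
      unfolding elim(1) using elim(2) by (intro mult_left_mono) auto
    then have "r y * (ln y + h (T y)) / ln y \<le> k y / y / ln y" using l by (intro divide_right_mono) auto
    moreover have "r y * (ln y + h (T y)) / ln y = r y * (1 + h (T y) / ln y)"
      using l by (simp add: add_divide_distrib distrib_left)
    moreover have "k y / y / ln y = 1 + (k y / y - ln y) / ln y" using l by (simp add: diff_divide_distrib)
    ultimately have "r y * (1 + h (T y) / ln y) \<le> 1 + (k y / y - ln y) / ln y" by simp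
    moreover have "1 + h (T y) / ln y > 0" using elim(3) by linarith
    ultimately show ?case by (simp only: pos_le_divide_eq)
  qed
  then have r: "(r \<longlongrightarrow> 1) at_top"
    by (intro tendsto_sandwich[OF r1 _ tendsto_const]) (use q in auto)
  then show "((\<lambda>y. T y / y) \<longlongrightarrow> 1) at_top" by (simp add: r_def)
  \<comment> \<open>This is \<open>key\<close> solved for (r - 1) ln y. Now that r tends to 1 the
    term r ln r vanishes, and the constants combine to 1 - gamma again.\<close>
  have "((\<lambda>y. (k y / y - ln y) - r y * ln (r y) - r y * h (T y)) \<longlongrightarrow> (euler_mascheroni - ln (2 * pi)) - 1 * ln 1 - 1 * A) at_top"
    by (intro tendsto_diff tendsto_mult tendsto_ln k r h) auto
  moreover have "eventually (\<lambda>y. (k y / y - ln y) - r y * ln (r y) - r y * h (T y) = (T y / y - 1) * ln y) at_top"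
    using key
  proof eventually_elim
    case (elim y)
    then show ?case unfolding r_def[symmetric, THEN fun_cong, of y] by (simp only: algebra_simps)
  qed
  ultimately have "((\<lambda>y. (T y / y - 1) * ln y) \<longlongrightarrow> (euler_mascheroni - ln (2 * pi)) - 1 * ln 1 - 1 * A) at_top"
    by (rule Lim_transform_eventually)
  then show "((\<lambda>y. (T y / y - 1) * ln y) \<longlongrightarrow> 1 - euler_mascheroni) at_top"
    by (simp add: A_def)
qed

text \<open>The increment is the main term times T y - y plus two values of the error
  \<open>E\<close>. Both must be o(y / ln y); for the one at T y this uses that T y / y and hence
  also ln (T y) / ln y tend to 1.\<close>

lemma ladder_step_right:
  fixes T :: "real \<Rightarrow> real"
  assumes \<sigma>: "\<sigma> > 1/2"
    and gt: "eventually (\<lambda>y. y < T y) at_top"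
    and T1: "((\<lambda>y. T y / y) \<longlongrightarrow> 1) at_top"
    and T2: "((\<lambda>y. (T y / y - 1) * ln y) \<longlongrightarrow> c) at_top"
  shows "((\<lambda>y. integral {y..T y} (\<lambda>t. (cmod (zeta (Complex \<sigma> t)))\<^sup>2) * ln y / y) \<longlongrightarrow> zeta_r (2 * \<sigma>) * c) at_top"
proof -
  define f where "f = (\<lambda>t. (cmod (zeta (Complex \<sigma> t)))\<^sup>2)"
  define E where "E = (\<lambda>X. integral {1..X} f - zeta_r (2 * \<sigma>) * X)"
  have E: "((\<lambda>X. E X * ln X / X) \<longlongrightarrow> 0) at_top"
    unfolding E_def f_def by (rule zeta_mean_square_asymp[OF \<sigma>])
  have Tinf: "filterlim T at_top at_top"
    by (rule filterlim_at_top_mono[OF filterlim_ident]) (use gt in eventually_elim, auto)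
  note ET = filterlim_compose[OF E Tinf]
  have lninf: "filterlim (\<lambda>y::real. ln y) at_infinity at_top"
    by (rule filterlim_at_top_imp_at_infinity[OF ln_at_top])
  have "((\<lambda>y. ln (T y / y)) \<longlongrightarrow> ln 1) at_top" by (intro tendsto_ln T1) auto
  then have "((\<lambda>y. ln (T y / y) / ln y) \<longlongrightarrow> 0) at_top"
    by (intro tendsto_divide_0[OF _ lninf])
  then have lr: "((\<lambda>y. 1 / (1 + ln (T y / y) / ln y)) \<longlongrightarrow> 1 / (1 + 0)) at_top"
    by (intro tendsto_divide tendsto_add tendsto_const) auto
  have lim: "((\<lambda>y. zeta_r (2 * \<sigma>) * ((T y / y - 1) * ln y) + E (T y) * ln (T y) / T y * (T y / y) * (1 / (1 + ln (T y / y) / ln y)) - E y * ln y / y)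
     \<longlongrightarrow> zeta_r (2 * \<sigma>) * c + 0 * 1 * (1 / (1 + 0)) - 0) at_top"
    by (intro tendsto_add tendsto_diff tendsto_mult tendsto_const T1 T2 E ET lr)
  have "eventually (\<lambda>y. zeta_r (2 * \<sigma>) * ((T y / y - 1) * ln y) + E (T y) * ln (T y) / T y * (T y / y) * (1 / (1 + ln (T y / y) / ln y)) - E y * ln y / y =
     integral {y..T y} f * ln y / y) at_top"
    using gt eventually_gt_at_top[of 1]
  proof eventually_elim
    case (elim y)
    have lt: "ln (T y) = ln y + ln (T y / y)" "ln (T y) > 0" "ln y > 0" "T y > 0" using elim by (auto simp: ln_div)
    have "1 + ln (T y / y) / ln y = ln (T y) / ln y" using lt by (simp add: add_divide_distrib)
    then have e: "E (T y) * ln (T y) / T y * (T y / y) * (1 / (1 + ln (T y / y) / ln y)) = E (T y) * ln y / y"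
      using lt by simp
    have "integral {1..y} f + integral {y..T y} f = integral {1..T y} f"
      using elim unfolding f_def by (intro Henstock_Kurzweil_Integration.integral_combine integrable_zeta_square) auto
    then have "integral {y..T y} f = zeta_r (2 * \<sigma>) * (T y - y) + E (T y) - E y"
      by (simp add: E_def right_diff_distrib)
    then have "integral {y..T y} f * ln y / y = zeta_r (2 * \<sigma>) * ((T y - y) * ln y / y) + E (T y) * ln y / y - E y * ln y / y"
    proof -
      have "(z * d + a - b) * l / y = z * (d * l / y) + a * l / y - b * l / y" for z d a b l :: real
        by (simp add: algebra_simps add_divide_distrib diff_divide_distrib)
      then show ?thesis using \<open>integral {y..T y} f = _\<close> by simp
    qed
    moreover have "(T y - y) * ln y / y = (T y / y - 1) * ln y" using elim by (simp add: left_diff_distrib diff_divide_distrib)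
    ultimately show ?case unfolding e by simp
  qed
  from Lim_transform_eventually[OF lim this] show ?thesis by (simp add: f_def)
qed

section \<open>The fourth moment and the final quotient\<close>

lemma fourth_moment_asymp:
  assumes "fourth_moment_constants a"
  shows "((\<lambda>T. integral {0..T} (\<lambda>t. cmod (zeta (Complex (1/2) t)) ^ 4) / (T * ln T ^ 4)) \<longlongrightarrow> 1 / (2 * pi\<^sup>2)) at_top"
proof -
  define F where "F = (\<lambda>T. integral {0..T} (\<lambda>t. cmod (zeta (Complex (1/2) t)) ^ 4))"
  define P where "P = (\<lambda>T. T * (\<Sum>s=0..4. a s * ln T ^ (4 - s)))"
  have a0: "a 0 = 1 / (2 * pi\<^sup>2)" using assms by (simp add: fourth_moment_constants_def)
  \<comment> \<open>The choice 1/16 keeps the exponent 7/8 + 1/16 below 1.\<close>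
  have "(\<lambda>T. F T - P T) \<in> O[at_top](\<lambda>T. T powr (7/8 + 1/16))"
    using assms unfolding fourth_moment_constants_def F_def P_def by (elim conjE allE[of _ "1/16"]) simp
  moreover have "(\<lambda>T::real. T powr (7/8 + 1/16)) \<in> o[at_top](\<lambda>T. T * ln T ^ 4)" by real_asymp
  ultimately have "(\<lambda>T. F T - P T) \<in> o[at_top](\<lambda>T. T * ln T ^ 4)" by (rule landau_o.big_small_trans)
  then have 1: "((\<lambda>T. (F T - P T) / (T * ln T ^ 4)) \<longlongrightarrow> 0) at_top" by (rule smalloD_tendsto)
  have "((\<lambda>T. \<Sum>s=0..4. a s * (1 / ln T) ^ s) \<longlongrightarrow> (\<Sum>s=0..4. a s * 0 ^ s)) at_top"
    by (intro tendsto_sum tendsto_mult tendsto_power tendsto_const) real_asymp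
  also have "(\<Sum>s=0..4. a s * 0 ^ s) = a 0" by (simp add: numeral_eq_Suc)
  finally have "((\<lambda>T. (\<Sum>s=0..4. a s * (1 / ln T) ^ s) + (F T - P T) / (T * ln T ^ 4)) \<longlongrightarrow> a 0 + 0) at_top"
    by (intro tendsto_add 1)
  moreover have "eventually (\<lambda>T. (\<Sum>s=0..4. a s * (1 / ln T) ^ s) + (F T - P T) / (T * ln T ^ 4) = F T / (T * ln T ^ 4)) at_top"
    using eventually_gt_at_top[of 1]
  proof eventually_elim
    case (elim T)
    have l: "ln T \<noteq> 0" "T \<noteq> 0" using elim by auto
    have "P T / (T * ln T ^ 4) = (\<Sum>s=0..4. a s * (ln T ^ (4 - s) / ln T ^ 4))"
      using l by (simp add: P_def sum_divide_distrib)
    also have "\<dots> = (\<Sum>s=0..4. a s * (1 / ln T) ^ s)"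
    proof (intro sum.cong refl arg_cong2[where f = "(*)"])
      fix s :: nat assume "s \<in> {0..4}"
      then have "ln T ^ 4 = ln T ^ (4 - s) * ln T ^ s" by (simp flip: power_add)
      then show "ln T ^ (4 - s) / ln T ^ 4 = (1 / ln T) ^ s" using l by (simp add: power_divide)
    qed
    finally show ?case by (simp add: diff_divide_distrib)
  qed
  ultimately have "((\<lambda>T. F T / (T * ln T ^ 4)) \<longlongrightarrow> a 0 + 0) at_top" by (rule Lim_transform_eventually)
  then show ?thesis by (simp add: a0 F_def)
qed

text \<open>After division by y^4 the term with index s of the denominator carries a factor (1 / ln
  y)^s, since each factor B is smaller than A by a logarithm. So the denominator tends to g^4, and
  in the numerator the four logarithms of B^4 cancel those of the fourth moment.\<close>

lemma moment_quotient_limit: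
  fixes A B F :: "real \<Rightarrow> real" and c :: "nat \<Rightarrow> real"
  assumes A: "((\<lambda>y. A y / y) \<longlongrightarrow> g) at_top" and B: "((\<lambda>y. B y * ln y / y) \<longlongrightarrow> z * g) at_top"
    and F: "((\<lambda>y. F y / (y * ln y ^ 4)) \<longlongrightarrow> f) at_top"
    and g: "g \<noteq> 0" and c0: "c 0 = 1"
  shows "((\<lambda>y. B y ^ 4 * F y / (\<Sum>s=0..4. c s * A y ^ (4 - s) * B y ^ s) / y) \<longlongrightarrow> z ^ 4 * f) at_top"
proof -
  define D where "D = (\<lambda>y. \<Sum>s=0..4. c s * (A y / y) ^ (4 - s) * (B y * ln y / y) ^ s * (1 / ln y) ^ s)"
  have "(D \<longlongrightarrow> (\<Sum>s=0..4. c s * g ^ (4 - s) * (z * g) ^ s * 0 ^ s)) at_top"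
    unfolding D_def by (intro tendsto_sum tendsto_mult tendsto_power tendsto_const A B) real_asymp
  also have "(\<Sum>s=0..4. c s * g ^ (4 - s) * (z * g) ^ s * 0 ^ s) = g ^ 4"
    by (simp add: numeral_eq_Suc c0)
  finally have "((\<lambda>y. (B y * ln y / y) ^ 4 * (F y / (y * ln y ^ 4)) / D y) \<longlongrightarrow> (z * g) ^ 4 * f / g ^ 4) at_top"
    using g by (intro tendsto_divide tendsto_mult tendsto_power B F) auto
  moreover have "eventually (\<lambda>y. (B y * ln y / y) ^ 4 * (F y / (y * ln y ^ 4)) / D y =
      B y ^ 4 * F y / (\<Sum>s=0..4. c s * A y ^ (4 - s) * B y ^ s) / y) at_top"
    using eventually_gt_at_top[of 1]
  proof eventually_elim
    case (elim y)
    have l: "ln y \<noteq> 0" "y \<noteq> 0" using elim by auto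
    have D: "y ^ 4 * D y = (\<Sum>s=0..4. c s * A y ^ (4 - s) * B y ^ s)"
      unfolding D_def sum_distrib_left
    proof (intro sum.cong refl)
      fix s :: nat assume "s \<in> {0..4}"
      then have "y ^ 4 = y ^ (4 - s) * y ^ s" by (simp flip: power_add)
      then show "y ^ 4 * (c s * (A y / y) ^ (4 - s) * (B y * ln y / y) ^ s * (1 / ln y) ^ s) = c s * A y ^ (4 - s) * B y ^ s"
        using l by (simp add: power_divide power_mult_distrib)
    qed
    have "B y ^ 4 * F y / (\<Sum>s=0..4. c s * A y ^ (4 - s) * B y ^ s) / y = B y ^ 4 * F y / (y ^ 4 * y) / D y"
      unfolding D[symmetric] by (simp add: mult_ac)
    moreover have "(B y * ln y / y) ^ 4 * (F y / (y * ln y ^ 4)) = B y ^ 4 * F y / (y ^ 4 * y)"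
      using l by (simp add: power_divide power_mult_distrib)
    ultimately show ?case by (simp only:)
  qed
  ultimately have "((\<lambda>y. B y ^ 4 * F y / (\<Sum>s=0..4. c s * A y ^ (4 - s) * B y ^ s) / y) \<longlongrightarrow> (z * g) ^ 4 * f / g ^ 4) at_top"
    by (rule Lim_transform_eventually)
  then show ?thesis using g by (simp add: power_mult_distrib)
qed

theorem theorem3:
  fixes \<epsilon> \<sigma> x T0 :: real and \<phi>1 :: "real \<Rightarrow> real" and a c :: "nat \<Rightarrow> real"
  assumes "\<epsilon> > 0" and "\<sigma> \<ge> 1/2 + \<epsilon>" and "x > 0"
    and "jacobs_ladder T0 \<phi>1"
    and "fourth_moment_constants a"
    and "c 0 = 1"
    and "\<And>s. s \<in> {1..4} \<Longrightarrow>
           c s = 2 * pi\<^sup>2 * (1 / Re (zeta (of_real (2 * \<sigma>))) ^ s) * a s"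
  defines "u \<equiv> \<lambda>\<tau>::real. 2 * pi\<^sup>2 / Re (zeta (of_real (2 * \<sigma>))) ^ 4 * x * \<tau>"
    and "v \<equiv> \<lambda>\<tau>::real. x / (1 - euler_mascheroni) * \<tau>"
    and "I \<equiv> \<lambda>\<alpha> y. integral {y..inv_into {T0..} \<phi>1 y} (\<lambda>t. (cmod (zeta (Complex \<alpha> t)))\<^sup>2)"
  shows "(\<lambda>\<tau>. I (1/2) (v \<tau>)) \<sim>[at_top]
         (\<lambda>\<tau>. I \<sigma> (u \<tau>) ^ 4 * integral {0..u \<tau>} (\<lambda>t. cmod (zeta (Complex (1/2) t)) ^ 4) /
               (\<Sum>s=0..4. c s * I (1/2) (u \<tau>) ^ (4 - s) * I \<sigma> (u \<tau>) ^ s))"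
proof -
  define g :: real where "g = 1 - euler_mascheroni"
  define z where "z = zeta_r (2 * \<sigma>)"
  have g: "g > 0" using euler_mascheroni_less_13_over_22 by (simp add: g_def)
  have \<sigma>: "\<sigma> > 1/2" using assms(1,2) by simp
  have z: "z > 0" unfolding z_def using \<sigma> by (intro zeta_r_pos) auto
  obtain R where R: "eventually (\<lambda>y. R y \<ge> 14 * ln y) at_top"
    "eventually (\<lambda>y. inv_into {T0..} \<phi>1 y \<ge> 0 \<and> half_ms (inv_into {T0..} \<phi>1 y) = truncated_laplace y (y * R y)) at_top"
    by (rule jacobs_ladder_inverse[OF assms(4)]) blast
  note step = ladder_step[OF truncated_laplace_asymp[OF R(1)] R(2), folded g_def]
  have A: "((\<lambda>y. I (1/2) y / y) \<longlongrightarrow> g) at_top"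
    using step(2) by (simp add: I_def)
  have B: "((\<lambda>y. I \<sigma> y * ln y / y) \<longlongrightarrow> z * g) at_top"
    using ladder_step_right[OF \<sigma> step(1,3,4)] by (simp add: I_def z_def)
  define Q where "Q = (\<lambda>y. I \<sigma> y ^ 4 * integral {0..y} (\<lambda>t. cmod (zeta (Complex (1/2) t)) ^ 4) /
               (\<Sum>s=0..4. c s * I (1/2) y ^ (4 - s) * I \<sigma> y ^ s))"
  have Q: "((\<lambda>y. Q y / y) \<longlongrightarrow> z ^ 4 * (1 / (2 * pi\<^sup>2))) at_top"
    unfolding Q_def by (rule moment_quotient_limit[OF A B fourth_moment_asymp[OF assms(5)]]) (use g assms(6) in auto)
  \<comment> \<open>The factors of u and v are the reciprocals, times x, of the limits of
    \<open>Q y / y\<close> and of the critical integral divided by y, so both sides of the claim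
    divided by \<tau> tend to x.\<close>
  define \<alpha> where "\<alpha> = 2 * pi\<^sup>2 / z ^ 4 * x"
  have \<alpha>: "\<alpha> > 0" using z assms(3) by (simp add: \<alpha>_def)
  have u: "u = (\<lambda>\<tau>. \<alpha> * \<tau>)" by (simp add: u_def \<alpha>_def z_def zeta_r_def)
  define \<beta> where "\<beta> = x / g"
  have \<beta>: "\<beta> > 0" using g assms(3) by (simp add: \<beta>_def)
  have v: "v = (\<lambda>\<tau>. \<beta> * \<tau>)" by (simp add: v_def \<beta>_def g_def)
  have inf: "filterlim (\<lambda>\<tau>::real. k * \<tau>) at_top at_top" if "k > 0" for k
    using that by (intro filterlim_tendsto_pos_mult_at_top[OF tendsto_const] filterlim_ident)
  have "((\<lambda>\<tau>. \<beta> * (I (1/2) (\<beta> * \<tau>) / (\<beta> * \<tau>))) \<longlongrightarrow> \<beta> * g) at_top"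
    by (intro tendsto_mult tendsto_const filterlim_compose[OF A inf[OF \<beta>]])
  then have L: "((\<lambda>\<tau>. I (1/2) (v \<tau>) / \<tau>) \<longlongrightarrow> x) at_top"
    using \<beta> g assms(3) by (simp add: v \<beta>_def)
  have "((\<lambda>\<tau>. \<alpha> * (Q (\<alpha> * \<tau>) / (\<alpha> * \<tau>))) \<longlongrightarrow> \<alpha> * (z ^ 4 * (1 / (2 * pi\<^sup>2)))) at_top"
    by (intro tendsto_mult tendsto_const filterlim_compose[OF Q inf[OF \<alpha>]])
  moreover have "\<alpha> * (z ^ 4 * (1 / (2 * pi\<^sup>2))) = x" using z by (simp add: \<alpha>_def)
  ultimately have RR: "((\<lambda>\<tau>. Q (u \<tau>) / \<tau>) \<longlongrightarrow> x) at_top"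
    using \<alpha> by (simp add: u)
  have "((\<lambda>\<tau>. (I (1/2) (v \<tau>) / \<tau>) / (Q (u \<tau>) / \<tau>)) \<longlongrightarrow> x / x) at_top"
    using assms(3) by (intro tendsto_divide L RR) auto
  moreover have "eventually (\<lambda>\<tau>. (I (1/2) (v \<tau>) / \<tau>) / (Q (u \<tau>) / \<tau>) = I (1/2) (v \<tau>) / Q (u \<tau>)) at_top"
    using eventually_gt_at_top[of 0] by eventually_elim auto
  ultimately have "((\<lambda>\<tau>. I (1/2) (v \<tau>) / Q (u \<tau>)) \<longlongrightarrow> x / x) at_top"
    by (rule Lim_transform_eventually)
  then have "(\<lambda>\<tau>. I (1/2) (v \<tau>)) \<sim>[at_top] (\<lambda>\<tau>. Q (u \<tau>))"
    using assms(3) by (intro asymp_equivI') simp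
  then show ?thesis by (simp add: Q_def)
qed

end
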